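(* Let $F_j(\zeta_j)=a_j\zeta_j$ with $a_j\in\mathbb R$, $a_j<2m$, $j=1,2$. For $j$ with $0<a_j<2m$ put $$\omega_j=\frac{(-1)^j}{2}\Big(a_j-m-\sqrt{m^2-a_j^2+2ma_j}\Big),\qquad\varkappa_j=\sqrt{m^2-\omega_j^2},$$ and let $\mathcal S$ be the set of functions $$C_1\begin{pmatrix} e^{-\varkappa_1|x|}+\frac{me^{-\varkappa_1|x|}-\varkappa_1e^{-m|x|}}{\omega_1}\\ \varkappa_1\,\mathrm{sgn}\,x\,\frac{e^{-\varkappa_1|x|}-e^{-m|x|}}{\omega_1}\end{pmatrix}+C_2\begin{pmatrix}-\varkappa_2\,\mathrm{sgn}\,x\,\frac{e^{-\varkappa_2|x|}-e^{-m|x|}}{\omega_2}\\ e^{-\varkappa_2|x|}-\frac{me^{-\varkappa_2|x|}-\varkappa_2e^{-m|x|}}{\omega_2}\end{pmatrix},$$ where $C_j\in\mathbb C$ is arbitrary if $0<a_j<2m$ and $C_j=0$ (and the corresponding term is absent) if $a_j\le0$. Then for any $\psi_0\in H^1$ the solution $\psi\in C(\mathbb R,H^1)$ of $i\dot\psi=D_m\psi-D_m^{-1}\delta(x)F(\psi(0,t))$, $\psi(0)=\psi_0$, satisfies, for every $R>0$, $\lim_{t\to\pm\infty}\inf_{s\in\mathcal S}\|\psi(\cdot,t)-s\|_{H^1(-R,R)}=0$.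
   Context: $m>0$; $\alpha=\begin{pmatrix}0&1\\-1&0\end{pmatrix}$, $\beta=\begin{pmatrix}1&0\\0&-1\end{pmatrix}$; $D_m=\alpha\partial_x+m\beta$ on $\mathbb C^2$-valued distributions on $\mathbb R$, $D_m^{-1}:=D_m(-\partial_x^2+m^2)^{-1}$; $H^1=H^1(\mathbb R)\otimes\mathbb C^2$; $F(\zeta)=(F_1(\zeta_1),F_2(\zeta_2))$. The equation is understood in the sense of distributions (it is globally well posed in $C(\mathbb R,H^1)$ under these assumptions). *)

theory Defs
  imports "HOL-Analysis.Analysis"
begin

definition vec2 :: "complex \<Rightarrow> complex \<Rightarrow> complex^2" where
  "vec2 a b = (\<chi> i. if i = 1 then a else b)"

definition alphaM :: "complex^2^2" where
  "alphaM = (\<chi> i. if i = 1 then vec2 0 1 else vec2 (-1) 0)"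

definition betaM :: "complex^2^2" where
  "betaM = (\<chi> i. if i = 1 then vec2 1 0 else vec2 0 (-1))"

definition Fnl :: "real \<Rightarrow> real \<Rightarrow> complex^2 \<Rightarrow> complex^2" where
  "Fnl a1 a2 z = vec2 (of_real a1 * z $ 1) (of_real a2 * z $ 2)"

text \<open>Green function of (-d^2/dx^2 + m^2): (-d^2+m^2)^{-1} delta = e^{-m|x|}/(2m).\<close>
definition green :: "real \<Rightarrow> real \<Rightarrow> real" where
  "green m x = exp (- m * \<bar>x\<bar>) / (2 * m)"

definition smooth1 :: "(real \<Rightarrow> real) \<Rightarrow> bool" where
  "smooth1 \<phi> \<longleftrightarrow> (\<exists>D :: nat \<Rightarrow> real \<Rightarrow> real. D 0 = \<phi> \<and>
      (\<forall>k x. (D k has_real_derivative D (Suc k) x) (at x)))"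

definition testfun1 :: "real set \<Rightarrow> (real \<Rightarrow> real) \<Rightarrow> bool" where
  "testfun1 U \<phi> \<longleftrightarrow> smooth1 \<phi> \<and> compact (closure {x. \<phi> x \<noteq> 0}) \<and> closure {x. \<phi> x \<noteq> 0} \<subseteq> U"

definition smooth2 :: "(real \<times> real \<Rightarrow> real) \<Rightarrow> bool" where
  "smooth2 \<phi> \<longleftrightarrow> (\<exists>D :: nat \<Rightarrow> nat \<Rightarrow> real \<times> real \<Rightarrow> real. D 0 0 = \<phi> \<and>
      (\<forall>i j. continuous_on UNIV (D i j)) \<and>
      (\<forall>i j x t. ((\<lambda>y. D i j (y, t)) has_real_derivative D (Suc i) j (x, t)) (at x)) \<and>
      (\<forall>i j x t. ((\<lambda>s. D i j (x, s)) has_real_derivative D i (Suc j) (x, t)) (at t)))"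

definition testfun2 :: "(real \<times> real \<Rightarrow> real) \<Rightarrow> bool" where
  "testfun2 \<phi> \<longleftrightarrow> smooth2 \<phi> \<and> compact (closure {p. \<phi> p \<noteq> 0})"

definition L2_on :: "real set \<Rightarrow> (real \<Rightarrow> complex^2) \<Rightarrow> bool" where
  "L2_on U f \<longleftrightarrow> set_borel_measurable lborel U f \<and> set_integrable lborel U (\<lambda>x. (norm (f x))\<^sup>2)"

definition weak_deriv_on :: "real set \<Rightarrow> (real \<Rightarrow> complex^2) \<Rightarrow> (real \<Rightarrow> complex^2) \<Rightarrow> bool" where
  "weak_deriv_on U f g \<longleftrightarrow> (\<forall>\<phi>. testfun1 U \<phi> \<longrightarrow>
     (LINT x|lborel. deriv \<phi> x *\<^sub>R f x) = - (LINT x|lborel. \<phi> x *\<^sub>R g x))"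

definition H1_on :: "real set \<Rightarrow> (real \<Rightarrow> complex^2) \<Rightarrow> bool" where
  "H1_on U f \<longleftrightarrow> L2_on U f \<and> (\<exists>g. L2_on U g \<and> weak_deriv_on U f g)"

definition wderiv :: "real set \<Rightarrow> (real \<Rightarrow> complex^2) \<Rightarrow> real \<Rightarrow> complex^2" where
  "wderiv U f = (SOME g. L2_on U g \<and> weak_deriv_on U f g)"

text \<open>The H^1(U) norm (meaningful for f in H^1(U)).\<close>
definition H1norm_on :: "real set \<Rightarrow> (real \<Rightarrow> complex^2) \<Rightarrow> real" where
  "H1norm_on U f = sqrt ((LINT x:U|lborel. (norm (f x))\<^sup>2) + (LINT x:U|lborel. (norm (wderiv U f x))\<^sup>2))"

text \<open>psi x t: psi is a solution in C(R,H^1) of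
  i psi_t = D_m psi - D_m^{-1} delta(x) F(psi(0,t)) in the sense of distributions on R^2,
  where D_m^{-1} delta(x) v = D_m (green m x v), and D_m acting on distributions is tested by
  <D_m u, phi> = - alpha <u, phi_x> + m beta <u, phi>.  For each t the continuous
  representative of psi(.,t) is taken (so that psi(0,t) makes sense).\<close>
definition is_solution :: "real \<Rightarrow> real \<Rightarrow> real \<Rightarrow> (real \<Rightarrow> real \<Rightarrow> complex^2) \<Rightarrow> bool" where
  "is_solution m a1 a2 \<psi> \<longleftrightarrow>
     continuous_on UNIV (\<lambda>p. \<psi> (fst p) (snd p)) \<and>
     (\<forall>t. H1_on UNIV (\<lambda>x. \<psi> x t)) \<and>
     (\<forall>t0. ((\<lambda>t. H1norm_on UNIV (\<lambda>x. \<psi> x t - \<psi> x t0)) \<longlongrightarrow> 0) (at t0)) \<and>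
     (\<forall>\<phi>. testfun2 \<phi> \<longrightarrow>
        (let \<phi>x = (\<lambda>p. deriv (\<lambda>y. \<phi> (y, snd p)) (fst p));
             \<phi>t = (\<lambda>p. deriv (\<lambda>s. \<phi> (fst p, s)) (snd p))
         in (LINT p|lborel. ((- \<i>) * of_real (\<phi>t p)) *s \<psi> (fst p) (snd p))
          = (LINT p|lborel.
               (- of_real (\<phi>x p)) *s (alphaM *v \<psi> (fst p) (snd p))
             + (of_real (m * \<phi> p)) *s (betaM *v \<psi> (fst p) (snd p))
             - of_real (green m (fst p)) *s
                 ((- of_real (\<phi>x p)) *s (alphaM *v Fnl a1 a2 (\<psi> 0 (snd p)))
                  + (of_real (m * \<phi> p)) *s (betaM *v Fnl a1 a2 (\<psi> 0 (snd p)))))))"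

definition omega :: "real \<Rightarrow> real \<Rightarrow> nat \<Rightarrow> real" where
  "omega m a j = (-1) ^ j / 2 * (a - m - sqrt (m\<^sup>2 - a\<^sup>2 + 2 * m * a))"

definition kappa :: "real \<Rightarrow> real \<Rightarrow> nat \<Rightarrow> real" where
  "kappa m a j = sqrt (m\<^sup>2 - (omega m a j)\<^sup>2)"

definition u1 :: "real \<Rightarrow> real \<Rightarrow> real \<Rightarrow> complex^2" where
  "u1 m a x = (let w = omega m a 1; k = kappa m a 1 in
     vec2 (of_real (exp (- k * \<bar>x\<bar>) + (m * exp (- k * \<bar>x\<bar>) - k * exp (- m * \<bar>x\<bar>)) / w))
          (of_real (k * sgn x * (exp (- k * \<bar>x\<bar>) - exp (- m * \<bar>x\<bar>)) / w)))"

definition u2 :: "real \<Rightarrow> real \<Rightarrow> real \<Rightarrow> complex^2" where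
  "u2 m a x = (let w = omega m a 2; k = kappa m a 2 in
     vec2 (of_real (- k * sgn x * (exp (- k * \<bar>x\<bar>) - exp (- m * \<bar>x\<bar>)) / w))
          (of_real (exp (- k * \<bar>x\<bar>) - (m * exp (- k * \<bar>x\<bar>) - k * exp (- m * \<bar>x\<bar>)) / w)))"

definition Sset :: "real \<Rightarrow> real \<Rightarrow> real \<Rightarrow> (real \<Rightarrow> complex^2) set" where
  "Sset m a1 a2 = {(\<lambda>x. (if 0 < a1 then C1 *s u1 m a1 x else 0) + (if 0 < a2 then C2 *s u2 m a2 x else 0))
                   | C1 C2 :: complex. True}"

end

theory Submission
  imports Defs
begin

text \<open>
  The equation is linear and autonomous, so mollifying \<open>\<psi>\<close> in time gives solutions that are smooth
  in \<open>t\<close>, and the energy of the difference of two mollifications is bounded for all times by its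
  initial value, which is small. For a mollified solution \<open>(f, h)\<close> the combinations
  \<open>r = f\<^sub>even - h\<^sub>odd\<close> and \<open>s = f\<^sub>even + h\<^sub>odd\<close> involve \<open>a\<^sub>1\<close> only (and those with \<open>f\<close>, \<open>h\<close> exchanged
  \<open>a\<^sub>2\<close> only). On the half-line \<open>r\<close> solves the Klein-Gordon equation with
  \<open>r\<^sub>x + \<iota> r\<^sub>t + (a - m) r = 0\<close> at \<open>x = 0\<close>, where \<open>\<iota> = \<plusminus> \<i>\<close>. The energy with the boundary term
  \<open>(m - a) / 2 |r(0)|\<^sup>2\<close> is conserved, and it is coercive because \<open>a < 2 m\<close>. The function
  \<open>v = r\<^sub>x + \<iota> r\<^sub>t + (a - m) r\<close> solves the Klein-Gordon equation with Dirichlet data, so by Morawetz'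
  estimate it decays locally. Eliminating the time derivative from \<open>v\<close> leaves
  \<open>(\<partial>\<^sub>x + K\<^sub>1) (\<partial>\<^sub>x + K\<^sub>2) r \<rightarrow> 0\<close> with \<open>Re K\<^sub>2 \<le> 0\<close>. The factor \<open>K\<^sub>2\<close> contributes
  nothing because \<open>r\<close> is bounded in \<open>L\<^sup>2\<close>, and neither does \<open>K\<^sub>1\<close> if \<open>a \<le> 0\<close>. If \<open>a > 0\<close> then
  \<open>K\<^sub>1 = \<kappa> > 0\<close> and \<open>r\<close> approaches \<open>r(0, t) exp (- \<kappa> x)\<close>, the trace of a solitary wave.
\<close>

subsection \<open>Smooth kernels and convolution\<close>

text \<open>The energy and Morawetz identities need more derivatives than an H^1 solution has.
  Smoothing in time alone supplies them, because the equation trades x-derivatives for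
  t-derivatives, and it leaves the point interaction at x = 0 intact. The price is that \<psi>
  itself is never covered by the regular theory. Energy bounds are therefore applied to the
  difference of two mollifications, of scales d and e0, and d tends to 0 only after pairing with a
  test function in x. Such a pairing turns the mollification of an H^1-valued curve into that of a
  continuous vector-valued one, and L^2 duality recovers norms from pairings; this also copes with
  weak derivatives that are known only through a choice.

  The energy contains r_t, which is not part of the H^1 data at a given time; the relation \<iota>
  r_t = s_x + m s replaces it by first x-derivatives. Boundary terms at infinity are discarded
  without pointwise decay: bounded integrals provide arbitrarily distant points where the flux is
  small.\<close>

abbreviation sqn :: "'a::real_inner \<Rightarrow> real" where "sqn z \<equiv> z \<bullet> z"

abbreviation jcont :: "(real \<Rightarrow> real \<Rightarrow> 'a::topological_space) \<Rightarrow> bool" where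
  "jcont f \<equiv> continuous_on ({0..} \<times> UNIV) (\<lambda>p. f (fst p) (snd p))"

text \<open>All derivatives are carried along as one sequence, as in \<open>smooth1\<close>. The
  support lies in [-1, 1] for every kernel, which lets all convolutions run over one fixed
  interval.\<close>

definition smooth_kernel :: "(nat \<Rightarrow> real \<Rightarrow> real) \<Rightarrow> bool" where
  "smooth_kernel D \<longleftrightarrow> (\<forall>k x. (D k has_real_derivative D (Suc k) x) (at x)) \<and> (\<forall>k x. 1 \<le> \<bar>x\<bar> \<longrightarrow> D k x = 0)"

section \<open>A bump function with all its derivatives\<close>

fun bump_poly :: "nat \<Rightarrow> real poly" where
  "bump_poly 0 = 1"
| "bump_poly (Suc k) = pderiv (bump_poly k) * [:1, 0, -1:]^2
     + smult (4 * real k) ([:0, 1:] * [:1, 0, -1:] * bump_poly k) - smult 2 ([:0, 1:] * bump_poly k)"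

text \<open>The k-th derivative of exp (- 1 / (1 - x^2)). The recursion for \<open>bump_poly\<close>
  is the product rule with everything brought to the denominator (1 - x^2) ^ (2 k + 2).\<close>

definition bump :: "nat \<Rightarrow> real \<Rightarrow> real" where
  "bump k x = (if \<bar>x\<bar> < 1 then poly (bump_poly k) x / (1 - x\<^sup>2) ^ (2 * k) * exp (- 1 / (1 - x\<^sup>2)) else 0)"

lemma power_le_fact_exp:
  fixes y :: real assumes "0 \<le> y" shows "y ^ n \<le> fact n * exp y"
proof -
  have "(\<Sum>k\<in>{n}. y ^ k /\<^sub>R fact k) \<le> (\<Sum>k. y ^ k /\<^sub>R fact k)"
    by (rule sum_le_suminf) (use summable_exp_generic[of y] assms in auto)
  then have "y ^ n / fact n \<le> exp y" by (simp add: exp_def field_simps)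
  then show ?thesis by (simp add: field_simps)
qed

text \<open>Seen from a point outside the open interval the function is quadratically small.
  Together with \<open>DERIV_0_of_le_square\<close> this gives derivative 0 on the whole closed
  exterior, the end points included.\<close>

lemma bump_le_square: "\<exists>C. \<forall>y x. 1 \<le> \<bar>x\<bar> \<longrightarrow> \<bar>bump k y\<bar> \<le> C * (y - x)\<^sup>2"
proof -
  have "bounded (poly (bump_poly k) ` {-1..1})"
    by (intro compact_imp_bounded compact_continuous_image continuous_intros) auto
  then obtain A where A: "\<And>y. \<bar>y\<bar> \<le> 1 \<Longrightarrow> \<bar>poly (bump_poly k) y\<bar> \<le> A"
    unfolding bounded_iff by (fastforce simp: abs_le_iff)
  have A0: "0 \<le> A" using A[of 0] by auto
  \<comment> \<open>The power 2 k cancels the denominator; the two further powers of w become the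
    square of the distance to x.\<close>
  define n where "n = 2 * k + 2"
  have "\<bar>bump k y\<bar> \<le> (A * fact n * 4) * (y - x)\<^sup>2" if x: "1 \<le> \<bar>x\<bar>" for x y
  proof (cases "\<bar>y\<bar> < 1")
    case True
    define w where "w = 1 - y\<^sup>2"
    have w: "0 < w" using True by (simp add: w_def abs_square_less_1)
    have "(1 / w) ^ n \<le> fact n * exp (1 / w)" by (rule power_le_fact_exp) (use w in simp)
    then have "exp (- 1 / w) \<le> fact n * w ^ n"
      using w by (simp add: exp_minus field_simps)
    then have e: "exp (- 1 / w) / w ^ (2 * k) \<le> fact n * w\<^sup>2"
      using w by (simp add: n_def divide_le_eq power_add power2_eq_square mult.assoc[symmetric] mult.commute[of "w ^ _"] del: fact_Suc)
    have "\<bar>bump k y\<bar> = \<bar>poly (bump_poly k) y\<bar> * (exp (- 1 / w) / w ^ (2 * k))"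
      using True w by (simp add: bump_def w_def abs_mult)
    also have "\<dots> \<le> A * (fact n * w\<^sup>2)"
      by (rule mult_mono) (use A[of y] True A0 e w in auto)
    also have "A * (fact n * w\<^sup>2) \<le> A * (fact n * (2 * (y - x))\<^sup>2)"
    proof -
      have "w = (1 - \<bar>y\<bar>) * (1 + \<bar>y\<bar>)" by (simp add: w_def algebra_simps power2_eq_square)
      also have "\<dots> \<le> (1 - \<bar>y\<bar>) * 2" by (rule mult_left_mono) (use True in auto)
      also have "\<dots> \<le> 2 * \<bar>y - x\<bar>" using x abs_triangle_ineq2[of x y] by (simp add: abs_minus_commute)
      finally have "\<bar>w\<bar> \<le> \<bar>2 * (y - x)\<bar>" using w by (simp only: abs_mult abs_of_pos abs_numeral)
      then have "w\<^sup>2 \<le> (2 * (y - x))\<^sup>2" by (simp only: abs_le_square_iff)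
      then show ?thesis using A0 by (intro mult_left_mono) auto
    qed
    also have "(2 * (y - x))\<^sup>2 = 4 * (y - x)\<^sup>2" by (simp only: power_mult_distrib) simp
    finally show ?thesis by (simp only: mult.assoc)
  next
    case False
    then show ?thesis using A0 by (simp add: bump_def)
  qed
  then show ?thesis by blast
qed

lemma DERIV_0_of_le_square:
  fixes f :: "real \<Rightarrow> real"
  assumes "\<And>y. \<bar>f y\<bar> \<le> C * (y - x)\<^sup>2" shows "(f has_real_derivative 0) (at x)"
proof -
  have fx: "f x = 0" using assms[of x] by simp
  have "((\<lambda>y. (f y - f x) / (y - x)) \<longlongrightarrow> 0) (at x)"
  proof (rule Lim_null_comparison)
    have "\<bar>f y / (y - x)\<bar> \<le> C * \<bar>y - x\<bar>" if "y \<noteq> x" for y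
      using assms[of y] that by (simp add: field_simps abs_mult power2_eq_square)
    then show "\<forall>\<^sub>F y in at x. norm ((f y - f x) / (y - x)) \<le> C * \<bar>y - x\<bar>"
      by (auto simp: eventually_at_filter fx)
    have "((\<lambda>y. C * \<bar>y - x\<bar>) \<longlongrightarrow> C * \<bar>x - x\<bar>) (at x)" by (intro tendsto_intros)
    then show "((\<lambda>y. C * \<bar>y - x\<bar>) \<longlongrightarrow> 0) (at x)" by simp
  qed
  then show ?thesis by (simp add: has_field_derivative_iff)
qed

lemma kernel_bump: "smooth_kernel bump"
  unfolding smooth_kernel_def
proof (intro conjI allI impI)
  fix k x
  show "(bump k has_real_derivative bump (Suc k) x) (at x)"
  proof (cases "\<bar>x\<bar> < 1")
    case True
    define w where "w = 1 - x\<^sup>2"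
    have w: "0 < w" using True by (simp add: w_def abs_square_less_1)
    have "((\<lambda>x. poly (bump_poly k) x / (1 - x\<^sup>2) ^ (2 * k) * exp (- 1 / (1 - x\<^sup>2)))
        has_real_derivative bump (Suc k) x) (at x)"
    proof -
      have W: "((\<lambda>x. 1 - x\<^sup>2) has_real_derivative - 2 * x) (at x)"
        by (auto intro!: derivative_eq_intros)
      have E: "((\<lambda>x. exp (- 1 / (1 - x\<^sup>2))) has_real_derivative exp (- 1 / w) * (- 2 * x / w\<^sup>2)) (at x)"
        using w by (auto intro!: derivative_eq_intros simp: w_def power2_eq_square field_simps)
      have Wk: "((\<lambda>x. (1 - x\<^sup>2) ^ (2 * k)) has_real_derivative - (4 * k * x * w ^ (2 * k)) / w) (at x)"
      proof (cases k)
        case (Suc j)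
        show ?thesis
          by (rule DERIV_cong[OF DERIV_power[OF W, of "2 * k"]])
            (use w in \<open>simp add: Suc w_def[symmetric] field_simps\<close>)
      qed simp
      have w2: "w = 1 - x * x" by (simp add: w_def power2_eq_square)
      have pw: "poly [:1, 0, -1:] x = w" by (simp add: w_def power2_eq_square)
      have B: "bump (Suc k) x = (poly (pderiv (bump_poly k)) x * w\<^sup>2 + 4 * real k * (x * w * poly (bump_poly k) x)
            - 2 * (x * poly (bump_poly k) x)) / (w ^ (2 * k) * w\<^sup>2) * exp (- 1 / w)"
        using True by (simp add: bump_def pw w_def[symmetric] power_add[symmetric] del: mult_pCons_left mult_pCons_right)
          (simp add: power2_eq_square w2[symmetric])
      define q where "q = w ^ (2 * k)"
      have q: "q \<noteq> 0" using w by (simp add: q_def)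
      show ?thesis
        by (rule DERIV_cong[OF DERIV_mult[OF DERIV_divide[OF poly_DERIV Wk] E]])
          (use w q in \<open>unfold B w_def[symmetric] q_def[symmetric], simp_all add: divide_simps, simp add: algebra_simps power2_eq_square\<close>)
    qed
    then show ?thesis
      by (rule DERIV_cong_ev[THEN iffD1, rotated -1, OF _ refl])
        (use True in \<open>auto simp: bump_def eventually_nhds intro!: exI[of _ "{-1<..<1}"]\<close>)
  next
    case False
    obtain C where "\<forall>y x. 1 \<le> \<bar>x\<bar> \<longrightarrow> \<bar>bump k y\<bar> \<le> C * (y - x)\<^sup>2" using bump_le_square by blast
    then have "(bump k has_real_derivative 0) (at x)"
      by (intro DERIV_0_of_le_square[of _ C]) (use False in auto)
    then show ?thesis using False by (simp add: bump_def)
  qed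
next
  fix k x assume "1 \<le> \<bar>x :: real\<bar>" then show "bump k x = 0" by (simp add: bump_def)
qed

lemma kernel_D: "smooth_kernel D \<Longrightarrow> (D k has_real_derivative D (Suc k) x) (at x)"
  and kernel_0: "smooth_kernel D \<Longrightarrow> 1 \<le> \<bar>x\<bar> \<Longrightarrow> D k x = 0"
  by (auto simp: smooth_kernel_def)

lemma kernel_cont: "smooth_kernel D \<Longrightarrow> continuous_on S (D k)"
  by (rule DERIV_continuous_on[of _ _ "D (Suc k)"]) (auto intro: kernel_D DERIV_subset)

lemma kernel_shift: "smooth_kernel D \<Longrightarrow> smooth_kernel (\<lambda>k. D (n + k))"
  by (auto simp: smooth_kernel_def)

lemma kernel_diff: "smooth_kernel D \<Longrightarrow> smooth_kernel E \<Longrightarrow> smooth_kernel (\<lambda>k x. D k x - E k x)"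
  by (auto simp: smooth_kernel_def intro!: derivative_eq_intros)

text \<open>The normalising integral runs over [-1, 1], the interval of integration in
  \<open>conv\<close>, so the mass is 1 in exactly the sense in which it is used. The factor e ^ k
  comes from the chain rule.\<close>

definition moll :: "real \<Rightarrow> nat \<Rightarrow> real \<Rightarrow> real" where
  "moll e k x = bump k (x / e) / (e ^ k * integral {-1..1} (\<lambda>x. bump 0 (x / e)))"

lemma bump_nonneg: "0 \<le> bump 0 x"
  by (simp add: bump_def)

lemma integral_bump_pos: assumes "0 < e" shows "0 < integral {-1..1} (\<lambda>x. bump 0 (x / e))"
proof -
  have c: "continuous_on {-1..1} (\<lambda>x. bump 0 (x / e))"
    by (intro continuous_on_compose2[OF kernel_cont[OF kernel_bump, of UNIV]] continuous_intros)
      (use assms in auto)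
  have "0 \<le> integral {-1..1} (\<lambda>x. bump 0 (x / e))"
    by (rule integral_nonneg) (auto intro!: integrable_continuous_real c bump_nonneg)
  moreover have "integral {-1..1} (\<lambda>x. bump 0 (x / e)) \<noteq> 0"
  proof
    assume "integral {-1..1} (\<lambda>x. bump 0 (x / e)) = 0"
    then have "bump 0 (0 / e) = 0" using integral_eq_0_iff[OF c] bump_nonneg by fastforce
    then show False by (simp add: bump_def)
  qed
  ultimately show ?thesis by simp
qed

lemma kernel_moll: assumes "0 < e" "e \<le> 1" shows "smooth_kernel (moll e)"
  unfolding smooth_kernel_def moll_def
proof (intro conjI allI impI)
  fix k x
  define I where "I = integral {-1..1} (\<lambda>x. bump 0 (x / e))"
  have I: "I > 0" using integral_bump_pos assms by (simp add: I_def)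
  have "((\<lambda>x. bump k (x / e)) has_real_derivative bump (Suc k) (x / e) * (1 / e)) (at x)"
    by (rule DERIV_chain2[OF kernel_D[OF kernel_bump]]) (use assms in \<open>auto intro!: derivative_eq_intros\<close>)
  from DERIV_cdivide[OF this, of "e ^ k * I"]
  show "((\<lambda>x. bump k (x / e) / (e ^ k * I)) has_real_derivative bump (Suc k) (x / e) / (e ^ Suc k * I)) (at x)"
    by (simp add: mult.assoc)
next
  fix k x assume "1 \<le> \<bar>x :: real\<bar>"
  then have "1 \<le> \<bar>x / e\<bar>" using assms by (simp add: abs_divide le_divide_eq)
  then show "bump k (x / e) / (e ^ k * integral {- 1..1} (\<lambda>x. bump 0 (x / e))) = 0"
    using kernel_0[OF kernel_bump] by simp
qed

lemma moll_nonneg: "0 < e \<Longrightarrow> 0 \<le> moll e 0 x"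
  using integral_bump_pos[of e] by (simp add: moll_def bump_nonneg)

lemma moll_0: "0 < e \<Longrightarrow> e \<le> \<bar>x\<bar> \<Longrightarrow> moll e k x = 0"
  by (simp add: moll_def kernel_0[OF kernel_bump] abs_divide)

lemma integral_moll: "0 < e \<Longrightarrow> integral {-1..1} (moll e 0) = 1"
  using integral_bump_pos[of e] by (simp add: moll_def[abs_def])

section \<open>Convolution with a kernel in one variable\<close>

definition conv :: "(real \<Rightarrow> real) \<Rightarrow> (real \<Rightarrow> 'a) \<Rightarrow> real \<Rightarrow> 'a::euclidean_space" where
  "conv \<theta> f t = integral {-1..1} (\<lambda>u. \<theta> u *\<^sub>R f (t - u))"

lemma conv_continuous:
  fixes f :: "'b::topological_space \<Rightarrow> real \<Rightarrow> 'a::euclidean_space"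
  assumes "continuous_on UNIV \<theta>" "continuous_on (U \<times> UNIV) (\<lambda>p. f (fst p) (snd p))"
  shows "continuous_on (U \<times> UNIV) (\<lambda>p. conv \<theta> (f (fst p)) (snd p))"
  unfolding conv_def cbox_interval[symmetric]
  by (rule integral_continuous_on_param)
    (auto simp: split_beta intro!: continuous_intros continuous_on_compose2[OF assms(1)]
       continuous_on_compose2[OF assms(2), where f = "\<lambda>x. (fst (fst x), snd (fst x) - snd x)", simplified])

lemma conv_integrable:
  fixes f :: "real \<Rightarrow> 'a::euclidean_space"
  assumes "continuous_on UNIV \<theta>" "continuous_on UNIV f"
  shows "(\<lambda>u. \<theta> u *\<^sub>R f (t - u)) integrable_on {a..b}"
  by (intro integrable_continuous_real continuous_intros continuous_on_compose2[OF assms(1)]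
      continuous_on_compose2[OF assms(2)]) auto

text \<open>With L > 0 the interval on the right is the same for all t near c, and t occurs only in
  the kernel. This prepares differentiation under the integral in \<open>conv_deriv\<close>.\<close>

lemma conv_eq:
  fixes f :: "real \<Rightarrow> 'a::euclidean_space"
  assumes "continuous_on UNIV \<theta>" "\<And>x. 1 \<le> \<bar>x\<bar> \<Longrightarrow> \<theta> x = 0" "continuous_on UNIV f" "\<bar>t - c\<bar> \<le> L"
  shows "conv \<theta> f t = integral {c-L-1..c+L+1} (\<lambda>s. \<theta> (t - s) *\<^sub>R f s)"
proof -
  have 1: "((\<lambda>u. \<theta> u *\<^sub>R f (t - u)) has_integral conv \<theta> f t) {-1..1}"
    unfolding conv_def using conv_integrable[OF assms(1,3)] by (rule integrable_integral)
  have "((\<lambda>u. \<theta> u *\<^sub>R f (t - u)) has_integral conv \<theta> f t) {t-c-L-1..t-c+L+1}"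
  proof (rule has_integral_on_superset[OF 1])
    fix x assume "x \<notin> {-1..1::real}"
    then show "\<theta> x *\<^sub>R f (t - x) = 0" using assms(2)[of x] by auto
  qed (use assms(4) in \<open>auto simp: abs_le_iff\<close>)
  from has_integral_affinity[OF this[folded cbox_interval], of "-1" t]
  have "((\<lambda>s. \<theta> (t - s) *\<^sub>R f s) has_integral conv \<theta> f t) ((\<lambda>x. - x + t) ` {t-c-L-1..t-c+L+1})"
    by simp
  also have "(\<lambda>x. - x + t) ` {t-c-L-1..t-c+L+1} = {c-L-1..c+L+1}"
    by (auto simp: image_iff algebra_simps intro!: bexI[of _ "t - _"])
  finally show ?thesis by (simp add: integral_unique)
qed

lemma conv_deriv:
  fixes f :: "real \<Rightarrow> 'a::euclidean_space"
  assumes D: "smooth_kernel D" and f: "continuous_on UNIV f"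
  shows "((conv (D k) f) has_vector_derivative conv (D (Suc k)) f t) (at t)"
proof -
  \<comment> \<open>The window of \<open>conv_eq\<close> with centre t and L = 1.\<close>
  have "((\<lambda>x. integral (cbox (t-1-1) (t+1+1)) (\<lambda>s. D k (x - s) *\<^sub>R f s)) has_vector_derivative
     integral (cbox (t-1-1) (t+1+1)) (\<lambda>s. D (Suc k) (t - s) *\<^sub>R f s)) (at t within ball t 1)"
  proof (rule leibniz_rule_vector_derivative)
    fix x s
    have "((\<lambda>x. D k (x - s)) has_real_derivative D (Suc k) (x - s)) (at x within ball t 1)"
      using DERIV_chain2[OF kernel_D[OF D], where g = "\<lambda>x. x - s" and Db = 1, simplified]
      by (rule meta_mp) (auto intro!: derivative_eq_intros)
    then show "((\<lambda>x. D k (x - s) *\<^sub>R f s) has_vector_derivative D (Suc k) (x - s) *\<^sub>R f s) (at x within ball t 1)"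
      by (auto intro!: derivative_eq_intros simp: has_real_derivative_iff_has_vector_derivative)
  next
    fix x show "(\<lambda>s. D k (x - s) *\<^sub>R f s) integrable_on cbox (t-1-1) (t+1+1)"
      by (intro integrable_continuous continuous_intros continuous_on_compose2[OF kernel_cont[OF D, of UNIV]]
        continuous_on_subset[OF f]) auto
  next
    show "continuous_on (ball t 1 \<times> cbox (t-1-1) (t+1+1)) (\<lambda>(x, s). D (Suc k) (x - s) *\<^sub>R f s)"
      unfolding split_beta
      by (intro continuous_intros continuous_on_compose2[OF kernel_cont[OF D, of UNIV]]
        continuous_on_compose2[OF f]) auto
  qed auto
  then have "((\<lambda>x. integral (cbox (t-1-1) (t+1+1)) (\<lambda>s. D k (x - s) *\<^sub>R f s)) has_vector_derivative
     integral (cbox (t-1-1) (t+1+1)) (\<lambda>s. D (Suc k) (t - s) *\<^sub>R f s)) (at t)"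
    by (simp add: at_within_open[OF centre_in_ball[THEN iffD2]])
  also have "integral (cbox (t-1-1) (t+1+1)) (\<lambda>s. D (Suc k) (t - s) *\<^sub>R f s) = conv (D (Suc k)) f t"
    using conv_eq[OF kernel_cont[OF D] kernel_0[OF D] f, of t t 1 "Suc k"] by simp
  finally show ?thesis
  proof (rule has_vector_derivative_transform_within_open[where S = "ball t 1"])
    fix x assume "x \<in> ball t 1"
    then show "integral (cbox (t-1-1) (t+1+1)) (\<lambda>s. D k (x - s) *\<^sub>R f s) = conv (D k) f x"
      using conv_eq[OF kernel_cont[OF D] kernel_0[OF D] f, of x t 1 k] by (simp add: dist_real_def abs_minus_commute)
  qed auto
qed

lemma conv_moll_close:
  fixes f :: "real \<Rightarrow> 'a::euclidean_space"
  assumes e: "0 < e" "e \<le> 1" and f: "continuous_on UNIV f"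
    and B: "\<And>u. \<bar>u\<bar> \<le> e \<Longrightarrow> norm (f (t - u) - f t) \<le> B"
  shows "norm (conv (moll e 0) f t - f t) \<le> B"
proof -
  have m: "continuous_on UNIV (moll e 0)" by (rule kernel_cont[OF kernel_moll[OF e]])
  have i: "(\<lambda>u. moll e 0 u *\<^sub>R f t) integrable_on {-1..1}"
    by (intro integrable_continuous_real continuous_intros continuous_on_subset[OF m]) auto
  have "conv (moll e 0) f t - f t = integral {-1..1} (\<lambda>u. moll e 0 u *\<^sub>R f (t - u)) - integral {-1..1} (\<lambda>u. moll e 0 u *\<^sub>R f t)"
    using integral_moll[OF e(1)]
    by (simp add: conv_def integral_unique[OF has_integral_scaleR_left[OF integrable_integral[OF integrable_continuous_real[OF continuous_on_subset[OF m]]]]])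
  also have "\<dots> = integral {-1..1} (\<lambda>u. moll e 0 u *\<^sub>R (f (t - u) - f t))"
    using conv_integrable[OF m f] i by (simp add: integral_diff[symmetric] scaleR_diff_right)
  also have "norm \<dots> \<le> integral {-1..1} (\<lambda>u. moll e 0 u * B)"
  proof (rule integral_norm_bound_integral)
    show "(\<lambda>u. moll e 0 u *\<^sub>R (f (t - u) - f t)) integrable_on {-1..1}"
      using integrable_diff[OF conv_integrable[OF m f] i] by (simp add: scaleR_diff_right)
    show "(\<lambda>u. moll e 0 u * B) integrable_on {-1..1}"
      by (intro integrable_continuous_real continuous_intros continuous_on_subset[OF m]) auto
    fix u
    show "norm (moll e 0 u *\<^sub>R (f (t - u) - f t)) \<le> moll e 0 u * B"
    proof (cases "\<bar>u\<bar> \<le> e")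
      case True then show ?thesis using B[OF True] moll_nonneg[OF e(1), of u] by (simp add: mult_left_mono)
    next
      case False then show ?thesis using moll_0[OF e(1), of u 0] by simp
    qed
  qed
  also have "\<dots> = B" using integral_moll[OF e(1)] by simp
  finally show ?thesis .
qed

lemma uniform_near_0:
  fixes G :: "'b::metric_space \<Rightarrow> real \<Rightarrow> 'a::metric_space"
  assumes "compact K" "continuous_on (K \<times> {-1..1}) (\<lambda>p. G (fst p) (snd p))" "0 < d"
  obtains e where "0 < e" "e \<le> 1" "\<And>p u. p \<in> K \<Longrightarrow> \<bar>u\<bar> \<le> e \<Longrightarrow> dist (G p u) (G p 0) \<le> d"
proof -
  have "uniformly_continuous_on (K \<times> {-1..1}) (\<lambda>p. G (fst p) (snd p))"
    by (intro compact_uniformly_continuous assms compact_Times compact_Icc)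
  then obtain e where e: "0 < e" "\<And>x y. x \<in> K \<times> {-1..1} \<Longrightarrow> y \<in> K \<times> {-1..1} \<Longrightarrow> dist y x < e \<Longrightarrow>
      dist (G (fst y) (snd y)) (G (fst x) (snd x)) < d"
    unfolding uniformly_continuous_on_def using assms(3) by metis
  show ?thesis
  proof (rule that[of "min 1 (e/2)"])
    fix p u assume "p \<in> K" "\<bar>u\<bar> \<le> min 1 (e/2)"
    then show "dist (G p u) (G p 0) \<le> d"
      using e(2)[of "(p,0)" "(p,u)"] e(1) by (auto simp: dist_Pair_Pair dist_real_def abs_le_iff)
  qed (use e in auto)
qed

text \<open>The hypothesis says that f' = h weakly. Mollification makes it a classical identity,
  which is integrated over [x, y]; as the scale tends to 0 it becomes f y - f x = \<integral> h, and
  h is continuous.\<close>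

lemma conv_du_Bois_Reymond:
  fixes f h :: "real \<Rightarrow> complex"
  assumes f: "continuous_on UNIV f" and h: "continuous_on UNIV h"
    and eq: "\<And>D x. smooth_kernel D \<Longrightarrow> conv (D 1) f x = conv (D 0) h x"
  shows "(f has_vector_derivative h x) (at x)"
proof -
  have *: "f y - f x = integral {x..y} h" if "x \<le> y" for x y
  proof -
    \<comment> \<open>One d for each end point from mollifying f, and d (y - x) from mollifying h
      under the integral.\<close>
    have *: "norm (f y - f x - integral {x..y} h) \<le> (y - x + 2) * d" if d: "0 < d" for d
    proof -
      have c: "continuous_on ({x..y} \<times> {-1..1}) (\<lambda>p. k (fst p - snd p))" if "continuous_on UNIV k" for k :: "real \<Rightarrow> complex"
        by (rule continuous_on_compose2[OF that]) (auto intro!: continuous_intros)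
      obtain e1 where e1: "0 < e1" "e1 \<le> 1" "\<And>p u. p \<in> {x..y} \<Longrightarrow> \<bar>u\<bar> \<le> e1 \<Longrightarrow> dist (f (p - u)) (f (p - 0)) \<le> d"
        using uniform_near_0[OF compact_Icc c[OF f] d] by metis
      obtain e2 where e2: "0 < e2" "e2 \<le> 1" "\<And>p u. p \<in> {x..y} \<Longrightarrow> \<bar>u\<bar> \<le> e2 \<Longrightarrow> dist (h (p - u)) (h (p - 0)) \<le> d"
        using uniform_near_0[OF compact_Icc c[OF h] d] by metis
      define e where "e = min e1 e2"
      have e: "0 < e" "e \<le> 1" using e1 e2 by (auto simp: e_def)
      have fc: "norm (conv (moll e 0) f p - f p) \<le> d" if "p \<in> {x..y}" for p
        using e1(3)[OF that] by (intro conv_moll_close[OF e f]) (auto simp: dist_norm e_def)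
      have hc: "norm (conv (moll e 0) h p - h p) \<le> d" if "p \<in> {x..y}" for p
        using e2(3)[OF that] by (intro conv_moll_close[OF e h]) (auto simp: dist_norm e_def)
      have k: "smooth_kernel (moll e)" by (rule kernel_moll[OF e])
      have "((\<lambda>p. conv (moll e 0) h p) has_integral conv (moll e 0) f y - conv (moll e 0) f x) {x..y}"
        using conv_deriv[OF k f, of 0] eq[OF k]
        by (intro fundamental_theorem_of_calculus \<open>x \<le> y\<close>) (auto intro: has_vector_derivative_at_within)
      then have "((\<lambda>p. conv (moll e 0) h p - h p) has_integral conv (moll e 0) f y - conv (moll e 0) f x - integral {x..y} h) {x..y}"
        by (intro has_integral_diff integrable_integral integrable_continuous_real continuous_on_subset[OF h]) auto
      then have "norm (conv (moll e 0) f y - conv (moll e 0) f x - integral {x..y} h) \<le> d * measure lborel (cbox x y)"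
        by (intro has_integral_bound[of d "\<lambda>p. conv (moll e 0) h p - h p"]) (use hc d in auto)
      then have "norm (conv (moll e 0) f y - conv (moll e 0) f x - integral {x..y} h) \<le> d * (y - x)"
        using \<open>x \<le> y\<close> by simp
      moreover have tri: "norm (a - b + c) \<le> norm a + norm b + norm c" for a b c :: complex
        using norm_triangle_ineq[of "a - b" c] norm_triangle_ineq4[of a b] by linarith
      have "norm (f y - f x - integral {x..y} h) \<le> norm (conv (moll e 0) f y - conv (moll e 0) f x - integral {x..y} h)
          + norm (conv (moll e 0) f y - f y) + norm (conv (moll e 0) f x - f x)"
      proof -
        have "f y - f x - integral {x..y} h = (conv (moll e 0) f y - conv (moll e 0) f x - integral {x..y} h)
          - (conv (moll e 0) f y - f y) + (conv (moll e 0) f x - f x)" by simp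
        then show ?thesis
          using tri[of "conv (moll e 0) f y - conv (moll e 0) f x - integral {x..y} h" "conv (moll e 0) f y - f y" "conv (moll e 0) f x - f x"]
          by (simp only:)
      qed
      ultimately show ?thesis using fc[of x] fc[of y] \<open>x \<le> y\<close> by (simp add: algebra_simps)
    qed
    have "norm (f y - f x - integral {x..y} h) \<le> 0"
    proof (rule field_le_epsilon)
      fix d :: real assume "0 < d"
      have "0 < y - x + 2" using \<open>x \<le> y\<close> by simp
      then have "(y - x + 2) * (d / (y - x + 2)) = d" "0 < d / (y - x + 2)" using \<open>0 < d\<close> by auto
      then show "norm (f y - f x - integral {x..y} h) \<le> 0 + d"
        using *[of "d / (y - x + 2)"] by simp
    qed
    then show ?thesis by simp
  qed
  have "((\<lambda>y. integral {x-1..y} h) has_vector_derivative h x) (at x within {x-1..x+1})"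
    by (rule integral_has_vector_derivative) (auto intro: continuous_on_subset[OF h])
  then have "((\<lambda>y. f (x-1) + integral {x-1..y} h) has_vector_derivative h x) (at x within {x-1..x+1})"
    by (auto intro!: derivative_eq_intros)
  then have "(f has_vector_derivative h x) (at x within {x-1..x+1})"
  proof (rule has_vector_derivative_transform_within[where d = 1])
    fix y assume "y \<in> {x-1..x+1}"
    then show "f (x-1) + integral {x-1..y} h = f y" using *[of "x-1" y, symmetric] by simp
  qed auto
  moreover have "at x within {x-1..x+1} = at x" by (rule at_within_Icc_at) auto
  ultimately show ?thesis by simp
qed

subsection \<open>Duality for square-integrable functions\<close>

lemma testfun1_of_kernel_like:
  assumes "\<And>k x. (D k has_real_derivative D (Suc k) x) (at x)"
    and "\<And>x. x \<notin> {a..b} \<Longrightarrow> D 0 x = 0" "{a..b} \<subseteq> U"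
  shows "testfun1 U (D 0)"
proof -
  have sub: "closure {x. D 0 x \<noteq> 0} \<subseteq> {a..b}"
  proof (rule closure_minimal)
    show "{x. D 0 x \<noteq> 0} \<subseteq> {a..b}" using assms(2) by blast
  qed auto
  then have "compact (closure {x. D 0 x \<noteq> 0})"
    by (meson bounded_closed_interval bounded_subset closed_closure compact_eq_bounded_closed)
  then show ?thesis
    using assms(1,3) sub by (auto simp: testfun1_def smooth1_def intro!: exI[of _ D])
qed

section \<open>Truncation in value and in space\<close>

definition clip :: "real \<Rightarrow> real \<Rightarrow> real" where "clip N y = max (- N) (min N y)"

lemma clip_bound: "0 \<le> N \<Longrightarrow> \<bar>clip N y\<bar> \<le> N"
  by (auto simp: clip_def)

lemma clip_le: "0 \<le> N \<Longrightarrow> \<bar>clip N y\<bar> \<le> \<bar>y\<bar>" and clip_sq_le: "0 \<le> N \<Longrightarrow> (clip N y)\<^sup>2 \<le> clip N y * y"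
proof -
  assume N: "0 \<le> N"
  show "\<bar>clip N y\<bar> \<le> \<bar>y\<bar>" using N by (auto simp: clip_def)
  show "(clip N y)\<^sup>2 \<le> clip N y * y"
  proof (cases "0 \<le> y")
    case True
    then have "clip N y = min N y" using N by (auto simp: clip_def)
    then show ?thesis using N True by (auto simp: power2_eq_square min_def intro: mult_left_mono)
  next
    case False
    then have "clip N y = max (-N) y" using N by (auto simp: clip_def)
    then show ?thesis using N False by (auto simp: power2_eq_square max_def mult_left_mono[of N "- y" N, simplified])
  qed
qed

lemma clip_continuous: "continuous_on S (clip N)"
  unfolding clip_def by (intro continuous_intros)

lemma clip_eq: "\<bar>y\<bar> \<le> N \<Longrightarrow> clip N y = y" by (auto simp: clip_def)

text \<open>For N > 0 a trapezoid that vanishes up to distance 1/N inside the end points and equals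
  1 from distance 2/N on. The margin leaves room for a mollification supported in (c, d).\<close>

definition plateau :: "real \<Rightarrow> real \<Rightarrow> real \<Rightarrow> real \<Rightarrow> real" where
  "plateau c d N x = max 0 (min 1 (N * min (x - c) (d - x) - 1))"

lemma plateau_continuous: "continuous_on S (plateau c d N)"
  unfolding plateau_def by (intro continuous_intros)

lemma plateau_bounds: "0 \<le> plateau c d N x" "plateau c d N x \<le> 1"
  by (auto simp: plateau_def)

lemma plateau_0: "0 < N \<Longrightarrow> x \<notin> {c + 1/N..d - 1/N} \<Longrightarrow> plateau c d N x = 0"
proof -
  assume N: "0 < N" and x: "x \<notin> {c + 1/N..d - 1/N}"
  have "x - c < 1 / N \<or> d - x < 1 / N" using x by auto
  then have "min (x - c) (d - x) < 1 / N" by linarith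
  then have "N * min (x - c) (d - x) < 1" using N by (simp add: less_divide_eq mult.commute)
  then show ?thesis by (simp add: plateau_def)
qed

lemma plateau_tendsto_1: assumes "x \<in> {c<..<d}"
  shows "(\<lambda>n. plateau c d (real n) x) \<longlonglongrightarrow> 1"
proof (rule tendsto_eventually)
  obtain n0 where n0: "2 / min (x - c) (d - x) < real n0" using reals_Archimedean2 by blast
  have "plateau c d (real n) x = 1" if "n0 \<le> n" for n
  proof -
    have "2 / min (x - c) (d - x) < real n" using n0 that by linarith
    then have "2 < real n * min (x - c) (d - x)" using assms by (simp add: divide_less_eq split: if_splits)
    then show ?thesis by (simp add: plateau_def)
  qed
  then show "\<forall>\<^sub>F n in sequentially. plateau c d (real n) x = 1"
    unfolding eventually_sequentially by blast
qed

lemma sq_le_imp: fixes y :: real assumes "0 \<le> y" "0 \<le> M" "y \<le> M * sqrt y" shows "y \<le> M\<^sup>2"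
proof (cases "y = 0")
  case False
  then have y: "0 < sqrt y" using assms by auto
  have "sqrt y * sqrt y \<le> M * sqrt y" using assms by simp
  then have "sqrt y \<le> M" using y by (rule mult_right_le_imp_le)
  then have "(sqrt y)\<^sup>2 \<le> M\<^sup>2" using y by (intro power_mono) auto
  then show ?thesis using assms by simp
qed auto

text \<open>The L^2 norm recovered from pairings with test functions. The ideal test function would
  be D itself; it is reached in stages, from test functions to continuous functions to truncations
  of D.\<close>

locale dual_bound =
  fixes c d M :: real and D :: "real \<Rightarrow> real"
  assumes cd: "c < d" and M: "0 \<le> M"
    and D_int: "integrable lborel D" and D_out: "\<And>x. x \<notin> {c<..<d} \<Longrightarrow> D x = 0"
    and bound: "\<And>\<xi>. testfun1 {c<..<d} \<xi> \<Longrightarrow> \<bar>LINT x|lborel. \<xi> x * D x\<bar> \<le> M * sqrt (LINT x|lborel. (\<xi> x)\<^sup>2)"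
begin

lemma bounded_mult_integrable:
  assumes "g \<in> borel_measurable borel" "\<And>x. \<bar>g x\<bar> \<le> B"
  shows "integrable lborel (\<lambda>x. g x * D x)"
proof (rule Bochner_Integration.integrable_bound[OF integrable_mult_left[OF integrable_abs[OF D_int], of B]])
  show "(\<lambda>x. g x * D x) \<in> borel_measurable lborel"
    using assms borel_measurable_integrable[OF D_int] by simp
  show "AE x in lborel. norm (g x * D x) \<le> norm (\<bar>D x\<bar> * B)"
  proof (rule AE_I2)
    fix x show "norm (g x * D x) \<le> norm (\<bar>D x\<bar> * B)"
      using mult_right_mono[OF assms(2)[of x], of "\<bar>D x\<bar>"] assms(2)[of x] by (simp add: abs_mult mult.commute)
  qed
qed

lemma bounded_supp_integrable:
  fixes f :: "real \<Rightarrow> real"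
  assumes "f \<in> borel_measurable borel" "\<And>x. \<bar>f x\<bar> \<le> B" "\<And>x. x \<notin> {c<..<d} \<Longrightarrow> f x = 0"
  shows "integrable lborel f"
proof (rule Bochner_Integration.integrable_bound[of _ "\<lambda>x. indicator {c<..<d} x * B"])
  show "integrable lborel (\<lambda>x. indicator {c<..<d} x * B)"
    using cd by (intro integrable_mult_left) (simp add: integrable_indicator_iff)
  show "f \<in> borel_measurable lborel" using assms(1) by simp
  show "AE x in lborel. norm (f x) \<le> norm (indicator {c<..<d} x * B)"
  proof (rule AE_I2)
    fix x show "norm (f x) \<le> norm (indicator {c<..<d} x * B)"
      using assms(2)[of x] assms(3)[of x] by (cases "x \<in> {c<..<d}") auto
  qed
qed

text \<open>g is the uniform limit of its mollifications, and these are test functions because g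
  keeps a distance \<delta> from the end points. On a bounded interval uniform convergence carries
  both sides of \<open>bound\<close> to the limit.\<close>

lemma bound_continuous:
  assumes g: "continuous_on UNIV g" and B: "\<And>x. \<bar>g x\<bar> \<le> B"
    and \<delta>: "0 < \<delta>" and supp: "\<And>x. x \<notin> {c + \<delta>..d - \<delta>} \<Longrightarrow> g x = 0"
  shows "\<bar>LINT x|lborel. g x * D x\<bar> \<le> M * sqrt (LINT x|lborel. (g x)\<^sup>2)"
proof -
  define ID where "ID = (LINT x|lborel. \<bar>D x\<bar>)"
  have gm: "g \<in> borel_measurable borel" by (rule borel_measurable_continuous_onI[OF g])
  have key: "\<bar>LINT x|lborel. g x * D x\<bar> \<le> M * sqrt ((LINT x|lborel. (g x)\<^sup>2) + \<eta> * (2 * B + \<eta>) * (d - c)) + \<eta> * ID"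
    if \<eta>: "0 < \<eta>" for \<eta>
  proof -
    have "continuous_on ({c..d} \<times> {-1..1}) (\<lambda>p. g (fst p - snd p))"
      by (rule continuous_on_compose2[OF g]) (auto intro!: continuous_intros)
    then obtain e0 where e0: "0 < e0" "e0 \<le> 1" "\<And>p u. p \<in> {c..d} \<Longrightarrow> \<bar>u\<bar> \<le> e0 \<Longrightarrow> dist (g (p - u)) (g (p - 0)) \<le> \<eta>"
      using uniform_near_0[OF compact_Icc _ \<eta>, of c d "\<lambda>p u. g (p - u)"] by metis
    \<comment> \<open>Half of the margin \<delta>, so that the mollified function still vanishes
      near c and d.\<close>
    define e where "e = min e0 (\<delta>/2)"
    have e: "0 < e" "e \<le> 1" using e0 \<delta> by (auto simp: e_def)
    define G where "G k x = conv (moll e k) g x" for k x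
    have k: "smooth_kernel (moll e)" by (rule kernel_moll[OF e])
    have G0: "G 0 x = 0" if "x \<notin> {c + \<delta>/2..d - \<delta>/2}" for x
    proof -
      have "moll e 0 u *\<^sub>R g (x - u) = 0" for u
      proof (cases "e \<le> \<bar>u\<bar>")
        case True then show ?thesis using moll_0[OF e(1) True] by simp
      next
        case False
        then have "x - u \<notin> {c + \<delta>..d - \<delta>}" using that by (auto simp: e_def abs_le_iff)
        then show ?thesis using supp by simp
      qed
      then show ?thesis unfolding G_def conv_def by (simp only: integral_0)
    qed
    have deriv: "(G k has_real_derivative G (Suc k) x) (at x)" for k x
      unfolding G_def[abs_def] using conv_deriv[OF k g] by (simp add: has_real_derivative_iff_has_vector_derivative)
    have tf: "testfun1 {c<..<d} (G 0)"
      by (rule testfun1_of_kernel_like[of G "c + \<delta>/2" "d - \<delta>/2", OF deriv G0]) (use \<delta> in auto)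
    have close: "\<bar>G 0 x - g x\<bar> \<le> \<eta>" for x
    proof (cases "x \<in> {c..d}")
      case True
      then show ?thesis using e0(3)[OF True] conv_moll_close[OF e g, of x \<eta>]
        by (auto simp: G_def dist_real_def e_def)
    next
      case False
      then have "G 0 x = 0" "g x = 0" using \<delta> by (auto intro!: G0 supp)
      then show ?thesis using \<eta> by simp
    qed
    have Gc: "continuous_on UNIV (G 0)" using deriv by (intro DERIV_continuous_on) blast
    have Gm: "G 0 \<in> borel_measurable borel" by (rule borel_measurable_continuous_onI[OF Gc])
    have GB: "\<bar>G 0 x\<bar> \<le> B + \<eta>" for x using close[of x] B[of x] by linarith
    have Gout: "x \<notin> {c<..<d} \<Longrightarrow> G 0 x = 0" for x by (rule G0) (use \<delta> in auto)
    have gout: "x \<notin> {c<..<d} \<Longrightarrow> g x = 0" for x by (rule supp) (use \<delta> in auto)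
    have i1: "integrable lborel (\<lambda>x. G 0 x * D x)" by (rule bounded_mult_integrable[OF Gm GB])
    have i2: "integrable lborel (\<lambda>x. g x * D x)" by (rule bounded_mult_integrable[OF gm B])
    have B0: "0 \<le> B" using B[of 0] by linarith
    have "\<bar>(LINT x|lborel. g x * D x) - (LINT x|lborel. G 0 x * D x)\<bar> = \<bar>LINT x|lborel. (g x - G 0 x) * D x\<bar>"
      using i1 i2 by (simp add: left_diff_distrib)
    also have "\<dots> \<le> (LINT x|lborel. \<bar>(g x - G 0 x) * D x\<bar>)" by (rule integral_abs_bound)
    also have "\<dots> \<le> (LINT x|lborel. \<eta> * \<bar>D x\<bar>)"
    proof (rule integral_mono)
      show "integrable lborel (\<lambda>x. \<bar>(g x - G 0 x) * D x\<bar>)"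
        using Bochner_Integration.integrable_diff[OF i2 i1] by (intro integrable_abs) (simp add: left_diff_distrib)
      show "\<bar>(g x - G 0 x) * D x\<bar> \<le> \<eta> * \<bar>D x\<bar>" for x
        using mult_right_mono[OF close[of x], of "\<bar>D x\<bar>"] by (simp add: abs_mult abs_minus_commute)
    qed (use D_int in simp)
    finally have d1: "\<bar>(LINT x|lborel. g x * D x) - (LINT x|lborel. G 0 x * D x)\<bar> \<le> \<eta> * ID"
      by (simp add: ID_def)
    have gsq: "integrable lborel (\<lambda>x. (g x)\<^sup>2)"
      by (rule bounded_supp_integrable[of _ "B\<^sup>2"]) (use gm B gout in \<open>auto simp: abs_le_square_iff[symmetric] B0\<close>)
    have ind: "integrable lborel (\<lambda>x. indicator {c<..<d} x * K)" for K :: real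
      using cd by (intro integrable_mult_left) (simp add: integrable_indicator_iff)
    have "(LINT x|lborel. (G 0 x)\<^sup>2) \<le> (LINT x|lborel. (g x)\<^sup>2 + indicator {c<..<d} x * (\<eta> * (2 * B + \<eta>)))"
    proof (rule integral_mono)
      show "integrable lborel (\<lambda>x. (G 0 x)\<^sup>2)"
        by (rule bounded_supp_integrable[of _ "(B + \<eta>)\<^sup>2"]) (use Gm GB Gout B0 \<eta> in \<open>auto simp: abs_le_square_iff[symmetric]\<close>)
      show "integrable lborel (\<lambda>x. (g x)\<^sup>2 + indicator {c<..<d} x * (\<eta> * (2 * B + \<eta>)))"
        by (intro Bochner_Integration.integrable_add gsq ind)
      fix x
      show "(G 0 x)\<^sup>2 \<le> (g x)\<^sup>2 + indicator {c<..<d} x * (\<eta> * (2 * B + \<eta>))"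
      proof (cases "x \<in> {c<..<d}")
        case True
        have "(G 0 x)\<^sup>2 - (g x)\<^sup>2 = (G 0 x - g x) * (G 0 x + g x)" by (simp add: algebra_simps power2_eq_square)
        also have "\<dots> \<le> \<bar>G 0 x - g x\<bar> * \<bar>G 0 x + g x\<bar>" by (metis abs_ge_self abs_mult)
        also have "\<dots> \<le> \<eta> * (2 * B + \<eta>)"
          by (rule mult_mono) (use close[of x] GB[of x] B[of x] \<eta> in auto)
        finally show ?thesis using True by simp
      qed (simp add: Gout gout)
    qed
    also have "\<dots> = (LINT x|lborel. (g x)\<^sup>2) + \<eta> * (2 * B + \<eta>) * (d - c)"
      using cd by (subst Bochner_Integration.integral_add[OF gsq ind]) simp
    finally have "M * sqrt (LINT x|lborel. (G 0 x)\<^sup>2) \<le> M * sqrt ((LINT x|lborel. (g x)\<^sup>2) + \<eta> * (2 * B + \<eta>) * (d - c))"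
      by (intro mult_left_mono M) simp
    with bound[OF tf] d1 show ?thesis by linarith
  qed
  have "((\<lambda>\<eta>. M * sqrt ((LINT x|lborel. (g x)\<^sup>2) + \<eta> * (2 * B + \<eta>) * (d - c)) + \<eta> * ID) \<longlongrightarrow>
      M * sqrt ((LINT x|lborel. (g x)\<^sup>2) + 0 * (2 * B + 0) * (d - c)) + 0 * ID) (at_right 0)"
    by (intro tendsto_intros)
  then have "\<bar>LINT x|lborel. g x * D x\<bar> \<le> M * sqrt ((LINT x|lborel. (g x)\<^sup>2) + 0 * (2 * B + 0) * (d - c)) + 0 * ID"
    by (rule tendsto_lowerbound) (auto simp: eventually_at_right_less intro!: eventually_at_rightI[of 0 1] key)
  then show ?thesis by simp
qed

text \<open>For a truncation h of D one has h^2 \<le> h D pointwise, so pairing with h gives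
  \<parallel>h\<parallel>^2 \<le> M \<parallel>h\<parallel>. Continuous functions converging to D
  almost everywhere make h admissible: they are passed to the limit at a fixed truncation level n,
  which supplies the dominating functions, and n grows only afterwards.\<close>

theorem L2_le:
  assumes D2: "integrable lborel (\<lambda>x. (D x)\<^sup>2)"
  shows "(LINT x|lborel. (D x)\<^sup>2) \<le> M\<^sup>2"
proof -
  \<comment> \<open>This notion of measurability comes with continuous functions that converge to D
    off a negligible set.\<close>
  have "D measurable_on UNIV"
    using borel_measurable_integrable[OF D_int]
    by (simp add: measurable_on_iff_borel_measurable lebesgue_on_UNIV_eq measurable_completion)
  then obtain N g where N: "negligible N" and gc: "\<And>n. continuous_on UNIV (g n)"
    and lim: "\<And>x. x \<notin> N \<Longrightarrow> (\<lambda>n. g n x) \<longlonglongrightarrow> D x"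
    unfolding measurable_on_def by auto
  have AEN: "AE x in lborel. x \<notin> N"
  proof -
    have "N \<in> null_sets lebesgue" using N negligible_iff_null_sets by blast
    then show ?thesis using AE_not_in AE_completion_iff by blast
  qed
  have Dm: "D \<in> borel_measurable borel" using borel_measurable_integrable[OF D_int] by simp
  define h where "h n x = plateau c d (real n) x * clip (real n) (D x)" for n x
  have cm: "clip N \<in> borel_measurable borel" for N by (rule borel_measurable_continuous_onI[OF clip_continuous])
  have pm: "plateau c d N \<in> borel_measurable borel" for N by (rule borel_measurable_continuous_onI[OF plateau_continuous])
  have hm: "h n \<in> borel_measurable borel" for n
    unfolding h_def using Dm pm[of n] measurable_compose[OF Dm cm] by measurable
  have main: "(LINT x|lborel. (h n x)\<^sup>2) \<le> M\<^sup>2" if n: "0 < n" for n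
  proof -
    define G where "G k x = plateau c d (real n) x * clip (real n) (g k x)" for k x
    have Gc: "continuous_on UNIV (G k)" for k
      unfolding G_def by (intro continuous_intros plateau_continuous continuous_on_compose2[OF clip_continuous[of UNIV] gc]) auto
    have Gm: "G k \<in> borel_measurable borel" for k by (rule borel_measurable_continuous_onI[OF Gc])
    have pc: "\<bar>plateau c d (real n) x * clip (real n) y\<bar> \<le> real n" for x y
      using mult_mono[OF plateau_bounds(2)[of c d "real n" x] clip_bound[of "real n" y]] plateau_bounds(1)[of c d "real n" x]
      by (simp add: abs_mult)
    have GB: "\<bar>G k x\<bar> \<le> real n" for k x unfolding G_def by (rule pc)
    have hB: "\<bar>h n x\<bar> \<le> real n" for x unfolding h_def by (rule pc)
    have supp: "G k x = 0" if "x \<notin> {c + 1/real n..d - 1/real n}" for k x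
      using plateau_0[of "real n" x c d] that n by (simp add: G_def)
    have in_cd: "x \<in> {c<..<d}" if "x \<in> {c + 1/real n..d - 1/real n}" for x
    proof -
      have "0 < 1 / real n" using n by simp
      then show ?thesis using that unfolding atLeastAtMost_iff greaterThanLessThan_iff by linarith
    qed
    have Glim: "(\<lambda>k. G k x) \<longlonglongrightarrow> h n x" if "x \<notin> N" for x
      unfolding G_def h_def
      by (intro tendsto_intros continuous_on_tendsto_compose[OF clip_continuous[of UNIV] lim[OF that]]) auto
    have 1: "\<bar>LINT x|lborel. G k x * D x\<bar> \<le> M * sqrt (LINT x|lborel. (G k x)\<^sup>2)" for k
      by (rule bound_continuous[OF Gc GB _ supp]) (use n in auto)
    have l1: "(\<lambda>k. LINT x|lborel. G k x * D x) \<longlonglongrightarrow> (LINT x|lborel. h n x * D x)"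
    proof (rule integral_dominated_convergence[where w = "\<lambda>x. real n * \<bar>D x\<bar>"])
      show "AE x in lborel. (\<lambda>k. G k x * D x) \<longlonglongrightarrow> h n x * D x"
        using AEN by eventually_elim (intro tendsto_intros Glim)
      show "AE x in lborel. norm (G k x * D x) \<le> real n * \<bar>D x\<bar>" for k
        using GB by (auto simp: abs_mult intro!: AE_I2 mult_right_mono)
    qed (use Gm hm Dm D_int in auto)
    have l2: "(\<lambda>k. LINT x|lborel. (G k x)\<^sup>2) \<longlonglongrightarrow> (LINT x|lborel. (h n x)\<^sup>2)"
    proof (rule integral_dominated_convergence[where w = "\<lambda>x. indicator {c<..<d} x * (real n)\<^sup>2"])
      show "AE x in lborel. (\<lambda>k. (G k x)\<^sup>2) \<longlonglongrightarrow> (h n x)\<^sup>2"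
        using AEN by eventually_elim (intro tendsto_intros Glim)
      show "AE x in lborel. norm ((G k x)\<^sup>2) \<le> indicator {c<..<d} x * (real n)\<^sup>2" for k
      proof (rule AE_I2)
        fix x show "norm ((G k x)\<^sup>2) \<le> indicator {c<..<d} x * (real n)\<^sup>2"
        proof (cases "x \<in> {c<..<d}")
          case True then show ?thesis using GB[of k x] by (simp add: abs_le_square_iff[symmetric])
        next
          case False then show ?thesis using supp[of x k] in_cd[of x] by auto
        qed
      qed
      show "integrable lborel (\<lambda>x. indicator {c<..<d} x * (real n)\<^sup>2)"
        using cd by (intro integrable_mult_left) (simp add: integrable_indicator_iff)
    qed (use Gm hm in auto)
    have 2: "\<bar>LINT x|lborel. h n x * D x\<bar> \<le> M * sqrt (LINT x|lborel. (h n x)\<^sup>2)"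
      by (rule LIMSEQ_le[OF tendsto_rabs[OF l1] tendsto_mult[OF tendsto_const tendsto_real_sqrt[OF l2]]]) (use 1 in blast)
    have "(LINT x|lborel. (h n x)\<^sup>2) \<le> (LINT x|lborel. h n x * D x)"
    proof (rule integral_mono')
      show "integrable lborel (\<lambda>x. h n x * D x)" by (rule bounded_mult_integrable[OF hm hB])
      fix x
      have p2: "(plateau c d (real n) x)\<^sup>2 \<le> plateau c d (real n) x"
        using plateau_bounds[of c d "real n" x] by (simp add: power2_eq_square mult_left_le)
      have "(h n x)\<^sup>2 = (plateau c d (real n) x)\<^sup>2 * (clip (real n) (D x))\<^sup>2" by (simp add: h_def power_mult_distrib)
      also have "\<dots> \<le> plateau c d (real n) x * (clip (real n) (D x) * D x)"
        by (intro mult_mono p2 clip_sq_le plateau_bounds) auto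
      finally show *: "(h n x)\<^sup>2 \<le> h n x * D x" by (simp add: h_def mult.assoc)
      show "0 \<le> h n x * D x" using * zero_le_power2[of "h n x"] by linarith
    qed
    then show ?thesis using 2 by (intro sq_le_imp M) auto
  qed
  have "(\<lambda>n. LINT x|lborel. (h n x)\<^sup>2) \<longlonglongrightarrow> (LINT x|lborel. (D x)\<^sup>2)"
  proof (rule integral_dominated_convergence[where w = "\<lambda>x. (D x)\<^sup>2"])
    show "AE x in lborel. (\<lambda>n. (h n x)\<^sup>2) \<longlonglongrightarrow> (D x)\<^sup>2"
    proof (rule AE_I2)
      fix x
      show "(\<lambda>n. (h n x)\<^sup>2) \<longlonglongrightarrow> (D x)\<^sup>2"
      proof (cases "x \<in> {c<..<d}")
        case True
        have "(\<lambda>n. clip (real n) (D x)) \<longlonglongrightarrow> D x"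
        proof (rule tendsto_eventually)
          obtain n0 where "\<bar>D x\<bar> < real n0" using reals_Archimedean2 by blast
          then show "\<forall>\<^sub>F n in sequentially. clip (real n) (D x) = D x"
            unfolding eventually_sequentially by (intro exI[of _ n0]) (auto intro: clip_eq)
        qed
        then have "(\<lambda>n. (h n x)\<^sup>2) \<longlonglongrightarrow> (1 * D x)\<^sup>2"
          unfolding h_def by (intro tendsto_intros plateau_tendsto_1[OF True])
        then show ?thesis by simp
      next
        case False
        then show ?thesis using D_out[OF False] by (simp add: h_def clip_def)
      qed
    qed
    show "AE x in lborel. norm ((h n x)\<^sup>2) \<le> (D x)\<^sup>2" for n
    proof (rule AE_I2)
      fix x
      have "\<bar>h n x\<bar> \<le> 1 * \<bar>D x\<bar>" unfolding h_def abs_mult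
        by (intro mult_mono) (use plateau_bounds[of c d "real n" x] clip_le[of "real n" "D x"] in auto)
      then show "norm ((h n x)\<^sup>2) \<le> (D x)\<^sup>2" by (simp add: abs_le_square_iff)
    qed
  qed (use hm Dm D2 in auto)
  then show ?thesis
    by (rule LIMSEQ_le_const2) (use main in \<open>auto intro!: exI[of _ 1]\<close>)
qed

end

subsection \<open>The Klein-Gordon equation on the half-line\<close>

lemma inner_has_real_derivative:
  fixes f g :: "real \<Rightarrow> 'a::real_inner"
  assumes "(f has_vector_derivative f') (at x within S)" "(g has_vector_derivative g') (at x within S)"
  shows "((\<lambda>x. f x \<bullet> g x) has_real_derivative f x \<bullet> g' + f' \<bullet> g x) (at x within S)"
  using bounded_bilinear.has_vector_derivative[OF bounded_bilinear_inner assms]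
  by (simp add: has_real_derivative_iff_has_vector_derivative)

section \<open>Slices, iterated integrals and the integrated balance law\<close>

lemma continuous_on_slice1:
  assumes "continuous_on (A \<times> UNIV) (\<lambda>p. f (fst p) (snd p))"
  shows "continuous_on A (\<lambda>x. f x t)"
proof -
  have "continuous_on A (\<lambda>x. (x, t))" by (intro continuous_intros)
  from continuous_on_compose2[OF assms this] show ?thesis by force
qed

lemma continuous_on_slice2:
  assumes "continuous_on (A \<times> UNIV) (\<lambda>p. f (fst p) (snd p))" "x \<in> A"
  shows "continuous_on S (f x)"
proof -
  have "continuous_on S (\<lambda>t. (x, t))" by (intro continuous_intros)
  from continuous_on_compose2[OF assms(1) this] show ?thesis using assms(2) by force
qed

lemma continuous_on_integral_slice:
  fixes f :: "real \<Rightarrow> real \<Rightarrow> real"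
  assumes "continuous_on (A \<times> UNIV) (\<lambda>p. f (fst p) (snd p))" "{a..b} \<subseteq> A"
  shows "continuous_on S (\<lambda>t. integral {a..b} (\<lambda>x. f x t))"
  unfolding cbox_interval[symmetric]
proof (rule integral_continuous_on_param)
  show "continuous_on (S \<times> cbox a b) (\<lambda>(t, x). f x t)"
  proof -
    have "continuous_on (S \<times> cbox a b) (\<lambda>p. (snd p, fst p))" by (intro continuous_intros)
    moreover have "(\<lambda>p. (snd p, fst p)) ` (S \<times> cbox a b) \<subseteq> A \<times> UNIV" using assms(2) by auto
    ultimately show ?thesis using continuous_on_compose2[OF assms(1)] by (force simp: split_beta)
  qed
qed

lemma continuous_on_integral_slice2:
  fixes f :: "real \<Rightarrow> real \<Rightarrow> real"
  assumes "continuous_on (A \<times> UNIV) (\<lambda>p. f (fst p) (snd p))"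
  shows "continuous_on A (\<lambda>x. integral {a..b} (\<lambda>t. f x t))"
  unfolding cbox_interval[symmetric]
proof (rule integral_continuous_on_param)
  show "continuous_on (A \<times> cbox a b) (\<lambda>(x, t). f x t)"
    using continuous_on_subset[OF assms, of "A \<times> cbox a b"] by (auto simp: split_beta)
qed

lemma integral_swap_slice:
  fixes f :: "real \<Rightarrow> real \<Rightarrow> real"
  assumes "continuous_on (A \<times> UNIV) (\<lambda>p. f (fst p) (snd p))" "{a..b} \<subseteq> A"
  shows "integral {a..b} (\<lambda>x. integral {c..d} (\<lambda>t. f x t)) = integral {c..d} (\<lambda>t. integral {a..b} (\<lambda>x. f x t))"
proof -
  have "cbox (a, c) (b, d) \<subseteq> A \<times> UNIV" using assms(2) by (auto simp: cbox_Pair_eq)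
  then have "continuous_on (cbox (a, c) (b, d)) (\<lambda>(x, y). f x y)"
    using continuous_on_subset[OF assms(1)] by (simp add: split_beta)
  from integral_swap_continuous[OF this] show ?thesis by (simp add: cbox_interval)
qed

text \<open>The local law is e_t = F_x - Q with density e, flux F and sink Q; it enters as e_t = d
  and F_x = d + Q. Only the order of two integrals of a continuous function is exchanged, and
  nothing is differentiated under an integral.\<close>

lemma balance_law:
  fixes e d F Q :: "real \<Rightarrow> real \<Rightarrow> real"
  assumes X: "0 \<le> X" and t: "t1 \<le> t2"
    and et: "\<And>x t. 0 \<le> x \<Longrightarrow> ((\<lambda>t. e x t) has_real_derivative d x t) (at t)"
    and Fx: "\<And>x t. 0 \<le> x \<Longrightarrow> ((\<lambda>x. F x t) has_real_derivative (d x t + Q x t)) (at x within {0..})"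
    and ec: "jcont e"
    and dc: "jcont d"
    and Qc: "jcont Q"
  shows "integral {0..X} (\<lambda>x. e x t2) - integral {0..X} (\<lambda>x. e x t1)
    = integral {t1..t2} (\<lambda>t. F X t - F 0 t) - integral {t1..t2} (\<lambda>t. integral {0..X} (\<lambda>x. Q x t))"
proof -
  have sub: "{0..X} \<subseteq> {0..}" by auto
  have ex: "(\<lambda>x. f x t) integrable_on {0..X}" if "jcont f"
    for f :: "real \<Rightarrow> real \<Rightarrow> real" and t
    by (rule integrable_continuous_real[OF continuous_on_subset[OF continuous_on_slice1[OF that] sub]])
  have F_int: "((\<lambda>x. d x t + Q x t) has_integral F X t - F 0 t) {0..X}" for t
  proof (rule fundamental_theorem_of_calculus[OF X])
    fix x assume "x \<in> {0..X}"
    then have "((\<lambda>x. F x t) has_real_derivative d x t + Q x t) (at x within {0..X})"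
      using has_field_derivative_subset[OF Fx sub] by simp
    then show "((\<lambda>x. F x t) has_vector_derivative d x t + Q x t) (at x within {0..X})"
      by (simp add: has_real_derivative_iff_has_vector_derivative)
  qed
  have "integral {0..X} (\<lambda>x. e x t2) - integral {0..X} (\<lambda>x. e x t1) = integral {0..X} (\<lambda>x. e x t2 - e x t1)"
    using ex[OF ec] by (simp add: integral_diff)
  also have "\<dots> = integral {0..X} (\<lambda>x. integral {t1..t2} (\<lambda>t. d x t))"
  proof (rule integral_cong)
    fix x assume "x \<in> {0..X}"
    then have "(d x has_integral e x t2 - e x t1) {t1..t2}"
      using et[of x] by (intro fundamental_theorem_of_calculus t)
        (auto simp: has_real_derivative_iff_has_vector_derivative intro: has_vector_derivative_at_within)
    then show "e x t2 - e x t1 = integral {t1..t2} (\<lambda>t. d x t)" by (simp add: integral_unique)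
  qed
  also have "\<dots> = integral {t1..t2} (\<lambda>t. integral {0..X} (\<lambda>x. d x t))"
    by (rule integral_swap_slice[OF dc sub])
  also have "\<dots> = integral {t1..t2} (\<lambda>t. (F X t - F 0 t) - integral {0..X} (\<lambda>x. Q x t))"
  proof (rule integral_cong)
    fix t
    show "integral {0..X} (\<lambda>x. d x t) = (F X t - F 0 t) - integral {0..X} (\<lambda>x. Q x t)"
      using F_int[of t] integral_add[OF ex[OF dc, of t] ex[OF Qc, of t]] by (simp add: integral_unique)
  qed
  also have "\<dots> = integral {t1..t2} (\<lambda>t. F X t - F 0 t) - integral {t1..t2} (\<lambda>t. integral {0..X} (\<lambda>x. Q x t))"
  proof (rule integral_diff)
    \<comment> \<open>The flux difference inherits integrability in t from two integrals of
      continuous functions.\<close>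
    have "F X t - F 0 t = integral {0..X} (\<lambda>x. d x t) + integral {0..X} (\<lambda>x. Q x t)" for t
    proof -
      show ?thesis
        using F_int[of t] integral_add[OF ex[OF dc, of t] ex[OF Qc, of t]] by (simp add: integral_unique)
    qed
    then show "(\<lambda>t. F X t - F 0 t) integrable_on {t1..t2}"
      by (simp add: integrable_add integrable_continuous_real continuous_on_integral_slice[OF dc sub] continuous_on_integral_slice[OF Qc sub])
    show "(\<lambda>t. integral {0..X} (\<lambda>x. Q x t)) integrable_on {t1..t2}"
      by (intro integrable_continuous_real continuous_on_integral_slice[OF Qc sub])
  qed
  finally show ?thesis .
qed

text \<open>A substitute for decay at infinity. Applied to the time integral of a density, it finds
  arbitrarily distant points through which hardly any flux passes.\<close>

lemma small_somewhere:
  fixes h :: "real \<Rightarrow> real"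
  assumes c: "continuous_on {0..} h" and h0: "\<And>x. 0 \<le> x \<Longrightarrow> 0 \<le> h x"
    and B: "\<And>X. 0 \<le> X \<Longrightarrow> integral {0..X} h \<le> B" and e: "0 < e"
  obtains X where "X0 \<le> X" "0 \<le> X" "h X < e"
proof (rule ccontr)
  assume "\<not> thesis"
  then have big: "\<And>X. X0 \<le> X \<Longrightarrow> 0 \<le> X \<Longrightarrow> e \<le> h X" using that by (meson linorder_not_less)
  define Y where "Y = max X0 0"
  \<comment> \<open>If h stayed above e on [Y, Z], its integral there would be at least |B| +
    1.\<close>
  define Z where "Z = Y + (\<bar>B\<bar> + 1) / e"
  have YZ: "0 \<le> Y" "Y \<le> Z" using e by (auto simp: Y_def Z_def)
  have i: "h integrable_on {a..b}" if "0 \<le> a" for a b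
    by (intro integrable_continuous_real continuous_on_subset[OF c]) (use that in auto)
  have "e * (Z - Y) = integral {Y..Z} (\<lambda>x. e)" using YZ by simp
  also have "\<dots> \<le> integral {Y..Z} h"
    by (rule integral_le) (use i YZ big in \<open>auto simp: Y_def\<close>)
  also have "\<dots> \<le> integral {0..Z} h"
    by (rule integral_subset_le) (use i YZ h0 in auto)
  also have "\<dots> \<le> B" using YZ by (intro B) simp
  also have "B < e * (Z - Y)" using e by (simp add: Z_def)
  finally show False by simp
qed

text \<open>Barbalat's lemma. If h t \<ge> e, the Lipschitz bound keeps h above e / 2 on [t, t + d],
  which adds at least d e / 2 to the integral; a convergent integral does not permit this for large
  t.\<close>

lemma tendsto_0_of_integral_bound:
  fixes h :: "real \<Rightarrow> real"
  assumes h0: "\<And>t. 0 \<le> h t" and lip: "\<And>s t. s \<le> t \<Longrightarrow> \<bar>h t - h s\<bar> \<le> L * (t - s)"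
    and c: "continuous_on UNIV h"
    and B: "\<And>T. 0 \<le> T \<Longrightarrow> integral {0..T} h \<le> B"
  shows "(h \<longlongrightarrow> 0) at_top"
proof (rule tendstoI)
  fix e :: real assume e: "0 < e"
  have i: "h integrable_on {a..b}" for a b
    by (intro integrable_continuous_real continuous_on_subset[OF c]) auto
  have L: "0 \<le> L" using lip[of 0 1] by simp
  define d where "d = e / (2 * (L + 1))"
  have d: "0 < d" "L * d < e / 2"
    using e L by (auto simp: d_def field_simps)
  define H where "H T = integral {0..T} h" for T
  define l where "l = (SUP T\<in>{0..}. H T)"
  have bdd: "bdd_above (H ` {0..})" using B by (auto simp: H_def intro!: bdd_aboveI)
  have Hl: "H T \<le> l" if "0 \<le> T" for T unfolding l_def by (rule cSUP_upper[OF _ bdd]) (use that in auto)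
  have "l - d * e / 2 < l" using d e by simp
  then obtain T0 where T0: "0 \<le> T0" "l - d * e / 2 < H T0"
    unfolding l_def using less_cSUP_iff[OF _ bdd] by auto
  have "h t < e" if t: "T0 \<le> t" for t
  proof -
    have "d * (h t - L * d) = integral {t..t+d} (\<lambda>s. h t - L * d)" using d by simp
    also have "\<dots> \<le> integral {t..t+d} h"
    proof (rule integral_le)
      fix s assume s: "s \<in> {t..t+d}"
      have "L * (s - t) \<le> L * d" using s L by (intro mult_left_mono) auto
      then show "h t - L * d \<le> h s" using lip[of t s] s by auto
    qed (use i in auto)
    also have "integral {t..t+d} h = H (t+d) - H t"
      using Henstock_Kurzweil_Integration.integral_combine[of 0 t "t+d" h] i T0 t d by (simp add: H_def)
    also have "H t \<ge> H T0" unfolding H_def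
      by (rule integral_subset_le) (use i h0 t in auto)
    then have "H (t+d) - H t \<le> H (t+d) - H T0" by simp
    also have "\<dots> < d * e / 2" using Hl[of "t+d"] T0 t d by linarith
    finally have "d * (h t - L * d) < d * (e / 2)" by simp
    then have "h t - L * d < e / 2" using d(1) by (rule mult_left_less_imp_less[OF _ less_imp_le])
    then show ?thesis using d by linarith
  qed
  then have "dist (h t) 0 < e" if "T0 \<le> t" for t using that h0[of t] by simp
  then show "\<forall>\<^sub>F t in at_top. dist (h t) 0 < e" by (meson eventually_at_top_linorderI)
qed

lemma inner_of_real_mult: "z \<bullet> (of_real c * w) = c * (z \<bullet> w)" "(of_real c * z) \<bullet> w = c * (z \<bullet> w)" for z w :: complex
  by (simp_all add: scaleR_conv_of_real[symmetric])

text \<open>\<open>v k\<close> and \<open>vx k\<close> are the k-th time derivatives of v and of its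
  x-derivative, and the last assumption is v_xx = v_tt + m^2 v. Derivatives in x are one-sided at
  0.\<close>

locale kg =
  fixes m :: real and v vx :: "nat \<Rightarrow> real \<Rightarrow> real \<Rightarrow> complex"
  assumes v_cont: "\<And>k. jcont (v k)"
    and vx_cont: "\<And>k. jcont (vx k)"
    and v_t: "\<And>k x t. 0 \<le> x \<Longrightarrow> ((\<lambda>t. v k x t) has_vector_derivative v (Suc k) x t) (at t)"
    and vx_t: "\<And>k x t. 0 \<le> x \<Longrightarrow> ((\<lambda>t. vx k x t) has_vector_derivative vx (Suc k) x t) (at t)"
    and v_x: "\<And>k x t. 0 \<le> x \<Longrightarrow> ((\<lambda>x. v k x t) has_vector_derivative vx k x t) (at x within {0..})"
    and vx_x: "\<And>k x t. 0 \<le> x \<Longrightarrow> ((\<lambda>x. vx k x t) has_vector_derivative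
        v (Suc (Suc k)) x t + of_real (m\<^sup>2) * v k x t) (at x within {0..})"
begin

definition energy_density :: "nat \<Rightarrow> real \<Rightarrow> real \<Rightarrow> real" where
  "energy_density k x t = (sqn (v (Suc k) x t) + sqn (vx k x t) + m\<^sup>2 * sqn (v k x t)) / 2"

lemma energy_balance:
  assumes "0 \<le> X" "t1 \<le> t2"
  shows "integral {0..X} (\<lambda>x. energy_density k x t2) - integral {0..X} (\<lambda>x. energy_density k x t1)
    = integral {t1..t2} (\<lambda>t. v (Suc k) X t \<bullet> vx k X t - v (Suc k) 0 t \<bullet> vx k 0 t)"
proof -
  define d where "d x t = v (Suc (Suc k)) x t \<bullet> v (Suc k) x t + vx (Suc k) x t \<bullet> vx k x t + m\<^sup>2 * (v (Suc k) x t \<bullet> v k x t)" for x t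
  have "integral {0..X} (\<lambda>x. energy_density k x t2) - integral {0..X} (\<lambda>x. energy_density k x t1)
    = integral {t1..t2} (\<lambda>t. v (Suc k) X t \<bullet> vx k X t - v (Suc k) 0 t \<bullet> vx k 0 t)
      - integral {t1..t2} (\<lambda>t. integral {0..X} (\<lambda>x. 0))"
  proof (rule balance_law[OF assms, where d = d])
    fix x t :: real assume x: "0 \<le> x"
    show "(energy_density k x has_real_derivative d x t) (at t)"
      unfolding energy_density_def
      by (rule DERIV_cong[OF DERIV_cdivide[OF DERIV_add[OF DERIV_add[OF
            inner_has_real_derivative[OF v_t[OF x] v_t[OF x]] inner_has_real_derivative[OF vx_t[OF x] vx_t[OF x]]]
            DERIV_cmult[OF inner_has_real_derivative[OF v_t[OF x] v_t[OF x]]]]]])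
        (simp add: d_def inner_commute)
    show "((\<lambda>x. v (Suc k) x t \<bullet> vx k x t) has_real_derivative d x t + 0) (at x within {0..})"
      by (rule DERIV_cong[OF inner_has_real_derivative[OF v_x[OF x] vx_x[OF x]]])
        (simp only: d_def inner_add_right inner_of_real_mult, simp add: inner_commute)
  qed (auto simp: d_def energy_density_def intro!: continuous_intros v_cont vx_cont)
  then show ?thesis by simp
qed

end

section \<open>Morawetz' estimate and local decay for Dirichlet data\<close>

locale kg_dirichlet = kg +
  assumes dirichlet: "\<And>k t. v k 0 t = 0"
    and bounded: "\<And>k. \<exists>B. \<forall>t. \<forall>X\<ge>0. integral {0..X} (\<lambda>x. sqn (v k x t) + sqn (vx k x t)) \<le> B"
begin

text \<open>This makes Q in \<open>morawetz_identity\<close> positive definite. The term - |v|^2 /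
  (1 + x)^3 in the flux F is responsible: it adds nothing at x = 0 because of the Dirichlet
  condition, but without it Q would be indefinite. With a factor \<lambda> in front of that term the
  discriminant of Q is 4 \<lambda>^2 - 8 \<lambda> + 1, which is least at \<lambda> = 1.\<close>

lemma morawetz_quadratic:
  fixes V W :: complex and y :: real
  assumes "0 < y"
  shows "sqn V / y\<^sup>2 / 4 \<le> sqn V / y ^ 2 - 3 * (W \<bullet> V) / y ^ 3 + 3 * sqn W / y ^ 4"
proof -
  have "0 \<le> 3 * sqn ((1/(2*y)) *\<^sub>R V - (1/y\<^sup>2) *\<^sub>R W)" by simp
  also have "\<dots> = 3/4 * sqn V / y\<^sup>2 - 3 * (W \<bullet> V) / y ^ 3 + 3 * sqn W / y ^ 4"
    using assms by (simp add: inner_diff_left inner_diff_right inner_commute power2_eq_square power3_eq_cube power4_eq_xxxx field_simps)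
  finally show ?thesis by (simp add: field_simps)
qed

lemma inner_young: "\<bar>V \<bullet> W\<bar> \<le> (sqn V + sqn W) / 2" for V W :: complex
proof -
  have "0 \<le> sqn (V + W)" "0 \<le> sqn (V - W)" by simp_all
  then show ?thesis by (simp add: inner_add_left inner_add_right inner_diff_left inner_diff_right inner_commute)
qed

lemma inner_young2: "\<bar>U \<bullet> V\<bar> + \<bar>U \<bullet> W\<bar> \<le> sqn U + sqn V + sqn W" for U V W :: complex
  using inner_young[of U V] inner_young[of U W] inner_ge_zero[of V] inner_ge_zero[of W] by argo

lemma recip2: "y \<noteq> 0 \<Longrightarrow> ((\<lambda>y. 1 / (2 * y\<^sup>2)) has_real_derivative - 1 / y ^ 3) (at y)"
  and recip3: "y \<noteq> 0 \<Longrightarrow> ((\<lambda>y. 1 / y ^ 3) has_real_derivative - 3 / y ^ 4) (at y)" for y :: real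
  by (auto intro!: derivative_eq_intros simp: field_simps power2_eq_square power3_eq_cube power4_eq_xxxx)

text \<open>Here \<open>q\<close> stands for 1 / (1 + x), \<open>c\<close> for x / (1 + x), so that
  c' = q^2, and \<open>m2\<close> for m^2. The left side is F_x as the product rule delivers it, the
  right side is \<mu>_t + Q.\<close>

lemma morawetz_algebra:
  fixes V VX V1 VX1 V2 :: complex and q c m2 :: real
  shows "q\<^sup>2 * ((sqn VX + sqn V1 - m2 * sqn V) / 2)
    + ((VX \<bullet> (V2 + of_real m2 * V) + (V2 + of_real m2 * V) \<bullet> VX) + (V1 \<bullet> VX1 + VX1 \<bullet> V1) - m2 * (V \<bullet> VX + VX \<bullet> V)) / 2 * c
    + (- (q ^ 3) * (VX \<bullet> V) + (sqn VX + (V2 + of_real m2 * V) \<bullet> V) * (q\<^sup>2 / 2))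
    - (- 3 * q ^ 4 * sqn V + (V \<bullet> VX + VX \<bullet> V) * q ^ 3)
    = V2 \<bullet> (of_real c * VX + of_real (q\<^sup>2 / 2) * V) + V1 \<bullet> (of_real c * VX1 + of_real (q\<^sup>2 / 2) * V1)
      + (sqn VX * q\<^sup>2 - 3 * (V \<bullet> VX) * q ^ 3 + 3 * sqn V * q ^ 4)"
proof -
  define q2 q3 q4 where "q2 = q\<^sup>2" "q3 = q ^ 3" "q4 = q ^ 4"
  show ?thesis unfolding q2_q3_q4_def[symmetric] by (simp add: inner_complex_def algebra_simps add_divide_distrib diff_divide_distrib)
qed

text \<open>The multiplier is \<open>x / (1 + x) \<partial>\<^sub>x\<close> plus half of its divergence.\<close>
lemma morawetz_identity:
  fixes k :: nat and X T :: real
  defines "\<mu> \<equiv> \<lambda>x t. v (Suc k) x t \<bullet> (of_real (x / (1 + x)) * vx k x t + of_real (1 / (2 * (1 + x)\<^sup>2)) * v k x t)"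
  and "F \<equiv> \<lambda>x t. x / (1 + x) * (sqn (vx k x t) + sqn (v (Suc k) x t) - m\<^sup>2 * sqn (v k x t)) / 2
       + (vx k x t \<bullet> v k x t) / (2 * (1 + x)\<^sup>2) - sqn (v k x t) / (1 + x) ^ 3"
  and "Q \<equiv> \<lambda>x t. sqn (vx k x t) / (1 + x)\<^sup>2 - 3 * (v k x t \<bullet> vx k x t) / (1 + x) ^ 3
       + 3 * sqn (v k x t) / (1 + x) ^ 4"
  assumes "0 \<le> X" "0 \<le> T"
  shows "integral {0..X} (\<lambda>x. \<mu> x T) - integral {0..X} (\<lambda>x. \<mu> x 0)
    = integral {0..T} (\<lambda>t. F X t) - integral {0..T} (\<lambda>t. integral {0..X} (\<lambda>x. Q x t))"
proof -
  define d where "d x t = v (Suc (Suc k)) x t \<bullet> (of_real (x / (1 + x)) * vx k x t + of_real (1 / (2 * (1 + x)\<^sup>2)) * v k x t)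
    + v (Suc k) x t \<bullet> (of_real (x / (1 + x)) * vx (Suc k) x t + of_real (1 / (2 * (1 + x)\<^sup>2)) * v (Suc k) x t)" for x t
  have "integral {0..X} (\<lambda>x. \<mu> x T) - integral {0..X} (\<lambda>x. \<mu> x 0)
    = integral {0..T} (\<lambda>t. F X t - F 0 t) - integral {0..T} (\<lambda>t. integral {0..X} (\<lambda>x. Q x t))"
  proof (rule balance_law[OF assms(4,5), where d = d])
    fix x t :: real assume x: "0 \<le> x"
    show "(\<mu> x has_real_derivative d x t) (at t)"
    proof -
      have "((\<lambda>t. of_real (x / (1 + x)) * vx k x t + of_real (1 / (2 * (1 + x)\<^sup>2)) * v k x t) has_vector_derivative
        of_real (x / (1 + x)) * vx (Suc k) x t + of_real (1 / (2 * (1 + x)\<^sup>2)) * v (Suc k) x t) (at t)"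
        by (intro has_vector_derivative_add has_vector_derivative_mult_right v_t vx_t x)
      from inner_has_real_derivative[OF v_t[OF x] this] show ?thesis
        unfolding \<mu>_def d_def by (simp add: add.commute)
    qed
    have y: "1 + x \<noteq> 0" using x by simp
    have shift: "((\<lambda>x. f (1 + x)) has_real_derivative D) (at x within {0..})"
      if "(f has_real_derivative D) (at (1 + x))" for f D
    proof -
      have "((\<lambda>x. 1 + x) has_real_derivative 1) (at x within {0..})" by (auto intro!: derivative_eq_intros)
      from DERIV_chain2[where g = "\<lambda>x. 1 + x", OF that this] show ?thesis by simp
    qed
    have a1: "((\<lambda>x. x / (1 + x)) has_real_derivative 1 / (1 + x)\<^sup>2) (at x within {0..})"
      using y by (auto intro!: derivative_eq_intros simp: field_simps power2_eq_square)
    have a2: "((\<lambda>x. 1 / (2 * (1 + x)\<^sup>2)) has_real_derivative - 1 / (1 + x) ^ 3) (at x within {0..})"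
      by (rule shift[where f = "\<lambda>y. 1 / (2 * y\<^sup>2)"], rule recip2[OF y])
    have a3: "((\<lambda>x. 1 / (1 + x) ^ 3) has_real_derivative - 3 / (1 + x) ^ 4) (at x within {0..})"
      by (rule shift[where f = "\<lambda>y. 1 / y ^ 3"], rule recip3[OF y])
    note i1 = inner_has_real_derivative[OF vx_x[OF x, of k t] vx_x[OF x, of k t]]
    note i2 = inner_has_real_derivative[OF v_x[OF x, of "Suc k" t] v_x[OF x, of "Suc k" t]]
    note i3 = inner_has_real_derivative[OF v_x[OF x, of k t] v_x[OF x, of k t]]
    note i4 = inner_has_real_derivative[OF vx_x[OF x, of k t] v_x[OF x, of k t]]
    have F_eq: "F = (\<lambda>x t. (x / (1 + x)) * ((sqn (vx k x t) + sqn (v (Suc k) x t) - m\<^sup>2 * sqn (v k x t)) / 2)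
       + (1 / (2 * (1 + x)\<^sup>2)) * (vx k x t \<bullet> v k x t) - (1 / (1 + x) ^ 3) * sqn (v k x t))"
      by (simp add: F_def)
    define q where "q = 1 / (1 + x)"
    have q: "1 / (1 + x)\<^sup>2 = q\<^sup>2" "1 / (2 * (1 + x)\<^sup>2) = q\<^sup>2 / 2" "1 / (1 + x) ^ 3 = q ^ 3"
      "- 1 / (1 + x) ^ 3 = - (q ^ 3)" "- 3 / (1 + x) ^ 4 = - 3 * q ^ 4"
      by (simp_all add: q_def power_one_over)
    have Qq: "Q x t = sqn (vx k x t) * q\<^sup>2 - 3 * (v k x t \<bullet> vx k x t) * q ^ 3 + 3 * sqn (v k x t) * q ^ 4"
      by (simp add: Q_def q_def power_one_over)
    show "((\<lambda>x. F x t) has_real_derivative d x t + Q x t) (at x within {0..})"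
      unfolding F_eq d_def Qq q(2)
      by (rule DERIV_cong[OF DERIV_diff[OF DERIV_add[OF DERIV_mult[OF a1 DERIV_cdivide[OF DERIV_diff[OF DERIV_add[OF i1 i2] DERIV_cmult[OF i3]]]]
          DERIV_mult[OF a2 i4]] DERIV_mult[OF a3 i3]]])
        (unfold q, rule morawetz_algebra)
  next
    have y: "(1::real) + a \<noteq> 0" if "a \<in> {0..}" for a using that by auto
    show "jcont \<mu>"
      unfolding \<mu>_def by (intro continuous_intros v_cont vx_cont) (use y in auto)
    show "jcont d"
      unfolding d_def by (intro continuous_intros v_cont vx_cont) (use y in auto)
    show "jcont Q"
      unfolding Q_def by (intro continuous_intros v_cont vx_cont) (use y in auto)
  qed
  \<comment> \<open>The first term vanishes with its weight x / (1 + x), the other two by the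
    Dirichlet condition.\<close>
  moreover have "F 0 t = 0" for t by (simp add: F_def dirichlet)
  ultimately show ?thesis by simp
qed

lemma v_int: "jcont f \<Longrightarrow> 0 \<le> b \<Longrightarrow> (\<lambda>x. f x t) integrable_on {b..X}"
  for f :: "real \<Rightarrow> real \<Rightarrow> 'a::euclidean_space"
  by (rule integrable_continuous_real[OF continuous_on_subset[OF continuous_on_slice1]]) auto

text \<open>The density \<mu> is controlled at the two end times by \<open>bounded\<close>, and the
  flux is small at a well-chosen right end. So the space-time integral of the positive form Q is
  bounded independently of T, and this integrability in time is the source of decay.\<close>

lemma morawetz_bound:
  "\<exists>C. \<forall>T\<ge>0. \<forall>X\<ge>0. integral {0..T} (\<lambda>t. integral {0..X} (\<lambda>x. sqn (vx k x t) / (1 + x)\<^sup>2)) \<le> C"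
proof -
  define N where "N k x t = sqn (v k x t) + sqn (vx k x t)" for k x t
  have Nc: "jcont (N k)" for k
    unfolding N_def by (intro continuous_intros v_cont vx_cont)
  have N0: "0 \<le> N k x t" for k x t by (simp add: N_def)
  obtain B where B: "\<And>k t X. 0 \<le> X \<Longrightarrow> integral {0..X} (\<lambda>x. N k x t) \<le> B k"
    using bounded unfolding N_def by metis
  define P where "P x t = N k x t + N (Suc k) x t" for x t
  have Pc: "jcont P"
    unfolding P_def by (intro continuous_intros Nc)
  have P0: "0 \<le> P x t" for x t by (simp add: P_def N0)
  define BP where "BP = B k + B (Suc k)"
  have BP: "integral {0..X} (\<lambda>x. P x t) \<le> BP" if "0 \<le> X" for X t
    unfolding P_def BP_def using B[OF that] by (subst integral_add) (auto intro!: v_int Nc add_mono)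
  define \<mu> where "\<mu> x t = v (Suc k) x t \<bullet> (of_real (x / (1 + x)) * vx k x t + of_real (1 / (2 * (1 + x)\<^sup>2)) * v k x t)" for x t
  define F where "F x t = x / (1 + x) * (sqn (vx k x t) + sqn (v (Suc k) x t) - m\<^sup>2 * sqn (v k x t)) / 2
       + (vx k x t \<bullet> v k x t) / (2 * (1 + x)\<^sup>2) - sqn (v k x t) / (1 + x) ^ 3" for x t
  define Q where "Q x t = sqn (vx k x t) / (1 + x)\<^sup>2 - 3 * (v k x t \<bullet> vx k x t) / (1 + x) ^ 3
       + 3 * sqn (v k x t) / (1 + x) ^ 4" for x t
  define q where "q x t = sqn (vx k x t) / (1 + x)\<^sup>2" for x t
  have y: "(1::real) + a \<noteq> 0" if "a \<in> {0..}" for a using that by auto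
  have Qc: "jcont Q"
    unfolding Q_def by (intro continuous_intros v_cont vx_cont) (use y in auto)
  have \<mu>c: "jcont \<mu>"
    unfolding \<mu>_def by (intro continuous_intros v_cont vx_cont) (use y in auto)
  have Fc: "jcont F"
    unfolding F_def by (intro continuous_intros v_cont vx_cont) (use y in auto)
  have qc: "jcont q"
    unfolding q_def by (intro continuous_intros v_cont vx_cont) (use y in auto)
  have w1: "0 \<le> x / (1 + x)" "x / (1 + x) \<le> 1" "0 \<le> 1 / (2 * (1 + x)\<^sup>2)" "1 / (2 * (1 + x)\<^sup>2) \<le> 1/2"
    "0 \<le> 1 / (1 + x) ^ 3" "1 / (1 + x) ^ 3 \<le> 1" if "0 \<le> x" for x :: real
    using that one_le_power[of "1 + x" 2] one_le_power[of "1 + x" 3] by (auto simp: divide_le_eq)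
  have \<mu>B: "\<bar>\<mu> x t\<bar> \<le> P x t" if x: "0 \<le> x" for x t
  proof -
    have "\<mu> x t = x / (1 + x) * (v (Suc k) x t \<bullet> vx k x t) + 1 / (2 * (1 + x)\<^sup>2) * (v (Suc k) x t \<bullet> v k x t)"
      unfolding \<mu>_def inner_add_right inner_of_real_mult ..
    moreover have "\<bar>x / (1 + x) * (v (Suc k) x t \<bullet> vx k x t)\<bar> \<le> 1 * \<bar>v (Suc k) x t \<bullet> vx k x t\<bar>"
      unfolding abs_mult by (rule mult_right_mono) (use w1[OF x] in auto)
    moreover have "\<bar>1 / (2 * (1 + x)\<^sup>2) * (v (Suc k) x t \<bullet> v k x t)\<bar> \<le> 1 * \<bar>v (Suc k) x t \<bullet> v k x t\<bar>"
      unfolding abs_mult by (rule mult_right_mono) (use w1[OF x] in auto)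
    ultimately have "\<bar>\<mu> x t\<bar> \<le> \<bar>v (Suc k) x t \<bullet> vx k x t\<bar> + \<bar>v (Suc k) x t \<bullet> v k x t\<bar>" by linarith
    also have "\<dots> \<le> P x t"
      using inner_young2[of "v (Suc k) x t" "vx k x t" "v k x t"] inner_ge_zero[of "vx (Suc k) x t"]
      unfolding P_def N_def by argo
    finally show ?thesis .
  qed
  have FB: "F x t \<le> 2 * P x t" if x: "0 \<le> x" for x t
  proof -
    have "x / (1 + x) * (sqn (vx k x t) + sqn (v (Suc k) x t) - m\<^sup>2 * sqn (v k x t))
      \<le> x / (1 + x) * (sqn (vx k x t) + sqn (v (Suc k) x t))"
      by (rule mult_left_mono) (use w1[OF x] in auto)
    also have "\<dots> \<le> 1 * (sqn (vx k x t) + sqn (v (Suc k) x t))"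
      by (rule mult_right_mono) (use w1[OF x] in auto)
    also have "\<dots> \<le> P x t" using inner_ge_zero[of "vx (Suc k) x t"] inner_ge_zero[of "v k x t"] unfolding P_def N_def by argo
    finally have "x / (1 + x) * (sqn (vx k x t) + sqn (v (Suc k) x t) - m\<^sup>2 * sqn (v k x t)) \<le> P x t" .
    moreover have "1 / (2 * (1 + x)\<^sup>2) * (vx k x t \<bullet> v k x t) \<le> P x t"
    proof -
      have "1 / (2 * (1 + x)\<^sup>2) * (vx k x t \<bullet> v k x t) \<le> 1 / (2 * (1 + x)\<^sup>2) * \<bar>vx k x t \<bullet> v k x t\<bar>"
        by (rule mult_left_mono) (use w1[OF x] in auto)
      also have "\<dots> \<le> 1 * \<bar>vx k x t \<bullet> v k x t\<bar>" by (rule mult_right_mono) (use w1[OF x] in auto)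
      also have "\<dots> \<le> P x t" using inner_young[of "vx k x t" "v k x t"] N0[of "Suc k" x t]
          inner_ge_zero[of "vx k x t"] inner_ge_zero[of "v k x t"] unfolding P_def N_def by argo
      finally show ?thesis .
    qed
    moreover have "0 \<le> (sqn (v k x t)) / (1 + x) ^ 3" using x by simp
    moreover have "F x t = (x / (1 + x) * (sqn (vx k x t) + sqn (v (Suc k) x t) - m\<^sup>2 * sqn (v k x t))) / 2
      + 1 / (2 * (1 + x)\<^sup>2) * (vx k x t \<bullet> v k x t) - sqn (v k x t) / (1 + x) ^ 3"
      by (simp add: F_def)
    ultimately show ?thesis using P0[of x t] by argo
  qed
  have Qq: "q x t / 4 \<le> Q x t" if "0 \<le> x" for x t
    using morawetz_quadratic[of "1 + x" "vx k x t" "v k x t"] that by (simp add: Q_def q_def)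
  have q0: "0 \<le> q x t" for x t by (simp add: q_def)
  have "integral {0..T} (\<lambda>t. integral {0..X} (\<lambda>x. q x t)) \<le> 4 * (2 + 2 * BP)" if T: "0 \<le> T" and X: "0 \<le> X" for T X
  proof -
    define h where "h x = integral {0..T} (\<lambda>t. P x t)" for x
    have hc: "continuous_on {0..} h" unfolding h_def by (rule continuous_on_integral_slice2[OF Pc])
    have h0: "0 \<le> h x" if "0 \<le> x" for x unfolding h_def
      by (rule integral_nonneg) (use P0 that in \<open>auto intro!: integrable_continuous_real continuous_on_slice2[OF Pc]\<close>)
    have hB: "integral {0..Y} h \<le> T * BP" if Y: "0 \<le> Y" for Y
    proof -
      have sub: "{0..Y} \<subseteq> {0..}" by auto
      have "integral {0..Y} h = integral {0..T} (\<lambda>t. integral {0..Y} (\<lambda>x. P x t))"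
        unfolding h_def by (rule integral_swap_slice[OF Pc sub])
      also have "\<dots> \<le> integral {0..T} (\<lambda>t. BP)"
        by (rule integral_le) (auto intro!: BP Y integrable_continuous_real continuous_on_integral_slice[OF Pc sub])
      finally show ?thesis using T by simp
    qed
    \<comment> \<open>The interval is enlarged to a point with small time-integrated flux. Y depends
      on T, but the bounds for the flux and for \<mu> do not, and q \<ge> 0 brings the estimate back
      to [0, X].\<close>
    obtain Y where Y: "X \<le> Y" "0 \<le> Y" "h Y < 1" using small_somewhere[OF hc h0 hB, of 1 X] by auto
    have sub: "{0..Y} \<subseteq> {0..}" "{0..X} \<subseteq> {0..}" by auto
    have "integral {0..T} (\<lambda>t. F Y t) \<le> integral {0..T} (\<lambda>t. 2 * P Y t)"
      by (rule integral_le) (use Y FB in \<open>auto intro!: integrable_continuous_real continuous_intros continuous_on_slice2[OF Pc] continuous_on_slice2[OF Fc]\<close>)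
    then have 1: "integral {0..T} (\<lambda>t. F Y t) \<le> 2" using Y(3) by (simp add: h_def)
    have \<mu>2: "\<bar>integral {0..Y} (\<lambda>x. \<mu> x t)\<bar> \<le> BP" for t
    proof -
      have "norm (integral {0..Y} (\<lambda>x. \<mu> x t)) \<le> integral {0..Y} (\<lambda>x. P x t)"
        by (rule integral_norm_bound_integral) (use \<mu>B in \<open>auto intro!: v_int \<mu>c Pc\<close>)
      then show ?thesis using BP[OF Y(2), of t] by simp
    qed
    have "integral {0..T} (\<lambda>t. integral {0..Y} (\<lambda>x. Q x t)) = integral {0..T} (\<lambda>t. F Y t)
       - (integral {0..Y} (\<lambda>x. \<mu> x T) - integral {0..Y} (\<lambda>x. \<mu> x 0))"
      using morawetz_identity[OF Y(2) T, of k] unfolding \<mu>_def F_def Q_def by simp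
    also have "\<dots> \<le> 2 + 2 * BP" using 1 \<mu>2[of T] \<mu>2[of 0] by linarith
    finally have 2: "integral {0..T} (\<lambda>t. integral {0..Y} (\<lambda>x. Q x t)) \<le> 2 + 2 * BP" .
    have "integral {0..T} (\<lambda>t. integral {0..X} (\<lambda>x. q x t)) \<le> integral {0..T} (\<lambda>t. 4 * integral {0..Y} (\<lambda>x. Q x t))"
    proof (rule integral_le)
      fix t
      have "integral {0..X} (\<lambda>x. q x t) \<le> integral {0..Y} (\<lambda>x. q x t)"
        by (rule integral_subset_le) (use Y q0 in \<open>auto intro!: v_int qc\<close>)
      also have "\<dots> \<le> integral {0..Y} (\<lambda>x. 4 * Q x t)"
      proof (rule integral_le)
        show "(\<lambda>x. 4 * Q x t) integrable_on {0..Y}" using v_int[OF Qc order_refl] by (rule integrable_on_mult_right)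
        show "q x t \<le> 4 * Q x t" if "x \<in> {0..Y}" for x using Qq[of x t] that by simp
      qed (auto intro!: v_int qc)
      finally show "integral {0..X} (\<lambda>x. q x t) \<le> 4 * integral {0..Y} (\<lambda>x. Q x t)" by simp
    qed (auto intro!: integrable_continuous_real continuous_intros continuous_on_integral_slice[OF Qc sub(1)] continuous_on_integral_slice[OF qc sub(2)])
    then show ?thesis using 2 by simp
  qed
  then show ?thesis unfolding q_def by blast
qed

text \<open>On [0, R] the weight (1 + x)^(-2) is at least (1 + R)^(-2), so the local norm is
  integrable in time. Its time derivative is bounded because \<open>bounded\<close> also covers the
  next time derivative, and Barbalat's lemma applies.\<close>

lemma vx_tendsto:
  assumes R: "0 \<le> R"
  shows "((\<lambda>t. integral {0..R} (\<lambda>x. sqn (vx k x t))) \<longlongrightarrow> 0) at_top"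
proof -
  have Ec: "jcont (\<lambda>x t. sqn (vx k x t))"
    by (intro continuous_intros vx_cont)
  have Bc: "jcont (\<lambda>x t. sqn (v k x t) + sqn (vx k x t))" for k
    by (intro continuous_intros vx_cont v_cont)
  have sub: "{0..R} \<subseteq> {0..}" by auto
  obtain B where B: "\<And>k t X. 0 \<le> X \<Longrightarrow> integral {0..X} (\<lambda>x. sqn (v k x t) + sqn (vx k x t)) \<le> B k"
    using bounded by metis
  obtain C where C: "\<And>T X. 0 \<le> T \<Longrightarrow> 0 \<le> X \<Longrightarrow> integral {0..T} (\<lambda>t. integral {0..X} (\<lambda>x. sqn (vx k x t) / (1 + x)\<^sup>2)) \<le> C"
    using morawetz_bound[of k] by blast
  have qc: "jcont (\<lambda>x t. sqn (vx k x t) / (1 + x)\<^sup>2)"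
    by (intro continuous_intros v_cont vx_cont) auto
  show ?thesis
  proof (rule tendsto_0_of_integral_bound)
    show "0 \<le> integral {0..R} (\<lambda>x. sqn (vx k x t))" for t
      by (rule integral_nonneg) (auto intro!: v_int[OF Ec])
    show "continuous_on UNIV (\<lambda>t. integral {0..R} (\<lambda>x. sqn (vx k x t)))"
      by (rule continuous_on_integral_slice[OF Ec sub])
    show "integral {0..T} (\<lambda>t. integral {0..R} (\<lambda>x. sqn (vx k x t))) \<le> (1 + R)\<^sup>2 * C" if T: "0 \<le> T" for T
    proof -
      have "integral {0..T} (\<lambda>t. integral {0..R} (\<lambda>x. sqn (vx k x t))) \<le>
         integral {0..T} (\<lambda>t. (1 + R)\<^sup>2 * integral {0..R} (\<lambda>x. sqn (vx k x t) / (1 + x)\<^sup>2))"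
      proof (rule integral_le)
        fix t
        have "integral {0..R} (\<lambda>x. sqn (vx k x t)) \<le> integral {0..R} (\<lambda>x. (1 + R)\<^sup>2 * (sqn (vx k x t) / (1 + x)\<^sup>2))"
        proof (rule integral_le)
          fix x assume x: "x \<in> {0..R}"
          have "(1 + x)\<^sup>2 * sqn (vx k x t) \<le> (1 + R)\<^sup>2 * sqn (vx k x t)"
            by (intro mult_right_mono power_mono) (use x in auto)
          then show "sqn (vx k x t) \<le> (1 + R)\<^sup>2 * (sqn (vx k x t) / (1 + x)\<^sup>2)"
            using x by (simp add: field_simps)
        next
          show "(\<lambda>x. (1 + R)\<^sup>2 * (sqn (vx k x t) / (1 + x)\<^sup>2)) integrable_on {0..R}"
            by (rule integrable_on_mult_right[OF v_int[OF qc order_refl]])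
        qed (rule v_int[OF Ec order_refl])
        then show "integral {0..R} (\<lambda>x. sqn (vx k x t)) \<le> (1 + R)\<^sup>2 * integral {0..R} (\<lambda>x. sqn (vx k x t) / (1 + x)\<^sup>2)"
          unfolding integral_mult_right .
      qed (auto intro!: integrable_continuous_real continuous_intros continuous_on_integral_slice[OF qc sub] continuous_on_integral_slice[OF Ec sub])
      also have "\<dots> \<le> (1 + R)\<^sup>2 * C" using C[OF T R] by (simp add: mult_left_mono)
      finally show ?thesis .
    qed
    fix s t :: real assume st: "s \<le> t"
    define d where "d x t = 2 * (vx k x t \<bullet> vx (Suc k) x t)" for x t
    have dc: "jcont d" "jcont (\<lambda>x t. - d x t)"
      unfolding d_def by (intro continuous_intros vx_cont)+
    \<comment> \<open>The balance law with flux 0 and sink - d writes the difference as a time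
      integral.\<close>
    have "integral {0..R} (\<lambda>x. sqn (vx k x t)) - integral {0..R} (\<lambda>x. sqn (vx k x s))
      = integral {s..t} (\<lambda>t. 0 - 0) - integral {s..t} (\<lambda>t. integral {0..R} (\<lambda>x. - d x t))"
    proof (rule balance_law[OF R st _ _ Ec dc])
      fix x t :: real assume x: "0 \<le> x"
      show "((\<lambda>t. sqn (vx k x t)) has_real_derivative d x t) (at t)"
        by (rule DERIV_cong[OF inner_has_real_derivative[OF vx_t[OF x] vx_t[OF x]]]) (simp add: d_def inner_commute)
    qed simp
    also have "\<dots> = integral {s..t} (\<lambda>t. integral {0..R} (\<lambda>x. d x t))" by simp
    also have "\<bar>\<dots>\<bar> \<le> integral {s..t} (\<lambda>t. B k + B (Suc k))"
    proof -
      have "norm (integral {s..t} (\<lambda>t. integral {0..R} (\<lambda>x. d x t))) \<le> integral {s..t} (\<lambda>t. B k + B (Suc k))"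
      proof (rule integral_norm_bound_integral)
        fix t
        have "norm (integral {0..R} (\<lambda>x. d x t)) \<le> integral {0..R} (\<lambda>x. (sqn (v k x t) + sqn (vx k x t))
            + (sqn (v (Suc k) x t) + sqn (vx (Suc k) x t)))"
        proof (rule integral_norm_bound_integral)
          fix x show "norm (d x t) \<le> (sqn (v k x t) + sqn (vx k x t))
            + (sqn (v (Suc k) x t) + sqn (vx (Suc k) x t))"
            using inner_young[of "vx k x t" "vx (Suc k) x t"] inner_ge_zero[of "v k x t"] inner_ge_zero[of "v (Suc k) x t"]
            unfolding d_def real_norm_def abs_mult abs_numeral by argo
        qed (auto intro!: v_int[OF dc(1)] integrable_add v_int[OF Bc])
        also have "\<dots> \<le> B k + B (Suc k)"
          using B[OF R, of k t] B[OF R, of "Suc k" t] by (subst integral_add) (auto intro!: v_int[OF Bc])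
        finally show "norm (integral {0..R} (\<lambda>x. d x t)) \<le> B k + B (Suc k)" .
      qed (auto intro!: integrable_continuous_real continuous_on_integral_slice[OF dc(1) sub])
      then show ?thesis by simp
    qed
    finally show "\<bar>integral {0..R} (\<lambda>x. sqn (vx k x t)) - integral {0..R} (\<lambda>x. sqn (vx k x s))\<bar> \<le> (B k + B (Suc k)) * (t - s)"
      using st by (simp add: mult.commute)
  qed
qed

text \<open>By the Dirichlet condition v is the integral of its x-derivative from 0. Young's
  inequality with parameter c = e / (R + 1) passes from the L^2 bound on \<open>vx\<close> to the
  L^1 bound that is needed.\<close>

lemma v_tendsto:
  assumes R: "0 \<le> R" and e: "0 < e"
  shows "\<forall>\<^sub>F t in at_top. \<forall>x\<in>{0..R}. norm (v k x t) \<le> e"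
proof -
  define c where "c = e / (R + 1)"
  have c: "0 < c" "R * c \<le> e" using R e by (auto simp: c_def field_simps)
  have Ec: "jcont (\<lambda>x t. sqn (vx k x t))"
    by (intro continuous_intros vx_cont)
  have Ec2: "jcont (\<lambda>x t. sqn (vx k x t) / (2 * c))"
    by (intro continuous_intros vx_cont) (use c in auto)
  have "\<forall>\<^sub>F t in at_top. integral {0..R} (\<lambda>x. sqn (vx k x t)) < e * c"
    using vx_tendsto[OF R, of k] e c by (intro order_tendstoD) auto
  then show ?thesis
  proof eventually_elim
    case (elim t)
    show ?case
    proof
      fix x assume x: "x \<in> {0..R}"
      have "((\<lambda>x. vx k x t) has_integral v k x t - v k 0 t) {0..x}"
        by (rule fundamental_theorem_of_calculus) (use x in \<open>auto intro!: has_vector_derivative_within_subset[OF v_x]\<close>)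
      then have "v k x t = integral {0..x} (\<lambda>x. vx k x t)" by (simp add: dirichlet integral_unique)
      also have "norm \<dots> \<le> integral {0..x} (\<lambda>x. c / 2 + sqn (vx k x t) / (2 * c))"
      proof (rule integral_norm_bound_integral)
        fix x
        have "0 \<le> (norm (vx k x t) - c)\<^sup>2" by simp
        then show "norm (vx k x t) \<le> c / 2 + sqn (vx k x t) / (2 * c)"
          using c by (simp add: power2_norm_eq_inner[symmetric] field_simps power2_eq_square)
      qed (auto intro!: v_int[OF vx_cont] integrable_add v_int[OF Ec2])
      also have "\<dots> \<le> integral {0..R} (\<lambda>x. c / 2 + sqn (vx k x t) / (2 * c))"
        by (rule integral_subset_le) (use x c in \<open>auto intro!: integrable_add v_int[OF Ec2]\<close>)
      also have "\<dots> = R * c / 2 + integral {0..R} (\<lambda>x. sqn (vx k x t)) / (2 * c)"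
        using R by (subst integral_add) (auto intro!: v_int[OF Ec2])
      also have "\<dots> \<le> e / 2 + e / 2"
      proof (rule add_mono)
        show "R * c / 2 \<le> e / 2" using c by simp
        show "integral {0..R} (\<lambda>x. sqn (vx k x t)) / (2 * c) \<le> e / 2" using elim c by (simp add: field_simps)
      qed
      finally show "norm (v k x t) \<le> e" by simp
    qed
  qed
qed

end

lemma slice_integrable:
  fixes f :: "real \<Rightarrow> real \<Rightarrow> 'a::euclidean_space"
  assumes "jcont f" "0 \<le> b"
  shows "(\<lambda>x. f x t) integrable_on {b..X}"
  by (rule integrable_continuous_real[OF continuous_on_subset[OF continuous_on_slice1[OF assms(1)]]]) (use assms(2) in auto)

subsection \<open>The half-line system\<close>

text \<open>The index \<open>k\<close> counts time derivatives; both signs of \<open>\<iota>\<close> are needed for the second component and for \<open>t \<rightarrow> -\<infinity>\<close>.\<close>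
locale halfline =
  fixes m a :: real and \<iota> :: complex and r s :: "nat \<Rightarrow> real \<Rightarrow> real \<Rightarrow> complex"
  assumes m: "0 < m" and a: "a < 2 * m" and iota: "\<iota> = \<i> \<or> \<iota> = - \<i>"
    and r_cont: "\<And>k. jcont (r k)"
    and s_cont: "\<And>k. jcont (s k)"
    and r_t: "\<And>k x t. 0 \<le> x \<Longrightarrow> ((\<lambda>t. r k x t) has_vector_derivative r (Suc k) x t) (at t)"
    and s_t: "\<And>k x t. 0 \<le> x \<Longrightarrow> ((\<lambda>t. s k x t) has_vector_derivative s (Suc k) x t) (at t)"
    and r_x: "\<And>k x t. 0 \<le> x \<Longrightarrow> ((\<lambda>x. r k x t) has_vector_derivative
        - \<iota> * s (Suc k) x t + of_real m * r k x t - of_real (a * exp (- m * x)) * r k 0 t) (at x within {0..})"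
    and s_x: "\<And>k x t. 0 \<le> x \<Longrightarrow> ((\<lambda>x. s k x t) has_vector_derivative
        \<iota> * r (Suc k) x t - of_real m * s k x t) (at x within {0..})"
    and s_0: "\<And>k t. s k 0 t = r k 0 t"
    and L2_bound: "\<And>k T. \<exists>B. \<forall>t\<in>{-T..T}. \<forall>X\<ge>0. integral {0..X} (\<lambda>x. sqn (r k x t) + sqn (s k x t)) \<le> B"
begin

definition rx where "rx k x t = - \<iota> * s (Suc k) x t + of_real m * r k x t - of_real (a * exp (- m * x)) * r k 0 t"
definition sx where "sx k x t = \<iota> * r (Suc k) x t - of_real m * s k x t"

lemma iota_sq: "\<iota> * \<iota> = -1" "\<iota> * (\<iota> * z) = - z" and norm_iota: "norm \<iota> = 1"
  using iota by auto

lemma inner_iota: "z \<bullet> (\<iota> * z) = 0" "(\<iota> * z) \<bullet> z = 0"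
  using iota by (auto simp: inner_complex_def)

lemma inner_iota_iota: "sqn (\<iota> * z) = sqn z"
  using iota by (auto simp: inner_complex_def)

lemma r0_cont: "continuous_on S (\<lambda>p. r k 0 (snd p))"
  using continuous_on_compose2[OF continuous_on_slice2[OF r_cont, of 0 UNIV k] continuous_on_snd[OF continuous_on_id], of S] by simp

lemma rx_cont: "jcont (rx k)"
  unfolding rx_def by (intro continuous_intros r_cont s_cont r0_cont)

lemma sx_cont: "jcont (sx k)"
  unfolding sx_def by (intro continuous_intros r_cont s_cont)

text \<open>The source a e^(- m x) r(0) drops out of the second-order equation because \<partial>_x
  + m annihilates e^(- m x). The interaction survives only in the boundary condition at 0.\<close>

sublocale r: kg m r rx
proof
  fix k :: nat and x t :: real assume x: "0 \<le> x"
  show "((\<lambda>t. rx k x t) has_vector_derivative rx (Suc k) x t) (at t)"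
    unfolding rx_def using x
    by (intro has_vector_derivative_diff has_vector_derivative_add has_vector_derivative_mult_right r_t s_t) auto
  show "((\<lambda>x. r k x t) has_vector_derivative rx k x t) (at x within {0..})"
    unfolding rx_def by (rule r_x[OF x])
  have E: "((\<lambda>x. complex_of_real (a * exp (- m * x))) has_vector_derivative of_real (- m * (a * exp (- m * x)))) (at x within {0..})"
    by (rule has_vector_derivative_of_real) (auto intro!: derivative_eq_intros simp: has_real_derivative_iff_has_vector_derivative[symmetric])
  have "((\<lambda>x. rx k x t) has_vector_derivative
      - \<iota> * (\<iota> * r (Suc (Suc k)) x t - of_real m * s (Suc k) x t) + of_real m * rx k x t
      - of_real (- m * (a * exp (- m * x))) * r k 0 t) (at x within {0..})"
    unfolding rx_def[of _ _ t, abs_def]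
    by (intro has_vector_derivative_diff has_vector_derivative_add has_vector_derivative_mult_right has_vector_derivative_mult_left
        r_x[OF x] s_x[OF x] E)
  also have "- \<iota> * (\<iota> * r (Suc (Suc k)) x t - of_real m * s (Suc k) x t) + of_real m * rx k x t
      - of_real (- m * (a * exp (- m * x))) * r k 0 t = r (Suc (Suc k)) x t + of_real (m\<^sup>2) * r k x t"
    by (simp add: rx_def algebra_simps iota_sq power2_eq_square)
  finally show "((\<lambda>x. rx k x t) has_vector_derivative r (Suc (Suc k)) x t + of_real (m\<^sup>2) * r k x t) (at x within {0..})" .
qed (auto intro: r_cont rx_cont r_t)

section \<open>Conserved energy of the half-line problem and its coercivity\<close>

lemma r0_deriv: "((\<lambda>t. sqn (r k 0 t)) has_real_derivative 2 * (r (Suc k) 0 t \<bullet> r k 0 t)) (at t)"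
  by (rule DERIV_cong[OF inner_has_real_derivative[OF r_t r_t]]) (simp_all add: inner_commute)

text \<open>At 0 the equation reads r_x = - \<iota> r_t + (m - a) r, and \<iota> r_t is orthogonal
  to r_t for the real inner product. What remains is the time derivative of (m - a) / 2 |r|^2, which
  explains the boundary term in \<open>energy\<close>.\<close>

lemma boundary_flux: "r (Suc k) 0 t \<bullet> rx k 0 t = (m - a) * (r (Suc k) 0 t \<bullet> r k 0 t)"
proof -
  have "rx k 0 t = - (\<iota> * r (Suc k) 0 t) + of_real (m - a) * r k 0 t"
    by (simp add: rx_def s_0 algebra_simps)
  then show ?thesis by (simp only: inner_add_right inner_minus_right inner_iota inner_of_real_mult minus_zero add_0)
qed

definition energy where
  "energy k X t = integral {0..X} (\<lambda>x. r.energy_density k x t) + (m - a) / 2 * sqn (r k 0 t)"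

lemma energy_diff:
  assumes "0 \<le> X" "t1 \<le> t2"
  shows "energy k X t2 - energy k X t1 = integral {t1..t2} (\<lambda>t. r (Suc k) X t \<bullet> rx k X t)"
proof -
  have i: "(\<lambda>t. r (Suc k) Y t \<bullet> rx k Y t) integrable_on {t1..t2}" if "0 \<le> Y" for Y
    by (intro integrable_continuous_real continuous_intros continuous_on_slice2[OF r_cont] continuous_on_slice2[OF rx_cont]) (use that in auto)
  have "((\<lambda>t. 2 * (r (Suc k) 0 t \<bullet> r k 0 t)) has_integral r k 0 t2 \<bullet> r k 0 t2 - sqn (r k 0 t1)) {t1..t2}"
    by (rule fundamental_theorem_of_calculus[OF assms(2)])
      (auto simp: has_real_derivative_iff_has_vector_derivative[symmetric] intro: has_field_derivative_at_within r0_deriv)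
  from has_integral_mult_right[OF this, of "(m - a) / 2"]
  have "((\<lambda>t. r (Suc k) 0 t \<bullet> rx k 0 t) has_integral (m - a) / 2 * (sqn (r k 0 t2) - sqn (r k 0 t1))) {t1..t2}"
    unfolding boundary_flux by (simp add: mult.assoc)
  then have "integral {t1..t2} (\<lambda>t. r (Suc k) 0 t \<bullet> rx k 0 t) = (m - a) / 2 * (sqn (r k 0 t2) - sqn (r k 0 t1))"
    by (rule integral_unique)
  then show ?thesis
    using r.energy_balance[OF assms, of k] integral_diff[OF i[OF assms(1)] i[of 0]]
    unfolding energy_def right_diff_distrib by linarith
qed

lemma rx_sq_le: "sqn (rx k x t) \<le> 3 * sqn (s (Suc k) x t) + 3 * m\<^sup>2 * sqn (r k x t)
    + 3 * a\<^sup>2 * sqn (r k 0 t) * exp (- 2 * m * x)"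
proof -
  have three: "sqn (u + v - w) \<le> 3 * sqn u + 3 * sqn v + 3 * sqn w" for u v w :: complex
  proof -
    have "0 \<le> sqn (u - v) + sqn (u + w) + sqn (v + w)" by simp
    then show ?thesis by (simp add: inner_add_left inner_add_right inner_diff_left inner_diff_right inner_commute)
  qed
  have "exp (- 2 * m * x) = (exp (- m * x))\<^sup>2" by (simp add: exp_double[symmetric])
  then show ?thesis
    using three[of "- \<iota> * s (Suc k) x t" "of_real m * r k x t" "of_real (a * exp (- m * x)) * r k 0 t"]
    unfolding rx_def[symmetric] by (simp only: inner_of_real_mult minus_mult_left[symmetric] inner_minus_left inner_minus_right inner_iota_iota)
      (simp add: power2_eq_square algebra_simps)
qed

text \<open>The first-order equation trades r_x for s_t, r and an exponentially decaying multiple of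
  r(0, t), whose L^2 norms are bounded on compact time intervals. Uniformity in time comes later,
  from the energy.\<close>

lemma local_bound: "\<exists>B. \<forall>t\<in>{-T..T}. \<forall>X\<ge>0. integral {0..X} (\<lambda>x. sqn (r k x t) + sqn (rx k x t)) \<le> B"
proof -
  obtain B0 where B0: "\<And>t X. t \<in> {-T..T} \<Longrightarrow> 0 \<le> X \<Longrightarrow> integral {0..X} (\<lambda>x. sqn (r k x t) + sqn (s k x t)) \<le> B0"
    using L2_bound[of T k] by blast
  obtain B1 where B1: "\<And>t X. t \<in> {-T..T} \<Longrightarrow> 0 \<le> X \<Longrightarrow> integral {0..X} (\<lambda>x. sqn (r (Suc k) x t) + sqn (s (Suc k) x t)) \<le> B1"
    using L2_bound[of T "Suc k"] by blast
  have "bounded ((\<lambda>t. sqn (r k 0 t)) ` {-T..T})"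
    by (intro compact_imp_bounded compact_continuous_image continuous_intros continuous_on_slice2[OF r_cont]) auto
  then obtain Z where Z: "\<And>t. t \<in> {-T..T} \<Longrightarrow> r k 0 t \<bullet> r k 0 t \<le> Z"
    unfolding bounded_iff by (fastforce simp: abs_le_iff)
  have "integral {0..X} (\<lambda>x. sqn (r k x t) + sqn (rx k x t)) \<le> (1 + 3 * m\<^sup>2) * B0 + 3 * B1 + 3 * a\<^sup>2 * Z / (2 * m)"
    if t: "t \<in> {-T..T}" and X: "0 \<le> X" for t X
  proof -
    define z where "z = sqn (r k 0 t)"
    have z: "0 \<le> z" "z \<le> Z" using Z[OF t] by (auto simp: z_def)
    have E: "((\<lambda>x. exp (- 2 * m * x)) has_integral (1 - exp (- 2 * m * X)) / (2 * m)) {0..X}"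
    proof -
      have "((\<lambda>x. exp (- 2 * m * x)) has_integral (- exp (- 2 * m * X) / (2 * m)) - (- exp (- 2 * m * 0) / (2 * m))) {0..X}"
        by (rule fundamental_theorem_of_calculus[OF X])
          (use m in \<open>auto simp: has_real_derivative_iff_has_vector_derivative[symmetric] intro!: derivative_eq_intros\<close>)
      then show ?thesis by (simp add: diff_divide_distrib)
    qed
    have c0: "jcont (\<lambda>x t. sqn (r k x t) + sqn (s k x t))" for k
      by (intro continuous_intros r_cont s_cont)
    have cx: "jcont (\<lambda>x t. sqn (r k x t) + sqn (rx k x t))"
      by (intro continuous_intros r_cont rx_cont)
    have I0: "0 \<le> integral {0..X} (\<lambda>x. sqn (r k x t) + sqn (s k x t))" for k
      by (rule integral_nonneg[OF slice_integrable[OF c0 order_refl]]) auto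
    have "((\<lambda>x. (1 + 3 * m\<^sup>2) * (sqn (r k x t) + sqn (s k x t))
        + 3 * (sqn (r (Suc k) x t) + sqn (s (Suc k) x t)) + 3 * a\<^sup>2 * z * exp (- 2 * m * x)) has_integral
       (1 + 3 * m\<^sup>2) * integral {0..X} (\<lambda>x. sqn (r k x t) + sqn (s k x t))
        + 3 * integral {0..X} (\<lambda>x. sqn (r (Suc k) x t) + sqn (s (Suc k) x t)) + 3 * a\<^sup>2 * z * ((1 - exp (- 2 * m * X)) / (2 * m))) {0..X}"
      by (intro has_integral_add has_integral_mult_right E integrable_integral slice_integrable[OF c0]) auto
    then have "integral {0..X} (\<lambda>x. sqn (r k x t) + sqn (rx k x t)) \<le>
       (1 + 3 * m\<^sup>2) * integral {0..X} (\<lambda>x. sqn (r k x t) + sqn (s k x t))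
        + 3 * integral {0..X} (\<lambda>x. sqn (r (Suc k) x t) + sqn (s (Suc k) x t)) + 3 * a\<^sup>2 * z * ((1 - exp (- 2 * m * X)) / (2 * m))"
    proof (rule has_integral_le[OF integrable_integral[OF slice_integrable[OF cx order_refl]]])
      fix x
      have "0 \<le> sqn (s k x t)" "0 \<le> 3 * m\<^sup>2 * sqn (s k x t)" "0 \<le> sqn (r (Suc k) x t)" by simp_all
      moreover have "(1 + 3 * m\<^sup>2) * (sqn (r k x t) + sqn (s k x t)) = sqn (r k x t) + sqn (s k x t)
         + 3 * m\<^sup>2 * sqn (r k x t) + 3 * m\<^sup>2 * sqn (s k x t)" by (simp add: algebra_simps)
      ultimately show "sqn (r k x t) + sqn (rx k x t) \<le> (1 + 3 * m\<^sup>2) * (sqn (r k x t) + sqn (s k x t))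
        + 3 * (sqn (r (Suc k) x t) + sqn (s (Suc k) x t)) + 3 * a\<^sup>2 * z * exp (- 2 * m * x)"
        using rx_sq_le[of k x t] unfolding z_def by argo
    qed
    also have "(1 + 3 * m\<^sup>2) * integral {0..X} (\<lambda>x. sqn (r k x t) + sqn (s k x t))
        + 3 * integral {0..X} (\<lambda>x. sqn (r (Suc k) x t) + sqn (s (Suc k) x t)) + 3 * a\<^sup>2 * z * ((1 - exp (- 2 * m * X)) / (2 * m))
      \<le> (1 + 3 * m\<^sup>2) * B0 + 3 * B1 + 3 * a\<^sup>2 * Z * (1 / (2 * m))"
    proof (intro add_mono mult_mono)
      show "(1 - exp (- 2 * m * X)) / (2 * m) \<le> 1 / (2 * m)" using m by (simp add: divide_right_mono)
      show "0 \<le> (1 - exp (- 2 * m * X)) / (2 * m)" using m X by simp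
    qed (use B0[OF t X] B1[OF t X] z I0 in auto)
    finally show ?thesis by simp
  qed
  then show ?thesis by blast
qed

lemma energy_mono_X: "0 \<le> X \<Longrightarrow> X \<le> Y \<Longrightarrow> energy k X t \<le> energy k Y t"
proof -
  assume X: "0 \<le> X" "X \<le> Y"
  have c: "jcont (r.energy_density k)"
    unfolding r.energy_density_def by (intro continuous_intros r_cont rx_cont) auto
  show ?thesis
    unfolding energy_def
    by (intro add_right_mono integral_subset_le slice_integrable[OF c]) (use X in \<open>auto simp: r.energy_density_def\<close>)
qed

text \<open>Conservation on the whole half-line, expressed through bounds on all [0, X], since the
  energy increases with X. Between the two times, in either order, the flux through a suitable
  distant Y is below e.\<close>

lemma energy_preserved:
  assumes K: "\<And>X. 0 \<le> X \<Longrightarrow> energy k X t1 \<le> K" and X: "0 \<le> X"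
  shows "energy k X t2 \<le> K"
proof (rule field_le_epsilon)
  fix e :: real assume e: "0 < e"
  define T where "T = max \<bar>t1\<bar> \<bar>t2\<bar>"
  define u where "u = min t1 t2"
  define w where "w = max t1 t2"
  have uw: "u \<le> w" "{u..w} \<subseteq> {-T..T}" by (auto simp: u_def w_def T_def)
  obtain B0 where B0: "\<And>t X. t \<in> {-T..T} \<Longrightarrow> 0 \<le> X \<Longrightarrow> integral {0..X} (\<lambda>x. sqn (r k x t) + sqn (rx k x t)) \<le> B0"
    using local_bound[of T k] by blast
  obtain B1 where B1: "\<And>t X. t \<in> {-T..T} \<Longrightarrow> 0 \<le> X \<Longrightarrow> integral {0..X} (\<lambda>x. sqn (r (Suc k) x t) + sqn (rx (Suc k) x t)) \<le> B1"
    using local_bound[of T "Suc k"] by blast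
  define P where "P x t = (sqn (r k x t) + sqn (rx k x t)) + (sqn (r (Suc k) x t) + sqn (rx (Suc k) x t))" for x t
  have c: "jcont (\<lambda>x t. sqn (r k x t) + sqn (rx k x t))" for k
    by (intro continuous_intros r_cont rx_cont)
  have Pc: "jcont P"
    unfolding P_def by (intro continuous_intros c)
  define h where "h x = integral {u..w} (\<lambda>t. P x t)" for x
  have hc: "continuous_on {0..} h" unfolding h_def by (rule continuous_on_integral_slice2[OF Pc])
  have h0: "0 \<le> h x" if "0 \<le> x" for x unfolding h_def
    by (rule integral_nonneg) (use that in \<open>auto simp: P_def intro!: integrable_continuous_real continuous_on_slice2[OF Pc, unfolded P_def]\<close>)
  have hB: "integral {0..Y} h \<le> (w - u) * (B0 + B1)" if Y: "0 \<le> Y" for Y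
  proof -
    have sub: "{0..Y} \<subseteq> {0..}" by auto
    have "integral {0..Y} h = integral {u..w} (\<lambda>t. integral {0..Y} (\<lambda>x. P x t))"
      unfolding h_def by (rule integral_swap_slice[OF Pc sub])
    also have "\<dots> \<le> integral {u..w} (\<lambda>t. B0 + B1)"
    proof (rule integral_le)
      fix t assume "t \<in> {u..w}"
      then have t: "t \<in> {-T..T}" using uw by auto
      show "integral {0..Y} (\<lambda>x. P x t) \<le> B0 + B1"
        unfolding P_def using B0[OF t Y] B1[OF t Y] by (subst integral_add) (auto intro!: slice_integrable[OF c])
    qed (auto intro!: integrable_continuous_real continuous_on_integral_slice[OF Pc sub])
    finally show ?thesis using uw by simp
  qed
  obtain Y where Y: "X \<le> Y" "0 \<le> Y" "h Y < e" using small_somewhere[OF hc h0 hB e, of X] by auto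
  have "norm (integral {u..w} (\<lambda>t. r (Suc k) Y t \<bullet> rx k Y t)) \<le> integral {u..w} (\<lambda>t. P Y t)"
  proof (rule integral_norm_bound_integral)
    fix t
    have "0 \<le> sqn (r (Suc k) Y t + rx k Y t)" "0 \<le> sqn (r (Suc k) Y t - rx k Y t)" by simp_all
    then have "2 * \<bar>r (Suc k) Y t \<bullet> rx k Y t\<bar> \<le> sqn (r (Suc k) Y t) + sqn (rx k Y t)"
      by (simp add: inner_add_left inner_add_right inner_diff_left inner_diff_right inner_commute abs_if)
    moreover have "0 \<le> sqn (r k Y t)" "0 \<le> sqn (rx (Suc k) Y t)"  "0 \<le> sqn (r (Suc k) Y t)" "0 \<le> sqn (rx k Y t)" by simp_all
    ultimately show "norm (r (Suc k) Y t \<bullet> rx k Y t) \<le> P Y t" unfolding P_def real_norm_def by argo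
  qed (use Y in \<open>auto intro!: integrable_continuous_real continuous_intros continuous_on_slice2[OF r_cont] continuous_on_slice2[OF rx_cont] continuous_on_slice2[OF Pc]\<close>)
  then have "\<bar>energy k Y w - energy k Y u\<bar> < e"
    using energy_diff[OF Y(2) uw(1), of k] Y(3) by (simp add: h_def)
  then have "\<bar>energy k Y t2 - energy k Y t1\<bar> < e"
    by (cases "t1 \<le> t2") (auto simp: u_def w_def abs_minus_commute)
  then show "energy k X t2 \<le> K + e"
    using K[OF Y(2)] energy_mono_X[OF X Y(1), of k t2] by linarith
qed

text \<open>For a > m the boundary term of the energy is negative; \<open>robin_ineq\<close> absorbs
  it into the fraction q = (a - m) / m of the integral, and q < 1 exactly if a < 2 m. Half of 1 - q
  = (2 m - a) / m is left.\<close>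

definition coer :: real where "coer = min 1 ((2 * m - a) / m) / 2"

lemma coer_pos: "0 < coer" using m a by (simp add: coer_def)

text \<open>Integrate 0 \<le> |r_x + m r|^2, whose cross term is m times the x-derivative of |r|^2.
  This is the sharp trace inequality, with equality for e^(- m x).\<close>

lemma robin_ineq: assumes "0 \<le> X"
  shows "m * sqn (r k 0 t) \<le> integral {0..X} (\<lambda>x. sqn (rx k x t) + m\<^sup>2 * sqn (r k x t)) + m * sqn (r k X t)"
proof -
  have c: "jcont (\<lambda>x t. sqn (rx k x t) + m\<^sup>2 * sqn (r k x t))"
    by (intro continuous_intros r_cont rx_cont)
  have "((\<lambda>x. 2 * (r k x t \<bullet> rx k x t)) has_integral r k X t \<bullet> r k X t - sqn (r k 0 t)) {0..X}"
  proof (rule fundamental_theorem_of_calculus[OF assms])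
    fix x assume x: "x \<in> {0..X}"
    have "((\<lambda>x. sqn (r k x t)) has_real_derivative 2 * (r k x t \<bullet> rx k x t)) (at x within {0..})"
      by (rule DERIV_cong[OF inner_has_real_derivative[OF r.v_x r.v_x]]) (use x in \<open>auto simp: inner_commute\<close>)
    then show "((\<lambda>x. sqn (r k x t)) has_vector_derivative 2 * (r k x t \<bullet> rx k x t)) (at x within {0..X})"
      unfolding has_real_derivative_iff_has_vector_derivative by (rule has_vector_derivative_within_subset) auto
  qed
  then have "((\<lambda>x. (sqn (rx k x t) + m\<^sup>2 * sqn (r k x t)) + m * (2 * (r k x t \<bullet> rx k x t))) has_integral
     integral {0..X} (\<lambda>x. sqn (rx k x t) + m\<^sup>2 * sqn (r k x t)) + m * (sqn (r k X t) - sqn (r k 0 t))) {0..X}"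
    by (intro has_integral_add has_integral_mult_right integrable_integral slice_integrable[OF c]) auto
  then have "0 \<le> integral {0..X} (\<lambda>x. sqn (rx k x t) + m\<^sup>2 * sqn (r k x t)) + m * (sqn (r k X t) - sqn (r k 0 t))"
  proof (rule has_integral_nonneg)
    fix x
    have "0 \<le> sqn (rx k x t + of_real m * r k x t)" by simp
    also have "\<dots> = (sqn (rx k x t) + m\<^sup>2 * sqn (r k x t)) + m * (2 * (r k x t \<bullet> rx k x t))"
      unfolding inner_add_left inner_add_right inner_of_real_mult by (simp add: inner_commute power2_eq_square algebra_simps)
    finally show "0 \<le> (sqn (rx k x t) + m\<^sup>2 * sqn (r k x t)) + m * (2 * (r k x t \<bullet> rx k x t))" .
  qed
  then show ?thesis by (simp add: algebra_simps)
qed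

lemma r_small_somewhere:
  assumes "0 < e" obtains Y where "X \<le> Y" "0 \<le> Y" "sqn (r k Y t) < e"
proof -
  obtain B0 where B0: "\<And>X. 0 \<le> X \<Longrightarrow> integral {0..X} (\<lambda>x. sqn (r k x t) + sqn (s k x t)) \<le> B0"
  proof -
    have "t \<in> {- \<bar>t\<bar>..\<bar>t\<bar>}" by auto
    then show ?thesis using L2_bound[of "\<bar>t\<bar>" k] that by blast
  qed
  have c: "jcont (\<lambda>x t. sqn (r k x t))"
    "jcont (\<lambda>x t. sqn (r k x t) + sqn (s k x t))"
    by (intro continuous_intros r_cont s_cont)+
  have "integral {0..X} (\<lambda>x. sqn (r k x t)) \<le> B0" if "0 \<le> X" for X
    by (rule order_trans[OF integral_le B0[OF that]]) (auto intro!: slice_integrable[OF c(1)] slice_integrable[OF c(2)])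
  from small_somewhere[OF continuous_on_slice1[OF c(1)] _ this assms, of X] that show ?thesis by auto
qed

lemma energy_coercive:
  assumes K: "\<And>X. 0 \<le> X \<Longrightarrow> energy k X t \<le> K" and X: "0 \<le> X"
  shows "coer * integral {0..X} (\<lambda>x. sqn (r (Suc k) x t) + sqn (rx k x t) + m\<^sup>2 * sqn (r k x t)) \<le> K"
proof (rule field_le_epsilon)
  fix e :: real assume e: "0 < e"
  \<comment> \<open>Makes the remainder (a - m) |r(Y)|^2 left by \<open>robin_ineq\<close> at most
    e.\<close>
  define d where "d = e / (\<bar>a - m\<bar> + 1)"
  have d: "0 < d" "\<bar>a - m\<bar> * d \<le> e" using e by (auto simp: d_def field_simps)
  obtain Y where Y: "X \<le> Y" "0 \<le> Y" "sqn (r k Y t) < d" by (rule r_small_somewhere[OF d(1)])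
  have c1: "jcont (\<lambda>x t. sqn (r (Suc k) x t))"
    by (intro continuous_intros r_cont)
  have c2: "jcont (\<lambda>x t. sqn (rx k x t) + m\<^sup>2 * sqn (r k x t))"
    by (intro continuous_intros r_cont rx_cont)
  have c12: "jcont (\<lambda>x t. sqn (r (Suc k) x t) + sqn (rx k x t) + m\<^sup>2 * sqn (r k x t))"
    by (intro continuous_intros r_cont rx_cont)
  define I1 where "I1 = integral {0..Y} (\<lambda>x. sqn (r (Suc k) x t))"
  define I2 where "I2 = integral {0..Y} (\<lambda>x. sqn (rx k x t) + m\<^sup>2 * sqn (r k x t))"
  have I0: "0 \<le> I1" "0 \<le> I2" unfolding I1_def I2_def
    using integral_nonneg[OF slice_integrable[OF c1 order_refl]] integral_nonneg[OF slice_integrable[OF c2 order_refl]] by simp_all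
  have sum: "integral {0..Y} (\<lambda>x. sqn (r (Suc k) x t) + sqn (rx k x t) + m\<^sup>2 * sqn (r k x t)) = I1 + I2"
    unfolding I1_def I2_def
    using integral_add[OF slice_integrable[OF c1 order_refl, of t Y] slice_integrable[OF c2 order_refl, of t Y]] by (simp add: add.assoc)
  have En: "energy k Y t = (I1 + I2) / 2 + (m - a) / 2 * sqn (r k 0 t)"
    by (simp add: energy_def r.energy_density_def sum)
  have "coer * integral {0..X} (\<lambda>x. sqn (r (Suc k) x t) + sqn (rx k x t) + m\<^sup>2 * sqn (r k x t)) \<le> coer * (I1 + I2)"
    unfolding sum[symmetric] using coer_pos Y
    by (intro mult_left_mono integral_subset_le slice_integrable[OF c12]) auto
  also have "\<dots> \<le> energy k Y t + e"
  proof (cases "a \<le> m")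
    case True
    have "coer * (I1 + I2) \<le> 1/2 * (I1 + I2)" using I0 by (intro mult_right_mono) (auto simp: coer_def)
    moreover have "0 \<le> (m - a) / 2 * sqn (r k 0 t)" using True by simp
    ultimately show ?thesis using En e by linarith
  next
    case False
    define q where "q = (a - m) / m"
    have q: "0 < q" using False m by (simp add: q_def)
    have "coer = min 1 (1 - q) / 2" using m by (simp add: coer_def q_def field_simps)
    then have co: "coer = (1 - q) / 2" using q by simp
    have "(a - m) * sqn (r k 0 t) = q * (m * sqn (r k 0 t))" using m by (simp add: q_def)
    also have "\<dots> \<le> q * (I2 + m * sqn (r k Y t))"
      unfolding I2_def by (rule mult_left_mono[OF robin_ineq[OF Y(2)]]) (use q in simp)
    also have "\<dots> = q * I2 + (a - m) * sqn (r k Y t)" using m by (simp add: q_def field_simps)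
    also have "(a - m) * sqn (r k Y t) \<le> (a - m) * d" using Y(3) False by (intro mult_left_mono) auto
    also have "\<dots> \<le> e" using d(2) False by simp
    finally have 1: "(a - m) * sqn (r k 0 t) \<le> q * I2 + e" by simp
    have "energy k Y t = (I1 + I2) / 2 - ((a - m) * sqn (r k 0 t)) / 2" unfolding En by (simp add: field_simps)
    moreover have "coer * (I1 + I2) = (I1 + I2) / 2 - (q * I1) / 2 - (q * I2) / 2" unfolding co by (simp add: field_simps)
    moreover have "0 \<le> q * I1" using q I0 by simp
    ultimately show ?thesis using 1 e by linarith
  qed
  also have "energy k Y t \<le> K" by (rule K[OF Y(2)])
  finally show "coer * integral {0..X} (\<lambda>x. sqn (r (Suc k) x t) + sqn (rx k x t) + m\<^sup>2 * sqn (r k x t)) \<le> K + e" by simp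
qed

end

section \<open>First-order equations in x with decaying right side\<close>

lemma ode_ascend:
  fixes f fx :: "real \<Rightarrow> complex"
  assumes f: "\<And>y. y \<in> {0..x} \<Longrightarrow> (f has_vector_derivative fx y) (at y within {0..x})"
    and c: "continuous_on {0..x} fx" and \<mu>: "0 \<le> Re \<mu>" and x: "0 \<le> x"
  shows "norm (f x) \<le> norm (f 0) + integral {0..x} (\<lambda>y. norm (fx y + \<mu> * f y))"
proof -
  have fc: "continuous_on {0..x} f" using f has_vector_derivative_continuous continuous_on_eq_continuous_within by blast
  have E: "((\<lambda>y. exp (of_real y * \<mu>)) has_vector_derivative \<mu> * exp (of_real y * \<mu>)) (at y within {0..x})" for y
    by (rule has_vector_derivative_real_field) (auto intro!: derivative_eq_intros)
  have "((\<lambda>y. exp (of_real y * \<mu>) * (fx y + \<mu> * f y)) has_integral exp (of_real x * \<mu>) * f x - exp (of_real 0 * \<mu>) * f 0) {0..x}"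
  proof (rule fundamental_theorem_of_calculus[OF x])
    fix y assume "y \<in> {0..x}"
    from has_vector_derivative_mult[OF E f[OF this]]
    show "((\<lambda>y. exp (of_real y * \<mu>) * f y) has_vector_derivative exp (of_real y * \<mu>) * (fx y + \<mu> * f y)) (at y within {0..x})"
      by (simp add: algebra_simps)
  qed
  then have 1: "exp (of_real x * \<mu>) * f x = f 0 + integral {0..x} (\<lambda>y. exp (of_real y * \<mu>) * (fx y + \<mu> * f y))"
    by (simp add: integral_unique)
  have i: "(\<lambda>y. norm (fx y + \<mu> * f y)) integrable_on {0..x}"
    by (intro integrable_continuous_real continuous_intros c fc)
  have "norm (integral {0..x} (\<lambda>y. exp (of_real y * \<mu>) * (fx y + \<mu> * f y))) \<le> integral {0..x} (\<lambda>y. exp (x * Re \<mu>) * norm (fx y + \<mu> * f y))"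
  proof (rule integral_norm_bound_integral)
    show "(\<lambda>y. exp (of_real y * \<mu>) * (fx y + \<mu> * f y)) integrable_on {0..x}"
      by (intro integrable_continuous_real continuous_intros c fc)
    show "(\<lambda>y. exp (x * Re \<mu>) * norm (fx y + \<mu> * f y)) integrable_on {0..x}"
      by (intro integrable_on_mult_right i)
    fix y assume y: "y \<in> {0..x}"
    have "exp (y * Re \<mu>) \<le> exp (x * Re \<mu>)" using y \<mu> by (simp add: mult_right_mono)
    then show "norm (exp (of_real y * \<mu>) * (fx y + \<mu> * f y)) \<le> exp (x * Re \<mu>) * norm (fx y + \<mu> * f y)"
      by (simp add: norm_mult mult_right_mono)
  qed
  then have "exp (x * Re \<mu>) * norm (f x) \<le> norm (f 0) + exp (x * Re \<mu>) * integral {0..x} (\<lambda>y. norm (fx y + \<mu> * f y))"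
    using arg_cong[OF 1, of norm] norm_triangle_ineq[of "f 0" "integral {0..x} (\<lambda>y. exp (of_real y * \<mu>) * (fx y + \<mu> * f y))"]
    by (simp add: norm_mult)
  also have "norm (f 0) \<le> exp (x * Re \<mu>) * norm (f 0)"
    using mult_right_mono[of 1 "exp (x * Re \<mu>)" "norm (f 0)"] x \<mu> by simp
  finally have "exp (x * Re \<mu>) * norm (f x) \<le> exp (x * Re \<mu>) * (norm (f 0) + integral {0..x} (\<lambda>y. norm (fx y + \<mu> * f y)))"
    by (simp add: algebra_simps)
  then show ?thesis by simp
qed

text \<open>The sign of Re \<mu> decides from which end the equation is solved. Here the integrating
  factor, normalised at x, is bounded by 1 to the right of x, so one starts from the far point y; in
  \<open>ode_ascend\<close> one starts from 0.\<close>

lemma ode_descend: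
  fixes f fx :: "real \<Rightarrow> complex"
  assumes f: "\<And>u. u \<in> {x..y} \<Longrightarrow> (f has_vector_derivative fx u) (at u within {x..y})"
    and c: "continuous_on {x..y} fx" and \<mu>: "Re \<mu> \<le> 0" and x: "x \<le> y"
  shows "norm (f x) \<le> norm (f y) + integral {x..y} (\<lambda>u. norm (fx u + \<mu> * f u))"
proof -
  have fc: "continuous_on {x..y} f" using f has_vector_derivative_continuous continuous_on_eq_continuous_within by blast
  have E: "((\<lambda>u. exp (of_real (u - x) * \<mu>)) has_vector_derivative \<mu> * exp (of_real (u - x) * \<mu>)) (at u within {x..y})" for u
    unfolding of_real_diff by (rule has_vector_derivative_real_field) (auto intro!: derivative_eq_intros)
  have "((\<lambda>u. exp (of_real (u - x) * \<mu>) * (fx u + \<mu> * f u)) has_integral exp (of_real (y - x) * \<mu>) * f y - exp (of_real (x - x) * \<mu>) * f x) {x..y}"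
  proof (rule fundamental_theorem_of_calculus[OF x])
    fix u assume "u \<in> {x..y}"
    from has_vector_derivative_mult[OF E f[OF this]]
    show "((\<lambda>u. exp (of_real (u - x) * \<mu>) * f u) has_vector_derivative exp (of_real (u - x) * \<mu>) * (fx u + \<mu> * f u)) (at u within {x..y})"
      by (simp add: algebra_simps)
  qed
  then have 1: "f x = exp (of_real (y - x) * \<mu>) * f y - integral {x..y} (\<lambda>u. exp (of_real (u - x) * \<mu>) * (fx u + \<mu> * f u))"
    by (simp add: integral_unique)
  have e: "norm (exp (of_real (u - x) * \<mu>)) \<le> 1" if "x \<le> u" for u
    using that \<mu> by (simp add: mult_nonneg_nonpos)
  have "norm (integral {x..y} (\<lambda>u. exp (of_real (u - x) * \<mu>) * (fx u + \<mu> * f u))) \<le> integral {x..y} (\<lambda>u. norm (fx u + \<mu> * f u))"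
  proof (rule integral_norm_bound_integral)
    fix u assume "u \<in> {x..y}"
    then show "norm (exp (of_real (u - x) * \<mu>) * (fx u + \<mu> * f u)) \<le> norm (fx u + \<mu> * f u)"
      unfolding norm_mult using e[of u] by (intro mult_left_le_one_le) auto
  qed (auto intro!: integrable_continuous_real continuous_intros c fc)
  moreover have "norm (exp (of_real (y - x) * \<mu>) * f y) \<le> norm (f y)"
    unfolding norm_mult using e[OF x] by (intro mult_left_le_one_le) auto
  ultimately show ?thesis
    using norm_triangle_ineq4[of "exp (of_real (y - x) * \<mu>) * f y" "integral {x..y} (\<lambda>u. exp (of_real (u - x) * \<mu>) * (fx u + \<mu> * f u))"] 1
    by simp
qed

definition locally_vanishing :: "(real \<Rightarrow> real \<Rightarrow> complex) \<Rightarrow> bool" where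
  "locally_vanishing f \<longleftrightarrow> (\<forall>R\<ge>0. \<forall>e>0. \<forall>\<^sub>F t in at_top. \<forall>x\<in>{0..R}. norm (f x t) \<le> e)"

text \<open>Used besides the uniform notion because the x-derivative of a Dirichlet solution is
  controlled only in the mean; the first-order equations in x accept such a right side.\<close>

definition locally_vanishing_L1 :: "(real \<Rightarrow> real \<Rightarrow> complex) \<Rightarrow> bool" where
  "locally_vanishing_L1 f \<longleftrightarrow> (\<forall>R\<ge>0. \<forall>e>0. \<forall>\<^sub>F t in at_top. integral {0..R} (\<lambda>x. norm (f x t)) \<le> e)"

lemma locally_vanishing_add:
  assumes "locally_vanishing f" "locally_vanishing g"
  shows "locally_vanishing (\<lambda>x t. f x t + g x t)"
  unfolding locally_vanishing_def
proof (intro allI impI)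
  fix R e :: real assume R: "0 \<le> R" and e: "0 < e"
  have "0 < e / 2" using e by simp
  then have "\<forall>\<^sub>F t in at_top. \<forall>x\<in>{0..R}. norm (f x t) \<le> e / 2" "\<forall>\<^sub>F t in at_top. \<forall>x\<in>{0..R}. norm (g x t) \<le> e / 2"
    using assms R unfolding locally_vanishing_def by blast+
  then show "\<forall>\<^sub>F t in at_top. \<forall>x\<in>{0..R}. norm (f x t + g x t) \<le> e"
    by eventually_elim (metis add_mono field_sum_of_halves norm_triangle_le)
qed

lemma locally_vanishing_cmult:
  assumes "locally_vanishing f"
  shows "locally_vanishing (\<lambda>x t. c * f x t)"
  unfolding locally_vanishing_def
proof (intro allI impI)
  fix R e :: real assume R: "0 \<le> R" and e: "0 < e"
  have "0 < e / (norm c + 1)" using e by (simp add: add_nonneg_pos)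
  then have "\<forall>\<^sub>F t in at_top. \<forall>x\<in>{0..R}. norm (f x t) \<le> e / (norm c + 1)"
    using assms R unfolding locally_vanishing_def by blast
  then show "\<forall>\<^sub>F t in at_top. \<forall>x\<in>{0..R}. norm (c * f x t) \<le> e"
  proof eventually_elim
    case (elim t)
    show ?case
    proof
      fix x assume "x \<in> {0..R}"
      then have "norm (c * f x t) \<le> norm c * (e / (norm c + 1))"
        unfolding norm_mult using elim by (intro mult_left_mono) auto
      also have "\<dots> \<le> e"
      proof -
        have "0 < norm c + 1" by (simp add: add_nonneg_pos)
        then show ?thesis using e by (simp add: divide_le_eq algebra_simps)
      qed
      finally show "norm (c * f x t) \<le> e" .
    qed
  qed
qed

lemma locally_vanishing_diff:
  assumes "locally_vanishing f" "locally_vanishing g"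
  shows "locally_vanishing (\<lambda>x t. f x t - g x t)"
  using locally_vanishing_add[OF assms(1) locally_vanishing_cmult[OF assms(2), of "-1"]] by simp

lemma locally_vanishing_imp_L1:
  assumes "locally_vanishing f" and c: "jcont f"
  shows "locally_vanishing_L1 f"
  unfolding locally_vanishing_L1_def
proof (intro allI impI)
  fix R e :: real assume R: "0 \<le> R" and e: "0 < e"
  have "0 < e / (R + 1)" using e R by simp
  then have "\<forall>\<^sub>F t in at_top. \<forall>x\<in>{0..R}. norm (f x t) \<le> e / (R + 1)"
    using assms R unfolding locally_vanishing_def by blast
  then show "\<forall>\<^sub>F t in at_top. integral {0..R} (\<lambda>x. norm (f x t)) \<le> e"
  proof eventually_elim
    case (elim t)
    have "integral {0..R} (\<lambda>x. norm (f x t)) \<le> integral {0..R} (\<lambda>x. e / (R + 1))"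
      by (rule integral_le) (use elim in \<open>auto intro!: slice_integrable continuous_intros c\<close>)
    also have "\<dots> \<le> e" using R e by (simp add: field_simps)
    finally show ?case .
  qed
qed

lemma locally_vanishing_ascend:
  fixes f fx :: "real \<Rightarrow> real \<Rightarrow> complex"
  assumes f: "\<And>x t. 0 \<le> x \<Longrightarrow> ((\<lambda>x. f x t) has_vector_derivative fx x t) (at x within {0..})"
    and fxc: "\<And>t. continuous_on {0..} (\<lambda>x. fx x t)"
    and \<mu>: "0 \<le> Re \<mu>" and w: "locally_vanishing_L1 (\<lambda>x t. fx x t + \<mu> * f x t)"
    and f0: "((\<lambda>t. f 0 t) \<longlongrightarrow> 0) at_top"
  shows "locally_vanishing f"
  unfolding locally_vanishing_def
proof (intro allI impI)
  fix R e :: real assume R: "0 \<le> R" and e: "0 < e"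
  have "0 < e / 2" using e by simp
  then have "\<forall>\<^sub>F t in at_top. integral {0..R} (\<lambda>x. norm (fx x t + \<mu> * f x t)) \<le> e / 2"
    using w R unfolding locally_vanishing_L1_def by blast
  moreover have "\<forall>\<^sub>F t in at_top. norm (f 0 t) < e / 2"
    using tendstoD[OF f0, of "e / 2"] e by (simp add: dist_norm)
  ultimately show "\<forall>\<^sub>F t in at_top. \<forall>x\<in>{0..R}. norm (f x t) \<le> e"
  proof eventually_elim
    case (elim t)
    have fc: "continuous_on {0..} (\<lambda>x. f x t)"
      using f[of _ t] has_vector_derivative_continuous continuous_on_eq_continuous_within by (metis atLeast_iff)
    show ?case
    proof
      fix x assume x: "x \<in> {0..R}"
      have "norm (f x t) \<le> norm (f 0 t) + integral {0..x} (\<lambda>y. norm (fx y t + \<mu> * f y t))"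
        by (rule ode_ascend[OF _ _ \<mu>]) (use x in \<open>auto intro!: has_vector_derivative_within_subset[OF f] continuous_on_subset[OF fxc]\<close>)
      also have "integral {0..x} (\<lambda>y. norm (fx y t + \<mu> * f y t)) \<le> integral {0..R} (\<lambda>y. norm (fx y t + \<mu> * f y t))"
        by (rule integral_subset_le)
          (use x in \<open>auto intro!: integrable_continuous_real continuous_intros continuous_on_subset[OF fxc] continuous_on_subset[OF fc]\<close>)
      finally show "norm (f x t) \<le> e" using elim by linarith
    qed
  qed
qed

text \<open>No boundary value of f is known to decay. Instead the estimate of f at x by f at y is
  averaged over y in [x, x + L], and the uniform L^2 bound makes the average of |f| small once L is
  large.\<close>

lemma locally_vanishing_descend:
  fixes f fx :: "real \<Rightarrow> real \<Rightarrow> complex"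
  assumes f: "\<And>x t. 0 \<le> x \<Longrightarrow> ((\<lambda>x. f x t) has_vector_derivative fx x t) (at x within {0..})"
    and fc: "jcont f"
    and fxc: "jcont fx"
    and \<mu>: "Re \<mu> \<le> 0" and w: "locally_vanishing_L1 (\<lambda>x t. fx x t + \<mu> * f x t)"
    and B: "\<And>t X. 0 \<le> X \<Longrightarrow> integral {0..X} (\<lambda>x. sqn (f x t)) \<le> B"
  shows "locally_vanishing f"
  unfolding locally_vanishing_def
proof (intro allI impI)
  fix R e :: real assume R: "0 \<le> R" and e: "0 < e"
  have B0: "0 \<le> B" using B[of 0 0] by simp
  define c where "c = e / 4"
  \<comment> \<open>Chosen so that B / (2 c), which bounds the L^2 term after integration over
    [x, x + L], is at most L c.\<close>
  define L where "L = (B + 1) / (2 * c * c)"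
  have c: "0 < c" and L: "0 < L" using e B0 by (auto simp: c_def L_def)
  have "0 < e / 4" "0 \<le> R + L" using e R L by simp_all
  then have "\<forall>\<^sub>F t in at_top. integral {0..R+L} (\<lambda>x. norm (fx x t + \<mu> * f x t)) \<le> e / 4"
    using w unfolding locally_vanishing_L1_def by blast
  then show "\<forall>\<^sub>F t in at_top. \<forall>x\<in>{0..R}. norm (f x t) \<le> e"
  proof eventually_elim
    case (elim t)
    define I where "I = integral {0..R+L} (\<lambda>x. norm (fx x t + \<mu> * f x t))"
    have fc1: "continuous_on {0..} (\<lambda>x. f x t)" by (rule continuous_on_slice1[OF fc])
    have fx1: "continuous_on {0..} (\<lambda>x. fx x t)" by (rule continuous_on_slice1[OF fxc])
    show ?case
    proof
      fix x assume x: "x \<in> {0..R}"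
      have pt: "norm (f x t) \<le> norm (f y t) + I" if y: "y \<in> {x..x+L}" for y
      proof -
        have "norm (f x t) \<le> norm (f y t) + integral {x..y} (\<lambda>y. norm (fx y t + \<mu> * f y t))"
          by (rule ode_descend[OF _ _ \<mu>]) (use x y in \<open>auto intro!: has_vector_derivative_within_subset[OF f] continuous_on_subset[OF fx1]\<close>)
        also have "integral {x..y} (\<lambda>y. norm (fx y t + \<mu> * f y t)) \<le> I"
          unfolding I_def
          by (rule integral_subset_le)
            (use x y in \<open>auto intro!: integrable_continuous_real continuous_intros continuous_on_subset[OF fx1] continuous_on_subset[OF fc1]\<close>)
        finally show ?thesis by simp
      qed
      have ffc: "jcont (\<lambda>x t. sqn (f x t))"
        "jcont (\<lambda>x t. sqn (f x t) / (2 * c))"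
        using c by (intro continuous_intros fc; simp)+
      have "L * norm (f x t) = integral {x..x+L} (\<lambda>y. norm (f x t))" using L by simp
      also have "\<dots> \<le> integral {x..x+L} (\<lambda>y. (c / 2 + I) + sqn (f y t) / (2 * c))"
      proof (rule integral_le)
        fix y assume y: "y \<in> {x..x+L}"
        have "0 \<le> (norm (f y t) - c)\<^sup>2" by simp
        then have "norm (f y t) \<le> c / 2 + sqn (f y t) / (2 * c)"
          using c by (simp add: power2_norm_eq_inner[symmetric] field_simps power2_eq_square)
        with pt[OF y] show "norm (f x t) \<le> (c / 2 + I) + sqn (f y t) / (2 * c)" by linarith
      qed (use x in \<open>auto intro!: integrable_add slice_integrable[OF ffc(2)]\<close>)
      also have "\<dots> = L * (c / 2 + I) + integral {x..x+L} (\<lambda>y. sqn (f y t)) / (2 * c)"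
      proof -
        have "0 \<le> x" using x by simp
        from integral_add[OF integrable_const_ivl slice_integrable[OF ffc(2) this], of "x + L" "c / 2 + I" t]
        show ?thesis using L by simp
      qed
      also have "integral {x..x+L} (\<lambda>y. sqn (f y t)) \<le> integral {0..x+L} (\<lambda>y. sqn (f y t))"
        by (rule integral_subset_le) (use x in \<open>auto intro!: slice_integrable[OF ffc(1)]\<close>)
      also have "\<dots> \<le> B" by (rule B) (use x L in auto)
      finally have "L * norm (f x t) \<le> L * (c / 2 + I) + B / (2 * c)" using c by (simp add: divide_right_mono)
      also have "B / (2 * c) \<le> L * c" using c B0 by (simp add: L_def field_simps)
      finally have "L * norm (f x t) \<le> L * (c / 2 + I + c)" by (simp add: algebra_simps)
      then have "norm (f x t) \<le> c / 2 + I + c" using L by simp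
      then show "norm (f x t) \<le> e" using elim e unfolding I_def[symmetric] c_def by linarith
    qed
  qed
qed

section \<open>Stability and uniform bounds without time derivatives\<close>

context halfline
begin

text \<open>An H^1 density without time derivatives, so that it can be read off from a solution at a
  single time. Its integral and |r(0)|^2 together bound the energy (\<open>energy_le\<close>), and
  the energy bounds its integral (\<open>S_bound\<close>).\<close>

definition S where "S k x t = sqn (r k x t) + sqn (rx k x t) + sqn (s k x t) + sqn (sx k x t)"

lemma S_cont: "jcont (S k)"
  unfolding S_def by (intro continuous_intros r_cont rx_cont s_cont sx_cont)

lemma s_has_derivative: "0 \<le> x \<Longrightarrow> ((\<lambda>x. s k x t) has_vector_derivative sx k x t) (at x within {0..})"
  unfolding sx_def by (rule s_x)

lemma r_Suc_eq: "sqn (r (Suc k) x t) = sqn (sx k x t + of_real m * s k x t)"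
  by (simp add: sx_def inner_iota_iota)

lemma r_Suc_expand: "sqn (r (Suc k) x t) = sqn (sx k x t) + m\<^sup>2 * sqn (s k x t) + m * (2 * (s k x t \<bullet> sx k x t))"
  unfolding r_Suc_eq inner_add_left inner_add_right inner_of_real_mult by (simp add: inner_commute power2_eq_square algebra_simps)

text \<open>|r_t|^2 = |s_x + m s|^2 expands into |s_x|^2 + m^2 |s|^2 and m times the x-derivative of
  |s|^2. The boundary term m |s(0)|^2 = m |r(0)|^2 has the unfavourable sign and is absorbed by
  \<open>robin_ineq\<close>.\<close>

lemma s_energy_bound:
  assumes K: "\<And>X. 0 \<le> X \<Longrightarrow> energy k X t \<le> K" and X: "0 \<le> X"
  shows "integral {0..X} (\<lambda>x. sqn (sx k x t) + m\<^sup>2 * sqn (s k x t)) \<le> K / coer"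
proof (rule field_le_epsilon)
  fix e :: real assume e: "0 < e"
  have "0 < e / m" using e m by simp
  then obtain Y where Y: "X \<le> Y" "0 \<le> Y" "sqn (r k Y t) < e / m" by (rule r_small_somewhere)
  have c1: "jcont (\<lambda>x t. sqn (r (Suc k) x t))"
    by (intro continuous_intros r_cont)
  have c2: "jcont (\<lambda>x t. sqn (rx k x t) + m\<^sup>2 * sqn (r k x t))"
    by (intro continuous_intros r_cont rx_cont)
  have c3: "jcont (\<lambda>x t. sqn (sx k x t) + m\<^sup>2 * sqn (s k x t))"
    by (intro continuous_intros s_cont sx_cont)
  have "((\<lambda>x. 2 * (s k x t \<bullet> sx k x t)) has_integral s k X t \<bullet> s k X t - sqn (s k 0 t)) {0..X}"
  proof (rule fundamental_theorem_of_calculus[OF X])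
    fix x assume x: "x \<in> {0..X}"
    have "((\<lambda>x. sqn (s k x t)) has_real_derivative 2 * (s k x t \<bullet> sx k x t)) (at x within {0..})"
      by (rule DERIV_cong[OF inner_has_real_derivative[OF s_has_derivative s_has_derivative]]) (use x in \<open>auto simp: inner_commute\<close>)
    then show "((\<lambda>x. sqn (s k x t)) has_vector_derivative 2 * (s k x t \<bullet> sx k x t)) (at x within {0..X})"
      unfolding has_real_derivative_iff_has_vector_derivative by (rule has_vector_derivative_within_subset) auto
  qed
  then have "((\<lambda>x. sqn (r (Suc k) x t)) has_integral
     integral {0..X} (\<lambda>x. sqn (sx k x t) + m\<^sup>2 * sqn (s k x t)) + m * (sqn (s k X t) - sqn (s k 0 t))) {0..X}"
    unfolding r_Suc_expand
    by (intro has_integral_add[OF integrable_integral[OF slice_integrable[OF c3 order_refl]] has_integral_mult_right])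
  then have "integral {0..X} (\<lambda>x. sqn (sx k x t) + m\<^sup>2 * sqn (s k x t))
      = integral {0..X} (\<lambda>x. sqn (r (Suc k) x t)) + m * sqn (r k 0 t) - m * sqn (s k X t)"
    by (simp add: integral_unique s_0 algebra_simps)
  also have "\<dots> \<le> integral {0..X} (\<lambda>x. sqn (r (Suc k) x t)) + m * sqn (r k 0 t)"
    using m by simp
  also have "integral {0..X} (\<lambda>x. sqn (r (Suc k) x t)) \<le> integral {0..Y} (\<lambda>x. sqn (r (Suc k) x t))"
    by (rule integral_subset_le) (use Y in \<open>auto intro!: slice_integrable[OF c1]\<close>)
  also have "m * sqn (r k 0 t) \<le> integral {0..Y} (\<lambda>x. sqn (rx k x t) + m\<^sup>2 * sqn (r k x t)) + m * sqn (r k Y t)"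
    by (rule robin_ineq[OF Y(2)])
  also have "m * sqn (r k Y t) \<le> e" using Y(3) m by (simp add: field_simps)
  also have "integral {0..Y} (\<lambda>x. sqn (r (Suc k) x t)) + (integral {0..Y} (\<lambda>x. sqn (rx k x t) + m\<^sup>2 * sqn (r k x t)) + e)
     = integral {0..Y} (\<lambda>x. sqn (r (Suc k) x t) + sqn (rx k x t) + m\<^sup>2 * sqn (r k x t)) + e"
    using integral_add[OF slice_integrable[OF c1 order_refl, of t Y] slice_integrable[OF c2 order_refl, of t Y]] by (simp add: add.assoc)
  also have "\<dots> \<le> K / coer + e"
    using energy_coercive[OF K Y(2)] coer_pos by (simp add: field_simps)
  finally show "integral {0..X} (\<lambda>x. sqn (sx k x t) + m\<^sup>2 * sqn (s k x t)) \<le> K / coer + e" by simp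
qed

lemma S_bound:
  assumes K: "\<And>X. 0 \<le> X \<Longrightarrow> energy k X t \<le> K" and X: "0 \<le> X"
  shows "integral {0..X} (\<lambda>x. S k x t) \<le> (1 + 1 / m\<^sup>2) * (2 * K / coer)"
proof -
  have c1: "jcont (\<lambda>x t. sqn (r (Suc k) x t) + sqn (rx k x t) + m\<^sup>2 * sqn (r k x t))"
    by (intro continuous_intros r_cont rx_cont)
  have c3: "jcont (\<lambda>x t. sqn (sx k x t) + m\<^sup>2 * sqn (s k x t))"
    by (intro continuous_intros s_cont sx_cont)
  have "integral {0..X} (\<lambda>x. S k x t) \<le> (1 + 1 / m\<^sup>2) * (integral {0..X} (\<lambda>x. sqn (r (Suc k) x t) + sqn (rx k x t) + m\<^sup>2 * sqn (r k x t))
     + integral {0..X} (\<lambda>x. sqn (sx k x t) + m\<^sup>2 * sqn (s k x t)))"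
  proof (rule has_integral_le[OF integrable_integral[OF slice_integrable[OF S_cont order_refl]]
        has_integral_mult_right[OF has_integral_add[OF integrable_integral[OF slice_integrable[OF c1 order_refl]] integrable_integral[OF slice_integrable[OF c3 order_refl]]]]])
    fix x
    define A where "A = sqn (r (Suc k) x t)"
    define B where "B = sqn (rx k x t)"
    define C where "C = sqn (r k x t)"
    define D where "D = sqn (sx k x t)"
    define E where "E = sqn (s k x t)"
    have nn: "0 \<le> A" "0 \<le> B" "0 \<le> C" "0 \<le> D" "0 \<le> E" by (auto simp: A_def B_def C_def D_def E_def)
    have "(1 + 1 / m\<^sup>2) * ((A + B + m\<^sup>2 * C) + (D + m\<^sup>2 * E)) = (A + B + D) * (1 + 1 / m\<^sup>2) + C + E + m\<^sup>2 * C + m\<^sup>2 * E"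
      using m by (simp add: field_simps)
    moreover have "B + D \<le> (A + B + D) * (1 + 1 / m\<^sup>2)"
    proof -
      have "B + D \<le> (A + B + D) * 1" using nn by simp
      also have "\<dots> \<le> (A + B + D) * (1 + 1 / m\<^sup>2)" using nn by (intro mult_left_mono) auto
      finally show ?thesis .
    qed
    moreover have "0 \<le> m\<^sup>2 * C" "0 \<le> m\<^sup>2 * E" using nn by auto
    ultimately show "S k x t \<le> (1 + 1 / m\<^sup>2) * ((sqn (r (Suc k) x t) + sqn (rx k x t) + m\<^sup>2 * sqn (r k x t))
       + (sqn (sx k x t) + m\<^sup>2 * sqn (s k x t)))"
      unfolding S_def A_def[symmetric] B_def[symmetric] C_def[symmetric] D_def[symmetric] E_def[symmetric] by linarith
  qed
  also have "\<dots> \<le> (1 + 1 / m\<^sup>2) * (K / coer + K / coer)"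
  proof (intro mult_left_mono add_mono)
    show "integral {0..X} (\<lambda>x. sqn (r (Suc k) x t) + sqn (rx k x t) + m\<^sup>2 * sqn (r k x t)) \<le> K / coer"
      using energy_coercive[OF K X] coer_pos by (simp add: field_simps)
  qed (use s_energy_bound[OF K X] in auto)
  finally show ?thesis by simp
qed

lemma energy_le:
  assumes A: "\<And>X. 0 \<le> X \<Longrightarrow> integral {0..X} (\<lambda>x. S k x t) \<le> A" and A0: "sqn (r k 0 t) \<le> A" and X: "0 \<le> X"
  shows "energy k X t \<le> (1 + m\<^sup>2 + \<bar>m - a\<bar>) * A"
proof -
  have ec: "jcont (r.energy_density k)"
    unfolding r.energy_density_def by (intro continuous_intros r_cont rx_cont) auto
  have "integral {0..X} (\<lambda>x. r.energy_density k x t) \<le> (1 + m\<^sup>2) * integral {0..X} (\<lambda>x. S k x t)"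
  proof (rule has_integral_le[OF integrable_integral[OF slice_integrable[OF ec order_refl]]
        has_integral_mult_right[OF integrable_integral[OF slice_integrable[OF S_cont order_refl]]]])
    fix x
    define B where "B = sqn (rx k x t)"
    define C where "C = sqn (r k x t)"
    define D where "D = sqn (sx k x t)"
    define E where "E = sqn (s k x t)"
    have nn: "0 \<le> B" "0 \<le> C" "0 \<le> D" "0 \<le> E" by (auto simp: B_def C_def D_def E_def)
    have "0 \<le> sqn (sx k x t - of_real m * s k x t)" by simp
    also have "\<dots> = D + m\<^sup>2 * E - m * (2 * (s k x t \<bullet> sx k x t))"
      unfolding inner_diff_left inner_diff_right inner_of_real_mult D_def E_def by (simp add: inner_commute power2_eq_square algebra_simps)
    finally have "sqn (r (Suc k) x t) \<le> 2 * D + 2 * (m\<^sup>2 * E)"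
      unfolding r_Suc_expand D_def[symmetric] E_def[symmetric] by linarith
    then have "r.energy_density k x t \<le> D + m\<^sup>2 * E + B / 2 + (m\<^sup>2 * C) / 2"
      unfolding r.energy_density_def B_def[symmetric] C_def[symmetric] by argo
    also have "\<dots> \<le> (C + B + E + D) + m\<^sup>2 * C + m\<^sup>2 * B + m\<^sup>2 * E + m\<^sup>2 * D"
    proof -
      have "0 \<le> m\<^sup>2 * C" "0 \<le> m\<^sup>2 * B" "0 \<le> m\<^sup>2 * D" using nn by auto
      then show ?thesis using nn by linarith
    qed
    also have "\<dots> = (1 + m\<^sup>2) * (C + B + E + D)" by (simp add: algebra_simps)
    finally show "r.energy_density k x t \<le> (1 + m\<^sup>2) * S k x t"
      unfolding S_def B_def C_def D_def E_def .
  qed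
  also have "\<dots> \<le> (1 + m\<^sup>2) * A" using A[OF X] by (intro mult_left_mono) auto
  finally have "integral {0..X} (\<lambda>x. r.energy_density k x t) \<le> (1 + m\<^sup>2) * A" .
  moreover have "(m - a) / 2 * sqn (r k 0 t) \<le> \<bar>m - a\<bar> * A"
  proof (rule mult_mono)
    show "(m - a) / 2 \<le> \<bar>m - a\<bar>" using abs_ge_self[of "m - a"] abs_ge_zero[of "m - a"] by argo
  qed (use A0 in auto)
  ultimately show ?thesis unfolding energy_def distrib_right by linarith
qed

text \<open>The constants of \<open>energy_le\<close> and \<open>S_bound\<close> combined. It
  depends on m and a alone and is therefore available before any mollification has been
  chosen.\<close>

definition stab :: real where "stab = (1 + 1 / m\<^sup>2) * (2 * (1 + m\<^sup>2 + \<bar>m - a\<bar>) / coer)"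

lemma stability:
  assumes "\<And>X. 0 \<le> X \<Longrightarrow> integral {0..X} (\<lambda>x. S k x t0) \<le> A" and "sqn (r k 0 t0) \<le> A" and "0 \<le> X"
  shows "integral {0..X} (\<lambda>x. S k x t) \<le> stab * A"
proof -
  have "energy k X t \<le> (1 + m\<^sup>2 + \<bar>m - a\<bar>) * A" if "0 \<le> X" for X
    by (rule energy_preserved[OF _ that]) (rule energy_le[OF assms(1,2)])
  from S_bound[OF this assms(3)]
  have "integral {0..X} (\<lambda>x. S k x t) \<le> (1 + 1 / m\<^sup>2) * (2 * ((1 + m\<^sup>2 + \<bar>m - a\<bar>) * A) / coer)" .
  also have "\<dots> = stab * A" unfolding stab_def by (simp only: times_divide_eq_left times_divide_eq_right mult.assoc)
  finally show ?thesis .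
qed

text \<open>This is boundedness rather than smallness: at time 0 the energy of the k-th time
  derivative is finite by \<open>local_bound\<close> for k and k + 1, and conservation makes the
  bound uniform in time. The Morawetz argument relies on it.\<close>

lemma global_bound: "\<exists>B. \<forall>t. \<forall>X\<ge>0. integral {0..X} (\<lambda>x. S k x t) \<le> B"
proof -
  obtain B0 where B0: "\<And>X. 0 \<le> X \<Longrightarrow> integral {0..X} (\<lambda>x. sqn (r k x 0) + sqn (rx k x 0)) \<le> B0"
    using local_bound[of 0 k] by auto
  obtain B1 where B1: "\<And>X. 0 \<le> X \<Longrightarrow> integral {0..X} (\<lambda>x. sqn (r (Suc k) x 0) + sqn (rx (Suc k) x 0)) \<le> B1"
    using local_bound[of 0 "Suc k"] by auto
  have c: "jcont (\<lambda>x t. sqn (r k x t) + sqn (rx k x t))" for k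
    by (intro continuous_intros r_cont rx_cont)
  have ec: "jcont (r.energy_density k)"
    unfolding r.energy_density_def by (intro continuous_intros r_cont rx_cont) auto
  define K where "K = (1 + m\<^sup>2) * B0 + B1 + \<bar>m - a\<bar> * sqn (r k 0 0)"
  have "energy k X 0 \<le> K" if X: "0 \<le> X" for X
  proof -
    have "integral {0..X} (\<lambda>x. r.energy_density k x 0) \<le> (1 + m\<^sup>2) * integral {0..X} (\<lambda>x. sqn (r k x 0) + sqn (rx k x 0))
       + integral {0..X} (\<lambda>x. sqn (r (Suc k) x 0) + sqn (rx (Suc k) x 0))"
    proof (rule has_integral_le[OF integrable_integral[OF slice_integrable[OF ec order_refl]]
        has_integral_add[OF has_integral_mult_right[OF integrable_integral[OF slice_integrable[OF c order_refl]]] integrable_integral[OF slice_integrable[OF c order_refl]]]])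
      fix x
      have "0 \<le> sqn (r (Suc k) x 0)" "0 \<le> sqn (rx (Suc k) x 0)" "0 \<le> sqn (r k x 0)" "0 \<le> sqn (rx k x 0)"
        "0 \<le> m\<^sup>2 * sqn (r k x 0)" "0 \<le> m\<^sup>2 * sqn (rx k x 0)" by simp_all
      then show "r.energy_density k x 0 \<le> (1 + m\<^sup>2) * (sqn (r k x 0) + sqn (rx k x 0))
         + (sqn (r (Suc k) x 0) + sqn (rx (Suc k) x 0))"
        unfolding r.energy_density_def distrib_right distrib_left mult_1 by argo
    qed
    also have "\<dots> \<le> (1 + m\<^sup>2) * B0 + B1"
      using B0[OF X] B1[OF X] by (intro add_mono mult_left_mono) auto
    finally have "integral {0..X} (\<lambda>x. r.energy_density k x 0) \<le> (1 + m\<^sup>2) * B0 + B1" .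
    moreover have "(m - a) / 2 * sqn (r k 0 0) \<le> \<bar>m - a\<bar> * sqn (r k 0 0)"
      by (rule mult_right_mono) (use abs_ge_self[of "m - a"] abs_ge_zero[of "m - a"] in argo, simp)
    ultimately show ?thesis unfolding energy_def K_def by linarith
  qed
  then have "energy k X t \<le> K" if "0 \<le> X" for X t using energy_preserved that by blast
  then have "integral {0..X} (\<lambda>x. S k x t) \<le> (1 + 1 / m\<^sup>2) * (2 * K / coer)" if "0 \<le> X" for X t
    using S_bound that by blast
  then show ?thesis by blast
qed

section \<open>The auxiliary solution with Dirichlet data\<close>

definition v where "v k x t = rx k x t + \<iota> * r (Suc k) x t + of_real (a - m) * r k x t"
definition vx where "vx k x t = r (Suc (Suc k)) x t + of_real (m\<^sup>2) * r k x t + \<iota> * rx (Suc k) x t + of_real (a - m) * rx k x t"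

lemma four_sq: "sqn (p + q + u + w) \<le> 4 * (sqn p + sqn q + sqn u + sqn w)" for p q u w :: complex
proof -
  have "0 \<le> sqn (p - q) + sqn (p - u) + sqn (p - w) + sqn (q - u) + sqn (q - w) + sqn (u - w)" by simp
  then show ?thesis by (simp add: inner_add_left inner_add_right inner_diff_left inner_diff_right inner_commute)
qed

lemma v_cont: "jcont (v k)"
  unfolding v_def by (intro continuous_intros r_cont rx_cont)

lemma vx_cont: "jcont (vx k)"
  unfolding vx_def by (intro continuous_intros r_cont rx_cont)

text \<open>v is a combination of derivatives of r with constant coefficients, hence again a
  solution, and its value at 0 is the boundary condition of r. The bounds cost two more time
  derivatives of r, one reason for carrying all orders along.\<close>

sublocale v: kg_dirichlet m v vx
proof
  show "jcont (v k)" for k by (rule v_cont)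
  show "jcont (vx k)" for k by (rule vx_cont)
  fix k :: nat and x t :: real assume x: "0 \<le> x"
  show "((\<lambda>t. v k x t) has_vector_derivative v (Suc k) x t) (at t)"
    unfolding v_def by (intro has_vector_derivative_add has_vector_derivative_mult_right r_t r.vx_t x)
  show "((\<lambda>t. vx k x t) has_vector_derivative vx (Suc k) x t) (at t)"
    unfolding vx_def by (intro has_vector_derivative_add has_vector_derivative_mult_right r_t r.vx_t x)
  have "((\<lambda>x. v k x t) has_vector_derivative (r (Suc (Suc k)) x t + of_real (m\<^sup>2) * r k x t) + \<iota> * rx (Suc k) x t + of_real (a - m) * rx k x t) (at x within {0..})"
    unfolding v_def by (intro has_vector_derivative_add has_vector_derivative_mult_right r.v_x r.vx_x x)
  then show "((\<lambda>x. v k x t) has_vector_derivative vx k x t) (at x within {0..})"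
    by (simp add: vx_def)
  have "((\<lambda>x. vx k x t) has_vector_derivative rx (Suc (Suc k)) x t + of_real (m\<^sup>2) * rx k x t
     + \<iota> * (r (Suc (Suc (Suc k))) x t + of_real (m\<^sup>2) * r (Suc k) x t) + of_real (a - m) * (r (Suc (Suc k)) x t + of_real (m\<^sup>2) * r k x t)) (at x within {0..})"
    unfolding vx_def by (intro has_vector_derivative_add has_vector_derivative_mult_right r.v_x r.vx_x x)
  also have "rx (Suc (Suc k)) x t + of_real (m\<^sup>2) * rx k x t
     + \<iota> * (r (Suc (Suc (Suc k))) x t + of_real (m\<^sup>2) * r (Suc k) x t) + of_real (a - m) * (r (Suc (Suc k)) x t + of_real (m\<^sup>2) * r k x t)
     = v (Suc (Suc k)) x t + of_real (m\<^sup>2) * v k x t"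
    by (simp add: v_def algebra_simps)
  finally show "((\<lambda>x. vx k x t) has_vector_derivative v (Suc (Suc k)) x t + of_real (m\<^sup>2) * v k x t) (at x within {0..})" .
next
  fix k :: nat and t :: real
  show "v k 0 t = 0" by (simp add: v_def rx_def s_0 algebra_simps)
next
  fix k :: nat
  obtain B where B: "\<And>k t X. 0 \<le> X \<Longrightarrow> integral {0..X} (\<lambda>x. S k x t) \<le> B k"
    using global_bound by metis
  define c where "c = 4 * (1 + (m\<^sup>2)\<^sup>2 + (a - m)\<^sup>2)"
  have nc: "jcont (\<lambda>x t. sqn (v k x t) + sqn (vx k x t))"
    by (intro continuous_intros v_cont vx_cont)
  have "integral {0..X} (\<lambda>x. sqn (v k x t) + sqn (vx k x t)) \<le> 2 * c * (B k + B (Suc k) + B (Suc (Suc k)))" if X: "0 \<le> X" for X t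
  proof -
    have "integral {0..X} (\<lambda>x. sqn (v k x t) + sqn (vx k x t)) \<le>
      2 * c * (integral {0..X} (\<lambda>x. S k x t) + integral {0..X} (\<lambda>x. S (Suc k) x t) + integral {0..X} (\<lambda>x. S (Suc (Suc k)) x t))"
    proof (rule has_integral_le[OF integrable_integral[OF slice_integrable[OF nc order_refl]]
        has_integral_mult_right[OF has_integral_add[OF has_integral_add[OF integrable_integral[OF slice_integrable[OF S_cont order_refl]]
         integrable_integral[OF slice_integrable[OF S_cont order_refl]]] integrable_integral[OF slice_integrable[OF S_cont order_refl]]]]])
      fix x
      define P where "P k = sqn (r k x t) + sqn (rx k x t)" for k
      have PS: "0 \<le> P k" "P k \<le> S k x t" for k by (auto simp: P_def S_def)
      have sm: "y \<le> c / 4 * y" "(m\<^sup>2)\<^sup>2 * y \<le> c / 4 * y" "(a - m)\<^sup>2 * y \<le> c / 4 * y" if "0 \<le> y" for y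
      proof -
        have "1 * y \<le> c / 4 * y" by (rule mult_right_mono) (use that in \<open>auto simp: c_def\<close>)
        then show "y \<le> c / 4 * y" by simp
      qed (rule mult_right_mono; use that in \<open>auto simp: c_def\<close>)+
      have c0: "0 \<le> c / 4" by (simp add: c_def)
      have "sqn (v k x t) \<le> 4 * (sqn (rx k x t) + sqn (r (Suc k) x t) + (a - m)\<^sup>2 * sqn (r k x t))"
        using four_sq[of "rx k x t" "\<iota> * r (Suc k) x t" "of_real (a - m) * r k x t" 0]
        unfolding inner_of_real_mult inner_iota_iota v_def by (simp add: power2_eq_square)
      also have "\<dots> \<le> c * (P k + P (Suc k))"
      proof -
        have "(a - m)\<^sup>2 * sqn (r k x t) \<le> c / 4 * sqn (r k x t)" "sqn (rx k x t) \<le> c / 4 * sqn (rx k x t)"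
          "sqn (r (Suc k) x t) \<le> c / 4 * sqn (r (Suc k) x t)" by (rule sm; simp)+
        moreover have "0 \<le> c / 4 * sqn (rx (Suc k) x t)" using c0 by simp
        ultimately show ?thesis unfolding P_def by (simp add: distrib_left)
      qed
      finally have 1: "sqn (v k x t) \<le> c * (P k + P (Suc k))" .
      have "sqn (vx k x t) \<le> 4 * (sqn (r (Suc (Suc k)) x t) + (m\<^sup>2)\<^sup>2 * sqn (r k x t)
          + sqn (rx (Suc k) x t) + (a - m)\<^sup>2 * sqn (rx k x t))"
        using four_sq[of "r (Suc (Suc k)) x t" "of_real (m\<^sup>2) * r k x t" "\<iota> * rx (Suc k) x t" "of_real (a - m) * rx k x t"]
        unfolding inner_of_real_mult inner_iota_iota vx_def by (simp add: power2_eq_square mult.assoc)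
      also have "\<dots> \<le> c * (P k + P (Suc k) + P (Suc (Suc k)))"
      proof -
        have "(m\<^sup>2)\<^sup>2 * sqn (r k x t) \<le> c / 4 * sqn (r k x t)" "(a - m)\<^sup>2 * sqn (rx k x t) \<le> c / 4 * sqn (rx k x t)"
          "sqn (r (Suc (Suc k)) x t) \<le> c / 4 * sqn (r (Suc (Suc k)) x t)"
          "sqn (rx (Suc k) x t) \<le> c / 4 * sqn (rx (Suc k) x t)" by (rule sm; simp)+
        moreover have "0 \<le> c / 4 * sqn (r (Suc k) x t)" "0 \<le> c / 4 * sqn (rx (Suc (Suc k)) x t)" using c0 by simp_all
        ultimately show ?thesis unfolding P_def by (simp add: distrib_left)
      qed
      finally have 2: "sqn (vx k x t) \<le> c * (P k + P (Suc k) + P (Suc (Suc k)))" .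
      have "sqn (v k x t) + sqn (vx k x t) \<le> c * (P k + P (Suc k)) + c * (P k + P (Suc k) + P (Suc (Suc k)))"
        using 1 2 by (rule add_mono)
      also have "\<dots> = c * (P k + P (Suc k) + (P k + P (Suc k) + P (Suc (Suc k))))" by (simp add: distrib_left)
      also have "\<dots> \<le> c * (2 * (S k x t + S (Suc k) x t + S (Suc (Suc k)) x t))"
        using PS(1)[of k] PS(1)[of "Suc k"] PS(1)[of "Suc (Suc k)"] PS(2)[of k] PS(2)[of "Suc k"] PS(2)[of "Suc (Suc k)"] c0
        by (intro mult_left_mono) auto
      finally show "sqn (v k x t) + sqn (vx k x t) \<le> 2 * c * (S k x t + S (Suc k) x t + S (Suc (Suc k)) x t)" by (simp only: mult.assoc mult.left_commute[of c 2])
    qed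
    also have "\<dots> \<le> 2 * c * (B k + B (Suc k) + B (Suc (Suc k)))"
      using B[OF X] by (intro mult_left_mono add_mono) (auto simp: c_def)
    finally show ?thesis .
  qed
  then show "\<exists>B. \<forall>t. \<forall>X\<ge>0. integral {0..X} (\<lambda>x. sqn (v k x t) + sqn (vx k x t)) \<le> B" by blast
qed

lemma v_vanishing: "locally_vanishing (v k)"
  unfolding locally_vanishing_def using v.v_tendsto by blast

lemma vx_vanishing: "locally_vanishing_L1 (vx k)"
  unfolding locally_vanishing_L1_def
proof (intro allI impI)
  fix R e :: real assume R: "0 \<le> R" and e: "0 < e"
  define c where "c = e / (R + 1)"
  have c: "0 < c" "R * c \<le> e" using R e by (auto simp: c_def field_simps)
  have Ec: "jcont (\<lambda>x t. sqn (vx k x t) / (2 * c))"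
    by (intro continuous_intros vx_cont) (use c in auto)
  have nc: "jcont (\<lambda>x t. norm (vx k x t))"
    by (intro continuous_intros vx_cont)
  have "\<forall>\<^sub>F t in at_top. integral {0..R} (\<lambda>x. sqn (vx k x t)) < e * c"
    using v.vx_tendsto[OF R, of k] e c by (intro order_tendstoD) auto
  then show "\<forall>\<^sub>F t in at_top. integral {0..R} (\<lambda>x. norm (vx k x t)) \<le> e"
  proof eventually_elim
    case (elim t)
    have "integral {0..R} (\<lambda>x. norm (vx k x t)) \<le> integral {0..R} (\<lambda>x. c / 2 + sqn (vx k x t) / (2 * c))"
    proof (rule integral_le)
      fix x
      have "0 \<le> (norm (vx k x t) - c)\<^sup>2" by simp
      then show "norm (vx k x t) \<le> c / 2 + sqn (vx k x t) / (2 * c)"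
        using c by (simp add: power2_norm_eq_inner[symmetric] field_simps power2_eq_square)
    qed (auto intro!: integrable_add slice_integrable[OF Ec] slice_integrable[OF nc])
    also have "\<dots> = R * c / 2 + integral {0..R} (\<lambda>x. sqn (vx k x t)) / (2 * c)"
      using R by (subst integral_add) (auto intro!: slice_integrable[OF Ec])
    also have "\<dots> \<le> e / 2 + e / 2"
    proof (rule add_mono)
      show "R * c / 2 \<le> e / 2" using c by simp
      show "integral {0..R} (\<lambda>x. sqn (vx k x t)) / (2 * c) \<le> e / 2" using elim c by (simp add: field_simps)
    qed
    finally show "integral {0..R} (\<lambda>x. norm (vx k x t)) \<le> e" by simp
  qed
qed

end

lemma locally_vanishing_L1_lin:
  assumes f: "locally_vanishing_L1 f" and g: "locally_vanishing_L1 g"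
    and fc: "jcont f"
    and gc: "jcont g"
  shows "locally_vanishing_L1 (\<lambda>x t. c * f x t + g x t)"
  unfolding locally_vanishing_L1_def
proof (intro allI impI)
  fix R e :: real assume R: "0 \<le> R" and e: "0 < e"
  define d where "d = e / (norm c + 1)"
  have n: "0 < norm c + 1" by (simp add: add_nonneg_pos)
  have d: "0 < d" "(norm c + 1) * d = e" using e n by (auto simp: d_def)
  have c1: "jcont (\<lambda>x t. norm (f x t))"
    "jcont (\<lambda>x t. norm (g x t))"
    "jcont (\<lambda>x t. norm (c * f x t + g x t))"
    by (intro continuous_intros fc gc)+
  have "\<forall>\<^sub>F t in at_top. integral {0..R} (\<lambda>x. norm (f x t)) \<le> d" "\<forall>\<^sub>F t in at_top. integral {0..R} (\<lambda>x. norm (g x t)) \<le> d"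
    using f g R d unfolding locally_vanishing_L1_def by blast+
  then show "\<forall>\<^sub>F t in at_top. integral {0..R} (\<lambda>x. norm (c * f x t + g x t)) \<le> e"
  proof eventually_elim
    case (elim t)
    have "integral {0..R} (\<lambda>x. norm (c * f x t + g x t)) \<le> norm c * integral {0..R} (\<lambda>x. norm (f x t)) + integral {0..R} (\<lambda>x. norm (g x t))"
      by (rule has_integral_le[OF integrable_integral[OF slice_integrable[OF c1(3) order_refl]]
          has_integral_add[OF has_integral_mult_right[OF integrable_integral[OF slice_integrable[OF c1(1) order_refl]]]
           integrable_integral[OF slice_integrable[OF c1(2) order_refl]]]])
        (metis norm_mult norm_triangle_ineq)
    also have "\<dots> \<le> norm c * d + d" using elim by (intro add_mono mult_left_mono) auto
    also have "\<dots> = e" using d(2) by (simp add: distrib_right)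
    finally show ?case .
  qed
qed

section \<open>Elimination of the time derivative and the limiting profiles\<close>

context halfline
begin

text \<open>\<open>- K1\<close>, \<open>- K2\<close> are the roots of the characteristic polynomial left after eliminating \<open>r\<^sub>t\<close> by means of \<open>v\<close>; see \<open>factorised\<close>.\<close>
definition disc where "disc = m\<^sup>2 - a\<^sup>2 + 2 * m * a"
definition K1 :: complex where "K1 = (of_real (a - m) + csqrt (of_real disc)) / 2"
definition K2 :: complex where "K2 = (of_real (a - m) - csqrt (of_real disc)) / 2"

lemma K_sum: "K1 + K2 = of_real (a - m)"
  by (simp add: K1_def K2_def field_simps)

lemma K_prod: "K1 * K2 = of_real ((a\<^sup>2 - 2 * a * m) / 2)"
proof -
  have "K1 * K2 = ((of_real (a - m))\<^sup>2 - (csqrt (of_real disc))\<^sup>2) / 4"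
    by (simp add: K1_def K2_def power2_eq_square algebra_simps)
  also have "\<dots> = of_real (((a - m)\<^sup>2 - disc) / 4)" by (simp only: power2_csqrt) simp
  also have "((a - m)\<^sup>2 - disc) / 4 = (a\<^sup>2 - 2 * a * m) / 2" by (simp add: disc_def power2_eq_square field_simps)
  finally show ?thesis .
qed

lemma Re_csqrt_disc: "Re (csqrt (of_real disc)) = (if 0 \<le> disc then sqrt disc else 0)"
  by (auto simp: csqrt_of_real_nonneg csqrt_of_real_nonpos)

text \<open>For a > m the claim is disc - (a - m)^2 = 2 a (2 m - a) \<ge> 0; otherwise it suffices
  that the principal square root has nonnegative real part. For very negative a the discriminant is
  negative and \<open>K1\<close>, \<open>K2\<close> are not real.\<close>

lemma Re_K2: "Re K2 \<le> 0"
proof -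
  have "a - m \<le> (if 0 \<le> disc then sqrt disc else 0)"
  proof (cases "a \<le> m")
    case True
    have "0 \<le> (if 0 \<le> disc then sqrt disc else 0)" by simp
    then show ?thesis using True by linarith
  next
    case False
    have "0 \<le> a * (2 * m - a)" using False m a by simp
    then have "(a - m)\<^sup>2 \<le> disc" by (simp add: disc_def power2_eq_square algebra_simps)
    moreover from this have "0 \<le> disc" by (meson order_trans zero_le_power2)
    ultimately show ?thesis by (simp add: real_le_rsqrt)
  qed
  then show ?thesis unfolding K2_def using Re_csqrt_disc by simp
qed

lemma Re_K1: assumes "a \<le> 0" shows "Re K1 \<le> 0"
proof -
  have "(if 0 \<le> disc then sqrt disc else 0) \<le> m - a"
  proof -
    have "a * (2 * m - a) \<le> 0" using assms m a by (intro mult_nonpos_nonneg) auto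
    then have "disc \<le> (m - a)\<^sup>2" by (simp add: disc_def power2_eq_square algebra_simps)
    then have "sqrt disc \<le> m - a" using assms m by (intro real_le_lsqrt) auto
    then show ?thesis using assms m by simp
  qed
  then show ?thesis unfolding K1_def using Re_csqrt_disc by simp
qed

definition g where "g x t = rx 0 x t + K1 * r 0 x t"
definition gx where "gx x t = r 2 x t + of_real (m\<^sup>2) * r 0 x t + K1 * rx 0 x t"

lemma g_x: assumes x: "0 \<le> x" shows "((\<lambda>x. g x t) has_vector_derivative gx x t) (at x within {0..})"
  using has_vector_derivative_add[OF r.vx_x[OF x, of 0 t] has_vector_derivative_mult_right[OF r.v_x[OF x, of 0 t], of K1]]
  unfolding g_def gx_def by (simp add: numeral_2_eq_2)

lemma g_cont: "jcont g"
  unfolding g_def by (intro continuous_intros r_cont rx_cont)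

lemma gx_cont: "jcont gx"
  unfolding gx_def by (intro continuous_intros r_cont rx_cont)

text \<open>Apply \<partial>_x - \<iota> \<partial>_t + (a - m) to v: the mixed derivative and r_t
  cancel, and by r_tt = r_xx - m^2 r what remains is twice the factorised operator applied to r. On
  the right, \<open>vx\<close> is the term for which only L^1 decay is at hand.\<close>

lemma factorised: "gx x t + K2 * g x t = 1/2 * vx 0 x t + (- (\<iota> / 2) * v 1 x t + of_real ((a - m) / 2) * v 0 x t)"
proof -
  have "gx x t + K2 * g x t = r 2 x t + of_real (m\<^sup>2) * r 0 x t + (K1 + K2) * rx 0 x t + (K1 * K2) * r 0 x t"
    by (simp add: g_def gx_def algebra_simps)
  also have "\<dots> = r 2 x t + of_real (a - m) * rx 0 x t + of_real (m\<^sup>2 + (a\<^sup>2 - 2 * a * m) / 2) * r 0 x t"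
    unfolding K_sum K_prod by (simp add: algebra_simps)
  also have "\<dots> = 1/2 * vx 0 x t + (- (\<iota> / 2) * v 1 x t + of_real ((a - m) / 2) * v 0 x t)"
    unfolding v_def vx_def by (simp add: numeral_2_eq_2 iota_sq power2_eq_square field_simps)
  finally show ?thesis .
qed

lemma g_vanishing: "locally_vanishing g"
proof -
  obtain B where B: "\<And>t X. 0 \<le> X \<Longrightarrow> integral {0..X} (\<lambda>x. S 0 x t) \<le> B"
    using global_bound[of 0] by blast
  define c where "c = 4 * (1 + norm K1 ^ 2)"
  show ?thesis
proof (rule locally_vanishing_descend[OF g_x g_cont gx_cont Re_K2])
  have "locally_vanishing (\<lambda>x t. - (\<iota> / 2) * v 1 x t + of_real ((a - m) / 2) * v 0 x t)"
    by (intro locally_vanishing_add locally_vanishing_cmult v_vanishing)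
  then have "locally_vanishing_L1 (\<lambda>x t. - (\<iota> / 2) * v 1 x t + of_real ((a - m) / 2) * v 0 x t)"
    by (rule locally_vanishing_imp_L1) (intro continuous_intros v_cont)
  then show "locally_vanishing_L1 (\<lambda>x t. gx x t + K2 * g x t)"
    unfolding factorised
    by (rule locally_vanishing_L1_lin[OF vx_vanishing _ vx_cont]) (intro continuous_intros v_cont)
  have gc: "jcont (\<lambda>x t. sqn (g x t))"
    by (intro continuous_intros g_cont)
  fix t X :: real assume X: "0 \<le> X"
  have "integral {0..X} (\<lambda>x. sqn (g x t)) \<le> c * integral {0..X} (\<lambda>x. S 0 x t)"
  proof (rule has_integral_le[OF integrable_integral[OF slice_integrable[OF gc order_refl]]
        has_integral_mult_right[OF integrable_integral[OF slice_integrable[OF S_cont order_refl]]]])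
    fix x
    have "sqn (g x t) \<le> 4 * (sqn (rx 0 x t) + sqn (K1 * r 0 x t))"
      using four_sq[of "rx 0 x t" "K1 * r 0 x t" 0 0] by (simp add: g_def)
    also have "sqn (K1 * r 0 x t) = norm K1 ^ 2 * sqn (r 0 x t)"
      by (simp add: power2_norm_eq_inner[symmetric] norm_mult power_mult_distrib)
    also have "4 * (sqn (rx 0 x t) + norm K1 ^ 2 * sqn (r 0 x t)) \<le> c * S 0 x t"
    proof -
      have "sqn (rx 0 x t) \<le> 1 * S 0 x t" "norm K1 ^ 2 * sqn (r 0 x t) \<le> norm K1 ^ 2 * S 0 x t"
        by (auto simp: S_def intro!: mult_left_mono)
      then show ?thesis unfolding c_def by (simp add: distrib_right distrib_left)
    qed
    finally show "sqn (g x t) \<le> c * S 0 x t" .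
  qed
  also have "\<dots> \<le> c * B" using B[OF X] by (intro mult_left_mono) (auto simp: c_def add_nonneg_pos)
  finally show "integral {0..X} (\<lambda>x. sqn (g x t)) \<le> c * B" .
qed
qed

lemma vanishing_r:
  assumes "a \<le> 0"
  shows "locally_vanishing (r 0)" "locally_vanishing (rx 0)"
proof -
  obtain B where B: "\<And>t X. 0 \<le> X \<Longrightarrow> integral {0..X} (\<lambda>x. S 0 x t) \<le> B"
    using global_bound[of 0] by blast
  have gc: "jcont (\<lambda>x t. sqn (r 0 x t))"
    by (intro continuous_intros r_cont)
  show *: "locally_vanishing (r 0)"
  proof (rule locally_vanishing_descend[OF r.v_x r_cont rx_cont Re_K1[OF assms]])
    show "locally_vanishing_L1 (\<lambda>x t. rx 0 x t + K1 * r 0 x t)"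
      using locally_vanishing_imp_L1[OF g_vanishing g_cont] by (simp add: g_def[abs_def])
    fix t X :: real assume X: "0 \<le> X"
    have "integral {0..X} (\<lambda>x. sqn (r 0 x t)) \<le> integral {0..X} (\<lambda>x. S 0 x t)"
      by (rule integral_le) (auto simp: S_def intro!: slice_integrable[OF gc] slice_integrable[OF S_cont[unfolded S_def]])
    then show "integral {0..X} (\<lambda>x. sqn (r 0 x t)) \<le> B" using B[OF X] by (rule order_trans)
  qed
  show "locally_vanishing (rx 0)"
    using locally_vanishing_diff[OF g_vanishing locally_vanishing_cmult[OF *, of K1]] by (simp add: g_def)
qed

definition \<kappa> where "\<kappa> = (a - m + sqrt disc) / 2"
text \<open>The value dictated by \<iota> r_t = v - r_x - (a - m) r: for v = 0 and r = e^(- \<kappa>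
  x) the right side is \<omega> e^(- \<kappa> x). In \<open>omega_kappa\<close> both constants are
  matched with those of the theorem.\<close>

definition \<omega> where "\<omega> = \<kappa> + m - a"

text \<open>The signs of \<kappa> and \<omega> come from disc - (m - a)^2 = 2 a (2 m - a) > 0, and
  \<kappa> < m from (3 m - a)^2 - disc = 2 (2 m - a)^2 > 0.\<close>

lemma kappa_facts:
  assumes "0 < a"
  shows "K1 = of_real \<kappa>" "0 < \<kappa>" "\<kappa> < m" "0 < \<omega>" "\<kappa>\<^sup>2 + \<omega>\<^sup>2 = m\<^sup>2"
proof -
  have am: "0 < a * (2 * m - a)" using assms a by simp
  have "disc = m\<^sup>2 + a * (2 * m - a)" by (simp add: disc_def power2_eq_square algebra_simps)
  then have d: "0 < disc" using am m by (simp add: add_pos_pos)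
  then show "K1 = of_real \<kappa>" by (simp add: K1_def \<kappa>_def csqrt_of_real_nonneg)
  have sq: "(sqrt disc)\<^sup>2 = disc" using d by simp
  have "(m - a)\<^sup>2 < (sqrt disc)\<^sup>2" unfolding sq using am by (simp add: disc_def power2_eq_square algebra_simps)
  then have "m - a < sqrt disc" "a - m < sqrt disc"
    using power2_less_imp_less[of "m - a" "sqrt disc"] power2_less_imp_less[of "a - m" "sqrt disc"] d
    by (auto simp: power2_commute[of a m])
  then show "0 < \<kappa>" "0 < \<omega>" by (auto simp: \<kappa>_def \<omega>_def field_simps)
  have "0 < (2 * m - a)\<^sup>2" using a by simp
  then have "(sqrt disc)\<^sup>2 < (3 * m - a)\<^sup>2" unfolding sq by (simp add: disc_def power2_eq_square algebra_simps)
  then have "sqrt disc < 3 * m - a" by (rule power2_less_imp_less) (use a m in auto)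
  then show "\<kappa> < m" by (simp add: \<kappa>_def)
  have "\<kappa>\<^sup>2 + \<omega>\<^sup>2 = ((sqrt disc)\<^sup>2 + (a - m)\<^sup>2) / 2" by (simp add: \<kappa>_def \<omega>_def power2_eq_square field_simps)
  also have "\<dots> = m\<^sup>2" unfolding sq by (simp add: disc_def power2_eq_square algebra_simps)
  finally show "\<kappa>\<^sup>2 + \<omega>\<^sup>2 = m\<^sup>2" .
qed

lemma exp_deriv: "((\<lambda>x. C * complex_of_real (exp (- b * x))) has_vector_derivative C * of_real (- b * exp (- b * x))) (at x within T)"
proof -
  have "((\<lambda>x. complex_of_real (exp (- b * x))) has_vector_derivative of_real (- b * exp (- b * x))) (at x within T)"
    by (rule has_vector_derivative_of_real) (auto intro!: derivative_eq_intros simp: has_real_derivative_iff_has_vector_derivative[symmetric])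
  then show ?thesis by (rule has_vector_derivative_mult_right)
qed

text \<open>The difference is identically 0 at x = 0. The equation with K1 = \<kappa> > 0 can
  therefore be solved from there, although r(0, t) itself need not decay.\<close>

lemma attraction_r:
  assumes "0 < a"
  shows "locally_vanishing (\<lambda>x t. r 0 x t - r 0 0 t * of_real (exp (- \<kappa> * x)))"
    "locally_vanishing (\<lambda>x t. rx 0 x t - r 0 0 t * of_real (- \<kappa> * exp (- \<kappa> * x)))"
proof -
  note k = kappa_facts[OF assms]
  have eq: "(rx 0 x t - r 0 0 t * of_real (- \<kappa> * exp (- \<kappa> * x))) + of_real \<kappa> * (r 0 x t - r 0 0 t * of_real (exp (- \<kappa> * x))) = g x t" for x t
    by (simp add: g_def k(1) algebra_simps)
  show 1: "locally_vanishing (\<lambda>x t. r 0 x t - r 0 0 t * of_real (exp (- \<kappa> * x)))"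
  proof (rule locally_vanishing_ascend)
    show "((\<lambda>x. r 0 x t - r 0 0 t * of_real (exp (- \<kappa> * x))) has_vector_derivative rx 0 x t - r 0 0 t * of_real (- \<kappa> * exp (- \<kappa> * x))) (at x within {0..})"
      if "0 \<le> x" for x t
      by (intro has_vector_derivative_diff r.v_x that exp_deriv)
    show "continuous_on {0..} (\<lambda>x. rx 0 x t - r 0 0 t * of_real (- \<kappa> * exp (- \<kappa> * x)))" for t
      by (intro continuous_intros continuous_on_slice1[OF rx_cont])
    show "0 \<le> Re (of_real \<kappa>)" using k by simp
    show "locally_vanishing_L1 (\<lambda>x t. (rx 0 x t - r 0 0 t * of_real (- \<kappa> * exp (- \<kappa> * x))) + of_real \<kappa> * (r 0 x t - r 0 0 t * of_real (exp (- \<kappa> * x))))"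
      unfolding eq by (rule locally_vanishing_imp_L1[OF g_vanishing g_cont])
  qed simp
  show "locally_vanishing (\<lambda>x t. rx 0 x t - r 0 0 t * of_real (- \<kappa> * exp (- \<kappa> * x)))"
    using locally_vanishing_diff[OF g_vanishing locally_vanishing_cmult[OF 1, of "of_real \<kappa>"]]
    by (simp only: eq[symmetric] add_diff_cancel_right')
qed

lemma vanishing_0:
  assumes "locally_vanishing f"
  shows "((\<lambda>t. f 0 t) \<longlongrightarrow> 0) at_top"
proof (rule tendstoI)
  fix e :: real assume e: "0 < e"
  have "0 < e / 2" using e by simp
  then have "\<forall>\<^sub>F t in at_top. \<forall>x\<in>{0..0}. norm (f x t) \<le> e / 2"
    using assms unfolding locally_vanishing_def by blast
  then show "\<forall>\<^sub>F t in at_top. dist (f 0 t) 0 < e"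
  proof eventually_elim
    case (elim t)
    then have "norm (f 0 t) \<le> e / 2" by simp
    then show ?case using e by (simp add: dist_norm)
  qed
qed

lemma iota_r1: "\<iota> * r 1 x t = v 0 x t - rx 0 x t - of_real (a - m) * r 0 x t"
  by (simp add: v_def)

text \<open>s solves s_x + m s = \<iota> r_t, whose right side decays by \<open>iota_r1\<close>, and
  s(0) = r(0) decays as well; so the equation is solved from 0.\<close>

lemma vanishing_s:
  assumes "a \<le> 0"
  shows "locally_vanishing (s 0)" "locally_vanishing (sx 0)"
proof -
  have "locally_vanishing (\<lambda>x t. \<iota> * r 1 x t)"
    unfolding iota_r1 by (intro locally_vanishing_diff locally_vanishing_cmult v_vanishing vanishing_r[OF assms])
  then have w: "locally_vanishing (\<lambda>x t. sx 0 x t + of_real m * s 0 x t)" by (simp add: sx_def)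
  show *: "locally_vanishing (s 0)"
  proof (rule locally_vanishing_ascend[OF s_has_derivative continuous_on_slice1[OF sx_cont] _ locally_vanishing_imp_L1[OF w]])
    show "jcont (\<lambda>x t. sx 0 x t + of_real m * s 0 x t)"
      by (intro continuous_intros s_cont sx_cont)
    show "((\<lambda>t. s 0 0 t) \<longlongrightarrow> 0) at_top" unfolding s_0 by (rule vanishing_0[OF vanishing_r(1)[OF assms]])
  qed (use m in auto)
  show "locally_vanishing (sx 0)"
    using locally_vanishing_diff[OF w locally_vanishing_cmult[OF *, of "of_real m"]] by simp
qed

text \<open>The solution of s' + m s = \<omega> e^(- \<kappa> x) with s(0) = 1;
  \<open>sprof'\<close> is its derivative.\<close>

definition sprof where "sprof x = exp (- m * x) + \<omega> * (exp (- \<kappa> * x) - exp (- m * x)) / (m - \<kappa>)"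
definition sprof' where "sprof' x = - m * exp (- m * x) + \<omega> * (m * exp (- m * x) - \<kappa> * exp (- \<kappa> * x)) / (m - \<kappa>)"

lemma attraction_s:
  assumes "0 < a"
  shows "locally_vanishing (\<lambda>x t. s 0 x t - r 0 0 t * of_real (sprof x))"
    "locally_vanishing (\<lambda>x t. sx 0 x t - r 0 0 t * of_real (sprof' x))"
proof -
  note k = kappa_facts[OF assms]
  define c where "c = \<omega> / (m - \<kappa>)"
  have c: "c * (m - \<kappa>) = \<omega>" using k by (simp add: c_def)
  have sp: "sprof = (\<lambda>x. (1 - c) * exp (- m * x) + c * exp (- \<kappa> * x))"
    by (intro ext) (simp add: sprof_def c_def diff_divide_distrib algebra_simps)
  have sp': "sprof' = (\<lambda>x. (1 - c) * (- m * exp (- m * x)) + c * (- \<kappa> * exp (- \<kappa> * x)))"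
    by (intro ext) (simp add: sprof'_def c_def diff_divide_distrib algebra_simps)
  have d: "((\<lambda>x. complex_of_real (sprof x)) has_vector_derivative of_real (sprof' x)) (at x within T)" for x T
  proof -
    have e: "((\<lambda>x. exp (- b * x)) has_real_derivative - b * exp (- b * x)) (at x within T)" for b
      by (auto intro!: derivative_eq_intros)
    have "(sprof has_real_derivative sprof' x) (at x within T)"
      unfolding sp sp' by (intro DERIV_add DERIV_cmult e)
    then show ?thesis
      using has_vector_derivative_of_real by (simp add: has_real_derivative_iff_has_vector_derivative)
  qed
  have sum: "sprof' x + m * sprof x = \<omega> * exp (- \<kappa> * x)" for x
    unfolding c[symmetric] sp sp' by (simp add: algebra_simps)
  have "locally_vanishing (\<lambda>x t. v 0 x t - (rx 0 x t - r 0 0 t * of_real (- \<kappa> * exp (- \<kappa> * x)))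
      - of_real (a - m) * (r 0 x t - r 0 0 t * of_real (exp (- \<kappa> * x))))"
    by (intro locally_vanishing_diff locally_vanishing_cmult v_vanishing attraction_r[OF assms])
  also have "(\<lambda>x t. v 0 x t - (rx 0 x t - r 0 0 t * of_real (- \<kappa> * exp (- \<kappa> * x)))
      - of_real (a - m) * (r 0 x t - r 0 0 t * of_real (exp (- \<kappa> * x))))
    = (\<lambda>x t. \<iota> * r 1 x t - r 0 0 t * of_real (\<omega> * exp (- \<kappa> * x)))"
    unfolding iota_r1 \<omega>_def by (intro ext) (simp add: algebra_simps)
  also have "\<dots> = (\<lambda>x t. (sx 0 x t - r 0 0 t * of_real (sprof' x)) + of_real m * (s 0 x t - r 0 0 t * of_real (sprof x)))"
    unfolding sum[symmetric] sx_def by (intro ext) (simp add: algebra_simps)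
  finally have w: "locally_vanishing (\<lambda>x t. (sx 0 x t - r 0 0 t * of_real (sprof' x)) + of_real m * (s 0 x t - r 0 0 t * of_real (sprof x)))" .
  have spc: "continuous_on UNIV (\<lambda>x. complex_of_real (sprof x))" "continuous_on UNIV (\<lambda>x. complex_of_real (sprof' x))"
    unfolding sp sp' by (intro continuous_intros)+
  have spc2: "jcont (\<lambda>x t. complex_of_real (sprof x))" "jcont (\<lambda>x t. complex_of_real (sprof' x))"
    unfolding sp sp' by (intro continuous_intros)+
  have L1: "locally_vanishing_L1 (\<lambda>x t. (sx 0 x t - r 0 0 t * of_real (sprof' x)) + of_real m * (s 0 x t - r 0 0 t * of_real (sprof x)))"
    by (rule locally_vanishing_imp_L1[OF w]) (intro continuous_intros s_cont sx_cont r0_cont spc2)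
  show *: "locally_vanishing (\<lambda>x t. s 0 x t - r 0 0 t * of_real (sprof x))"
  proof (rule locally_vanishing_ascend[where f = "\<lambda>x t. s 0 x t - r 0 0 t * of_real (sprof x)"
        and fx = "\<lambda>x t. sx 0 x t - r 0 0 t * of_real (sprof' x)" and \<mu> = "of_real m", OF _ _ _ L1])
    show "((\<lambda>x. s 0 x t - r 0 0 t * of_real (sprof x)) has_vector_derivative sx 0 x t - r 0 0 t * of_real (sprof' x)) (at x within {0..})"
      if "0 \<le> x" for x t
      by (intro has_vector_derivative_diff s_has_derivative that has_vector_derivative_mult_right d)
    show "continuous_on {0..} (\<lambda>x. sx 0 x t - r 0 0 t * of_real (sprof' x))" for t
      by (intro continuous_intros continuous_on_slice1[OF sx_cont] continuous_on_subset[OF spc(2)]) auto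
    show "((\<lambda>t. s 0 0 t - r 0 0 t * of_real (sprof 0)) \<longlongrightarrow> 0) at_top" by (simp add: s_0 sprof_def)
  qed (use m in auto)
  show "locally_vanishing (\<lambda>x t. sx 0 x t - r 0 0 t * of_real (sprof' x))"
    using locally_vanishing_diff[OF w locally_vanishing_cmult[OF *, of "of_real m"]] by (simp only: add_diff_cancel_right')
qed

end

subsection \<open>Mollification of the distributional equation\<close>

lemma vec2_nth [simp]: "vec2 u w $ 1 = u" "vec2 u w $ 2 = w"
  by (simp_all add: vec2_def)

lemma alphaM_nth [simp]: "(alphaM *v z) $ 1 = z $ 2" "(alphaM *v z) $ 2 = - z $ 1"
  by (simp_all add: alphaM_def matrix_vector_mult_def sum_2)

lemma betaM_nth [simp]: "(betaM *v z) $ 1 = z $ 1" "(betaM *v z) $ 2 = - z $ 2"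
  by (simp_all add: betaM_def matrix_vector_mult_def sum_2)

lemma Fnl_nth [simp]: "Fnl a1 a2 z $ 1 = of_real a1 * z $ 1" "Fnl a1 a2 z $ 2 = of_real a2 * z $ 2"
  by (simp_all add: Fnl_def)

lemma integrable_continuous_compact_support:
  fixes f :: "'a::euclidean_space \<Rightarrow> 'b::{banach, second_countable_topology}"
  assumes "continuous_on UNIV f" "compact K" "\<And>x. x \<notin> K \<Longrightarrow> f x = 0"
  shows "integrable lborel f"
proof -
  have "integrable lborel (\<lambda>x. indicator K x *\<^sub>R f x)"
    by (rule borel_integrable_compact[OF assms(2) continuous_on_subset[OF assms(1)]]) auto
  also have "(\<lambda>x. indicator K x *\<^sub>R f x) = f" using assms(3) by (auto simp: indicator_def)
  finally show ?thesis .
qed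

lemma LINT_eq_integral:
  fixes f :: "real \<Rightarrow> 'b::euclidean_space"
  assumes "continuous_on UNIV f" "\<And>x. x \<notin> {c..d} \<Longrightarrow> f x = 0"
  shows "(LINT x|lborel. f x) = integral {c..d} f"
proof -
  have "integrable lborel f" by (rule integrable_continuous_compact_support[OF assms(1) compact_Icc assms(2)])
  then have "set_integrable lborel {c..d} f" unfolding set_integrable_def
    by (rule Bochner_Integration.integrable_cong[THEN iffD1, OF refl, rotated]) (use assms(2) in \<open>auto simp: indicator_def\<close>)
  then have "(LINT x:{c..d}|lborel. f x) = integral {c..d} f" by (rule set_borel_integral_eq_integral(2))
  moreover have "(LINT x:{c..d}|lborel. f x) = (LINT x|lborel. f x)"
    unfolding set_lebesgue_integral_def
    by (rule Bochner_Integration.integral_cong) (use assms(2) in \<open>auto simp: indicator_def\<close>)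
  ultimately show ?thesis by simp
qed

lemma LINT_eq_conv:
  fixes f :: "real \<Rightarrow> 'a::euclidean_space"
  assumes D: "smooth_kernel D" and f: "continuous_on UNIV f"
  shows "(LINT x|lborel. D k (x0 - x) *\<^sub>R f x) = conv (D k) f x0"
proof -
  have "(LINT x|lborel. D k (x0 - x) *\<^sub>R f x) = integral {x0-0-1..x0+0+1} (\<lambda>x. D k (x0 - x) *\<^sub>R f x)"
  proof (rule LINT_eq_integral)
    show "continuous_on UNIV (\<lambda>x. D k (x0 - x) *\<^sub>R f x)"
      by (intro continuous_intros continuous_on_compose2[OF kernel_cont[OF D, of UNIV]] f) auto
    fix x assume "x \<notin> {x0-0-1..x0+0+1}"
    then have "1 \<le> \<bar>x0 - x\<bar>" by auto
    then show "D k (x0 - x) *\<^sub>R f x = 0" using kernel_0[OF D] by simp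
  qed
  also have "\<dots> = conv (D k) f x0"
    by (rule conv_eq[symmetric, OF kernel_cont[OF D] kernel_0[OF D] f]) auto
  finally show ?thesis .
qed

lemma LINT_prod_eq_conv:
  fixes F :: "real \<Rightarrow> real \<Rightarrow> complex"
  assumes D: "smooth_kernel D" and E: "smooth_kernel E" and F: "continuous_on UNIV (\<lambda>p. F (fst p) (snd p))"
  shows "(LINT p|lborel. of_real (D i (x0 - fst p) * E j (t0 - snd p)) * F (fst p) (snd p)) = conv (D i) (\<lambda>x. conv (E j) (F x) t0) x0"
    and "integrable lborel (\<lambda>p. of_real (D i (x0 - fst p) * E j (t0 - snd p)) * F (fst p) (snd p))"
proof -
  define G where "G p = of_real (D i (x0 - fst p) * E j (t0 - snd p)) * F (fst p) (snd p)" for p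
  have F': "continuous_on (UNIV \<times> UNIV) (\<lambda>p. F (fst p) (snd p))" using F by simp
  show "integrable lborel (\<lambda>p. of_real (D i (x0 - fst p) * E j (t0 - snd p)) * F (fst p) (snd p))"
  proof (rule integrable_continuous_compact_support)
    show "continuous_on UNIV (\<lambda>p. of_real (D i (x0 - fst p) * E j (t0 - snd p)) * F (fst p) (snd p))"
      by (intro continuous_intros F continuous_on_compose2[OF kernel_cont[OF D, of UNIV]] continuous_on_compose2[OF kernel_cont[OF E, of UNIV]]) auto
    show "compact ({x0-1..x0+1} \<times> {t0-1..t0+1})" by (intro compact_Times compact_Icc)
    fix p assume "p \<notin> {x0-1..x0+1} \<times> {t0-1..t0+1}"
    then have "1 \<le> \<bar>x0 - fst p\<bar> \<or> 1 \<le> \<bar>t0 - snd p\<bar>" by (cases p) auto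
    then show "of_real (D i (x0 - fst p) * E j (t0 - snd p)) * F (fst p) (snd p) = 0"
      using kernel_0[OF D] kernel_0[OF E] by auto
  qed
  then have "integrable (lborel \<Otimes>\<^sub>M lborel) G" by (simp add: lborel_prod G_def[abs_def])
  then have "integrable (lborel \<Otimes>\<^sub>M lborel) (\<lambda>(x, t). G (x, t))" by simp
  from lborel_pair.integral_fst'[OF this]
  have "(LINT p|lborel. G p) = (LINT x|lborel. LINT t|lborel. G (x, t))" by (simp add: lborel_prod)
  also have "\<dots> = (LINT x|lborel. D i (x0 - x) *\<^sub>R conv (E j) (F x) t0)"
  proof (rule Bochner_Integration.integral_cong[OF refl])
    fix x
    have "(LINT t|lborel. G (x, t)) = (LINT t|lborel. D i (x0 - x) *\<^sub>R (E j (t0 - t) *\<^sub>R F x t))"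
      by (simp add: G_def scaleR_conv_of_real mult_ac)
    also have "\<dots> = D i (x0 - x) *\<^sub>R conv (E j) (F x) t0"
      by (simp only: integral_scaleR_right LINT_eq_conv[OF E continuous_on_slice2[OF F' UNIV_I]])
    finally show "(LINT t|lborel. G (x, t)) = D i (x0 - x) *\<^sub>R conv (E j) (F x) t0" .
  qed
  also have "\<dots> = conv (D i) (\<lambda>x. conv (E j) (F x) t0) x0"
    by (rule LINT_eq_conv[OF D]) (rule continuous_on_slice1[OF conv_continuous[OF kernel_cont[OF E] F']])
  finally show "(LINT p|lborel. of_real (D i (x0 - fst p) * E j (t0 - snd p)) * F (fst p) (snd p)) = conv (D i) (\<lambda>x. conv (E j) (F x) t0) x0"
    by (simp add: G_def)
qed

lemma conv_add_cmult:
  fixes f g :: "real \<Rightarrow> complex"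
  assumes "continuous_on UNIV \<theta>" "continuous_on UNIV f" "continuous_on UNIV g"
  shows "conv \<theta> (\<lambda>x. c * f x + d * g x) t = c * conv \<theta> f t + d * conv \<theta> g t"
proof -
  have "((\<lambda>u. c * (\<theta> u *\<^sub>R f (t - u)) + d * (\<theta> u *\<^sub>R g (t - u))) has_integral c * conv \<theta> f t + d * conv \<theta> g t) {-1..1}"
    unfolding conv_def
    by (intro has_integral_add has_integral_mult_right integrable_integral conv_integrable assms)
  then show ?thesis unfolding conv_def[of _ "\<lambda>x. c * f x + d * g x"]
    by (intro integral_unique) (simp add: algebra_simps)
qed

lemma testfun2_kernel_prod:
  assumes D: "smooth_kernel D" and E: "smooth_kernel E"
  shows "testfun2 (\<lambda>p. D 0 (x0 - fst p) * E 0 (t0 - snd p))"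
  unfolding testfun2_def smooth2_def
proof (intro conjI exI[of _ "\<lambda>i j p. (-1) ^ (i + j) * D i (x0 - fst p) * E j (t0 - snd p)"] allI)
  fix i j x t
  show "continuous_on UNIV (\<lambda>p. (-1) ^ (i + j) * D i (x0 - fst p) * E j (t0 - snd p))"
    by (intro continuous_intros continuous_on_compose2[OF kernel_cont[OF D, of UNIV]] continuous_on_compose2[OF kernel_cont[OF E, of UNIV]]) auto
  have d: "((\<lambda>y. x0 - y) has_real_derivative -1) (at x)" for x0 x :: real by (auto intro!: derivative_eq_intros)
  show "((\<lambda>y. (-1) ^ (i + j) * D i (x0 - fst (y, t)) * E j (t0 - snd (y, t))) has_real_derivative
      (-1) ^ (Suc i + j) * D (Suc i) (x0 - fst (x, t)) * E j (t0 - snd (x, t))) (at x)"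
    unfolding fst_conv snd_conv
    by (rule DERIV_cong[OF DERIV_cmult_right[OF DERIV_cmult[OF DERIV_chain2[OF kernel_D[OF D] d]]]]) simp
  show "((\<lambda>s. (-1) ^ (i + j) * D i (x0 - fst (x, s)) * E j (t0 - snd (x, s))) has_real_derivative
      (-1) ^ (i + Suc j) * D i (x0 - fst (x, t)) * E (Suc j) (t0 - snd (x, t))) (at t)"
    unfolding fst_conv snd_conv
    by (rule DERIV_cong[OF DERIV_cmult[OF DERIV_chain2[OF kernel_D[OF E] d]]]) simp
next
  have sub: "closure {p. D 0 (x0 - fst p) * E 0 (t0 - snd p) \<noteq> 0} \<subseteq> {x0-1..x0+1} \<times> {t0-1..t0+1}"
  proof (rule closure_minimal)
    show "{p. D 0 (x0 - fst p) * E 0 (t0 - snd p) \<noteq> 0} \<subseteq> {x0-1..x0+1} \<times> {t0-1..t0+1}"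
    proof
      fix p assume "p \<in> {p. D 0 (x0 - fst p) * E 0 (t0 - snd p) \<noteq> 0}"
      then have "\<not> 1 \<le> \<bar>x0 - fst p\<bar>" "\<not> 1 \<le> \<bar>t0 - snd p\<bar>" using kernel_0[OF D, of "x0 - fst p" 0] kernel_0[OF E, of "t0 - snd p" 0] by auto
      then show "p \<in> {x0-1..x0+1} \<times> {t0-1..t0+1}" by (cases p) (auto simp: abs_le_iff)
    qed
    show "closed ({x0-1..x0+1} \<times> {t0-1..t0+1})" by (intro closed_Times closed_atLeastAtMost)
  qed
  have "compact ({x0-1..x0+1} \<times> {t0-1..t0+1})" by (intro compact_Times compact_Icc)
  then show "compact (closure {p. D 0 (x0 - fst p) * E 0 (t0 - snd p) \<noteq> 0})"
    using sub by (meson bounded_subset closed_closure compact_eq_bounded_closed)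
qed simp

lemma green_cont: "0 < m \<Longrightarrow> continuous_on S (green m)"
  unfolding green_def by (intro continuous_intros) auto

section \<open>From the weak equation to classical x-derivatives\<close>

locale solution =
  fixes m a1 a2 :: real and \<psi> :: "real \<Rightarrow> real \<Rightarrow> complex^2"
  assumes m: "0 < m" and sol: "is_solution m a1 a2 \<psi>"
begin

lemma psi_cont: "continuous_on UNIV (\<lambda>p. \<psi> (fst p) (snd p))"
  using sol by (simp add: is_solution_def)

lemma psi_nth_cont: "continuous_on (UNIV \<times> UNIV) (\<lambda>p. \<psi> (fst p) (snd p) $ j)"
  using continuous_on_component[OF psi_cont] by simp

text \<open>The equation is \<i> \<psi>_t = D_m Y with Y = \<psi> - G F(\<psi>(0)), where G is the
  Green function. After mollification in time Y is differentiable across x = 0, whereas \<psi> may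
  have a kink there.\<close>

definition Y1 where "Y1 x t = \<psi> x t $ 1 - of_real (green m x * a1) * \<psi> 0 t $ 1"
definition Y2 where "Y2 x t = \<psi> x t $ 2 - of_real (green m x * a2) * \<psi> 0 t $ 2"

lemma psi0_cont: "continuous_on UNIV (\<lambda>p::real \<times> real. \<psi> 0 (snd p) $ j)"
  using continuous_on_compose2[OF continuous_on_slice2[OF psi_nth_cont, of 0 UNIV j] continuous_on_snd[OF continuous_on_id], of UNIV] by simp

lemma Y_cont: "continuous_on UNIV (\<lambda>p. Y1 (fst p) (snd p))" "continuous_on UNIV (\<lambda>p. Y2 (fst p) (snd p))"
  unfolding Y1_def Y2_def
  by (auto intro!: continuous_intros psi_cont psi0_cont continuous_on_compose2[OF green_cont[OF m, of UNIV]])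

text \<open>Testing with D(x0 - x) E(t0 - t) turns the distributional equation into an identity of
  convolutions. Reflecting the kernels cancels the sign of integration by parts.\<close>

lemma weak_equation:
  assumes D: "smooth_kernel D" and E: "smooth_kernel E"
  shows "\<i> * conv (D 0) (\<lambda>x. conv (E 1) (\<lambda>t. \<psi> x t $ 1) t0) x0
      = conv (D 1) (\<lambda>x. conv (E 0) (Y2 x) t0) x0 + of_real m * conv (D 0) (\<lambda>x. conv (E 0) (Y1 x) t0) x0" (is ?first)
    and "\<i> * conv (D 0) (\<lambda>x. conv (E 1) (\<lambda>t. \<psi> x t $ 2) t0) x0
      = - conv (D 1) (\<lambda>x. conv (E 0) (Y1 x) t0) x0 - of_real m * conv (D 0) (\<lambda>x. conv (E 0) (Y2 x) t0) x0" (is ?second)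
proof -
  define \<phi> where "\<phi> p = D 0 (x0 - fst p) * E 0 (t0 - snd p)" for p :: "real \<times> real"
  have d: "((\<lambda>y. x0 - y) has_real_derivative -1) (at x)" for x0 x :: real by (auto intro!: derivative_eq_intros)
  have "((\<lambda>y. \<phi> (y, t)) has_real_derivative - (D 1 (x0 - x) * E 0 (t0 - t))) (at x)" for x t
    unfolding \<phi>_def using DERIV_cmult_right[OF DERIV_chain2[OF kernel_D[OF D] d]] by simp
  then have px: "deriv (\<lambda>y. \<phi> (y, snd p)) (fst p) = - (D 1 (x0 - fst p) * E 0 (t0 - snd p))" for p
    by (rule DERIV_imp_deriv)
  have "((\<lambda>s. \<phi> (x, s)) has_real_derivative - (D 0 (x0 - x) * E 1 (t0 - t))) (at t)" for x t
    unfolding \<phi>_def using DERIV_cmult[OF DERIV_chain2[OF kernel_D[OF E] d]] by simp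
  then have pt: "deriv (\<lambda>s. \<phi> (fst p, s)) (snd p) = - (D 0 (x0 - fst p) * E 1 (t0 - snd p))" for p
    by (rule DERIV_imp_deriv)
  have tf: "testfun2 \<phi>" unfolding \<phi>_def by (rule testfun2_kernel_prod[OF D E])
  define L where "L p = ((- \<i>) * of_real (- (D 0 (x0 - fst p) * E 1 (t0 - snd p)))) *s \<psi> (fst p) (snd p)" for p
  define Rr where "Rr p = (- of_real (- (D 1 (x0 - fst p) * E 0 (t0 - snd p)))) *s (alphaM *v \<psi> (fst p) (snd p))
             + (of_real (m * \<phi> p)) *s (betaM *v \<psi> (fst p) (snd p))
             - of_real (green m (fst p)) *s
                 ((- of_real (- (D 1 (x0 - fst p) * E 0 (t0 - snd p)))) *s (alphaM *v Fnl a1 a2 (\<psi> 0 (snd p)))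
                  + (of_real (m * \<phi> p)) *s (betaM *v Fnl a1 a2 (\<psi> 0 (snd p))))" for p
  have eq: "(LINT p|lborel. L p) = (LINT p|lborel. Rr p)"
    using sol tf unfolding is_solution_def Let_def L_def Rr_def px[symmetric] pt[symmetric] by blast
  have psi1: "continuous_on UNIV (\<lambda>p. \<psi> (fst p) (snd p) $ 1)" and psi2: "continuous_on UNIV (\<lambda>p. \<psi> (fst p) (snd p) $ 2)"
    using psi_nth_cont by simp_all
  note I = LINT_prod_eq_conv[OF D E]
  have L1: "L p $ 1 = \<i> * (of_real (D 0 (x0 - fst p) * E 1 (t0 - snd p)) * \<psi> (fst p) (snd p) $ 1)"
    and L2: "L p $ 2 = \<i> * (of_real (D 0 (x0 - fst p) * E 1 (t0 - snd p)) * \<psi> (fst p) (snd p) $ 2)" for p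
    by (simp_all add: L_def)
  have R1: "Rr p $ 1 = of_real (D 1 (x0 - fst p) * E 0 (t0 - snd p)) * Y2 (fst p) (snd p)
      + of_real m * (of_real (D 0 (x0 - fst p) * E 0 (t0 - snd p)) * Y1 (fst p) (snd p))" for p
    by (simp add: Rr_def \<phi>_def Y1_def Y2_def algebra_simps)
  have R2: "Rr p $ 2 = - (of_real (D 1 (x0 - fst p) * E 0 (t0 - snd p)) * Y1 (fst p) (snd p))
      - of_real m * (of_real (D 0 (x0 - fst p) * E 0 (t0 - snd p)) * Y2 (fst p) (snd p))" for p
    by (simp add: Rr_def \<phi>_def Y1_def Y2_def algebra_simps)
  have vec_int: "integrable lborel F" if "integrable lborel (\<lambda>p. F p $ 1)" "integrable lborel (\<lambda>p. F p $ 2)" for F :: "real \<times> real \<Rightarrow> complex^2"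
  proof -
    have lin: "bounded_linear (axis j :: complex \<Rightarrow> complex^2)" for j
      unfolding linear_conv_bounded_linear[symmetric] by (rule linearI) (auto simp: axis_def vec_eq_iff)
    have "integrable lborel (\<lambda>p. axis 1 (F p $ 1) + axis 2 (F p $ 2) :: complex^2)"
      by (intro Bochner_Integration.integrable_add integrable_bounded_linear[OF _ that(1)] integrable_bounded_linear[OF _ that(2)])
        (rule lin)+
    also have "(\<lambda>p. axis 1 (F p $ 1) + axis 2 (F p $ 2)) = F"
      by (auto simp: vec_eq_iff axis_def forall_2)
    finally show ?thesis .
  qed
  have Li: "integrable lborel L" by (rule vec_int) (simp_all only: L1 L2, (intro integrable_mult_right I(2) psi1 psi2)+)
  have Ri: "integrable lborel Rr"
    by (rule vec_int) (simp_all only: R1 R2, (intro Bochner_Integration.integrable_add Bochner_Integration.integrable_diff integrable_mult_right I(2) Y_cont Bochner_Integration.integrable_minus)+)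
  have nth: "(LINT p|lborel. F p) $ j = (LINT p|lborel. F p $ j)" if "integrable lborel F" for F :: "real \<times> real \<Rightarrow> complex^2" and j
    by (rule integral_bounded_linear[symmetric, OF bounded_linear_vec_nth that])
  have e1: "(LINT p|lborel. L p $ j) = (LINT p|lborel. Rr p $ j)" for j
    using arg_cong[OF eq, of "\<lambda>z. z $ j"] nth[OF Li] nth[OF Ri] by simp
  show ?first
    using e1[of 1] unfolding L1 R1
    by (simp only: integral_mult_right_zero Bochner_Integration.integral_add[OF I(2)[OF Y_cont(2)] integrable_mult_right[OF I(2)[OF Y_cont(1)]]] I(1)[OF psi1] I(1)[OF Y_cont(1)] I(1)[OF Y_cont(2)])
  show ?second
    using e1[of 2] unfolding L2 R2
    by (simp only: integral_mult_right_zero Bochner_Integration.integral_minus Bochner_Integration.integral_diff[OF Bochner_Integration.integrable_minus[OF I(2)[OF Y_cont(1)]] integrable_mult_right[OF I(2)[OF Y_cont(2)]]] I(1)[OF psi2] I(1)[OF Y_cont(1)] I(1)[OF Y_cont(2)])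
qed

lemma conv_Y:
  assumes E: "smooth_kernel E"
  shows "conv (E k) (Y1 x) t = conv (E k) (\<lambda>t. \<psi> x t $ 1) t - of_real (green m x * a1) * conv (E k) (\<lambda>t. \<psi> 0 t $ 1) t"
    "conv (E k) (Y2 x) t = conv (E k) (\<lambda>t. \<psi> x t $ 2) t - of_real (green m x * a2) * conv (E k) (\<lambda>t. \<psi> 0 t $ 2) t"
  using conv_add_cmult[OF kernel_cont[OF E] continuous_on_slice2[OF psi_nth_cont UNIV_I] continuous_on_slice2[OF psi_nth_cont UNIV_I], of k 1 x _ "- of_real (green m x * a1)" 0]
    conv_add_cmult[OF kernel_cont[OF E] continuous_on_slice2[OF psi_nth_cont UNIV_I] continuous_on_slice2[OF psi_nth_cont UNIV_I], of k 1 x _ "- of_real (green m x * a2)" 0]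
  unfolding Y1_def[abs_def] Y2_def[abs_def] by simp_all

text \<open>The smoothing in x was only a device for testing: D is arbitrary, so
  \<open>conv_du_Bois_Reymond\<close> removes it and leaves classical derivatives. Shifting the
  index of E yields all time derivatives at once.\<close>

lemma mollified_equation:
  assumes E: "smooth_kernel E"
  shows "((\<lambda>x. conv (E k) (Y1 x) t) has_vector_derivative - \<i> * conv (E (Suc k)) (\<lambda>t. \<psi> x t $ 2) t - of_real m * conv (E k) (Y2 x) t) (at x)"
    "((\<lambda>x. conv (E k) (Y2 x) t) has_vector_derivative \<i> * conv (E (Suc k)) (\<lambda>t. \<psi> x t $ 1) t - of_real m * conv (E k) (Y1 x) t) (at x)"
proof -
  have E': "smooth_kernel (\<lambda>j. E (k + j))" by (rule kernel_shift[OF E])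
  have cY: "continuous_on UNIV (\<lambda>x. conv (E j) (Y1 x) t)" "continuous_on UNIV (\<lambda>x. conv (E j) (Y2 x) t)" for j
    using continuous_on_slice1[OF conv_continuous[where f = Y1, OF kernel_cont[OF E], of UNIV]]
      continuous_on_slice1[OF conv_continuous[where f = Y2, OF kernel_cont[OF E], of UNIV]] Y_cont by simp_all
  have cp: "continuous_on UNIV (\<lambda>x. conv (E j) (\<lambda>t. \<psi> x t $ i) t)" for i j
    using continuous_on_slice1[OF conv_continuous[OF kernel_cont[OF E] psi_nth_cont]] .
  show "((\<lambda>x. conv (E k) (Y1 x) t) has_vector_derivative - \<i> * conv (E (Suc k)) (\<lambda>t. \<psi> x t $ 2) t - of_real m * conv (E k) (Y2 x) t) (at x)"
  proof (rule conv_du_Bois_Reymond)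
    fix D x assume D: "smooth_kernel D"
    show "conv (D 1) (\<lambda>x. conv (E k) (Y1 x) t) x = conv (D 0) (\<lambda>x. - \<i> * conv (E (Suc k)) (\<lambda>t. \<psi> x t $ 2) t - of_real m * conv (E k) (Y2 x) t) x"
    proof -
      have fe: "(\<lambda>x. - \<i> * conv (E (Suc k)) (\<lambda>t. \<psi> x t $ 2) t - of_real m * conv (E k) (Y2 x) t)
        = (\<lambda>x. - \<i> * conv (E (Suc k)) (\<lambda>t. \<psi> x t $ 2) t + (- of_real m) * conv (E k) (Y2 x) t)" by simp
      have w: "\<i> * conv (D 0) (\<lambda>x. conv (E (Suc k)) (\<lambda>t. \<psi> x t $ 2) t) x = - conv (D 1) (\<lambda>x. conv (E k) (Y1 x) t) x - of_real m * conv (D 0) (\<lambda>x. conv (E k) (Y2 x) t) x"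
        using weak_equation(2)[OF D E', of t x] by simp
      show ?thesis
        unfolding fe conv_add_cmult[OF kernel_cont[OF D, of _ 0] cp cY(2)] using w by algebra
    qed
  qed (intro continuous_intros cY cp)+
  show "((\<lambda>x. conv (E k) (Y2 x) t) has_vector_derivative \<i> * conv (E (Suc k)) (\<lambda>t. \<psi> x t $ 1) t - of_real m * conv (E k) (Y1 x) t) (at x)"
  proof (rule conv_du_Bois_Reymond)
    fix D x assume D: "smooth_kernel D"
    show "conv (D 1) (\<lambda>x. conv (E k) (Y2 x) t) x = conv (D 0) (\<lambda>x. \<i> * conv (E (Suc k)) (\<lambda>t. \<psi> x t $ 1) t - of_real m * conv (E k) (Y1 x) t) x"
    proof -
      have fe: "(\<lambda>x. \<i> * conv (E (Suc k)) (\<lambda>t. \<psi> x t $ 1) t - of_real m * conv (E k) (Y1 x) t)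
        = (\<lambda>x. \<i> * conv (E (Suc k)) (\<lambda>t. \<psi> x t $ 1) t + (- of_real m) * conv (E k) (Y1 x) t)" by simp
      have w: "\<i> * conv (D 0) (\<lambda>x. conv (E (Suc k)) (\<lambda>t. \<psi> x t $ 1) t) x = conv (D 1) (\<lambda>x. conv (E k) (Y2 x) t) x + of_real m * conv (D 0) (\<lambda>x. conv (E k) (Y1 x) t) x"
        using weak_equation(1)[OF D E', of t x] by simp
      show ?thesis
        unfolding fe conv_add_cmult[OF kernel_cont[OF D, of _ 0] cp cY(1)] using w by algebra
    qed
  qed (intro continuous_intros cY cp)+
qed

end

subsection \<open>Reduction to the half-line by parity\<close>

definition profU where "profU m a x = exp (- kappa m a 1 * x) + (m * exp (- kappa m a 1 * x) - kappa m a 1 * exp (- m * x)) / omega m a 1"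
definition profV where "profV m a x = kappa m a 1 * (exp (- kappa m a 1 * x) - exp (- m * x)) / omega m a 1"
definition profU' where "profU' m a x = - kappa m a 1 * exp (- kappa m a 1 * x) + m * kappa m a 1 * (exp (- m * x) - exp (- kappa m a 1 * x)) / omega m a 1"
definition profV' where "profV' m a x = kappa m a 1 * (m * exp (- m * x) - kappa m a 1 * exp (- kappa m a 1 * x)) / omega m a 1"

text \<open>The sign of omega absorbs the signs in \<open>u2\<close>. Hence \<open>u1\<close> is
  (U(|x|), sgn x V(|x|)) and \<open>u2\<close> is (sgn x V(|x|), U(|x|)) with the same functions
  \<open>profU\<close> and \<open>profV\<close> of the respective parameter.\<close>

lemma omega_2: "omega m a 2 = - omega m a 1" and kappa_2: "kappa m a 2 = kappa m a 1"
  by (simp_all add: omega_def kappa_def)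

context halfline
begin

lemma omega_kappa: assumes "0 < a" shows "omega m a 1 = \<omega>" "kappa m a 1 = \<kappa>"
proof -
  show w: "omega m a 1 = \<omega>" by (simp add: omega_def \<omega>_def \<kappa>_def disc_def field_simps)
  have "m\<^sup>2 - \<omega>\<^sup>2 = \<kappa>\<^sup>2" using kappa_facts(5)[OF assms] by simp
  then show "kappa m a 1 = \<kappa>" unfolding kappa_def w using kappa_facts(2)[OF assms] by simp
qed

text \<open>(r + s) / 2 is an even part and (s - r) / 2 an odd part. The factor l matches the values
  at 0: r and s have profile value 1 there, and U(0) = (\<omega> + m - \<kappa>) / \<omega> = (2 m -
  a) / \<omega>. The remaining algebra rests on \<omega>^2 = (m - \<kappa>) (m + \<kappa>).\<close>

lemma profile_identities:
  assumes "0 < a"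
  defines "l \<equiv> \<omega> / (2 * m - a)"
  shows "(exp (- \<kappa> * x) + sprof x) / 2 = l * profU m a x" "(sprof x - exp (- \<kappa> * x)) / 2 = l * profV m a x"
    "(- \<kappa> * exp (- \<kappa> * x) + sprof' x) / 2 = l * profU' m a x" "(sprof' x - - \<kappa> * exp (- \<kappa> * x)) / 2 = l * profV' m a x"
proof -
  note k = kappa_facts[OF assms(1)] and ok = omega_kappa[OF assms(1)]
  define e where "e = exp (- \<kappa> * x)"
  define E where "E = exp (- m * x)"
  define q where "q = m - \<kappa>"
  have q: "0 < q" "m = q + \<kappa>" using k by (auto simp: q_def)
  have ww: "\<omega> * \<omega> = q * (q + 2 * \<kappa>)" using k(5) by (simp add: q_def power2_eq_square algebra_simps)
  have aa: "2 * m - a = \<omega> + q" by (simp add: \<omega>_def q_def)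
  have wq: "0 < \<omega> + q" using k q by simp
  have S: "sprof x = E + \<omega> * (e - E) / q" and S': "sprof' x = - m * E + \<omega> * (m * E - \<kappa> * e) / q"
    by (simp_all add: sprof_def sprof'_def e_def E_def q_def)
  have U: "profU m a x = e + (m * e - \<kappa> * E) / \<omega>" "profV m a x = \<kappa> * (e - E) / \<omega>"
    "profU' m a x = - \<kappa> * e + m * \<kappa> * (E - e) / \<omega>" "profV' m a x = \<kappa> * (m * E - \<kappa> * e) / \<omega>"
    unfolding profU_def profV_def profU'_def profV'_def ok e_def E_def by simp_all
  have cross: "A / 2 = \<omega> / (\<omega> + q) * B" if "q * A * (\<omega> + q) = 2 * (\<omega> * B) * q" for A B
  proof -
    have "q * (A * (\<omega> + q)) = q * (2 * (\<omega> * B))" using that by (simp only: mult_ac)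
    then have "A * (\<omega> + q) = 2 * (\<omega> * B)" using q(1) by simp
    then show ?thesis using wq by (simp add: field_simps)
  qed
  have nz: "\<omega> \<noteq> 0" "q \<noteq> 0" using k q by auto
  have Sq: "q * sprof x = q * E + \<omega> * (e - E)" "q * sprof' x = - q * m * E + \<omega> * (m * E - \<kappa> * e)"
    using nz unfolding S S' by (simp_all add: field_simps)
  have Uw: "\<omega> * profU m a x = \<omega> * e + (m * e - \<kappa> * E)" "\<omega> * profV m a x = \<kappa> * (e - E)"
    "\<omega> * profU' m a x = - \<omega> * \<kappa> * e + m * \<kappa> * (E - e)" "\<omega> * profV' m a x = \<kappa> * (m * E - \<kappa> * e)"
    using nz unfolding U by (simp_all add: field_simps)
  show "(exp (- \<kappa> * x) + sprof x) / 2 = l * profU m a x"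
    unfolding l_def aa e_def[symmetric] by (rule cross) (use Sq(1) Uw(1) ww q(2) in algebra)
  show "(sprof x - exp (- \<kappa> * x)) / 2 = l * profV m a x"
    unfolding l_def aa e_def[symmetric] by (rule cross) (use Sq(1) Uw(2) ww q(2) in algebra)
  show "(- \<kappa> * exp (- \<kappa> * x) + sprof' x) / 2 = l * profU' m a x"
    unfolding l_def aa e_def[symmetric] by (rule cross) (use Sq(2) Uw(3) ww q(2) in algebra)
  show "(sprof' x - - \<kappa> * exp (- \<kappa> * x)) / 2 = l * profV' m a x"
    unfolding l_def aa e_def[symmetric] by (rule cross) (use Sq(2) Uw(4) ww q(2) in algebra)
qed

lemma attraction:
  obtains C :: "real \<Rightarrow> complex" where
    "locally_vanishing (\<lambda>x t. (r 0 x t + s 0 x t) / 2 - (if 0 < a then C t * of_real (profU m a x) else 0))"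
    "locally_vanishing (\<lambda>x t. (s 0 x t - r 0 x t) / 2 - (if 0 < a then C t * of_real (profV m a x) else 0))"
    "locally_vanishing (\<lambda>x t. (rx 0 x t + sx 0 x t) / 2 - (if 0 < a then C t * of_real (profU' m a x) else 0))"
    "locally_vanishing (\<lambda>x t. (sx 0 x t - rx 0 x t) / 2 - (if 0 < a then C t * of_real (profV' m a x) else 0))"
proof -
  have half: "locally_vanishing (\<lambda>x t. (F x t + G x t) / 2 - H x t)"
    if "locally_vanishing (\<lambda>x t. F x t - F' x t)" "locally_vanishing (\<lambda>x t. G x t - G' x t)" "\<And>x t. (F' x t + G' x t) / 2 = H x t"
    for F G H F' G' :: "real \<Rightarrow> real \<Rightarrow> complex"
  proof -
    have eq: "(1/2) * ((F x t - F' x t) + (G x t - G' x t)) = (F x t + G x t) / 2 - H x t" for x t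
      unfolding that(3)[symmetric] by (simp add: field_simps)
    show ?thesis using locally_vanishing_cmult[OF locally_vanishing_add[OF that(1,2)], of "1/2"] by (simp only: eq)
  qed
  have half': "locally_vanishing (\<lambda>x t. (F x t - G x t) / 2 - H x t)"
    if "locally_vanishing (\<lambda>x t. F x t - F' x t)" "locally_vanishing (\<lambda>x t. G x t - G' x t)" "\<And>x t. (F' x t - G' x t) / 2 = H x t"
    for F G H F' G' :: "real \<Rightarrow> real \<Rightarrow> complex"
  proof -
    have eq: "(1/2) * ((F x t - F' x t) - (G x t - G' x t)) = (F x t - G x t) / 2 - H x t" for x t
      unfolding that(3)[symmetric] by (simp add: field_simps)
    show ?thesis using locally_vanishing_cmult[OF locally_vanishing_diff[OF that(1,2)], of "1/2"] by (simp only: eq)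
  qed
  show ?thesis
  proof (cases "0 < a")
    case True
    note A = attraction_r[OF True] attraction_s[OF True] and id = profile_identities[OF True]
    define C where "C t = r 0 0 t * of_real (\<omega> / (2 * m - a))" for t
    have conv: "(r 0 0 t * of_real u + r 0 0 t * of_real w) / 2 = C t * of_real y" "(r 0 0 t * of_real w - r 0 0 t * of_real u) / 2 = C t * of_real y'"
      if "(u + w) / 2 = \<omega> / (2 * m - a) * y" "(w - u) / 2 = \<omega> / (2 * m - a) * y'" for t u w y y'
    proof -
      have "(r 0 0 t * of_real u + r 0 0 t * of_real w) / 2 = r 0 0 t * of_real ((u + w) / 2)" by (simp add: algebra_simps)
      then show "(r 0 0 t * of_real u + r 0 0 t * of_real w) / 2 = C t * of_real y" unfolding that(1) C_def by (simp only: of_real_mult mult.assoc)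
      have "(r 0 0 t * of_real w - r 0 0 t * of_real u) / 2 = r 0 0 t * of_real ((w - u) / 2)" by (simp add: algebra_simps)
      then show "(r 0 0 t * of_real w - r 0 0 t * of_real u) / 2 = C t * of_real y'" unfolding that(2) C_def by (simp only: of_real_mult mult.assoc)
    qed
    show ?thesis
    proof (rule that[of C]; simp only: True if_True)
      show "locally_vanishing (\<lambda>x t. (r 0 x t + s 0 x t) / 2 - C t * of_real (profU m a x))"
        by (rule half[OF A(1) A(3)]) (rule conv(1)[OF id(1,2)])
      show "locally_vanishing (\<lambda>x t. (s 0 x t - r 0 x t) / 2 - C t * of_real (profV m a x))"
        by (rule half'[OF A(3) A(1)]) (rule conv(2)[OF id(1,2)])
      show "locally_vanishing (\<lambda>x t. (rx 0 x t + sx 0 x t) / 2 - C t * of_real (profU' m a x))"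
        by (rule half[OF A(2) A(4)]) (rule conv(1)[OF id(3,4)])
      show "locally_vanishing (\<lambda>x t. (sx 0 x t - rx 0 x t) / 2 - C t * of_real (profV' m a x))"
        by (rule half'[OF A(4) A(2)]) (rule conv(2)[OF id(3,4)])
    qed
  next
    case False
    then have "a \<le> 0" by simp
    note V = vanishing_r[OF this] vanishing_s[OF this]
    have V0: "locally_vanishing (\<lambda>x t. F x t - 0)" if "locally_vanishing F" for F using that by simp
    show ?thesis
    proof (rule that[of "\<lambda>t. 0"]; simp only: False if_False)
      show "locally_vanishing (\<lambda>x t. (r 0 x t + s 0 x t) / 2 - 0)" by (rule half[OF V0[OF V(1)] V0[OF V(3)]]) simp
      show "locally_vanishing (\<lambda>x t. (s 0 x t - r 0 x t) / 2 - 0)" by (rule half'[OF V0[OF V(3)] V0[OF V(1)]]) simp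
      show "locally_vanishing (\<lambda>x t. (rx 0 x t + sx 0 x t) / 2 - 0)" by (rule half[OF V0[OF V(2)] V0[OF V(4)]]) simp
      show "locally_vanishing (\<lambda>x t. (sx 0 x t - rx 0 x t) / 2 - 0)" by (rule half'[OF V0[OF V(4)] V0[OF V(2)]]) simp
    qed
  qed
qed

end

section \<open>The Dirac system on the line, its symmetries and its half-line parts\<close>

definition hr :: "(nat \<Rightarrow> real \<Rightarrow> real \<Rightarrow> complex) \<Rightarrow> (nat \<Rightarrow> real \<Rightarrow> real \<Rightarrow> complex) \<Rightarrow> nat \<Rightarrow> real \<Rightarrow> real \<Rightarrow> complex" where
  "hr f h k x t = (f k x t + f k (- x) t) / 2 - (h k x t - h k (- x) t) / 2"
definition hs :: "(nat \<Rightarrow> real \<Rightarrow> real \<Rightarrow> complex) \<Rightarrow> (nat \<Rightarrow> real \<Rightarrow> real \<Rightarrow> complex) \<Rightarrow> nat \<Rightarrow> real \<Rightarrow> real \<Rightarrow> complex" where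
  "hs f h k x t = (f k x t + f k (- x) t) / 2 + (h k x t - h k (- x) t) / 2"

text \<open>The derivatives in \<open>f_x\<close> and \<open>h_x\<close> are those of f - G a f(0)
  and h - G c h(0), which exist at x = 0 too; f and h themselves may have kinks there.\<close>

locale dirac =
  fixes m a c :: real and \<iota> :: complex and f h :: "nat \<Rightarrow> real \<Rightarrow> real \<Rightarrow> complex"
  assumes m: "0 < m" and a: "a < 2 * m" and c: "c < 2 * m" and iota: "\<iota> = \<i> \<or> \<iota> = - \<i>"
    and f_cont: "\<And>k. continuous_on UNIV (\<lambda>p. f k (fst p) (snd p))"
    and h_cont: "\<And>k. continuous_on UNIV (\<lambda>p. h k (fst p) (snd p))"
    and f_t: "\<And>k x t. ((\<lambda>t. f k x t) has_vector_derivative f (Suc k) x t) (at t)"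
    and h_t: "\<And>k x t. ((\<lambda>t. h k x t) has_vector_derivative h (Suc k) x t) (at t)"
    and f_x: "\<And>k x t. ((\<lambda>x. f k x t - of_real (green m x * a) * f k 0 t) has_vector_derivative
        - \<iota> * h (Suc k) x t - of_real m * (h k x t - of_real (green m x * c) * h k 0 t)) (at x)"
    and h_x: "\<And>k x t. ((\<lambda>x. h k x t - of_real (green m x * c) * h k 0 t) has_vector_derivative
        \<iota> * f (Suc k) x t - of_real m * (f k x t - of_real (green m x * a) * f k 0 t)) (at x)"
    and L2: "\<And>k T. \<exists>B. \<forall>t\<in>{-T..T}. \<forall>X\<ge>0. integral {-X..X} (\<lambda>x. sqn (f k x t) + sqn (h k x t)) \<le> B"

text \<open>Exchanging the components only reverses \<iota>, so the half-line system for the second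
  coupling constant is an instance of the first.\<close>

lemma dirac_swap:
  assumes "dirac m a c \<iota> f h" shows "dirac m c a (- \<iota>) h f"
proof -
  interpret dirac m a c \<iota> f h by fact
  show ?thesis
  proof
    show "0 < m" "c < 2 * m" "a < 2 * m" by (rule m c a)+
    show "- \<iota> = \<i> \<or> - \<iota> = - \<i>" using iota by (elim disjE) simp_all
    show "\<exists>B. \<forall>t\<in>{-T..T}. \<forall>X\<ge>0. integral {-X..X} (\<lambda>x. sqn (h k x t) + sqn (f k x t)) \<le> B" for k T
      using L2[of T k] by (simp add: add.commute)
    show "((\<lambda>x. h k x t - of_real (green m x * c) * h k 0 t) has_vector_derivative
        - (- \<iota>) * f (Suc k) x t - of_real m * (f k x t - of_real (green m x * a) * f k 0 t)) (at x)" for k x t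
      using h_x[of k t x] by simp
  qed (rule f_cont h_cont f_t h_t f_x)+
qed

text \<open>Time reversal also reverses \<iota>, and each time derivative contributes a factor -1.
  This reduces t \<rightarrow> -\<infinity> to t \<rightarrow> \<infinity>.\<close>

lemma dirac_reverse:
  assumes "dirac m a c \<iota> f h"
  shows "dirac m a c (- \<iota>) (\<lambda>k x t. (-1) ^ k * f k x (- t)) (\<lambda>k x t. (-1) ^ k * h k x (- t))"
proof -
  interpret dirac m a c \<iota> f h by fact
  have rev: "((\<lambda>t. (-1) ^ k * f k x (- t)) has_vector_derivative (-1) ^ Suc k * f (Suc k) x (- t)) (at t)"
    if "\<And>t. ((\<lambda>t. f k x t) has_vector_derivative f (Suc k) x t) (at t)" for f :: "nat \<Rightarrow> real \<Rightarrow> real \<Rightarrow> complex" and k x t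
  proof -
    have "((\<lambda>t. - t) has_real_derivative -1) (at t)" by (auto intro!: derivative_eq_intros)
    then have "((\<lambda>t. f k x (- t)) has_vector_derivative (-1) *\<^sub>R f (Suc k) x (- t)) (at t)"
      using vector_diff_chain_at[of "\<lambda>t. - t" "-1" t "f k x"] that
      by (simp add: o_def has_real_derivative_iff_has_vector_derivative)
    from has_vector_derivative_mult_right[OF this, of "(-1) ^ k"] show ?thesis by simp
  qed
  have cont: "continuous_on UNIV (\<lambda>p. (-1) ^ k * f k (fst p) (- snd p))"
    if "continuous_on UNIV (\<lambda>p. f k (fst p) (snd p))" for f :: "nat \<Rightarrow> real \<Rightarrow> real \<Rightarrow> complex" and k
  proof -
    have "continuous_on UNIV (\<lambda>p::real \<times> real. (fst p, - snd p))" by (intro continuous_intros)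
    from continuous_on_compose2[OF that this] have "continuous_on UNIV (\<lambda>p. f k (fst p) (- snd p))" by force
    then show ?thesis by (intro continuous_intros)
  qed
  show ?thesis
  proof
    show "0 < m" "c < 2 * m" "a < 2 * m" by (rule m c a)+
    show "- \<iota> = \<i> \<or> - \<iota> = - \<i>" using iota by (elim disjE) simp_all
    show "continuous_on UNIV (\<lambda>p. (-1) ^ k * f k (fst p) (- snd p))" for k by (rule cont[of f, OF f_cont])
    show "continuous_on UNIV (\<lambda>p. (-1) ^ k * h k (fst p) (- snd p))" for k by (rule cont[of h, OF h_cont])
    fix k x t
    show "((\<lambda>t. (-1) ^ k * f k x (- t)) has_vector_derivative (-1) ^ Suc k * f (Suc k) x (- t)) (at t)"
      by (rule rev[of f, OF f_t])
    show "((\<lambda>t. (-1) ^ k * h k x (- t)) has_vector_derivative (-1) ^ Suc k * h (Suc k) x (- t)) (at t)"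
      by (rule rev[of h, OF h_t])
    show "((\<lambda>x. (-1) ^ k * f k x (- t) - of_real (green m x * a) * ((-1) ^ k * f k 0 (- t))) has_vector_derivative
        - (- \<iota>) * ((-1) ^ Suc k * h (Suc k) x (- t)) - of_real m * ((-1) ^ k * h k x (- t) - of_real (green m x * c) * ((-1) ^ k * h k 0 (- t)))) (at x)"
      using has_vector_derivative_mult_right[OF f_x[of k "- t" x], of "(-1) ^ k"] by (simp add: algebra_simps)
    show "((\<lambda>x. (-1) ^ k * h k x (- t) - of_real (green m x * c) * ((-1) ^ k * h k 0 (- t))) has_vector_derivative
        - \<iota> * ((-1) ^ Suc k * f (Suc k) x (- t)) - of_real m * ((-1) ^ k * f k x (- t) - of_real (green m x * a) * ((-1) ^ k * f k 0 (- t)))) (at x)"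
      using has_vector_derivative_mult_right[OF h_x[of k "- t" x], of "(-1) ^ k"] by (simp add: algebra_simps)
  next
    fix k T
    have inn: "sqn ((-1) ^ k * z) = sqn z" for z :: complex
      by (cases "even k") auto
    obtain B where B: "\<And>t X. t \<in> {-T..T} \<Longrightarrow> 0 \<le> X \<Longrightarrow> integral {-X..X} (\<lambda>x. sqn (f k x t) + sqn (h k x t)) \<le> B"
      using L2[of T k] by blast
    then show "\<exists>B. \<forall>t\<in>{-T..T}. \<forall>X\<ge>0. integral {-X..X} (\<lambda>x. sqn ((-1) ^ k * f k x (- t)) +
          sqn ((-1) ^ k * h k x (- t))) \<le> B"
      unfolding inn by (intro exI[of _ B]) auto
  qed
qed

lemma fold_integral:
  fixes F G :: "real \<Rightarrow> real"
  assumes F: "continuous_on {0..X} F" and G: "continuous_on {0..X} (\<lambda>x. G (- x))" and X: "0 \<le> X"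
    and N: "\<And>x. 0 < x \<Longrightarrow> N x = F x" "\<And>x. x < 0 \<Longrightarrow> N x = G x"
  shows "(N has_integral integral {0..X} (\<lambda>x. F x + G (- x))) {-X..X}"
proof -
  have n: "negligible {0::real}" by simp
  have "(F has_integral integral {0..X} F) {0..X}" by (intro integrable_integral integrable_continuous_real F)
  then have 1: "(N has_integral integral {0..X} F) {0..X}"
    by (rule has_integral_spike[OF n, rotated]) (use N(1) in auto)
  have "((\<lambda>x. G (- x)) has_integral integral {0..X} (\<lambda>x. G (- x))) {0..X}" by (intro integrable_integral integrable_continuous_real G)
  then have "((\<lambda>x. G (- (- x))) has_integral integral {0..X} (\<lambda>x. G (- x))) {- X..- 0}" by (rule has_integral_reflect_lemma_real)
  then have "(G has_integral integral {0..X} (\<lambda>x. G (- x))) {-X..0}" by simp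
  then have 2: "(N has_integral integral {0..X} (\<lambda>x. G (- x))) {-X..0}"
    by (rule has_integral_spike[OF n, rotated]) (use N(2) in auto)
  have "(N has_integral integral {0..X} (\<lambda>x. G (- x)) + integral {0..X} F) {-X..X}"
    by (rule has_integral_combine[OF _ _ 2 1]) (use X in auto)
  also have "integral {0..X} (\<lambda>x. G (- x)) + integral {0..X} F = integral {0..X} (\<lambda>x. F x + G (- x))"
    by (subst integral_add) (auto intro!: integrable_continuous_real F G)
  finally show ?thesis .
qed

lemma parallelogram: "sqn ((u + w) / 2 - (y - z) / 2) + sqn ((u + w) / 2 + (y - z) / 2)
   = sqn (u + w) / 2 + sqn (y - z) / 2" for u w y z :: complex
  by (simp add: inner_complex_def field_simps)

lemma dirac_halfline:
  assumes "dirac m a c \<iota> f h" shows "halfline m a \<iota> (hr f h) (hs f h)"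
proof -
  interpret dirac m a c \<iota> f h by fact
  have refl_cont: "jcont (\<lambda>x t. F (- x) t)" "jcont F"
    if F: "continuous_on UNIV (\<lambda>p. F (fst p) (snd p))" for F :: "real \<Rightarrow> real \<Rightarrow> complex"
  proof -
    have "continuous_on ({0..} \<times> UNIV) (\<lambda>p::real \<times> real. (- fst p, snd p))" by (intro continuous_intros)
    from continuous_on_compose2[OF F this] show "jcont (\<lambda>x t. F (- x) t)" by force
    show "jcont F" by (rule continuous_on_subset[OF F]) auto
  qed
  have t_deriv: "((\<lambda>t. hr f h k x t) has_vector_derivative hr f h (Suc k) x t) (at t)" "((\<lambda>t. hs f h k x t) has_vector_derivative hs f h (Suc k) x t) (at t)" for k x t
    unfolding hr_def hs_def by (intro has_vector_derivative_add has_vector_derivative_diff has_vector_derivative_divide f_t h_t)+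
  define Y where "Y k x t = f k x t - of_real (green m x * a) * f k 0 t" for k x t
  define Z where "Z k x t = h k x t - of_real (green m x * c) * h k 0 t" for k x t
  have gm: "green m (- x) = green m x" for x by (simp add: green_def)
  have neg: "((\<lambda>x. F (- x)) has_vector_derivative - D) (at x)" if "(F has_vector_derivative D) (at (- x))" for F :: "real \<Rightarrow> complex" and D x
  proof -
    have "((\<lambda>x. - x) has_real_derivative -1) (at x)" by (auto intro!: derivative_eq_intros)
    then show ?thesis
      using vector_diff_chain_at[of "\<lambda>x. - x" "-1" x F D] that by (simp add: o_def has_real_derivative_iff_has_vector_derivative)
  qed
  have E: "((\<lambda>x. complex_of_real (exp (- m * x) / (2 * m) * a)) has_vector_derivative - of_real (exp (- m * x) / 2 * a)) (at x within {0..})" for x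
  proof -
    have "((\<lambda>x. exp (- m * x) / (2 * m) * a) has_real_derivative - (exp (- m * x) / 2 * a)) (at x within {0..})"
      using m by (auto intro!: derivative_eq_intros)
    then show ?thesis
      unfolding of_real_minus[symmetric] by (rule has_vector_derivative_of_real)
  qed
  have x_deriv: "((\<lambda>x. hr f h k x t) has_vector_derivative - \<iota> * hs f h (Suc k) x t + of_real m * hr f h k x t - of_real (a * exp (- m * x)) * hr f h k 0 t) (at x within {0..})"
    "((\<lambda>x. hs f h k x t) has_vector_derivative \<iota> * hr f h (Suc k) x t - of_real m * hs f h k x t) (at x within {0..})"
    if x: "0 \<le> x" for k x t
  proof -
    define dY where "dY x = - \<iota> * h (Suc k) x t - of_real m * Z k x t" for x
    define dZ where "dZ x = \<iota> * f (Suc k) x t - of_real m * Y k x t" for x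
    have Yx: "((\<lambda>x. Y k x t) has_vector_derivative dY x) (at x)" for x
      unfolding Y_def dY_def Z_def by (rule f_x)
    have Zx: "((\<lambda>x. Z k x t) has_vector_derivative dZ x) (at x)" for x
      unfolding Y_def dZ_def Z_def by (rule h_x)
    define e where "e = (\<lambda>x. complex_of_real (exp (- m * x) / (2 * m) * a))"
    have p: "((\<lambda>x. (Y k x t + Y k (- x) t) / 2 + e x * f k 0 t) has_vector_derivative (dY x + - dY (- x)) / 2 + - of_real (exp (- m * x) / 2 * a) * f k 0 t) (at x within {0..})"
      unfolding e_def
      by (intro has_vector_derivative_add has_vector_derivative_divide has_vector_derivative_mult_left E
          has_vector_derivative_at_within[OF Yx] has_vector_derivative_at_within[OF neg[OF Yx]])
    have q: "((\<lambda>x. (Z k x t - Z k (- x) t) / 2) has_vector_derivative (dZ x - - dZ (- x)) / 2) (at x within {0..})"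
      by (intro has_vector_derivative_diff has_vector_derivative_divide
          has_vector_derivative_at_within[OF Zx] has_vector_derivative_at_within[OF neg[OF Zx]])
    \<comment> \<open>The Green function is even. It drops out of the odd part of h, which is why c
      disappears, and in the even part of f it is the smooth function \<open>e\<close> on x \<ge> 0,
      so that one-sided derivatives exist at 0.\<close>
    have pq: "(Y k y t + Y k (- y) t) / 2 + e y * f k 0 t = (f k y t + f k (- y) t) / 2" "(Z k y t - Z k (- y) t) / 2 = (h k y t - h k (- y) t) / 2"
      if "y \<in> {0..}" for y
      using that by (auto simp: Y_def Z_def gm e_def green_def field_simps)
    have me: "of_real m * of_real (green m x * a) = (of_real (exp (- m * x) / 2 * a) :: complex)"
      using m x by (simp add: green_def)
    have 1: "((\<lambda>x. hr f h k x t) has_vector_derivative ((dY x + - dY (- x)) / 2 + - of_real (exp (- m * x) / 2 * a) * f k 0 t) - (dZ x - - dZ (- x)) / 2) (at x within {0..})"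
    proof (rule has_vector_derivative_transform[OF _ _ has_vector_derivative_diff[OF p q]])
      fix y :: real assume "y \<in> {0..}"
      then show "hr f h k y t = (Y k y t + Y k (- y) t) / 2 + e y * f k 0 t - (Z k y t - Z k (- y) t) / 2"
        unfolding hr_def by (simp only: pq)
    qed (use x in simp)
    have 2: "((\<lambda>x. hs f h k x t) has_vector_derivative ((dY x + - dY (- x)) / 2 + - of_real (exp (- m * x) / 2 * a) * f k 0 t) + (dZ x - - dZ (- x)) / 2) (at x within {0..})"
    proof (rule has_vector_derivative_transform[OF _ _ has_vector_derivative_add[OF p q]])
      fix y :: real assume "y \<in> {0..}"
      then show "hs f h k y t = (Y k y t + Y k (- y) t) / 2 + e y * f k 0 t + (Z k y t - Z k (- y) t) / 2"
        unfolding hs_def by (simp only: pq)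
    qed (use x in simp)
    define G where "G = (of_real (exp (- m * x) / 2 * a) :: complex)"
    have G2: "of_real (a * exp (- m * x)) = 2 * G" by (simp add: G_def)
    have dd: "(dY x + - dY (- x)) / 2 = - \<iota> * ((h (Suc k) x t - h (Suc k) (- x) t) / 2) - of_real m * ((h k x t - h k (- x) t) / 2)"
      by (simp add: dY_def Z_def gm field_simps)
    have mY: "of_real m * Y k y t = of_real m * f k y t - G * f k 0 t" if "y = x \<or> y = - x" for y
      using that me by (auto simp: Y_def gm G_def right_diff_distrib mult.assoc[symmetric])
    have dz: "(dZ x - - dZ (- x)) / 2 = \<iota> * ((f (Suc k) x t + f (Suc k) (- x) t) / 2) - of_real m * ((f k x t + f k (- x) t) / 2) + G * f k 0 t"
      unfolding dZ_def mY[OF disjI1[OF refl]] mY[OF disjI2[OF refl]] by (simp add: field_simps)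
    have hr0: "hr f h k 0 t = f k 0 t" by (simp add: hr_def)
    have gen: "(- i * A - M * B + - G * z) - (i * P - M * Q + G * z) = - i * (P + A) + M * (Q - B) - 2 * G * z"
      "(- i * A - M * B + - G * z) + (i * P - M * Q + G * z) = i * (P - A) - M * (Q + B)" for i A M B G z P Q :: complex
      by (simp_all add: algebra_simps)
    show "((\<lambda>x. hr f h k x t) has_vector_derivative - \<iota> * hs f h (Suc k) x t + of_real m * hr f h k x t - of_real (a * exp (- m * x)) * hr f h k 0 t) (at x within {0..})"
    proof -
      have "((dY x + - dY (- x)) / 2 + - G * f k 0 t) - (dZ x - - dZ (- x)) / 2 = - \<iota> * hs f h (Suc k) x t + of_real m * hr f h k x t - 2 * G * hr f h k 0 t"
        unfolding dd dz hr0 unfolding hs_def hr_def by (rule gen(1))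
      then show ?thesis using 1 unfolding G2 G_def[symmetric] by simp
    qed
    show "((\<lambda>x. hs f h k x t) has_vector_derivative \<iota> * hr f h (Suc k) x t - of_real m * hs f h k x t) (at x within {0..})"
    proof -
      have "((dY x + - dY (- x)) / 2 + - G * f k 0 t) + (dZ x - - dZ (- x)) / 2 = \<iota> * hr f h (Suc k) x t - of_real m * hs f h k x t"
        unfolding dd dz hr0 unfolding hs_def hr_def by (rule gen(2))
      then show ?thesis using 2 unfolding G_def[symmetric] by simp
    qed
  qed
  show ?thesis
  proof
    show "0 < m" "a < 2 * m" by (rule m a)+
    show "\<iota> = \<i> \<or> \<iota> = - \<i>" by (rule iota)
    show "jcont (hr f h k)" for k
      unfolding hr_def by (intro continuous_intros refl_cont[of "f k", OF f_cont] refl_cont[of "h k", OF h_cont]) auto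
    show "jcont (hs f h k)" for k
      unfolding hs_def by (intro continuous_intros refl_cont[of "f k", OF f_cont] refl_cont[of "h k", OF h_cont]) auto
    show "hs f h k 0 t = hr f h k 0 t" for k t by (simp add: hs_def hr_def)
  next
    fix k T
    obtain B where B: "\<And>t X. t \<in> {-T..T} \<Longrightarrow> 0 \<le> X \<Longrightarrow> integral {-X..X} (\<lambda>x. sqn (f k x t) + sqn (h k x t)) \<le> B"
      using L2[of T k] by blast
    have "integral {0..X} (\<lambda>x. sqn (hr f h k x t) + sqn (hs f h k x t)) \<le> B" if t: "t \<in> {-T..T}" and X: "0 \<le> X" for t X
    proof -
      define F where "F x = sqn (f k x t) + sqn (h k x t)" for x
      have f1: "continuous_on UNIV (\<lambda>x. f k x t)" "continuous_on UNIV (\<lambda>x. h k x t)"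
        using continuous_on_slice1[of UNIV "f k" t] continuous_on_slice1[of UNIV "h k" t] f_cont[of k] h_cont[of k] by simp_all
      have Fc: "continuous_on UNIV F" unfolding F_def by (intro continuous_intros f1)
      have Fc': "continuous_on S F" "continuous_on S (\<lambda>x. F (- x))" for S
        by (rule continuous_on_subset[OF Fc], simp) (rule continuous_on_compose2[OF Fc], auto intro: continuous_intros)
      have h1: "continuous_on S (\<lambda>x. hr f h k x t)" "continuous_on S (\<lambda>x. hs f h k x t)" for S
        unfolding hr_def hs_def by (intro continuous_intros continuous_on_compose2[OF f1(1)] continuous_on_compose2[OF f1(2)]; auto)+
      have "integral {0..X} (\<lambda>x. sqn (hr f h k x t) + sqn (hs f h k x t)) \<le> integral {0..X} (\<lambda>x. F x + F (- x))"
      proof (rule integral_le)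
        fix x
        have "0 \<le> sqn (f k x t - f k (- x) t) / 2 + sqn (h k x t + h k (- x) t) / 2" by simp
        also have "\<dots> = F x + F (- x) - (sqn (f k x t + f k (- x) t) / 2 + sqn (h k x t - h k (- x) t) / 2)"
          unfolding F_def by (simp add: inner_complex_def field_simps)
        finally show "sqn (hr f h k x t) + sqn (hs f h k x t) \<le> F x + F (- x)"
          unfolding hr_def hs_def parallelogram by linarith
      qed (intro integrable_continuous_real continuous_intros h1 Fc')+
      also have "\<dots> = integral {-X..X} F"
        by (rule integral_unique[symmetric], rule fold_integral[OF Fc' X]) auto
      also have "\<dots> \<le> B" using B[OF t X] unfolding F_def .
      finally show ?thesis .
    qed
    then show "\<exists>B. \<forall>t\<in>{-T..T}. \<forall>X\<ge>0. integral {0..X} (\<lambda>x. sqn (hr f h k x t) + sqn (hs f h k x t)) \<le> B" by blast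
  qed (rule t_deriv x_deriv, assumption?)+
qed

section \<open>One-sided derivatives, stability and attraction on the line\<close>

lemma green_deriv: assumes "0 < m" "x \<noteq> 0"
  shows "(green m has_real_derivative - (sgn x * m * green m x)) (at x)"
proof (cases "0 < x")
  case True
  have "((\<lambda>x. exp (- m * x) / (2 * m)) has_real_derivative - (sgn x * m * green m x)) (at x)"
    using assms True by (auto intro!: derivative_eq_intros simp: green_def)
  then show ?thesis
    by (rule has_field_derivative_transform_within_open[where S = "{0<..}"]) (use True in \<open>auto simp: green_def\<close>)
next
  case False
  have "((\<lambda>x. exp (m * x) / (2 * m)) has_real_derivative - (sgn x * m * green m x)) (at x)"
    using assms False by (auto intro!: derivative_eq_intros simp: green_def)
  then show ?thesis
    by (rule has_field_derivative_transform_within_open[where S = "{..<0}"]) (use False assms in \<open>auto simp: green_def\<close>)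
qed

context dirac
begin

sublocale S1: halfline m a \<iota> "hr f h" "hs f h"
  by (rule dirac_halfline) (rule dirac_axioms)

sublocale S2: halfline m c "- \<iota>" "hr h f" "hs h f"
  by (rule dirac_halfline[OF dirac_swap]) (rule dirac_axioms)

text \<open>The x-derivative of f on the side of 0 with sign \<sigma>, given by an expression
  continuous on the whole line; \<open>FX\<close> selects the side. This keeps both one-sided limits
  at 0 available, and \<open>HXs\<close> does the same for h.\<close>

definition FXs where "FXs \<sigma> k x t = - \<iota> * h (Suc k) x t - of_real m * (h k x t - of_real (green m x * c) * h k 0 t)
   - of_real (\<sigma> * m * green m x * a) * f k 0 t"
definition HXs where "HXs \<sigma> k x t = \<iota> * f (Suc k) x t - of_real m * (f k x t - of_real (green m x * a) * f k 0 t)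
   - of_real (\<sigma> * m * green m x * c) * h k 0 t"
definition FX where "FX k x t = FXs (sgn x) k x t"
definition HX where "HX k x t = HXs (sgn x) k x t"

lemma f_deriv: assumes "x \<noteq> 0" shows "((\<lambda>x. f k x t) has_vector_derivative FX k x t) (at x)"
proof -
  have "((\<lambda>x. green m x * a) has_real_derivative - (sgn x * m * green m x) * a) (at x)"
    by (rule DERIV_cmult_right[OF green_deriv[OF m assms]])
  then have "((\<lambda>x. complex_of_real (green m x * a)) has_vector_derivative of_real (- (sgn x * m * green m x) * a)) (at x)"
    by (rule has_vector_derivative_of_real)
  from has_vector_derivative_add[OF f_x[of k t x] has_vector_derivative_mult_left[OF this, of "f k 0 t"]]
  show ?thesis by (simp add: FX_def FXs_def algebra_simps)
qed

lemma h_deriv: assumes "x \<noteq> 0" shows "((\<lambda>x. h k x t) has_vector_derivative HX k x t) (at x)"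
proof -
  have "((\<lambda>x. green m x * c) has_real_derivative - (sgn x * m * green m x) * c) (at x)"
    by (rule DERIV_cmult_right[OF green_deriv[OF m assms]])
  then have "((\<lambda>x. complex_of_real (green m x * c)) has_vector_derivative of_real (- (sgn x * m * green m x) * c)) (at x)"
    by (rule has_vector_derivative_of_real)
  from has_vector_derivative_add[OF h_x[of k t x] has_vector_derivative_mult_left[OF this, of "h k 0 t"]]
  show ?thesis by (simp add: HX_def HXs_def algebra_simps)
qed

lemma rx_sx_eq:
  assumes x: "0 \<le> x"
  defines "p \<equiv> \<lambda>k t. (FXs 1 k x t - FXs (- 1) k (- x) t) / 2" and "q \<equiv> \<lambda>k t. (HXs 1 k x t + HXs (- 1) k (- x) t) / 2"
    and "P \<equiv> \<lambda>k t. (HXs 1 k x t - HXs (- 1) k (- x) t) / 2" and "Q \<equiv> \<lambda>k t. (FXs 1 k x t + FXs (- 1) k (- x) t) / 2"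
  shows "S1.rx k x t = p k t - q k t" "S1.sx k x t = p k t + q k t" "S2.rx k x t = P k t - Q k t" "S2.sx k x t = P k t + Q k t"
proof -
  have gm: "green m (- x) = green m x" by (simp add: green_def)
  define G where "G = green m x"
  have e: "exp (- m * x) = 2 * m * G" using m x by (simp add: G_def green_def)
  have hr0: "hr F H k 0 t = F k 0 t" for F H k t by (simp add: hr_def)
  show "S1.rx k x t = p k t - q k t"
    unfolding S1.rx_def p_def q_def FXs_def HXs_def gm G_def[symmetric] e hr0 unfolding hr_def hs_def by (simp add: field_simps)
  show "S1.sx k x t = p k t + q k t"
    unfolding S1.sx_def p_def q_def FXs_def HXs_def gm G_def[symmetric] unfolding hr_def hs_def by (simp add: field_simps)
  show "S2.rx k x t = P k t - Q k t"
    unfolding S2.rx_def P_def Q_def FXs_def HXs_def gm G_def[symmetric] e hr0 unfolding hr_def hs_def by (simp add: field_simps)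
  show "S2.sx k x t = P k t + Q k t"
    unfolding S2.sx_def P_def Q_def FXs_def HXs_def gm G_def[symmetric] unfolding hr_def hs_def by (simp add: field_simps)
qed

definition Ns where "Ns \<sigma> k x t = sqn (f k x t) + sqn (h k x t) + sqn (FXs \<sigma> k x t) + sqn (HXs \<sigma> k x t)"
definition N where "N k x t = sqn (f k x t) + sqn (h k x t) + sqn (FX k x t) + sqn (HX k x t)"

text \<open>The values of r and s for both orders of the components depend isometrically on the
  values of f and h at x and - x; the same holds for the x-derivatives.\<close>

lemma Ns_sum:
  assumes x: "0 \<le> x" shows "Ns 1 k x t + Ns (- 1) k (- x) t = S1.S k x t + S2.S k x t"
proof -
  have two: "sqn ((u + w) / 2 - (y - z) / 2) + sqn ((u + w) / 2 + (y - z) / 2)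
     + sqn ((y + z) / 2 - (u - w) / 2) + sqn ((y + z) / 2 + (u - w) / 2)
     = sqn u + sqn w + sqn y + sqn z" for u w y z :: complex
    unfolding parallelogram by (simp add: inner_complex_def field_simps)
  have two': "sqn ((u - w) / 2 - (y + z) / 2) + sqn ((u - w) / 2 + (y + z) / 2)
     + sqn ((y - z) / 2 - (u + w) / 2) + sqn ((y - z) / 2 + (u + w) / 2)
     = sqn u + sqn w + sqn y + sqn z" for u w y z :: complex
    using two[of u "- w" y "- z"] by simp
  show ?thesis
    using two[of "f k x t" "f k (- x) t" "h k x t" "h k (- x) t"] two'[of "FXs 1 k x t" "FXs (- 1) k (- x) t" "HXs 1 k x t" "HXs (- 1) k (- x) t"]
    unfolding S1.S_def S2.S_def rx_sx_eq[OF x] Ns_def unfolding hr_def hs_def by linarith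
qed

lemma f_slice: "continuous_on A (\<lambda>x. f k x t)" and h_slice: "continuous_on A (\<lambda>x. h k x t)"
  using continuous_on_slice1[of UNIV "f k" t] continuous_on_slice1[of UNIV "h k" t] f_cont[of k] h_cont[of k]
  by (auto intro: continuous_on_subset)

lemma XS_cont: "continuous_on A (\<lambda>x. FXs \<sigma> k x t)" "continuous_on A (\<lambda>x. HXs \<sigma> k x t)"
  unfolding FXs_def HXs_def by (intro continuous_intros f_slice h_slice green_cont[OF m])+

lemma Ns_cont: "continuous_on A (\<lambda>x. Ns \<sigma> k x t)"
  unfolding Ns_def by (intro continuous_intros f_slice h_slice XS_cont)

lemma N_has_integral:
  assumes X: "0 \<le> X"
  shows "((\<lambda>x. N k x t) has_integral (integral {0..X} (\<lambda>x. S1.S k x t) + integral {0..X} (\<lambda>x. S2.S k x t))) {-X..X}"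
proof -
  have c: "continuous_on {0..X} (\<lambda>x. Ns (- 1) k (- x) t)"
    by (rule continuous_on_compose2[OF Ns_cont[of UNIV]]) (auto intro: continuous_intros)
  have "((\<lambda>x. N k x t) has_integral integral {0..X} (\<lambda>x. Ns 1 k x t + Ns (- 1) k (- x) t)) {-X..X}"
    by (rule fold_integral[OF Ns_cont c X]) (auto simp: N_def Ns_def FX_def HX_def)
  also have "integral {0..X} (\<lambda>x. Ns 1 k x t + Ns (- 1) k (- x) t) = integral {0..X} (\<lambda>x. S1.S k x t + S2.S k x t)"
    by (rule integral_cong) (use Ns_sum in auto)
  also have "\<dots> = integral {0..X} (\<lambda>x. S1.S k x t) + integral {0..X} (\<lambda>x. S2.S k x t)"
    by (rule integral_add[OF slice_integrable[OF S1.S_cont order_refl] slice_integrable[OF S2.S_cont order_refl]])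
  finally show ?thesis .
qed

lemma stability:
  assumes A: "\<And>X. 0 \<le> X \<Longrightarrow> integral {-X..X} (\<lambda>x. N k x t0) \<le> A"
    and A0: "sqn (f k 0 t0) \<le> A" "sqn (h k 0 t0) \<le> A" and X: "0 \<le> X"
  shows "integral {-X..X} (\<lambda>x. N k x t) \<le> (S1.stab + S2.stab) * A"
proof -
  have nn: "0 \<le> integral {0..X} (\<lambda>x. S1.S k x t0)" "0 \<le> integral {0..X} (\<lambda>x. S2.S k x t0)" for X
    using integral_nonneg[OF slice_integrable[OF S1.S_cont order_refl], of X k t0] integral_nonneg[OF slice_integrable[OF S2.S_cont order_refl], of X k t0]
    by (auto simp: S1.S_def S2.S_def)
  have I: "integral {0..X} (\<lambda>x. S1.S k x t0) \<le> A" "integral {0..X} (\<lambda>x. S2.S k x t0) \<le> A" if "0 \<le> X" for X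
    using A[OF that] nn[of X] integral_unique[OF N_has_integral[OF that, of k t0]] by linarith+
  have "hr F H k 0 t = F k 0 t" for F H k t by (simp add: hr_def)
  then have "integral {0..X} (\<lambda>x. S1.S k x t) \<le> S1.stab * A" "integral {0..X} (\<lambda>x. S2.S k x t) \<le> S2.stab * A"
    using S1.stability[OF I(1) _ X, of t] S2.stability[OF I(2) _ X, of t] A0 by simp_all
  then show ?thesis unfolding integral_unique[OF N_has_integral[OF X, of k t]] by (simp add: distrib_right)
qed

text \<open>With the next three definitions: the components of an element of \<open>Sset\<close> and
  their derivatives off 0, in terms of the half-line profiles. The parity belonging to C1 is
  opposite to that belonging to C2.\<close>

definition attr_f where "attr_f C1 C2 x = (if 0 < a then C1 * of_real (profU m a \<bar>x\<bar>) else 0) + (if 0 < c then C2 * of_real (sgn x * profV m c \<bar>x\<bar>) else (0::complex))"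
definition attr_h where "attr_h C1 C2 x = (if 0 < a then C1 * of_real (sgn x * profV m a \<bar>x\<bar>) else 0) + (if 0 < c then C2 * of_real (profU m c \<bar>x\<bar>) else (0::complex))"
definition attr_fx where "attr_fx C1 C2 x = (if 0 < a then C1 * of_real (sgn x * profU' m a \<bar>x\<bar>) else 0) + (if 0 < c then C2 * of_real (profV' m c \<bar>x\<bar>) else (0::complex))"
definition attr_hx where "attr_hx C1 C2 x = (if 0 < a then C1 * of_real (profV' m a \<bar>x\<bar>) else 0) + (if 0 < c then C2 * of_real (sgn x * profU' m c \<bar>x\<bar>) else (0::complex))"

lemma attraction:
  assumes R: "0 \<le> R" and e: "0 < e"
  shows "\<forall>\<^sub>F t in at_top. \<exists>C1 C2. \<forall>x. x \<noteq> 0 \<longrightarrow> \<bar>x\<bar> \<le> R \<longrightarrow>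
     norm (f 0 x t - attr_f C1 C2 x) \<le> e \<and> norm (h 0 x t - attr_h C1 C2 x) \<le> e \<and>
     norm (FX 0 x t - attr_fx C1 C2 x) \<le> e \<and> norm (HX 0 x t - attr_hx C1 C2 x) \<le> e"
proof -
  obtain C where C:
    "locally_vanishing (\<lambda>x t. (hr f h 0 x t + hs f h 0 x t) / 2 - (if 0 < a then C t * of_real (profU m a x) else 0))"
    "locally_vanishing (\<lambda>x t. (hs f h 0 x t - hr f h 0 x t) / 2 - (if 0 < a then C t * of_real (profV m a x) else 0))"
    "locally_vanishing (\<lambda>x t. (S1.rx 0 x t + S1.sx 0 x t) / 2 - (if 0 < a then C t * of_real (profU' m a x) else 0))"
    "locally_vanishing (\<lambda>x t. (S1.sx 0 x t - S1.rx 0 x t) / 2 - (if 0 < a then C t * of_real (profV' m a x) else 0))"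
    by (rule S1.attraction)
  obtain C' where C':
    "locally_vanishing (\<lambda>x t. (hr h f 0 x t + hs h f 0 x t) / 2 - (if 0 < c then C' t * of_real (profU m c x) else 0))"
    "locally_vanishing (\<lambda>x t. (hs h f 0 x t - hr h f 0 x t) / 2 - (if 0 < c then C' t * of_real (profV m c x) else 0))"
    "locally_vanishing (\<lambda>x t. (S2.rx 0 x t + S2.sx 0 x t) / 2 - (if 0 < c then C' t * of_real (profU' m c x) else 0))"
    "locally_vanishing (\<lambda>x t. (S2.sx 0 x t - S2.rx 0 x t) / 2 - (if 0 < c then C' t * of_real (profV' m c x) else 0))"
    by (rule S2.attraction)
  have e2: "0 < e / 2" using e by simp
  have ev: "\<forall>\<^sub>F t in at_top. \<forall>x\<in>{0..R}. norm (F x t) \<le> e / 2" if "locally_vanishing F" for F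
    using that R e2 unfolding locally_vanishing_def by blast
  have tri: "norm (u + w - (y + z)) \<le> e" if "norm (u - y) \<le> e / 2" "norm (w - z) \<le> e / 2" for u w y z :: complex
    using norm_triangle_ineq[of "u - y" "w - z"] that by (simp add: algebra_simps)
  have tri': "norm (u - w - (y - z)) \<le> e" if "norm (u - y) \<le> e / 2" "norm (w - z) \<le> e / 2" for u w y z :: complex
    using norm_triangle_ineq4[of "u - y" "w - z"] that by (simp add: algebra_simps)
  show ?thesis
    using ev[OF C(1)] ev[OF C(2)] ev[OF C(3)] ev[OF C(4)] ev[OF C'(1)] ev[OF C'(2)] ev[OF C'(3)] ev[OF C'(4)]
  proof eventually_elim
    case (elim t)
    have half: "(p - q + (p + q)) / 2 = p" "(p + q - (p - q)) / 2 = q" for p q :: complex by simp_all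
    have f_eq: "f 0 y t = (hr f h 0 y t + hs f h 0 y t) / 2 + (hs h f 0 y t - hr h f 0 y t) / 2"
      "f 0 (- y) t = (hr f h 0 y t + hs f h 0 y t) / 2 - (hs h f 0 y t - hr h f 0 y t) / 2"
      "h 0 y t = (hs f h 0 y t - hr f h 0 y t) / 2 + (hr h f 0 y t + hs h f 0 y t) / 2"
      "h 0 (- y) t = (hr h f 0 y t + hs h f 0 y t) / 2 - (hs f h 0 y t - hr f h 0 y t) / 2" for y
      unfolding hr_def hs_def half by (simp_all add: field_simps)
    have F_eq: "FXs 1 0 y t = (S1.rx 0 y t + S1.sx 0 y t) / 2 + (S2.sx 0 y t - S2.rx 0 y t) / 2"
      "FXs (- 1) 0 (- y) t = (S2.sx 0 y t - S2.rx 0 y t) / 2 - (S1.rx 0 y t + S1.sx 0 y t) / 2"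
      "HXs 1 0 y t = (S1.sx 0 y t - S1.rx 0 y t) / 2 + (S2.rx 0 y t + S2.sx 0 y t) / 2"
      "HXs (- 1) 0 (- y) t = (S1.sx 0 y t - S1.rx 0 y t) / 2 - (S2.rx 0 y t + S2.sx 0 y t) / 2" if "0 \<le> y" for y
      unfolding rx_sx_eq[OF that] half by (simp_all add: field_simps)
    show ?case
    proof (rule exI[of _ "C t"], rule exI[of _ "C' t"], intro allI impI)
      fix x :: real assume x: "x \<noteq> 0" "\<bar>x\<bar> \<le> R"
      show "norm (f 0 x t - attr_f (C t) (C' t) x) \<le> e \<and> norm (h 0 x t - attr_h (C t) (C' t) x) \<le> e \<and>
         norm (FX 0 x t - attr_fx (C t) (C' t) x) \<le> e \<and> norm (HX 0 x t - attr_hx (C t) (C' t) x) \<le> e"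
      proof (cases "0 < x")
        case True
        then have xx: "x \<in> {0..R}" "0 \<le> x" "\<bar>x\<bar> = x" "sgn x = 1" using x by auto
        note B = bspec[OF elim(1) xx(1)] bspec[OF elim(2) xx(1)] bspec[OF elim(3) xx(1)] bspec[OF elim(4) xx(1)]
          bspec[OF elim(5) xx(1)] bspec[OF elim(6) xx(1)] bspec[OF elim(7) xx(1)] bspec[OF elim(8) xx(1)]
        show ?thesis
          unfolding attr_f_def attr_h_def attr_fx_def attr_hx_def FX_def HX_def xx(3,4) mult_1 f_eq(1)[of x] f_eq(3)[of x] F_eq(1)[OF xx(2)] F_eq(3)[OF xx(2)]
          using tri[OF B(1) B(6)] tri[OF B(2) B(5)] tri[OF B(3) B(8)] tri[OF B(4) B(7)] by blast
      next
        case False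
        \<comment> \<open>For x < 0 the half-line functions are evaluated at y = - x, and the odd
          contributions change sign together with sgn x.\<close>
        define y where "y = - x"
        have yy: "y \<in> {0..R}" "0 \<le> y" "\<bar>x\<bar> = y" "sgn x = -1" "x = - y" using x False by (auto simp: y_def)
        have neg: "(if b then C * complex_of_real (- 1 * u) else 0) = - (if b then C * of_real u else 0)" for b C u by simp
        note B = bspec[OF elim(1) yy(1)] bspec[OF elim(2) yy(1)] bspec[OF elim(3) yy(1)] bspec[OF elim(4) yy(1)]
          bspec[OF elim(5) yy(1)] bspec[OF elim(6) yy(1)] bspec[OF elim(7) yy(1)] bspec[OF elim(8) yy(1)]
        have comm: "- u + w = w - u" "u + - w = u - w" for u w :: complex by simp_all
        show ?thesis
          unfolding attr_f_def attr_h_def attr_fx_def attr_hx_def FX_def HX_def yy(3,4) neg comm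
          unfolding yy(5) f_eq(2)[of y] f_eq(4)[of y] F_eq(2)[OF yy(2)] F_eq(4)[OF yy(2)]
          using tri'[OF B(1) B(6)] tri'[OF B(5) B(2)] tri'[OF B(8) B(3)] tri'[OF B(4) B(7)] by blast
      qed
    qed
  qed
qed

end

subsection \<open>Test functions and weak derivatives\<close>

lemma testfun1_facts:
  assumes "testfun1 U \<xi>"
  shows "continuous_on UNIV \<xi>" "continuous_on UNIV (deriv \<xi>)" "(\<xi> has_real_derivative deriv \<xi> x) (at x)"
    "x \<notin> U \<Longrightarrow> \<xi> x = 0" "x \<notin> U \<Longrightarrow> deriv \<xi> x = 0"
    "\<exists>L>0. \<forall>x. x \<notin> {-L..L} \<longrightarrow> \<xi> x = 0 \<and> deriv \<xi> x = 0"
proof -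
  obtain D where D: "D 0 = \<xi>" "\<And>k x. (D k has_real_derivative D (Suc k) x) (at x)"
    using assms unfolding testfun1_def smooth1_def by auto
  have d: "deriv \<xi> = D (Suc 0)" using DERIV_imp_deriv[OF D(2)[of 0]] D(1) by auto
  have cont: "continuous_on UNIV (D k)" for k using D(2) by (intro DERIV_continuous_on) blast
  show "continuous_on UNIV \<xi>" using cont[of 0] D(1) by simp
  show "continuous_on UNIV (deriv \<xi>)" using cont[of "Suc 0"] d by simp
  show "(\<xi> has_real_derivative deriv \<xi> x) (at x)" using D(2)[of 0 x] D(1) d by simp
  define K where "K = closure {x. \<xi> x \<noteq> 0}"
  have K: "compact K" "K \<subseteq> U" using assms by (auto simp: testfun1_def K_def)
  have out: "\<xi> x = 0 \<and> deriv \<xi> x = 0" if "x \<notin> K" for x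
  proof -
    have z: "\<xi> y = 0" if "y \<notin> K" for y using that closure_subset[of "{x. \<xi> x \<noteq> 0}"] by (auto simp: K_def)
    have "open (- K)" using K(1) compact_imp_closed by blast
    then have "(\<xi> has_real_derivative 0) (at x)"
      using has_field_derivative_transform_within_open[of "\<lambda>x. 0" 0 x "- K" \<xi>] that z by auto
    then show ?thesis using z[OF that] DERIV_imp_deriv by blast
  qed
  show "x \<notin> U \<Longrightarrow> \<xi> x = 0" "x \<notin> U \<Longrightarrow> deriv \<xi> x = 0" using out K(2) by blast+
  obtain L where L: "0 < L" "\<And>x. x \<in> K \<Longrightarrow> norm x \<le> L"
    using compact_imp_bounded[OF K(1)] unfolding bounded_pos by auto
  then show "\<exists>L>0. \<forall>x. x \<notin> {-L..L} \<longrightarrow> \<xi> x = 0 \<and> deriv \<xi> x = 0"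
    using out by (intro exI[of _ L]) (force simp: abs_le_iff)
qed

lemma testfun1_mono: "testfun1 U \<xi> \<Longrightarrow> U \<subseteq> V \<Longrightarrow> testfun1 V \<xi>"
  by (auto simp: testfun1_def)

text \<open>Continuous up to 0 from either side, with a free value at 0. The x-derivatives of
  solutions and of solitary waves are of this kind.\<close>

definition piecewise_cont :: "(real \<Rightarrow> 'a::euclidean_space) \<Rightarrow> bool" where
  "piecewise_cont F \<longleftrightarrow> (\<exists>P Q. continuous_on UNIV P \<and> continuous_on UNIV Q \<and> (\<forall>x>0. F x = P x) \<and> (\<forall>x<0. F x = Q x))"

lemma piecewise_cont_continuous: "continuous_on UNIV F \<Longrightarrow> piecewise_cont F"
  unfolding piecewise_cont_def by blast

lemma piecewise_cont_diff:
  assumes "piecewise_cont F" "piecewise_cont G" shows "piecewise_cont (\<lambda>x. F x - G x)"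
proof -
  obtain P Q where "continuous_on UNIV P" "continuous_on UNIV Q" "\<forall>x>0. F x = P x" "\<forall>x<0. F x = Q x"
    using assms(1) unfolding piecewise_cont_def by blast
  moreover obtain P' Q' where "continuous_on UNIV P'" "continuous_on UNIV Q'" "\<forall>x>0. G x = P' x" "\<forall>x<0. G x = Q' x"
    using assms(2) unfolding piecewise_cont_def by blast
  ultimately show ?thesis unfolding piecewise_cont_def
    by (intro exI[of _ "\<lambda>x. P x - P' x"] exI[of _ "\<lambda>x. Q x - Q' x"]) (auto intro: continuous_intros)
qed

lemma piecewise_cont_measurable:
  assumes "piecewise_cont F" shows "F \<in> borel_measurable borel"
proof -
  obtain P Q where PQ: "continuous_on UNIV P" "continuous_on UNIV Q" "\<forall>x>0. F x = P x" "\<forall>x<0. F x = Q x"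
    using assms unfolding piecewise_cont_def by blast
  have [measurable]: "P \<in> borel_measurable borel" "Q \<in> borel_measurable borel"
    using PQ by (auto intro: borel_measurable_continuous_onI)
  have "(\<lambda>x. if 0 < x then P x else if x < 0 then Q x else F 0) \<in> borel_measurable borel" by measurable
  also have "(\<lambda>x. if 0 < x then P x else if x < 0 then Q x else F 0) = F" using PQ by (auto simp: fun_eq_iff not_less antisym)
  finally show ?thesis .
qed

lemma piecewise_cont_bounded:
  assumes "piecewise_cont F" obtains B where "0 \<le> B" "\<And>x. x \<in> {a..b} \<Longrightarrow> norm (F x) \<le> B"
proof -
  obtain P Q where PQ: "continuous_on UNIV P" "continuous_on UNIV Q" "\<forall>x>0. F x = P x" "\<forall>x<0. F x = Q x"
    using assms unfolding piecewise_cont_def by blast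
  have "bounded (P ` {a..b})" "bounded (Q ` {a..b})"
    using PQ by (auto intro!: compact_imp_bounded compact_continuous_image intro: continuous_on_subset)
  then obtain B1 B2 where "\<And>x. x \<in> {a..b} \<Longrightarrow> norm (P x) \<le> B1" "\<And>x. x \<in> {a..b} \<Longrightarrow> norm (Q x) \<le> B2"
    unfolding bounded_iff by blast
  then have "norm (F x) \<le> max 0 (max (norm (F 0)) (max B1 B2))" if "x \<in> {a..b}" for x
    using PQ that by (cases x "0::real" rule: linorder_cases) (auto simp: le_max_iff_disj)
  then show ?thesis by (intro that[of "max 0 (max (norm (F 0)) (max B1 B2))"]) auto
qed

lemma integrable_bounded_on_interval:
  fixes f :: "real \<Rightarrow> 'a::euclidean_space"
  assumes "f \<in> borel_measurable borel" "\<And>x. x \<in> {a..b} \<Longrightarrow> norm (f x) \<le> B" "\<And>x. x \<notin> {a..b} \<Longrightarrow> f x = 0"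
  shows "integrable lborel f"
proof (rule Bochner_Integration.integrable_bound[of _ "\<lambda>x. indicator {a..b} x * B"])
  show "integrable lborel (\<lambda>x. indicator {a..b} x * B)"
    by (intro integrable_mult_left) (simp add: integrable_indicator_iff emeasure_lborel_Icc_eq)
  show "AE x in lborel. norm (f x) \<le> norm (indicator {a..b} x * B)"
  proof (rule AE_I2)
    fix x show "norm (f x) \<le> norm (indicator {a..b} x * B)"
      using assms(2)[of x] assms(3)[of x] by (cases "x \<in> {a..b}") auto
  qed
qed (use assms(1) in simp)

lemma piecewise_cont_square:
  fixes F :: "real \<Rightarrow> 'a::euclidean_space"
  assumes "piecewise_cont F"
  shows "set_integrable lborel {a<..<b} (\<lambda>x. (norm (F x))\<^sup>2)"
    and "(LINT x:{a<..<b}|lborel. (norm (F x))\<^sup>2) = integral {a..b} (\<lambda>x. sqn (F x))"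
    and "(\<lambda>x. sqn (F x)) integrable_on {a..b}"
proof -
  obtain B where B: "0 \<le> B" "\<And>x. x \<in> {a..b} \<Longrightarrow> norm (F x) \<le> B"
    using piecewise_cont_bounded[OF assms, where a = a and b = b] by blast
  have m: "F \<in> borel_measurable borel" by (rule piecewise_cont_measurable[OF assms])
  have i: "set_integrable lborel I (\<lambda>x. (norm (F x))\<^sup>2)" if "I \<subseteq> {a..b}" "I \<in> sets borel" for I
    unfolding set_integrable_def
  proof (rule integrable_bounded_on_interval[of _ a b "B\<^sup>2"])
    show "(\<lambda>x. indicator I x *\<^sub>R (norm (F x))\<^sup>2) \<in> borel_measurable borel" using m that(2) by measurable
    fix x show "x \<notin> {a..b} \<Longrightarrow> indicator I x *\<^sub>R (norm (F x))\<^sup>2 = 0" using that(1) by (auto simp: indicator_def)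
    assume "x \<in> {a..b}"
    then have "(norm (F x))\<^sup>2 \<le> B\<^sup>2" using B by (intro power_mono) auto
    then show "norm (indicator I x *\<^sub>R (norm (F x))\<^sup>2) \<le> B\<^sup>2" by (auto simp: indicator_def)
  qed
  show 1: "set_integrable lborel {a<..<b} (\<lambda>x. (norm (F x))\<^sup>2)" by (rule i) auto
  show "(LINT x:{a<..<b}|lborel. (norm (F x))\<^sup>2) = integral {a..b} (\<lambda>x. sqn (F x))"
    using set_borel_integral_eq_integral(2)[OF 1] by (simp add: integral_open_interval_real[symmetric] power2_norm_eq_inner)
  have "set_integrable lborel {a..b} (\<lambda>x. (norm (F x))\<^sup>2)" by (rule i) auto
  from set_borel_integral_eq_integral(1)[OF this] show "(\<lambda>x. sqn (F x)) integrable_on {a..b}"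
    by (simp add: power2_norm_eq_inner)
qed

lemma piecewise_cont_L2: "piecewise_cont F \<Longrightarrow> L2_on {a<..<b} F"
proof -
  assume F: "piecewise_cont F"
  have [measurable]: "F \<in> borel_measurable borel" by (rule piecewise_cont_measurable[OF F])
  have "(\<lambda>x. indicat_real {a<..<b} x *\<^sub>R F x) \<in> borel_measurable borel" by measurable
  then show ?thesis
    unfolding L2_on_def set_borel_measurable_def using piecewise_cont_square(1)[OF F] by simp
qed

text \<open>Young's inequality with every parameter c yields the Cauchy-Schwarz form; the optimal c
  is sqrt (B / A). Adding e to A and B avoids the degenerate cases.\<close>

lemma sqrt_mult_bound:
  fixes y A B :: real
  assumes "\<And>c. 0 < c \<Longrightarrow> y \<le> (c * A + B / c) / 2" "0 \<le> A" "0 \<le> B"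
  shows "y \<le> sqrt A * sqrt B"
proof -
  have *: "y \<le> sqrt (A + e) * sqrt (B + e)" if e: "0 < e" for e
  proof -
    define p q where "p = sqrt (A + e)" and "q = sqrt (B + e)"
    have pq: "0 < p" "0 < q" "A + e = p\<^sup>2" "B + e = q\<^sup>2" using assms e by (auto simp: p_def q_def)
    have "y \<le> (q / p * A + B / (q / p)) / 2" by (rule assms(1)) (use pq in auto)
    also have "\<dots> \<le> (q / p * (A + e) + (B + e) / (q / p)) / 2"
      using pq e by (intro divide_right_mono add_mono mult_left_mono) auto
    also have "\<dots> = p * q" unfolding pq using pq(1,2) by (simp add: power2_eq_square field_simps)
    finally show ?thesis by (simp add: p_def q_def)
  qed
  have "((\<lambda>e. sqrt (A + e) * sqrt (B + e)) \<longlongrightarrow> sqrt (A + 0) * sqrt (B + 0)) (at_right 0)"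
    by (intro tendsto_intros)
  then have "y \<le> sqrt (A + 0) * sqrt (B + 0)"
    by (rule tendsto_lowerbound) (auto intro!: eventually_at_rightI[of 0 1] *)
  then show ?thesis by simp
qed

lemma L2_prod:
  fixes F :: "real \<Rightarrow> complex^2"
  assumes F: "L2_on U F" and z: "continuous_on UNIV \<zeta>" "\<And>x. x \<notin> {-L..L} \<Longrightarrow> \<zeta> x = 0" "\<And>x. x \<notin> U \<Longrightarrow> \<zeta> x = 0"
  shows "integrable lborel (\<lambda>x. \<zeta> x *\<^sub>R F x)"
    and "norm (LINT x|lborel. \<zeta> x *\<^sub>R F x) \<le> sqrt (LINT x|lborel. (\<zeta> x)\<^sup>2) * sqrt (LINT x:U|lborel. (norm (F x))\<^sup>2)"
proof -
  define G where "G x = indicat_real U x *\<^sub>R F x" for x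
  have zG: "\<zeta> x *\<^sub>R F x = \<zeta> x *\<^sub>R G x" for x using z(3)[of x] by (auto simp: G_def indicator_def)
  have [measurable]: "G \<in> borel_measurable borel" using F unfolding L2_on_def set_borel_measurable_def G_def[abs_def] by simp
  have [measurable]: "\<zeta> \<in> borel_measurable borel" by (rule borel_measurable_continuous_onI[OF z(1)])
  have G2: "(norm (G x))\<^sup>2 = indicat_real U x *\<^sub>R (norm (F x))\<^sup>2" for x by (auto simp: G_def indicator_def)
  have iG: "integrable lborel (\<lambda>x. (norm (G x))\<^sup>2)" using F unfolding L2_on_def set_integrable_def G2 by simp
  have iz: "integrable lborel (\<lambda>x. (\<zeta> x)\<^sup>2)"
    by (rule integrable_continuous_compact_support[of _ "{-L..L}"]) (use z in \<open>auto intro!: continuous_intros\<close>)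
  have young: "norm (\<zeta> x *\<^sub>R G x) \<le> (k * (\<zeta> x)\<^sup>2 + (norm (G x))\<^sup>2 / k) / 2" if k: "0 < k" for k x
  proof -
    have "0 \<le> (k * \<bar>\<zeta> x\<bar> - norm (G x))\<^sup>2" by simp
    then have "2 * (k * (\<bar>\<zeta> x\<bar> * norm (G x))) \<le> k * (k * (\<zeta> x)\<^sup>2) + (norm (G x))\<^sup>2"
      by (simp add: power2_eq_square algebra_simps abs_mult_self_eq)
    then show ?thesis using k by (simp add: field_simps)
  qed
  have ib: "integrable lborel (\<lambda>x. (k * (\<zeta> x)\<^sup>2 + (norm (G x))\<^sup>2 / k) / 2)" for k
    using iz iG by auto
  show i: "integrable lborel (\<lambda>x. \<zeta> x *\<^sub>R F x)"
    unfolding zG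
  proof (rule Bochner_Integration.integrable_bound[OF ib[of 1]])
    show "AE x in lborel. norm (\<zeta> x *\<^sub>R G x) \<le> norm ((1 * (\<zeta> x)\<^sup>2 + (norm (G x))\<^sup>2 / 1) / 2)"
    proof (rule AE_I2)
      fix x show "norm (\<zeta> x *\<^sub>R G x) \<le> norm ((1 * (\<zeta> x)\<^sup>2 + (norm (G x))\<^sup>2 / 1) / 2)"
        using young[of 1 x] by simp
    qed
  qed simp
  show "norm (LINT x|lborel. \<zeta> x *\<^sub>R F x) \<le> sqrt (LINT x|lborel. (\<zeta> x)\<^sup>2) * sqrt (LINT x:U|lborel. (norm (F x))\<^sup>2)"
  proof (rule sqrt_mult_bound)
    fix k :: real assume k: "0 < k"
    have "norm (LINT x|lborel. \<zeta> x *\<^sub>R G x) \<le> (LINT x|lborel. (k * (\<zeta> x)\<^sup>2 + (norm (G x))\<^sup>2 / k) / 2)"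
    proof -
      have "norm (LINT x|lborel. \<zeta> x *\<^sub>R G x) \<le> (LINT x|lborel. norm (\<zeta> x *\<^sub>R G x))"
        by (rule Bochner_Integration.integral_norm_bound)
      also have "\<dots> \<le> (LINT x|lborel. (k * (\<zeta> x)\<^sup>2 + (norm (G x))\<^sup>2 / k) / 2)"
        using i ib young[OF k] unfolding zG by (intro integral_mono integrable_norm) auto
      finally show ?thesis .
    qed
    also have "\<dots> = (k * (LINT x|lborel. (\<zeta> x)\<^sup>2) + (LINT x:U|lborel. (norm (F x))\<^sup>2) / k) / 2"
      using iz iG unfolding set_lebesgue_integral_def G2[symmetric] by simp
    finally show "norm (LINT x|lborel. \<zeta> x *\<^sub>R F x) \<le> (k * (LINT x|lborel. (\<zeta> x)\<^sup>2) + (LINT x:U|lborel. (norm (F x))\<^sup>2) / k) / 2"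
      unfolding zG .
  next
    show "0 \<le> (LINT x:U|lborel. (norm (F x))\<^sup>2)"
      unfolding set_lebesgue_integral_def by (rule integral_nonneg_AE) auto
  qed simp
qed

text \<open>The factor 4 is \<open>DIM(complex^2)\<close>: scalar duality is applied to each real component.\<close>
lemma L2_duality:
  fixes F :: "real \<Rightarrow> complex^2"
  assumes cd: "c < d" and F: "L2_on {c<..<d} F" and M: "0 \<le> M"
    and bound: "\<And>\<xi>. testfun1 {c<..<d} \<xi> \<Longrightarrow> norm (LINT x|lborel. \<xi> x *\<^sub>R F x) \<le> M * sqrt (LINT x|lborel. (\<xi> x)\<^sup>2)"
  shows "(LINT x:{c<..<d}|lborel. (norm (F x))\<^sup>2) \<le> 4 * M\<^sup>2"
proof -
  define G where "G x = indicat_real {c<..<d} x *\<^sub>R F x" for x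
  have [measurable]: "G \<in> borel_measurable borel" using F unfolding L2_on_def set_borel_measurable_def G_def[abs_def] by simp
  have G2: "(norm (G x))\<^sup>2 = indicat_real {c<..<d} x *\<^sub>R (norm (F x))\<^sup>2" for x by (auto simp: G_def indicator_def)
  have iG: "integrable lborel (\<lambda>x. (norm (G x))\<^sup>2)" using F unfolding L2_on_def set_integrable_def G2 by simp
  have iG1: "integrable lborel G"
  proof (rule Bochner_Integration.integrable_bound[of _ "\<lambda>x. indicator {c<..<d} x + (norm (G x))\<^sup>2"])
    show "integrable lborel (\<lambda>x. indicator {c<..<d} x + (norm (G x))\<^sup>2)"
      using cd iG by (intro Bochner_Integration.integrable_add) (auto simp: integrable_indicator_iff)
    show "AE x in lborel. norm (G x) \<le> norm (indicator {c<..<d} x + (norm (G x))\<^sup>2)"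
    proof (rule AE_I2)
      fix x
      have "norm (G x) \<le> 1 + (norm (G x))\<^sup>2"
      proof -
        have "0 \<le> (norm (G x) - 1/2)\<^sup>2" by simp
        then show ?thesis by (simp add: power2_eq_square algebra_simps)
      qed
      then show "norm (G x) \<le> norm (indicator {c<..<d} x + (norm (G x))\<^sup>2)"
        by (cases "x \<in> {c<..<d}") (auto simp: G_def)
    qed
  qed simp
  have each: "integrable lborel (\<lambda>x. (G x \<bullet> b)\<^sup>2)" "(LINT x|lborel. (G x \<bullet> b)\<^sup>2) \<le> M\<^sup>2" if b: "b \<in> Basis" for b
  proof -
    show sq: "integrable lborel (\<lambda>x. (G x \<bullet> b)\<^sup>2)"
    proof (rule Bochner_Integration.integrable_bound[OF iG])
      show "AE x in lborel. norm ((G x \<bullet> b)\<^sup>2) \<le> norm ((norm (G x))\<^sup>2)"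
        using Basis_le_norm[OF b] by (auto simp: abs_le_square_iff[symmetric])
    qed simp
    interpret dual_bound c d M "\<lambda>x. G x \<bullet> b"
    proof
      show "integrable lborel (\<lambda>x. G x \<bullet> b)" using iG1 by simp
      fix \<xi> assume xi: "testfun1 {c<..<d} \<xi>"
      obtain L where L: "\<forall>x. x \<notin> {-L..L} \<longrightarrow> \<xi> x = 0 \<and> deriv \<xi> x = 0" using testfun1_facts(6)[OF xi] by blast
      have i: "integrable lborel (\<lambda>x. \<xi> x *\<^sub>R F x)"
        by (rule L2_prod(1)[OF F testfun1_facts(1)[OF xi]]) (use L testfun1_facts(4)[OF xi] in auto)
      have e: "\<xi> x * (G x \<bullet> b) = (\<xi> x *\<^sub>R F x) \<bullet> b" for x
        using testfun1_facts(4)[OF xi, of x] by (auto simp: G_def indicator_def)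
      have "(LINT x|lborel. \<xi> x * (G x \<bullet> b)) = (LINT x|lborel. \<xi> x *\<^sub>R F x) \<bullet> b"
        unfolding e by (rule integral_inner_left) (rule i)
      then have "\<bar>LINT x|lborel. \<xi> x * (G x \<bullet> b)\<bar> \<le> norm (LINT x|lborel. \<xi> x *\<^sub>R F x)"
        using Basis_le_norm[OF b] by simp
      then show "\<bar>LINT x|lborel. \<xi> x * (G x \<bullet> b)\<bar> \<le> M * sqrt (LINT x|lborel. (\<xi> x)\<^sup>2)"
        using bound[OF xi] by linarith
    qed (use cd M in \<open>auto simp: G_def\<close>)
    show "(LINT x|lborel. (G x \<bullet> b)\<^sup>2) \<le> M\<^sup>2" by (rule L2_le[OF sq])
  qed
  have "(LINT x:{c<..<d}|lborel. (norm (F x))\<^sup>2) = (LINT x|lborel. (norm (G x))\<^sup>2)"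
    unfolding set_lebesgue_integral_def G2 ..
  also have "\<dots> = (LINT x|lborel. (\<Sum>b\<in>Basis. (G x \<bullet> b)\<^sup>2))"
    unfolding power2_norm_eq_inner euclidean_inner[of "G _" "G _"] by (simp add: power2_eq_square)
  also have "\<dots> = (\<Sum>b\<in>Basis. LINT x|lborel. (G x \<bullet> b)\<^sup>2)"
    by (rule Bochner_Integration.integral_sum) (rule each(1))
  also have "\<dots> \<le> (\<Sum>b\<in>(Basis::(complex^2) set). M\<^sup>2)" by (rule sum_mono) (rule each(2))
  also have "\<dots> = 4 * M\<^sup>2" by simp
  finally show ?thesis .
qed

text \<open>F does not jump at 0, so its weak derivative carries no point mass there; the
  fundamental theorem of calculus tolerates the exceptional point.\<close>

lemma weak_deriv_piecewise:
  fixes F F' :: "real \<Rightarrow> complex^2"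
  assumes Fc: "continuous_on UNIV F" and d: "\<And>x. x \<noteq> 0 \<Longrightarrow> (F has_vector_derivative F' x) (at x)"
    and F': "piecewise_cont F'"
  shows "weak_deriv_on U F F'"
  unfolding weak_deriv_on_def
proof (intro allI impI)
  fix \<xi> assume xi: "testfun1 U \<xi>"
  note t = testfun1_facts[OF xi]
  obtain L where L: "0 < L" "\<And>x. x \<notin> {-L..L} \<Longrightarrow> \<xi> x = 0" "\<And>x. x \<notin> {-L..L} \<Longrightarrow> deriv \<xi> x = 0" using t(6) by blast
  have i1: "integrable lborel (\<lambda>x. deriv \<xi> x *\<^sub>R F x)"
    by (rule integrable_continuous_compact_support[of _ "{-L..L}"]) (use L t Fc in \<open>auto intro!: continuous_intros\<close>)
  have F'L: "L2_on {-(L+1)<..<L+1} F'" by (rule piecewise_cont_L2[OF F'])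
  have i2: "integrable lborel (\<lambda>x. \<xi> x *\<^sub>R F' x)"
    by (rule L2_prod(1)[OF F'L t(1)]) (use L in auto)
  have "((\<lambda>x. deriv \<xi> x *\<^sub>R F x + \<xi> x *\<^sub>R F' x) has_integral \<xi> (L+1) *\<^sub>R F (L+1) - \<xi> (-(L+1)) *\<^sub>R F (-(L+1))) {-(L+1)..L+1}"
  proof (rule fundamental_theorem_of_calculus_interior_strong[of "{0}"])
    show "continuous_on {-(L+1)..L+1} (\<lambda>x. \<xi> x *\<^sub>R F x)"
      by (intro continuous_intros continuous_on_subset[OF t(1)] continuous_on_subset[OF Fc]) auto
    fix x assume "x \<in> {-(L+1)<..<L+1} - {0}"
    then have "((\<lambda>x. \<xi> x *\<^sub>R F x) has_vector_derivative \<xi> x *\<^sub>R F' x + deriv \<xi> x *\<^sub>R F x) (at x)"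
      by (intro has_vector_derivative_scaleR t(3) d) auto
    then show "((\<lambda>x. \<xi> x *\<^sub>R F x) has_vector_derivative deriv \<xi> x *\<^sub>R F x + \<xi> x *\<^sub>R F' x) (at x)"
      by (simp add: add.commute)
  qed (use L in auto)
  then have h0: "((\<lambda>x. deriv \<xi> x *\<^sub>R F x + \<xi> x *\<^sub>R F' x) has_integral 0) {-(L+1)..L+1}" using L by simp
  have "((\<lambda>x. deriv \<xi> x *\<^sub>R F x + \<xi> x *\<^sub>R F' x) has_integral 0) UNIV"
  proof (rule has_integral_on_superset[OF h0])
    fix x assume "x \<notin> {-(L+1)..L+1}"
    then have "x \<notin> {-L..L}" by auto
    then show "deriv \<xi> x *\<^sub>R F x + \<xi> x *\<^sub>R F' x = 0" using L by simp
  qed simp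
  moreover have "((\<lambda>x. deriv \<xi> x *\<^sub>R F x + \<xi> x *\<^sub>R F' x) has_integral (LINT x|lborel. deriv \<xi> x *\<^sub>R F x + \<xi> x *\<^sub>R F' x)) UNIV"
    by (rule has_integral_integral_lborel) (use i1 i2 in simp)
  ultimately have "(LINT x|lborel. deriv \<xi> x *\<^sub>R F x + \<xi> x *\<^sub>R F' x) = 0" by (rule has_integral_unique[symmetric])
  then show "(LINT x|lborel. deriv \<xi> x *\<^sub>R F x) = - (LINT x|lborel. \<xi> x *\<^sub>R F' x)"
    using Bochner_Integration.integral_add[OF i1 i2] by (simp add: eq_neg_iff_add_eq_0)
qed

lemma norm_diff_sq_le: "(norm (u - w))\<^sup>2 \<le> 2 * (norm u)\<^sup>2 + 2 * (norm w)\<^sup>2" for u w :: "'a::real_inner"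
proof -
  have "0 \<le> (norm (u + w))\<^sup>2" by simp
  then show ?thesis by (simp add: power2_norm_eq_inner inner_add_left inner_add_right inner_diff_left inner_diff_right inner_commute)
qed

lemma L2_on_diff:
  assumes "L2_on U f" "L2_on U g" shows "L2_on U (\<lambda>x. f x - g x)"
proof -
  have m: "(\<lambda>x. indicat_real U x *\<^sub>R f x) \<in> borel_measurable lborel" "(\<lambda>x. indicat_real U x *\<^sub>R g x) \<in> borel_measurable lborel"
    using assms by (auto simp: L2_on_def set_borel_measurable_def)
  have i: "integrable lborel (\<lambda>x. indicat_real U x *\<^sub>R (norm (f x))\<^sup>2)" "integrable lborel (\<lambda>x. indicat_real U x *\<^sub>R (norm (g x))\<^sup>2)"
    using assms by (auto simp: L2_on_def set_integrable_def)
  have md: "(\<lambda>x. indicat_real U x *\<^sub>R (f x - g x)) \<in> borel_measurable lborel"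
    using borel_measurable_diff[OF m] by (simp add: scaleR_diff_right)
  have nd: "indicat_real U x *\<^sub>R (norm (f x - g x))\<^sup>2 = (norm (indicat_real U x *\<^sub>R (f x - g x)))\<^sup>2" for x
    by (auto simp: indicator_def)
  have "integrable lborel (\<lambda>x. indicat_real U x *\<^sub>R (norm (f x - g x))\<^sup>2)"
  proof (rule Bochner_Integration.integrable_bound)
    show "integrable lborel (\<lambda>x. 2 * (indicat_real U x *\<^sub>R (norm (f x))\<^sup>2) + 2 * (indicat_real U x *\<^sub>R (norm (g x))\<^sup>2))"
      using i by simp
    show "(\<lambda>x. indicat_real U x *\<^sub>R (norm (f x - g x))\<^sup>2) \<in> borel_measurable lborel"
      unfolding nd using md by measurable
    show "AE x in lborel. norm (indicat_real U x *\<^sub>R (norm (f x - g x))\<^sup>2) \<le> norm (2 * (indicat_real U x *\<^sub>R (norm (f x))\<^sup>2) + 2 * (indicat_real U x *\<^sub>R (norm (g x))\<^sup>2))"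
    proof (rule AE_I2)
      fix x
      have "0 \<le> 2 * (norm (f x))\<^sup>2 + 2 * (norm (g x))\<^sup>2" by simp
      then show "norm (indicat_real U x *\<^sub>R (norm (f x - g x))\<^sup>2) \<le> norm (2 * (indicat_real U x *\<^sub>R (norm (f x))\<^sup>2) + 2 * (indicat_real U x *\<^sub>R (norm (g x))\<^sup>2))"
        using norm_diff_sq_le[of "f x" "g x"] by (auto simp: indicator_def)
    qed
  qed
  then show ?thesis using md by (simp add: L2_on_def set_borel_measurable_def set_integrable_def)
qed

lemma L2_on_subset: assumes "L2_on U f" "V \<subseteq> U" "V \<in> sets borel" shows "L2_on V f"
proof -
  have e: "indicat_real V x *\<^sub>R y = indicat_real V x *\<^sub>R (indicat_real U x *\<^sub>R y)" for x and y :: "'b::real_vector"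
    using assms(2) by (auto simp: indicator_def)
  have M: "(\<lambda>x. indicat_real U x *\<^sub>R f x) \<in> borel_measurable borel" and I: "integrable lborel (\<lambda>x. indicat_real U x *\<^sub>R (norm (f x))\<^sup>2)"
    using assms(1) by (auto simp: L2_on_def set_borel_measurable_def set_integrable_def)
  have "(\<lambda>x. indicat_real V x *\<^sub>R (indicat_real U x *\<^sub>R f x)) \<in> borel_measurable borel"
    by (rule borel_measurable_scaleR[OF borel_measurable_indicator[OF assms(3)] M])
  moreover have "integrable lborel (\<lambda>x. indicat_real V x *\<^sub>R (indicat_real U x *\<^sub>R (norm (f x))\<^sup>2))"
    by (rule integrable_mult_indicator[OF _ I]) (use assms(3) in simp)
  ultimately show ?thesis
    unfolding L2_on_def set_borel_measurable_def set_integrable_def e[symmetric] by simp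
qed

lemma weak_deriv_on_diff:
  assumes f: "weak_deriv_on U f f'" "L2_on U f" "L2_on U f'" and g: "weak_deriv_on U g g'" "L2_on U g" "L2_on U g'"
  shows "weak_deriv_on U (\<lambda>x. f x - g x) (\<lambda>x. f' x - g' x)"
  unfolding weak_deriv_on_def
proof (intro allI impI)
  fix \<xi> assume xi: "testfun1 U \<xi>"
  note t = testfun1_facts[OF xi]
  obtain L where L: "0 < L" "\<And>x. x \<notin> {-L..L} \<Longrightarrow> \<xi> x = 0" "\<And>x. x \<notin> {-L..L} \<Longrightarrow> deriv \<xi> x = 0" using t(6) by blast
  have i: "integrable lborel (\<lambda>x. \<xi> x *\<^sub>R F x)" "integrable lborel (\<lambda>x. deriv \<xi> x *\<^sub>R F x)" if "L2_on U F" for F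
    by (rule L2_prod(1)[OF that t(1) L(2) t(4)]; assumption) (rule L2_prod(1)[OF that t(2) L(3) t(5)]; assumption)
  show "(LINT x|lborel. deriv \<xi> x *\<^sub>R (f x - g x)) = - (LINT x|lborel. \<xi> x *\<^sub>R (f' x - g' x))"
    using f(1) g(1) xi i(2)[OF f(2)] i(2)[OF g(2)] i(1)[OF f(3)] i(1)[OF g(3)]
    by (simp add: weak_deriv_on_def scaleR_diff_right)
qed

lemma weak_deriv_on_subset: "weak_deriv_on U f g \<Longrightarrow> V \<subseteq> U \<Longrightarrow> weak_deriv_on V f g"
  unfolding weak_deriv_on_def using testfun1_mono by blast

text \<open>All that is known about the chosen \<open>wderiv\<close>. Instead of identifying it,
  later proofs bound its norm through pairings with test functions.\<close>

lemma wderiv_props: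
  assumes "H1_on U f" shows "L2_on U (wderiv U f)" "weak_deriv_on U f (wderiv U f)"
proof -
  have "L2_on U (wderiv U f) \<and> weak_deriv_on U f (wderiv U f)"
    unfolding wderiv_def using assms someI_ex[of "\<lambda>g. L2_on U g \<and> weak_deriv_on U f g"] by (simp add: H1_on_def)
  then show "L2_on U (wderiv U f)" "weak_deriv_on U f (wderiv U f)" by auto
qed

lemma H1_on_diff: assumes "H1_on U f" "H1_on U g" shows "H1_on U (\<lambda>x. f x - g x)"
proof -
  have "L2_on U f" "L2_on U g" using assms by (auto simp: H1_on_def)
  with wderiv_props[OF assms(1)] wderiv_props[OF assms(2)] show ?thesis
    unfolding H1_on_def by (blast intro: L2_on_diff weak_deriv_on_diff)
qed

lemma H1_on_subset: "H1_on U f \<Longrightarrow> V \<subseteq> U \<Longrightarrow> V \<in> sets borel \<Longrightarrow> H1_on V f"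
  unfolding H1_on_def using L2_on_subset weak_deriv_on_subset by blast

lemma H1norm_on_ge:
  shows "sqrt (LINT x:U|lborel. (norm (f x))\<^sup>2) \<le> H1norm_on U f" "sqrt (LINT x:U|lborel. (norm (wderiv U f x))\<^sup>2) \<le> H1norm_on U f"
    and "0 \<le> H1norm_on U f"
proof -
  have "0 \<le> (LINT x:U|lborel. (norm (g x))\<^sup>2)" for g :: "real \<Rightarrow> complex^2"
    unfolding set_lebesgue_integral_def by (rule integral_nonneg_AE) auto
  then show "sqrt (LINT x:U|lborel. (norm (f x))\<^sup>2) \<le> H1norm_on U f" "sqrt (LINT x:U|lborel. (norm (wderiv U f x))\<^sup>2) \<le> H1norm_on U f"
     "0 \<le> H1norm_on U f"
    unfolding H1norm_on_def by (auto intro!: real_sqrt_le_mono real_sqrt_ge_zero add_nonneg_nonneg)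
qed

subsection \<open>Solutions mollified in time\<close>

lemma bounded_linear_axis: "bounded_linear (axis j :: complex \<Rightarrow> complex^2)"
  unfolding linear_conv_bounded_linear[symmetric] by (rule linearI) (auto simp: axis_def vec_eq_iff)

lemma vec2_axis: "vec2 u w = axis 1 u + axis 2 w"
  by (simp add: vec_eq_iff forall_2 axis_def)

lemma vec2_eta: "vec2 (z $ 1) (z $ 2) = z"
  by (simp add: vec_eq_iff forall_2)

lemma inner_vec2: "(z::complex^2) \<bullet> z = z $ 1 \<bullet> z $ 1 + z $ 2 \<bullet> z $ 2"
  by (simp add: inner_vec_def sum_2)

lemma vec2_diff: "vec2 u w - vec2 u' w' = vec2 (u - u') (w - w')"
  by (simp add: vec_eq_iff forall_2)

lemma continuous_on_vec2: "continuous_on A f \<Longrightarrow> continuous_on A h \<Longrightarrow> continuous_on A (\<lambda>x. vec2 (f x) (h x))"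
  unfolding vec2_axis by (intro continuous_on_add bounded_linear.continuous_on[OF bounded_linear_axis])

lemma has_vector_derivative_vec2:
  "(f has_vector_derivative f') F \<Longrightarrow> (h has_vector_derivative h') F \<Longrightarrow> ((\<lambda>x. vec2 (f x) (h x)) has_vector_derivative vec2 f' h') F"
  unfolding vec2_axis by (intro has_vector_derivative_add bounded_linear.has_vector_derivative[OF bounded_linear_axis])

lemma conv_nth:
  fixes F :: "real \<Rightarrow> complex^2"
  assumes "continuous_on UNIV \<theta>" "continuous_on UNIV F"
  shows "conv \<theta> F t $ j = conv \<theta> (\<lambda>s. F s $ j) t"
  using integral_linear[OF conv_integrable[OF assms, of t "-1" 1] bounded_linear_vec_nth[of j]]
  by (simp add: conv_def o_def)

lemma conv_kernel_diff:
  fixes F :: "real \<Rightarrow> 'a::euclidean_space"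
  assumes "continuous_on UNIV \<theta>" "continuous_on UNIV \<eta>" "continuous_on UNIV F"
  shows "conv (\<lambda>u. \<theta> u - \<eta> u) F t = conv \<theta> F t - conv \<eta> F t"
  unfolding conv_def scaleR_diff_left
  by (rule integral_diff) (intro conv_integrable assms)+

text \<open>Cauchy-Schwarz on [-1, 1], an interval of length 2. A is the mean of |F|, and
  nonnegativity of the variance gives 2 A^2 \<le> \<integral> |F|^2.\<close>

lemma conv_square_le:
  fixes F :: "real \<Rightarrow> 'a::euclidean_space"
  assumes \<theta>: "continuous_on UNIV \<theta>" "\<And>u. u \<in> {-1..1} \<Longrightarrow> \<bar>\<theta> u\<bar> \<le> K" and F: "continuous_on UNIV F"
  shows "sqn (conv \<theta> F t) \<le> 2 * K\<^sup>2 * integral {-1..1} (\<lambda>u. sqn (F (t - u)))"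
proof -
  have Fc: "continuous_on {-1..1} (\<lambda>u. F (t - u))"
    by (rule continuous_on_compose2[OF F]) (auto intro: continuous_intros)
  define A where "A = integral {-1..1} (\<lambda>u. norm (F (t - u))) / 2"
  have K: "0 \<le> K" using \<theta>(2)[of 0] by auto
  have "norm (conv \<theta> F t) \<le> integral {-1..1} (\<lambda>u. K * norm (F (t - u)))"
    unfolding conv_def
  proof (rule integral_norm_bound_integral)
    fix u :: real assume "u \<in> {-1..1}"
    then show "norm (\<theta> u *\<^sub>R F (t - u)) \<le> K * norm (F (t - u))"
      using \<theta>(2) by (auto intro: mult_right_mono)
  qed (intro conv_integrable \<theta>(1) F integrable_continuous_real continuous_intros Fc)+
  then have 1: "norm (conv \<theta> F t) \<le> K * (2 * A)" by (simp add: A_def)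
  have "((\<lambda>u. sqn (F (t - u)) - 2 * A * norm (F (t - u)) + A\<^sup>2) has_integral
      integral {-1..1} (\<lambda>u. sqn (F (t - u))) - 2 * A * (2 * A) + 2 * A\<^sup>2) {-1..1}"
  proof (intro has_integral_add has_integral_diff has_integral_mult_right)
    show "((\<lambda>u. sqn (F (t - u))) has_integral integral {-1..1} (\<lambda>u. sqn (F (t - u)))) {-1..1}"
      by (intro integrable_integral integrable_continuous_real continuous_intros Fc)
    have "((\<lambda>u. norm (F (t - u))) has_integral integral {-1..1} (\<lambda>u. norm (F (t - u)))) {-1..1}"
      by (intro integrable_integral integrable_continuous_real continuous_intros Fc)
    then show "((\<lambda>u. norm (F (t - u))) has_integral 2 * A) {-1..1}" by (simp add: A_def)
    show "((\<lambda>u. A\<^sup>2) has_integral 2 * A\<^sup>2) {-1..1::real}" using has_integral_const_real[of "A\<^sup>2" "-1" 1] by simp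
  qed
  then have "0 \<le> integral {-1..1} (\<lambda>u. sqn (F (t - u))) - 2 * A * (2 * A) + 2 * A\<^sup>2"
  proof (rule has_integral_nonneg)
    fix u
    have "0 \<le> (norm (F (t - u)) - A)\<^sup>2" by simp
    then show "0 \<le> sqn (F (t - u)) - 2 * A * norm (F (t - u)) + A\<^sup>2"
      by (simp add: power2_norm_eq_inner[symmetric] power2_eq_square algebra_simps)
  qed
  then have 2: "2 * A\<^sup>2 \<le> integral {-1..1} (\<lambda>u. sqn (F (t - u)))" by (simp add: power2_eq_square)
  have "sqn (conv \<theta> F t) = (norm (conv \<theta> F t))\<^sup>2" by (simp add: power2_norm_eq_inner)
  also have "\<dots> \<le> (K * (2 * A))\<^sup>2" using 1 by (intro power_mono) auto
  also have "\<dots> = 2 * K\<^sup>2 * (2 * A\<^sup>2)" by (simp add: power2_eq_square)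
  also have "\<dots> \<le> 2 * K\<^sup>2 * integral {-1..1} (\<lambda>u. sqn (F (t - u)))" using 2 by (intro mult_left_mono) auto
  finally show ?thesis .
qed

text \<open>Continuity of t \<mapsto> \<psi>(t) in H^1 provides bounds only near each t0; finitely
  many of these neighbourhoods suffice, and the sum of their bounds serves for all.\<close>

lemma compact_locally_bounded:
  fixes n :: "real \<Rightarrow> real"
  assumes "compact K" and "\<And>t0. \<exists>d>0. \<exists>B. \<forall>t. dist t t0 < d \<longrightarrow> n t \<le> B"
  shows "\<exists>B. \<forall>t\<in>K. n t \<le> B"
proof -
  obtain d B where d: "\<And>t0. 0 < d t0" "\<And>t0 t. dist t t0 < d t0 \<Longrightarrow> n t \<le> B t0" using assms(2) by metis
  have "K \<subseteq> (\<Union>t0\<in>K. ball t0 (d t0))" using d(1) by auto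
  then obtain C where C: "C \<subseteq> K" "finite C" "K \<subseteq> (\<Union>t0\<in>C. ball t0 (d t0))"
    using compactE_image[OF assms(1), of K "\<lambda>t0. ball t0 (d t0)"] by (metis open_ball)
  have "n t \<le> (\<Sum>t0\<in>C. \<bar>B t0\<bar>)" if "t \<in> K" for t
  proof -
    obtain t0 where t0: "t0 \<in> C" "t \<in> ball t0 (d t0)" using C(3) \<open>t \<in> K\<close> by blast
    then have t0: "t0 \<in> C" "dist t t0 < d t0" by (simp_all add: dist_commute)
    have "n t \<le> \<bar>B t0\<bar>" using d(2)[OF t0(2)] by linarith
    also have "\<dots> \<le> (\<Sum>t0\<in>C. \<bar>B t0\<bar>)" using C(2) t0(1) by (intro member_le_sum) auto
    finally show ?thesis .
  qed
  then show ?thesis by blast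
qed

lemma LINT_mono_set:
  fixes F :: "real \<Rightarrow> complex^2"
  assumes "L2_on UNIV F" "V \<in> sets borel"
  shows "(LINT x:V|lborel. (norm (F x))\<^sup>2) \<le> (LINT x:UNIV|lborel. (norm (F x))\<^sup>2)"
  unfolding set_lebesgue_integral_def
  by (rule integral_mono') (use assms in \<open>auto simp: L2_on_def set_integrable_def indicator_def\<close>)

context solution
begin

lemma psi_slice: "continuous_on A (\<lambda>x. \<psi> x t)" "continuous_on A (\<lambda>t. \<psi> x t)"
  using continuous_on_slice1[of UNIV \<psi> t] continuous_on_slice2[of UNIV \<psi> x A] psi_cont
  by (auto intro: continuous_on_subset)

lemma psi_H1: "H1_on UNIV (\<lambda>x. \<psi> x t)"
  and psi_tendsto: "((\<lambda>t. H1norm_on UNIV (\<lambda>x. \<psi> x t - \<psi> x t0)) \<longlongrightarrow> 0) (at t0)"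
  using sol by (auto simp: is_solution_def)

lemma psi_diff_H1: "H1_on UNIV (\<lambda>x. \<psi> x t - \<psi> x t0)"
  by (rule H1_on_diff[OF psi_H1 psi_H1])

text \<open>At \<open>t = t0\<close> this is not immediate, since \<open>wderiv\<close> of the zero function is an arbitrary choice among its weak derivatives.\<close>
lemma psi_close: assumes "0 < e" shows "\<exists>d>0. \<forall>t. dist t t0 < d \<longrightarrow> H1norm_on UNIV (\<lambda>x. \<psi> x t - \<psi> x t0) < e"
proof -
  obtain d where d: "0 < d" "\<And>t. t \<noteq> t0 \<Longrightarrow> dist t t0 < d \<Longrightarrow> dist (H1norm_on UNIV (\<lambda>x. \<psi> x t - \<psi> x t0)) 0 < e"
    using tendstoD[OF psi_tendsto[of t0] assms] unfolding eventually_at by auto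
  have "H1norm_on UNIV (\<lambda>x. \<psi> x t0 - \<psi> x t0) < e"
  proof -
    define W where "W = wderiv UNIV (\<lambda>x. \<psi> x t0 - \<psi> x t0)"
    have W: "L2_on UNIV W" "weak_deriv_on UNIV (\<lambda>x. \<psi> x t0 - \<psi> x t0) W" unfolding W_def by (rule wderiv_props[OF psi_diff_H1])+
    have z: "(LINT x:{-real n<..<real n}|lborel. (norm (W x))\<^sup>2) \<le> 0" if n: "0 < n" for n
    proof -
      have "(LINT x:{-real n<..<real n}|lborel. (norm (W x))\<^sup>2) \<le> 4 * 0\<^sup>2"
      proof (rule L2_duality)
        show "L2_on {-real n<..<real n} W" by (rule L2_on_subset[OF W(1)]) auto
        fix \<xi> assume "testfun1 {-real n<..<real n} \<xi>"
        then have "testfun1 UNIV \<xi>" by (rule testfun1_mono) auto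
        then have "(LINT x|lborel. \<xi> x *\<^sub>R W x) = 0" using W(2) by (simp add: weak_deriv_on_def)
        then show "norm (LINT x|lborel. \<xi> x *\<^sub>R W x) \<le> 0 * sqrt (LINT x|lborel. (\<xi> x)\<^sup>2)" by simp
      qed (use n in auto)
      then show ?thesis by simp
    qed
    have iW: "integrable lborel (\<lambda>x. (norm (W x))\<^sup>2)" using W(1) by (simp add: L2_on_def set_integrable_def)
    have "(\<lambda>n. LINT x:{-real n<..<real n}|lborel. (norm (W x))\<^sup>2) \<longlonglongrightarrow> (LINT x|lborel. (norm (W x))\<^sup>2)"
      unfolding set_lebesgue_integral_def
    proof (rule integral_dominated_convergence[where w = "\<lambda>x. (norm (W x))\<^sup>2"])
      show "AE x in lborel. (\<lambda>n. indicat_real {- real n<..<real n} x *\<^sub>R (norm (W x))\<^sup>2) \<longlonglongrightarrow> (norm (W x))\<^sup>2"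
      proof (rule AE_I2)
        fix x
        obtain n0 where n0: "\<bar>x\<bar> < real n0" using reals_Archimedean2 by blast
        show "(\<lambda>n. indicat_real {- real n<..<real n} x *\<^sub>R (norm (W x))\<^sup>2) \<longlonglongrightarrow> (norm (W x))\<^sup>2"
          by (rule tendsto_eventually) (use n0 in \<open>auto simp: eventually_sequentially indicator_def abs_less_iff intro!: exI[of _ n0]\<close>)
      qed
      show "AE x in lborel. norm (indicat_real {- real n<..<real n} x *\<^sub>R (norm (W x))\<^sup>2) \<le> (norm (W x))\<^sup>2" for n
        by (auto simp: indicator_def)
    qed (use iW in \<open>auto intro!: borel_measurable_scaleR dest: borel_measurable_integrable\<close>)
    then have "(LINT x|lborel. (norm (W x))\<^sup>2) \<le> 0"
      by (rule LIMSEQ_le_const2) (use z in \<open>auto intro!: exI[of _ 1]\<close>)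
    then have "H1norm_on UNIV (\<lambda>x. \<psi> x t0 - \<psi> x t0) \<le> 0"
      unfolding H1norm_on_def W_def[symmetric] by (simp add: set_lebesgue_integral_def)
    then show ?thesis using assms by linarith
  qed
  then have "H1norm_on UNIV (\<lambda>x. \<psi> x t - \<psi> x t0) < e" if "dist t t0 < d" for t
    using d(2)[of t] that by (cases "t = t0") (auto simp: abs_less_iff)
  then show ?thesis using d(1) by blast
qed

lemma psi_L2_diff: "(LINT x:UNIV|lborel. (norm (\<psi> x t - \<psi> x t0))\<^sup>2) \<le> (H1norm_on UNIV (\<lambda>x. \<psi> x t - \<psi> x t0))\<^sup>2"
  using H1norm_on_ge(1)[of UNIV "\<lambda>x. \<psi> x t - \<psi> x t0"] H1norm_on_ge(3)[of UNIV "\<lambda>x. \<psi> x t - \<psi> x t0"]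
  by (simp add: sqrt_le_D)

lemma psi_L2_bound: "\<exists>B. \<forall>t\<in>{-T..T}. \<forall>X\<ge>0. integral {-X..X} (\<lambda>x. sqn (\<psi> x t)) \<le> B"
proof -
  define n where "n t = (LINT x:UNIV|lborel. (norm (\<psi> x t))\<^sup>2)" for t
  have "\<exists>B. \<forall>t\<in>{-T..T}. n t \<le> B"
  proof (rule compact_locally_bounded)
    fix t0
    obtain d where d: "0 < d" "\<And>t. dist t t0 < d \<Longrightarrow> H1norm_on UNIV (\<lambda>x. \<psi> x t - \<psi> x t0) < 1"
      using psi_close[of 1 t0] by auto
    have "n t \<le> 2 * 1 + 2 * n t0" if t: "dist t t0 < d" for t
    proof -
      have i: "integrable lborel (\<lambda>x. (norm (\<psi> x t - \<psi> x t0))\<^sup>2)" "integrable lborel (\<lambda>x. (norm (\<psi> x t0))\<^sup>2)" "integrable lborel (\<lambda>x. (norm (\<psi> x t))\<^sup>2)"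
        using psi_diff_H1[of t t0] psi_H1[of t0] psi_H1[of t] by (auto simp: H1_on_def L2_on_def set_integrable_def)
      have nn: "(norm (\<psi> x t))\<^sup>2 \<le> 2 * (norm (\<psi> x t - \<psi> x t0))\<^sup>2 + 2 * (norm (\<psi> x t0))\<^sup>2" for x
        using norm_diff_sq_le[of "\<psi> x t - \<psi> x t0" "- \<psi> x t0"] by simp
      have "n t \<le> (LINT x|lborel. 2 * (norm (\<psi> x t - \<psi> x t0))\<^sup>2 + 2 * (norm (\<psi> x t0))\<^sup>2)"
        unfolding n_def set_lebesgue_integral_def using i nn
        by (intro integral_mono) auto
      also have "\<dots> = 2 * (LINT x|lborel. (norm (\<psi> x t - \<psi> x t0))\<^sup>2) + 2 * n t0"
        using i by (simp add: n_def set_lebesgue_integral_def)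
      also have "(LINT x|lborel. (norm (\<psi> x t - \<psi> x t0))\<^sup>2) \<le> 1\<^sup>2"
        using psi_L2_diff[of t t0] power_mono[OF less_imp_le[OF d(2)[OF t]] H1norm_on_ge(3), of 2] by (simp add: set_lebesgue_integral_def)
      finally show ?thesis by simp
    qed
    then show "\<exists>d>0. \<exists>B. \<forall>t. dist t t0 < d \<longrightarrow> n t \<le> B" using d(1) by blast
  qed auto
  then obtain B where B: "\<And>t. t \<in> {-T..T} \<Longrightarrow> n t \<le> B" by blast
  have "integral {-X..X} (\<lambda>x. sqn (\<psi> x t)) \<le> n t" for t X
    unfolding n_def piecewise_cont_square(2)[OF piecewise_cont_continuous[OF psi_slice(1)], symmetric]
    by (rule LINT_mono_set) (use psi_H1[of t] in \<open>auto simp: H1_on_def\<close>)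
  then show ?thesis using B by (meson order_trans)
qed

lemma conv_L2_bound:
  assumes E: "smooth_kernel E"
  shows "\<exists>B. \<forall>t\<in>{-T..T}. \<forall>X\<ge>0. integral {-X..X} (\<lambda>x. sqn (conv (E k) (\<psi> x) t)) \<le> B"
proof -
  have "bounded (E k ` {-1..1})"
    by (intro compact_imp_bounded compact_continuous_image kernel_cont[OF E] compact_Icc)
  then obtain K where K: "\<And>u. u \<in> {-1..1} \<Longrightarrow> \<bar>E k u\<bar> \<le> K" unfolding bounded_iff real_norm_def by blast
  \<comment> \<open>Through the kernel a time in [-T, T] sees \<psi> at times up to distance
    1.\<close>
  obtain B where B: "\<And>t X. t \<in> {-(T+1)..T+1} \<Longrightarrow> 0 \<le> X \<Longrightarrow> integral {-X..X} (\<lambda>x. sqn (\<psi> x t)) \<le> B"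
    using psi_L2_bound[of "T+1"] by blast
  have cc: "continuous_on (UNIV \<times> UNIV) (\<lambda>p. conv (E k) (\<psi> (fst p)) (snd p))"
    by (rule conv_continuous[OF kernel_cont[OF E]]) (use psi_cont in simp)
  have "integral {-X..X} (\<lambda>x. sqn (conv (E k) (\<psi> x) t)) \<le> 2 * K\<^sup>2 * (2 * B)" if t: "t \<in> {-T..T}" and X: "0 \<le> X" for t X
  proof -
    have c2: "continuous_on (UNIV \<times> UNIV) (\<lambda>p. sqn (\<psi> (fst p) (t - snd p)))"
    proof -
      have "continuous_on UNIV (\<lambda>p::real\<times>real. (fst p, t - snd p))" by (intro continuous_intros)
      from continuous_on_compose2[OF psi_cont this] have "continuous_on UNIV (\<lambda>p. \<psi> (fst p) (t - snd p))" by simp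
      then show ?thesis by (auto intro!: continuous_intros)
    qed
    have "integral {-X..X} (\<lambda>x. sqn (conv (E k) (\<psi> x) t)) \<le> integral {-X..X} (\<lambda>x. 2 * K\<^sup>2 * integral {-1..1} (\<lambda>u. sqn (\<psi> x (t - u))))"
    proof (rule integral_le)
      show "(\<lambda>x. sqn (conv (E k) (\<psi> x) t)) integrable_on {-X..X}"
        by (intro integrable_continuous_real continuous_intros continuous_on_subset[OF continuous_on_slice1[OF cc]]) auto
      show "(\<lambda>x. 2 * K\<^sup>2 * integral {-1..1} (\<lambda>u. sqn (\<psi> x (t - u)))) integrable_on {-X..X}"
        by (intro integrable_continuous_real continuous_intros continuous_on_subset[OF continuous_on_integral_slice2[OF c2]]) auto
      show "sqn (conv (E k) (\<psi> x) t) \<le> 2 * K\<^sup>2 * integral {-1..1} (\<lambda>u. sqn (\<psi> x (t - u)))" for x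
        by (rule conv_square_le[OF kernel_cont[OF E] K psi_slice(2)])
    qed
    also have "\<dots> = 2 * K\<^sup>2 * integral {-X..X} (\<lambda>x. integral {-1..1} (\<lambda>u. sqn (\<psi> x (t - u))))" by simp
    also have "integral {-X..X} (\<lambda>x. integral {-1..1} (\<lambda>u. sqn (\<psi> x (t - u))))
       = integral {-1..1} (\<lambda>u. integral {-X..X} (\<lambda>x. sqn (\<psi> x (t - u))))"
      by (rule integral_swap_slice[OF c2]) auto
    also have "2 * K\<^sup>2 * \<dots> \<le> 2 * K\<^sup>2 * integral {-1..1::real} (\<lambda>u. B)"
    proof (intro mult_left_mono integral_le)
      show "(\<lambda>u. integral {-X..X} (\<lambda>x. sqn (\<psi> x (t - u)))) integrable_on {-1..1}"
        by (intro integrable_continuous_real continuous_on_integral_slice[OF c2]) auto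
      fix u :: real assume "u \<in> {-1..1}"
      then show "integral {-X..X} (\<lambda>x. sqn (\<psi> x (t - u))) \<le> B" using t X by (intro B) auto
    qed auto
    finally show ?thesis by simp
  qed
  then show ?thesis by blast
qed

definition mf where "mf E k x t = conv (E k) (\<lambda>t. \<psi> x t $ 1) t" for E :: "nat \<Rightarrow> real \<Rightarrow> real"
definition mh where "mh E k x t = conv (E k) (\<lambda>t. \<psi> x t $ 2) t" for E :: "nat \<Rightarrow> real \<Rightarrow> real"

lemma vec2_mf_mh: "smooth_kernel E \<Longrightarrow> vec2 (mf E k x t) (mh E k x t) = conv (E k) (\<psi> x) t"
  unfolding mf_def mh_def conv_nth[OF kernel_cont psi_slice(2), symmetric] by (rule vec2_eta)

lemma dirac_mollified:
  assumes "a1 < 2 * m" "a2 < 2 * m" and E: "smooth_kernel E"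
  shows "dirac m a1 a2 \<i> (mf E) (mh E)"
proof
  fix k :: nat and x t :: real
  show "continuous_on UNIV (\<lambda>p. mf E k (fst p) (snd p))"
    using conv_continuous[OF kernel_cont[OF E] psi_nth_cont, of k 1] by (simp add: mf_def)
  show "continuous_on UNIV (\<lambda>p. mh E k (fst p) (snd p))"
    using conv_continuous[OF kernel_cont[OF E] psi_nth_cont, of k 2] by (simp add: mh_def)
  show "((\<lambda>t. mf E k x t) has_vector_derivative mf E (Suc k) x t) (at t)"
    using conv_deriv[OF E continuous_on_slice2[OF psi_nth_cont UNIV_I], of k x 1 t] by (simp add: mf_def[abs_def])
  show "((\<lambda>t. mh E k x t) has_vector_derivative mh E (Suc k) x t) (at t)"
    using conv_deriv[OF E continuous_on_slice2[OF psi_nth_cont UNIV_I], of k x 2 t] by (simp add: mh_def[abs_def])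
  show "((\<lambda>x. mf E k x t - of_real (green m x * a1) * mf E k 0 t) has_vector_derivative
        - \<i> * mh E (Suc k) x t - of_real m * (mh E k x t - of_real (green m x * a2) * mh E k 0 t)) (at x)"
    using mollified_equation(1)[OF E, of k t x] unfolding conv_Y[OF E] mf_def mh_def .
  show "((\<lambda>x. mh E k x t - of_real (green m x * a2) * mh E k 0 t) has_vector_derivative
        \<i> * mf E (Suc k) x t - of_real m * (mf E k x t - of_real (green m x * a1) * mf E k 0 t)) (at x)"
    using mollified_equation(2)[OF E, of k t x] unfolding conv_Y[OF E] mf_def mh_def .
next
  fix k T
  have "sqn (mf E k x t) + sqn (mh E k x t) = sqn (conv (E k) (\<psi> x) t)" for x t
    unfolding vec2_mf_mh[OF E, symmetric] inner_vec2 by simp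
  then show "\<exists>B. \<forall>t\<in>{-T..T}. \<forall>X\<ge>0. integral {-X..X} (\<lambda>x. sqn (mf E k x t) + sqn (mh E k x t)) \<le> B"
    using conv_L2_bound[OF E, of T k] by simp
qed (use m assms in auto)

text \<open>Pairing in x commutes with mollification in t. A statement about the mollified solution
  becomes one about the continuous vector-valued function s \<mapsto> \<integral> \<zeta>
  \<psi>(s).\<close>

lemma LINT_conv:
  assumes E: "smooth_kernel E" and z: "continuous_on UNIV \<zeta>" "\<And>x. x \<notin> {-L..L} \<Longrightarrow> \<zeta> x = 0"
  shows "(LINT x|lborel. \<zeta> x *\<^sub>R conv (E k) (\<psi> x) t) = conv (E k) (\<lambda>s. LINT x|lborel. \<zeta> x *\<^sub>R \<psi> x s) t"
    and "continuous_on UNIV (\<lambda>s. LINT x|lborel. \<zeta> x *\<^sub>R \<psi> x s)"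
proof -
  have J: "(LINT x|lborel. \<zeta> x *\<^sub>R \<psi> x s) = integral (cbox (-L) L) (\<lambda>x. \<zeta> x *\<^sub>R \<psi> x s)" for s
    unfolding cbox_interval by (rule LINT_eq_integral) (use z in \<open>auto intro!: continuous_intros psi_slice\<close>)
  have zc: "continuous_on A (\<lambda>p. \<zeta> (g p))" if "continuous_on A g" for A and g :: "'z::topological_space \<Rightarrow> real"
    by (rule continuous_on_compose2[OF z(1) that]) simp
  have pc: "continuous_on A (\<lambda>p. \<psi> (g p) (h p))" if "continuous_on A g" "continuous_on A h" for A and g h :: "'z::topological_space \<Rightarrow> real"
    using continuous_on_compose2[OF psi_cont continuous_on_Pair[OF that]] by simp
  show "continuous_on UNIV (\<lambda>s. LINT x|lborel. \<zeta> x *\<^sub>R \<psi> x s)"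
    unfolding J
    by (rule integral_continuous_on_param) (auto simp: split_beta intro!: continuous_intros zc pc)
  have cc: "continuous_on (UNIV \<times> UNIV) (\<lambda>p. conv (E k) (\<psi> (fst p)) (snd p))"
    by (rule conv_continuous[OF kernel_cont[OF E]]) (use psi_cont in simp)
  have "(LINT x|lborel. \<zeta> x *\<^sub>R conv (E k) (\<psi> x) t) = integral (cbox (-L) L) (\<lambda>x. \<zeta> x *\<^sub>R conv (E k) (\<psi> x) t)"
    unfolding cbox_interval by (rule LINT_eq_integral) (use z continuous_on_slice1[OF cc] in \<open>auto intro!: continuous_intros\<close>)
  also have "\<dots> = integral (cbox (-L) L) (\<lambda>x. integral (cbox (-1) 1) (\<lambda>u. \<zeta> x *\<^sub>R E k u *\<^sub>R \<psi> x (t - u)))"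
    unfolding conv_def cbox_interval integral_cmul ..
  also have "\<dots> = integral (cbox (-1) 1) (\<lambda>u. integral (cbox (-L) L) (\<lambda>x. \<zeta> x *\<^sub>R E k u *\<^sub>R \<psi> x (t - u)))"
    by (rule integral_swap_continuous)
      (auto simp: split_beta intro!: continuous_intros zc pc continuous_on_compose2[OF kernel_cont[OF E, of UNIV]])
  also have "\<dots> = integral (cbox (-1) 1) (\<lambda>u. E k u *\<^sub>R integral (cbox (-L) L) (\<lambda>x. \<zeta> x *\<^sub>R \<psi> x (t - u)))"
    unfolding scaleR_left_commute[of "\<zeta> x" for x] integral_cmul ..
  also have "\<dots> = conv (E k) (\<lambda>s. LINT x|lborel. \<zeta> x *\<^sub>R \<psi> x s) t"
    unfolding J by (simp add: conv_def cbox_interval)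
  finally show "(LINT x|lborel. \<zeta> x *\<^sub>R conv (E k) (\<psi> x) t) = conv (E k) (\<lambda>s. LINT x|lborel. \<zeta> x *\<^sub>R \<psi> x s) t" .
qed

end

subsection \<open>Convergence to the solitary manifold\<close>

lemma continuous_glue_0:
  fixes F P Q :: "real \<Rightarrow> 'a::topological_space"
  assumes "continuous_on UNIV P" "continuous_on UNIV Q" "P 0 = Q 0"
    and "\<And>x. 0 \<le> x \<Longrightarrow> F x = P x" "\<And>x. x \<le> 0 \<Longrightarrow> F x = Q x"
  shows "continuous_on UNIV F"
proof -
  have "continuous_on ({0..} \<union> {..0}) F"
  proof (rule continuous_on_closed_Un)
    show "continuous_on {0..} F" using continuous_on_subset[OF assms(1)] assms(4) by (subst continuous_on_cong[OF refl, of _ _ P]) auto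
    show "continuous_on {..0} F" using continuous_on_subset[OF assms(2)] assms(5) by (subst continuous_on_cong[OF refl, of _ _ Q]) auto
  qed auto
  also have "{0..} \<union> {..0} = (UNIV :: real set)" by auto
  finally show ?thesis .
qed

lemma has_vector_derivative_glue:
  fixes F P Q :: "real \<Rightarrow> 'a::real_normed_vector"
  assumes "0 < x \<Longrightarrow> (P has_vector_derivative D) (at x)" "x < 0 \<Longrightarrow> (Q has_vector_derivative D) (at x)" "x \<noteq> 0"
    and "\<And>x. 0 < x \<Longrightarrow> F x = P x" "\<And>x. x < 0 \<Longrightarrow> F x = Q x"
  shows "(F has_vector_derivative D) (at x)"
proof (cases "0 < x")
  case True
  show ?thesis
    by (rule has_vector_derivative_transform_within_open[OF assms(1)[OF True], of "{0<..}"]) (use True assms(4) in auto)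
next
  case False
  then have "x < 0" using assms(3) by simp
  show ?thesis
    by (rule has_vector_derivative_transform_within_open[OF assms(2)[OF \<open>x < 0\<close>], of "{..<0}"]) (use \<open>x < 0\<close> assms(5) in auto)
qed

lemma prof_deriv:
  shows "(profU m a has_real_derivative profU' m a x) (at x)" "(profV m a has_real_derivative profV' m a x) (at x)"
proof -
  define w where "w = omega m a 1"
  have e: "((\<lambda>x. exp (- b * x)) has_real_derivative - b * exp (- b * x)) (at x)" for b
    by (auto intro!: derivative_eq_intros)
  define k where "k = kappa m a 1"
  show "(profU m a has_real_derivative profU' m a x) (at x)"
    unfolding profU_def[abs_def] k_def[symmetric] w_def[symmetric]
    by (rule DERIV_cong[OF DERIV_add[OF e DERIV_cdivide[OF DERIV_diff[OF DERIV_cmult[OF e] DERIV_cmult[OF e]]]]])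
      (unfold profU'_def k_def[symmetric] w_def[symmetric], simp add: algebra_simps add_divide_distrib diff_divide_distrib)
  show "(profV m a has_real_derivative profV' m a x) (at x)"
    unfolding profV_def[abs_def] k_def[symmetric] w_def[symmetric]
    by (rule DERIV_cong[OF DERIV_cdivide[OF DERIV_cmult[OF DERIV_diff[OF e e]]]])
      (unfold profV'_def k_def[symmetric] w_def[symmetric], simp add: algebra_simps)
qed

lemma prof_continuous: "continuous_on A (profU m a)" "continuous_on A (profV m a)" "continuous_on A (profU' m a)" "continuous_on A (profV' m a)"
  unfolding profU_def[abs_def] profV_def[abs_def] profU'_def[abs_def] profV'_def[abs_def] divide_inverse
  by (intro continuous_intros)+

text \<open>The functions behind \<open>dirac.attr_f\<close> and \<open>dirac.attr_h\<close> depend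
  on m, a and c only, so the same profiles serve every mollification of a solution.\<close>

definition sol_profile :: "real \<Rightarrow> real \<Rightarrow> real \<Rightarrow> complex \<Rightarrow> complex \<Rightarrow> real \<Rightarrow> complex^2" where
  "sol_profile m a c C1 C2 x = vec2 (dirac.attr_f m a c C1 C2 x) (dirac.attr_h m a c C1 C2 x)"
definition sol_profile' :: "real \<Rightarrow> real \<Rightarrow> real \<Rightarrow> complex \<Rightarrow> complex \<Rightarrow> real \<Rightarrow> complex^2" where
  "sol_profile' m a c C1 C2 x = vec2 (dirac.attr_fx m a c C1 C2 x) (dirac.attr_hx m a c C1 C2 x)"

context dirac
begin

lemma sol_profile_in_Sset: "sol_profile m a c C1 C2 \<in> Sset m a c"
proof -
  have "sol_profile m a c C1 C2 = (\<lambda>x. (if 0 < a then C1 *s u1 m a x else 0) + (if 0 < c then C2 *s u2 m c x else 0))"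
    unfolding sol_profile_def[abs_def] attr_f_def[abs_def] attr_h_def[abs_def] u1_def u2_def Let_def omega_2 kappa_2 profU_def profV_def
    by (intro ext) (simp add: vec_eq_iff forall_2 mult_ac)
  then show ?thesis unfolding Sset_def by blast
qed

lemma sol_profile_facts:
  shows "continuous_on UNIV (sol_profile m a c C1 C2)"
    and "x \<noteq> 0 \<Longrightarrow> (sol_profile m a c C1 C2 has_vector_derivative sol_profile' m a c C1 C2 x) (at x)"
    and "piecewise_cont (sol_profile' m a c C1 C2)"
proof -
  define A where "A = (if 0 < a then C1 else 0)"
  define B where "B = (if 0 < c then C2 else 0)"
  define P where "P x = vec2 (A * of_real (profU m a x) + B * of_real (profV m c x)) (A * of_real (profV m a x) + B * of_real (profU m c x))" for x
  define Q where "Q x = vec2 (A * of_real (profU m a (- x)) - B * of_real (profV m c (- x))) (- A * of_real (profV m a (- x)) + B * of_real (profU m c (- x)))" for x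
  define P' where "P' x = vec2 (A * of_real (profU' m a x) + B * of_real (profV' m c x)) (A * of_real (profV' m a x) + B * of_real (profU' m c x))" for x
  define Q' where "Q' x = vec2 (- A * of_real (profU' m a (- x)) + B * of_real (profV' m c (- x))) (A * of_real (profV' m a (- x)) - B * of_real (profU' m c (- x)))" for x
  \<comment> \<open>The odd profile vanishes at 0, so the two pieces P and Q agree there.\<close>
  have V0: "profV m b 0 = 0" for b by (simp add: profV_def)
  have eq: "sol_profile m a c C1 C2 x = vec2 (A * of_real (profU m a \<bar>x\<bar>) + B * of_real (sgn x * profV m c \<bar>x\<bar>)) (A * of_real (sgn x * profV m a \<bar>x\<bar>) + B * of_real (profU m c \<bar>x\<bar>))" for x
    by (simp add: sol_profile_def attr_f_def attr_h_def A_def B_def)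
  have eq': "sol_profile' m a c C1 C2 x = vec2 (A * of_real (sgn x * profU' m a \<bar>x\<bar>) + B * of_real (profV' m c \<bar>x\<bar>)) (A * of_real (profV' m a \<bar>x\<bar>) + B * of_real (sgn x * profU' m c \<bar>x\<bar>))" for x
    by (simp add: sol_profile'_def attr_fx_def attr_hx_def A_def B_def)
  have pos: "sol_profile m a c C1 C2 x = P x" if "0 \<le> x" for x
    using that V0 unfolding eq P_def by (cases "x = 0") auto
  have neg: "sol_profile m a c C1 C2 x = Q x" if "x \<le> 0" for x
    using that V0 unfolding eq Q_def by (cases "x = 0") auto
  have pos': "sol_profile' m a c C1 C2 x = P' x" if "0 < x" for x using that unfolding eq' P'_def by simp
  have neg': "sol_profile' m a c C1 C2 x = Q' x" if "x < 0" for x using that unfolding eq' Q'_def by simp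
  have cn: "continuous_on UNIV (\<lambda>x. g (- x))" if "continuous_on UNIV g" for g :: "real \<Rightarrow> real"
    by (rule continuous_on_compose2[OF that]) (auto intro: continuous_intros)
  have c: "continuous_on UNIV P" "continuous_on UNIV Q" "continuous_on UNIV P'" "continuous_on UNIV Q'"
    unfolding P_def Q_def P'_def Q'_def
    by (intro continuous_on_vec2 continuous_intros prof_continuous cn[OF prof_continuous(1)] cn[OF prof_continuous(2)] cn[OF prof_continuous(3)] cn[OF prof_continuous(4)])+
  show "continuous_on UNIV (sol_profile m a c C1 C2)"
    by (rule continuous_glue_0[OF c(1,2) _ pos neg]) (simp_all add: P_def Q_def V0)
  show "piecewise_cont (sol_profile' m a c C1 C2)"
    unfolding piecewise_cont_def using c(3,4) pos' neg' by blast
  have D: "((\<lambda>x. complex_of_real (g x)) has_vector_derivative of_real (g' x)) (at x)"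
    "((\<lambda>x. complex_of_real (g (- x))) has_vector_derivative - of_real (g' (- x))) (at x)"
    if g: "\<And>x. (g has_real_derivative g' x) (at x)" for g g' :: "real \<Rightarrow> real" and x
  proof -
    show "((\<lambda>x. complex_of_real (g x)) has_vector_derivative of_real (g' x)) (at x)"
      by (rule has_vector_derivative_of_real[OF g])
    have "((\<lambda>x. - x) has_real_derivative - 1) (at x)" by (auto intro!: derivative_eq_intros)
    from DERIV_chain2[OF g this] have "((\<lambda>x. g (- x)) has_real_derivative - g' (- x)) (at x)" by simp
    from has_vector_derivative_of_real[OF this]
    show "((\<lambda>x. complex_of_real (g (- x))) has_vector_derivative - of_real (g' (- x))) (at x)" by simp
  qed
  assume x: "x \<noteq> 0"
  show "(sol_profile m a c C1 C2 has_vector_derivative sol_profile' m a c C1 C2 x) (at x)"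
  proof (rule has_vector_derivative_glue[of x P _ Q])
    assume "0 < x"
    show "(P has_vector_derivative sol_profile' m a c C1 C2 x) (at x)"
      unfolding pos'[OF \<open>0 < x\<close>] P_def[abs_def] P'_def
      by (intro has_vector_derivative_vec2 has_vector_derivative_add has_vector_derivative_mult_right D(1) prof_deriv)
  next
    assume "x < 0"
    have "(Q has_vector_derivative vec2 (A * - of_real (profU' m a (- x)) - B * - of_real (profV' m c (- x))) (- A * - of_real (profV' m a (- x)) + B * - of_real (profU' m c (- x)))) (at x)"
      unfolding Q_def[abs_def]
      by (intro has_vector_derivative_vec2 has_vector_derivative_add has_vector_derivative_diff has_vector_derivative_mult_right D(2) prof_deriv)
    then show "(Q has_vector_derivative sol_profile' m a c C1 C2 x) (at x)"
      unfolding neg'[OF \<open>x < 0\<close>] Q'_def by simp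
  qed (use x pos neg in auto)
qed

definition vf where "vf t x = vec2 (f 0 x t) (h 0 x t)"
definition vf' where "vf' t x = vec2 (FX 0 x t) (HX 0 x t)"

lemma vf_facts:
  shows "continuous_on UNIV (vf t)" and "x \<noteq> 0 \<Longrightarrow> (vf t has_vector_derivative vf' t x) (at x)" and "piecewise_cont (vf' t)"
proof -
  show "continuous_on UNIV (vf t)" unfolding vf_def[abs_def] by (intro continuous_on_vec2 f_slice h_slice)
  show "x \<noteq> 0 \<Longrightarrow> (vf t has_vector_derivative vf' t x) (at x)"
    unfolding vf_def[abs_def] vf'_def by (intro has_vector_derivative_vec2 f_deriv h_deriv)
  have "continuous_on UNIV (\<lambda>x. vec2 (FXs \<sigma> 0 x t) (HXs \<sigma> 0 x t))" for \<sigma>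
    by (intro continuous_on_vec2 XS_cont)
  then show "piecewise_cont (vf' t)"
    unfolding piecewise_cont_def
    by (intro exI[of _ "\<lambda>x. vec2 (FXs 1 0 x t) (HXs 1 0 x t)"] exI[of _ "\<lambda>x. vec2 (FXs (- 1) 0 x t) (HXs (- 1) 0 x t)"])
      (auto simp: vf'_def FX_def HX_def)
qed

lemma N_eq_vf: "integral {-X..X} (\<lambda>x. N 0 x t) = integral {-X..X} (\<lambda>x. sqn (vf t x)) + integral {-X..X} (\<lambda>x. sqn (vf' t x))"
proof -
  have "N 0 x t = sqn (vf t x) + sqn (vf' t x)" for x
    by (simp add: N_def vf_def vf'_def inner_vec2)
  then show ?thesis
    using integral_add[OF piecewise_cont_square(3)[OF piecewise_cont_continuous[OF vf_facts(1)[of t]]] piecewise_cont_square(3)[OF vf_facts(3)[of t]]] by simp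
qed

text \<open>For the reversed system the sign of \<iota> and the sign of the time derivative cancel,
  so its x-derivatives are those of the original system at time - t.\<close>

lemma reverse_attraction:
  assumes R: "0 \<le> R" and e: "0 < e"
  shows "\<forall>\<^sub>F t in at_bot. \<exists>C1 C2. \<forall>x. x \<noteq> 0 \<longrightarrow> \<bar>x\<bar> \<le> R \<longrightarrow>
     norm (f 0 x t - attr_f C1 C2 x) \<le> e \<and> norm (h 0 x t - attr_h C1 C2 x) \<le> e \<and>
     norm (FX 0 x t - attr_fx C1 C2 x) \<le> e \<and> norm (HX 0 x t - attr_hx C1 C2 x) \<le> e"
proof -
  define fr where "fr = (\<lambda>k x t. (-1) ^ k * f k x (- t))"
  define hr where "hr = (\<lambda>k x t. (-1) ^ k * h k x (- t))"
  have D: "dirac m a c (- \<iota>) fr hr" unfolding fr_def hr_def by (rule dirac_reverse) (rule dirac_axioms)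
  have X: "dirac.FX m a c (- \<iota>) fr hr 0 x t = FX 0 x (- t)" "dirac.HX m a c (- \<iota>) fr hr 0 x t = HX 0 x (- t)" for x t
    unfolding dirac.FX_def[OF D] dirac.HX_def[OF D] dirac.FXs_def[OF D] dirac.HXs_def[OF D] FX_def HX_def FXs_def HXs_def
    by (simp_all add: fr_def hr_def)
  have "fr 0 x t = f 0 x (- t)" "hr 0 x t = h 0 x (- t)" for x t by (simp_all add: fr_def hr_def)
  then have "\<forall>\<^sub>F t in at_top. \<exists>C1 C2. \<forall>x. x \<noteq> 0 \<longrightarrow> \<bar>x\<bar> \<le> R \<longrightarrow>
     norm (f 0 x (- t) - attr_f C1 C2 x) \<le> e \<and> norm (h 0 x (- t) - attr_h C1 C2 x) \<le> e \<and>
     norm (FX 0 x (- t) - attr_fx C1 C2 x) \<le> e \<and> norm (HX 0 x (- t) - attr_hx C1 C2 x) \<le> e"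
    using dirac.attraction[OF D R e] unfolding X by simp
  then show ?thesis unfolding at_bot_mirror eventually_filtermap by simp
qed

end

section \<open>The difference of two mollifications\<close>

context solution
begin

lemma kernel_difference:
  assumes d: "0 < d" "d \<le> 1" "0 < e" "e \<le> 1"
  shows "smooth_kernel (\<lambda>k u. moll d k u - moll e k u)"
  by (intro kernel_diff kernel_moll assms)

lemma conv_difference_le:
  fixes J :: "real \<Rightarrow> 'a::euclidean_space"
  assumes de: "0 < d" "d \<le> e0" "0 < e" "e \<le> e0" "e0 \<le> 1" and J: "continuous_on UNIV J"
    and B: "\<And>s. \<bar>s\<bar> \<le> e0 \<Longrightarrow> norm (J s - J 0) \<le> B"
  shows "norm (conv (\<lambda>u. moll d 0 u - moll e 0 u) J 0) \<le> 2 * B"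
proof -
  have d1: "d \<le> 1" "e \<le> 1" using de by auto
  have "conv (\<lambda>u. moll d 0 u - moll e 0 u) J 0 = (conv (moll d 0) J 0 - J 0) - (conv (moll e 0) J 0 - J 0)"
    using conv_kernel_diff[OF kernel_cont[OF kernel_moll[OF de(1) d1(1)]] kernel_cont[OF kernel_moll[OF de(3) d1(2)]] J, of 0 0 0] by simp
  also have "norm \<dots> \<le> norm (conv (moll d 0) J 0 - J 0) + norm (conv (moll e 0) J 0 - J 0)" by (rule norm_triangle_ineq4)
  also have "\<dots> \<le> B + B"
    by (intro add_mono conv_moll_close J) (use de d1 B in auto)
  finally show ?thesis by simp
qed

text \<open>At time 0 the difference is small because t \<mapsto> \<psi>(t) is continuous into H^1;
  this is measured by pairings with \<xi> and \<xi>' and carried to all times by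
  \<open>dirac.stability\<close>. The 32 arises because duality turns a pairing bound 2 \<mu> into 4
  (2 \<mu>)^2, once for the function and once for its derivative.\<close>

lemma difference_initial:
  assumes de: "0 < d" "d \<le> e0" "0 < e" "e \<le> e0" "e0 \<le> 1" and a12: "a1 < 2 * m" "a2 < 2 * m" and mu: "0 < \<mu>"
    and B: "\<And>s. \<bar>s\<bar> \<le> e0 \<Longrightarrow> H1norm_on UNIV (\<lambda>x. \<psi> x s - \<psi> x 0) \<le> \<mu>"
    and B0: "\<And>s. \<bar>s\<bar> \<le> e0 \<Longrightarrow> norm (\<psi> 0 s - \<psi> 0 0) \<le> \<mu>"
    and X: "0 \<le> X"
  defines "E \<equiv> \<lambda>k u. moll d k u - moll e k u"
  shows "integral {-X..X} (\<lambda>x. dirac.N m a1 a2 \<i> (mf E) (mh E) 0 x t) \<le> (halfline.stab m a1 + halfline.stab m a2) * (32 * \<mu>\<^sup>2)"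
proof -
  have E: "smooth_kernel E" unfolding E_def by (rule kernel_difference) (use de in auto)
  interpret D: dirac m a1 a2 \<i> "mf E" "mh E" by (rule dirac_mollified[OF a12 E])
  have vf: "D.vf t x = conv (E 0) (\<psi> x) t" for t x unfolding D.vf_def by (rule vec2_mf_mh[OF E])
  have E0: "E 0 = (\<lambda>u. moll d 0 u - moll e 0 u)" by (simp add: E_def)
  \<comment> \<open>Applied with \<zeta> = \<xi> and with \<zeta> = \<xi>'; in both cases c is the
    L^2 norm of \<xi>.\<close>
  have key: "norm (LINT x|lborel. \<zeta> x *\<^sub>R D.vf 0 x) \<le> 2 * (\<mu> * c)"
    if z: "continuous_on UNIV \<zeta>" "\<And>x. x \<notin> {-L..L} \<Longrightarrow> \<zeta> x = 0"
      and zb: "\<And>s. \<bar>s\<bar> \<le> e0 \<Longrightarrow> norm (LINT x|lborel. \<zeta> x *\<^sub>R (\<psi> x s - \<psi> x 0)) \<le> \<mu> * c" for \<zeta> L c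
  proof -
    have i: "integrable lborel (\<lambda>x. \<zeta> x *\<^sub>R \<psi> x s)" for s
      by (rule integrable_continuous_compact_support[of _ "{-L..L}"]) (use z in \<open>auto intro!: continuous_intros psi_slice\<close>)
    have "norm ((LINT x|lborel. \<zeta> x *\<^sub>R \<psi> x s) - (LINT x|lborel. \<zeta> x *\<^sub>R \<psi> x 0)) \<le> \<mu> * c" if "\<bar>s\<bar> \<le> e0" for s
      using zb[OF that] i by (simp add: scaleR_diff_right)
    then have "norm (conv (\<lambda>u. moll d 0 u - moll e 0 u) (\<lambda>s. LINT x|lborel. \<zeta> x *\<^sub>R \<psi> x s) 0) \<le> 2 * (\<mu> * c)"
      by (intro conv_difference_le[OF de LINT_conv(2)[OF E z]])
    moreover have "(LINT x|lborel. \<zeta> x *\<^sub>R D.vf 0 x) = conv (E 0) (\<lambda>s. LINT x|lborel. \<zeta> x *\<^sub>R \<psi> x s) 0"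
      unfolding vf by (rule LINT_conv(1)[OF E z])
    ultimately show ?thesis unfolding E0 by simp
  qed
  have xi1: "norm (LINT x|lborel. \<xi> x *\<^sub>R D.vf 0 x) \<le> 2 * (\<mu> * sqrt (LINT x|lborel. (\<xi> x)\<^sup>2))"
    and xi2: "norm (LINT x|lborel. deriv \<xi> x *\<^sub>R D.vf 0 x) \<le> 2 * (\<mu> * sqrt (LINT x|lborel. (\<xi> x)\<^sup>2))"
    if xi: "testfun1 UNIV \<xi>" for \<xi>
  proof -
    note t = testfun1_facts[OF xi]
    obtain L where L: "\<And>x. x \<notin> {-L..L} \<Longrightarrow> \<xi> x = 0" "\<And>x. x \<notin> {-L..L} \<Longrightarrow> deriv \<xi> x = 0" using t(6) by blast
    show "norm (LINT x|lborel. \<xi> x *\<^sub>R D.vf 0 x) \<le> 2 * (\<mu> * sqrt (LINT x|lborel. (\<xi> x)\<^sup>2))"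
    proof (rule key[OF t(1) L(1)])
      fix s assume s: "\<bar>s\<bar> \<le> e0"
      have "norm (LINT x|lborel. \<xi> x *\<^sub>R (\<psi> x s - \<psi> x 0)) \<le> sqrt (LINT x|lborel. (\<xi> x)\<^sup>2) * sqrt (LINT x:UNIV|lborel. (norm (\<psi> x s - \<psi> x 0))\<^sup>2)"
        by (rule L2_prod(2)[OF _ t(1) L(1)]) (use psi_diff_H1[of s 0] in \<open>auto simp: H1_on_def\<close>)
      also have "\<dots> \<le> sqrt (LINT x|lborel. (\<xi> x)\<^sup>2) * \<mu>"
        by (intro mult_left_mono order_trans[OF H1norm_on_ge(1) B[OF s]]) simp
      finally show "norm (LINT x|lborel. \<xi> x *\<^sub>R (\<psi> x s - \<psi> x 0)) \<le> \<mu> * sqrt (LINT x|lborel. (\<xi> x)\<^sup>2)" by (simp add: mult.commute)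
    qed
    show "norm (LINT x|lborel. deriv \<xi> x *\<^sub>R D.vf 0 x) \<le> 2 * (\<mu> * sqrt (LINT x|lborel. (\<xi> x)\<^sup>2))"
    proof (rule key[OF t(2) L(2)])
      fix s assume s: "\<bar>s\<bar> \<le> e0"
      define W where "W = wderiv UNIV (\<lambda>x. \<psi> x s - \<psi> x 0)"
      have W: "L2_on UNIV W" "weak_deriv_on UNIV (\<lambda>x. \<psi> x s - \<psi> x 0) W" unfolding W_def by (rule wderiv_props[OF psi_diff_H1])+
      have "norm (LINT x|lborel. deriv \<xi> x *\<^sub>R (\<psi> x s - \<psi> x 0)) = norm (LINT x|lborel. \<xi> x *\<^sub>R W x)"
        using W(2) xi by (simp add: weak_deriv_on_def)
      also have "\<dots> \<le> sqrt (LINT x|lborel. (\<xi> x)\<^sup>2) * sqrt (LINT x:UNIV|lborel. (norm (W x))\<^sup>2)"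
        by (rule L2_prod(2)[OF W(1) t(1) L(1)]) auto
      also have "\<dots> \<le> sqrt (LINT x|lborel. (\<xi> x)\<^sup>2) * \<mu>"
        unfolding W_def by (intro mult_left_mono order_trans[OF H1norm_on_ge(2) B[OF s]]) simp
      finally show "norm (LINT x|lborel. deriv \<xi> x *\<^sub>R (\<psi> x s - \<psi> x 0)) \<le> \<mu> * sqrt (LINT x|lborel. (\<xi> x)\<^sup>2)" by (simp add: mult.commute)
    qed
  qed
  have "integral {-X..X} (\<lambda>x. D.N 0 x 0) \<le> 32 * \<mu>\<^sup>2" if X: "0 \<le> X" for X
  proof (cases "X = 0")
    case False
    then have X: "- X < X" using X by simp
    have wd: "weak_deriv_on UNIV (D.vf 0) (D.vf' 0)" by (rule weak_deriv_piecewise[OF D.vf_facts])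
    have "(LINT x:{-X<..<X}|lborel. (norm (D.vf 0 x))\<^sup>2) \<le> 4 * (2 * \<mu>)\<^sup>2"
      by (rule L2_duality[OF X piecewise_cont_L2[OF piecewise_cont_continuous[OF D.vf_facts(1)]]])
        (use mu xi1 testfun1_mono in \<open>auto simp: mult.assoc\<close>)
    moreover have "(LINT x:{-X<..<X}|lborel. (norm (D.vf' 0 x))\<^sup>2) \<le> 4 * (2 * \<mu>)\<^sup>2"
    proof (rule L2_duality[OF X piecewise_cont_L2[OF D.vf_facts(3)]])
      fix \<xi> assume "testfun1 {-X<..<X} \<xi>"
      then have xi: "testfun1 UNIV \<xi>" by (rule testfun1_mono) simp
      then have "norm (LINT x|lborel. \<xi> x *\<^sub>R D.vf' 0 x) = norm (LINT x|lborel. deriv \<xi> x *\<^sub>R D.vf 0 x)"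
        using wd by (simp add: weak_deriv_on_def)
      then show "norm (LINT x|lborel. \<xi> x *\<^sub>R D.vf' 0 x) \<le> 2 * \<mu> * sqrt (LINT x|lborel. (\<xi> x)\<^sup>2)" using xi2[OF xi] by simp
    qed (use mu in simp)
    ultimately show ?thesis
      unfolding D.N_eq_vf piecewise_cont_square(2)[OF piecewise_cont_continuous[OF D.vf_facts(1)]] piecewise_cont_square(2)[OF D.vf_facts(3)]
      by (simp add: power2_eq_square)
  qed simp
  moreover have "sqn (mf E 0 0 0) \<le> 32 * \<mu>\<^sup>2 \<and> mh E 0 0 0 \<bullet> mh E 0 0 0 \<le> 32 * \<mu>\<^sup>2"
  proof -
    have "norm (D.vf 0 0) \<le> 2 * \<mu>"
      unfolding vf E0 by (rule conv_difference_le[OF de psi_slice(2) B0])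
    then have "(norm (D.vf 0 0))\<^sup>2 \<le> (2 * \<mu>)\<^sup>2" by (intro power_mono) auto
    then have "sqn (mf E 0 0 0) + sqn (mh E 0 0 0) \<le> 4 * \<mu>\<^sup>2"
      unfolding power2_norm_eq_inner D.vf_def inner_vec2 by (simp add: power2_eq_square power2_norm_eq_inner)
    moreover have "0 \<le> sqn (mf E 0 0 0)" "0 \<le> sqn (mh E 0 0 0)" "0 \<le> \<mu>\<^sup>2" by simp_all
    ultimately show ?thesis by linarith
  qed
  ultimately show ?thesis using D.stability[of 0 0 "32 * \<mu>\<^sup>2" X t] X by blast
qed

end

lemma L2_le_of_bound:
  fixes F :: "real \<Rightarrow> complex^2"
  assumes F: "piecewise_cont F" and R: "0 < R" and B: "\<And>x. x \<noteq> 0 \<Longrightarrow> \<bar>x\<bar> \<le> R \<Longrightarrow> (norm (F x))\<^sup>2 \<le> B"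
  shows "(LINT x:{-R<..<R}|lborel. (norm (F x))\<^sup>2) \<le> 2 * R * B"
proof -
  have i: "set_integrable lborel {-R<..<R} (\<lambda>x. B)"
    unfolding set_integrable_def by (intro integrable_scaleR_left) (use R in \<open>auto simp: integrable_indicator_iff\<close>)
  have "(LINT x:{-R<..<R}|lborel. (norm (F x))\<^sup>2) \<le> (LINT x:{-R<..<R}|lborel. B)"
    unfolding set_lebesgue_integral_def
  proof (rule integral_mono_AE)
    show "integrable lborel (\<lambda>x. indicat_real {-R<..<R} x *\<^sub>R (norm (F x))\<^sup>2)" "integrable lborel (\<lambda>x. indicat_real {-R<..<R} x *\<^sub>R B)"
      using piecewise_cont_square(1)[OF F] i by (simp_all add: set_integrable_def)
    show "AE x in lborel. indicat_real {-R<..<R} x *\<^sub>R (norm (F x))\<^sup>2 \<le> indicat_real {-R<..<R} x *\<^sub>R B"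
      using AE_lborel_singleton[of "0::real"]
    proof eventually_elim
      fix x :: real assume "x \<noteq> 0"
      then show "indicat_real {-R<..<R} x *\<^sub>R (norm (F x))\<^sup>2 \<le> indicat_real {-R<..<R} x *\<^sub>R B"
        using B[of x] by (auto simp: indicator_def)
    qed
  qed
  also have "\<dots> = 2 * R * B" using R by (simp add: set_lebesgue_integral_def)
  finally show ?thesis .
qed

lemma (in dirac) L2_le_N:
  assumes X: "0 < X" and K: "integral {-X..X} (\<lambda>x. N 0 x t) \<le> K"
  shows "(LINT x:{-X<..<X}|lborel. (norm (vf t x))\<^sup>2) \<le> K" "(LINT x:{-X<..<X}|lborel. (norm (vf' t x))\<^sup>2) \<le> K"
proof -
  note pc = piecewise_cont_continuous[OF vf_facts(1)[of t]] vf_facts(3)[of t]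
  have "0 \<le> integral {-X..X} (\<lambda>x. sqn (vf t x))" "0 \<le> integral {-X..X} (\<lambda>x. sqn (vf' t x))"
    using piecewise_cont_square(3)[OF pc(1)] piecewise_cont_square(3)[OF pc(2)] by (auto intro!: integral_nonneg)
  then show "(LINT x:{-X<..<X}|lborel. (norm (vf t x))\<^sup>2) \<le> K" "(LINT x:{-X<..<X}|lborel. (norm (vf' t x))\<^sup>2) \<le> K"
    using K unfolding N_eq_vf piecewise_cont_square(2)[OF pc(1)] piecewise_cont_square(2)[OF pc(2)] by linarith+
qed

section \<open>Back from the mollifications to the solution\<close>

context solution
begin

text \<open>The limit d \<rightarrow> 0. The bound Q between the scales d and e0 is uniform in d,
  and the pairing of \<zeta> with the mollification of scale d tends to its pairing with \<psi>,
  which depends continuously on time.\<close>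

lemma pairing_approx:
  assumes e0: "0 < e0" "e0 \<le> 1" and z: "continuous_on UNIV \<zeta>" "\<And>x. x \<notin> {-L..L} \<Longrightarrow> \<zeta> x = 0" and g: "continuous_on UNIV g"
    and Q: "\<And>d. 0 < d \<Longrightarrow> d \<le> e0 \<Longrightarrow> norm (LINT x|lborel. \<zeta> x *\<^sub>R conv (\<lambda>u. moll d 0 u - moll e0 0 u) (\<psi> x) t) \<le> Q"
    and P: "norm (LINT x|lborel. \<zeta> x *\<^sub>R (conv (moll e0 0) (\<psi> x) t - g x)) \<le> P"
  shows "norm (LINT x|lborel. \<zeta> x *\<^sub>R (\<psi> x t - g x)) \<le> Q + P"
proof (rule field_le_epsilon)
  fix r :: real assume r: "0 < r"
  define J where "J s = (LINT x|lborel. \<zeta> x *\<^sub>R \<psi> x s)" for s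
  have J: "continuous_on UNIV J" unfolding J_def[abs_def] by (rule LINT_conv(2)[OF kernel_moll[OF e0] z])
  then have "isCont J t" by (simp add: continuous_on_eq_continuous_at)
  then obtain d1 where d1: "0 < d1" "\<And>s. dist s t < d1 \<Longrightarrow> dist (J s) (J t) < r" unfolding continuous_at_eps_delta using r by blast
  define d where "d = min e0 (d1 / 2)"
  have d: "0 < d" "d \<le> e0" "d \<le> 1" "d < d1" using d1(1) e0 by (auto simp: d_def)
  have k: "smooth_kernel (moll d)" "smooth_kernel (moll e0)" using d e0 by (auto intro: kernel_moll)
  have i: "integrable lborel (\<lambda>x. \<zeta> x *\<^sub>R h x)" if "continuous_on UNIV h" for h :: "real \<Rightarrow> complex^2"
    by (rule integrable_continuous_compact_support[of _ "{-L..L}"]) (use z that in \<open>auto intro!: continuous_intros\<close>)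
  have cc: "continuous_on UNIV (\<lambda>x. conv (E 0) (\<psi> x) t)" if "smooth_kernel E" for E
    by (rule continuous_on_slice1[OF conv_continuous[OF kernel_cont[OF that], of UNIV \<psi> 0]]) (use psi_cont in auto)
  have ii: "integrable lborel (\<lambda>x. \<zeta> x *\<^sub>R \<psi> x t)" "integrable lborel (\<lambda>x. \<zeta> x *\<^sub>R g x)"
    "integrable lborel (\<lambda>x. \<zeta> x *\<^sub>R conv (moll d 0) (\<psi> x) t)" "integrable lborel (\<lambda>x. \<zeta> x *\<^sub>R conv (moll e0 0) (\<psi> x) t)"
    by (intro i psi_slice g cc k)+
  have "norm (conv (moll d 0) J t - J t) \<le> r"
    by (rule conv_moll_close[OF d(1,3) J]) (use d1(2) d(4) in \<open>force simp: dist_norm intro: less_imp_le\<close>)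
  moreover have "conv (moll d 0) J t = (LINT x|lborel. \<zeta> x *\<^sub>R conv (moll d 0) (\<psi> x) t)"
    unfolding J_def[abs_def] by (rule LINT_conv(1)[OF k(1) z, symmetric])
  ultimately have 1: "norm ((LINT x|lborel. \<zeta> x *\<^sub>R conv (moll d 0) (\<psi> x) t) - (LINT x|lborel. \<zeta> x *\<^sub>R \<psi> x t)) \<le> r" by (simp add: J_def)
  have "conv (\<lambda>u. moll d 0 u - moll e0 0 u) (\<psi> x) t = conv (moll d 0) (\<psi> x) t - conv (moll e0 0) (\<psi> x) t" for x
    by (rule conv_kernel_diff[OF kernel_cont[OF k(1)] kernel_cont[OF k(2)] psi_slice(2)])
  then have 2: "norm ((LINT x|lborel. \<zeta> x *\<^sub>R conv (moll d 0) (\<psi> x) t) - (LINT x|lborel. \<zeta> x *\<^sub>R conv (moll e0 0) (\<psi> x) t)) \<le> Q"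
    using Q[OF d(1,2)] ii by (simp add: scaleR_diff_right)
  have 3: "norm ((LINT x|lborel. \<zeta> x *\<^sub>R conv (moll e0 0) (\<psi> x) t) - (LINT x|lborel. \<zeta> x *\<^sub>R g x)) \<le> P"
    using P ii by (simp add: scaleR_diff_right)
  have n: "norm (u - w) \<le> norm (y - z) + norm (z - w) + norm (y - u)" for u w y z :: "complex^2"
    using norm_triangle_ineq[of "y - z" "z - w"] norm_triangle_ineq4[of "y - w" "y - u"] by simp
  show "norm (LINT x|lborel. \<zeta> x *\<^sub>R (\<psi> x t - g x)) \<le> Q + P + r"
    using n[of "LINT x|lborel. \<zeta> x *\<^sub>R \<psi> x t" "LINT x|lborel. \<zeta> x *\<^sub>R g x"] 1 2 3 ii
    by (simp add: scaleR_diff_right) (meson add_mono order_trans)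
qed

text \<open>In the sense of pairings, p bounds the step from \<psi> to its mollification of scale
  e0. The step from there to the profile is at most \<eta> in each component off 0, hence at most
  sqrt (2 R (2 \<eta>^2)) = 2 sqrt R \<eta> in L^2, and likewise for the derivatives. With M the sum
  of both bounds, duality gives 4 M^2 twice, and 8 M^2 \<le> (3 M)^2.\<close>

lemma H1_close:
  fixes C1 C2 :: complex
  assumes e0: "0 < e0" "e0 \<le> 1" and a12: "a1 < 2 * m" "a2 < 2 * m" and R: "0 < R"
    and K: "\<And>d X. 0 < d \<Longrightarrow> d \<le> e0 \<Longrightarrow> 0 \<le> X \<Longrightarrow>
      integral {-X..X} (\<lambda>x. dirac.N m a1 a2 \<i> (mf (\<lambda>k u. moll d k u - moll e0 k u)) (mh (\<lambda>k u. moll d k u - moll e0 k u)) 0 x t) \<le> p\<^sup>2"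
    and p: "0 \<le> p" and eta: "0 \<le> \<eta>"
    and near: "\<And>x. x \<noteq> 0 \<Longrightarrow> \<bar>x\<bar> \<le> R \<Longrightarrow> norm (mf (moll e0) 0 x t - dirac.attr_f m a1 a2 C1 C2 x) \<le> \<eta> \<and>
      norm (mh (moll e0) 0 x t - dirac.attr_h m a1 a2 C1 C2 x) \<le> \<eta> \<and>
      norm (dirac.FX m a1 a2 \<i> (mf (moll e0)) (mh (moll e0)) 0 x t - dirac.attr_fx m a1 a2 C1 C2 x) \<le> \<eta> \<and>
      norm (dirac.HX m a1 a2 \<i> (mf (moll e0)) (mh (moll e0)) 0 x t - dirac.attr_hx m a1 a2 C1 C2 x) \<le> \<eta>"
  shows "H1norm_on {-R<..<R} (\<lambda>x. \<psi> x t - sol_profile m a1 a2 C1 C2 x) \<le> 3 * (p + 2 * sqrt R * \<eta>)"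
proof -
  define s where "s = sol_profile m a1 a2 C1 C2"
  define s' where "s' = sol_profile' m a1 a2 C1 C2"
  define M where "M = p + 2 * sqrt R * \<eta>"
  have M: "0 \<le> M" using p eta R by (simp add: M_def)
  have k: "smooth_kernel (moll e0)" by (rule kernel_moll[OF e0])
  interpret E: dirac m a1 a2 \<i> "mf (moll e0)" "mh (moll e0)" by (rule dirac_mollified[OF a12 k])
  have sc: "continuous_on UNIV s" and sp: "piecewise_cont s'" unfolding s_def s'_def by (rule E.sol_profile_facts)+
  have sw: "weak_deriv_on U s s'" for U
    unfolding s_def s'_def by (rule weak_deriv_piecewise[OF E.sol_profile_facts])
  have Evf: "E.vf t x = conv (moll e0 0) (\<psi> x) t" for x unfolding E.vf_def by (rule vec2_mf_mh[OF k])
  have tri: "sqrt (2 * R * (2 * \<eta>\<^sup>2)) = 2 * sqrt R * \<eta>" using eta by (simp add: real_sqrt_mult)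
  have nv: "(norm (vec2 u w - vec2 y z))\<^sup>2 \<le> 2 * \<eta>\<^sup>2" if "norm (u - y) \<le> \<eta>" "norm (w - z) \<le> \<eta>" for u w y z
    using power_mono[OF that(1) norm_ge_zero, of 2] power_mono[OF that(2) norm_ge_zero, of 2]
    unfolding vec2_diff power2_norm_eq_inner inner_vec2 by (simp add: power2_norm_eq_inner)
  have pc1: "piecewise_cont (\<lambda>x. E.vf t x - s x)" and pc2: "piecewise_cont (\<lambda>x. E.vf' t x - s' x)"
    by (intro piecewise_cont_diff piecewise_cont_continuous[OF E.vf_facts(1)] piecewise_cont_continuous[OF sc] sp E.vf_facts(3))+
  have b1: "(LINT x:{-R<..<R}|lborel. (norm (E.vf t x - s x))\<^sup>2) \<le> 2 * R * (2 * \<eta>\<^sup>2)"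
    by (rule L2_le_of_bound[OF pc1 R]) (use near in \<open>auto simp: E.vf_def s_def sol_profile_def intro!: nv\<close>)
  have b2: "(LINT x:{-R<..<R}|lborel. (norm (E.vf' t x - s' x))\<^sup>2) \<le> 2 * R * (2 * \<eta>\<^sup>2)"
    by (rule L2_le_of_bound[OF pc2 R]) (use near in \<open>auto simp: E.vf'_def s'_def sol_profile'_def intro!: nv\<close>)
  have low: "norm (LINT x|lborel. \<xi> x *\<^sub>R F x) \<le> b * sqrt (LINT x|lborel. (\<xi> x)\<^sup>2)"
    if xi: "testfun1 {-R<..<R} \<xi>" and F: "piecewise_cont F" and B: "(LINT x:{-R<..<R}|lborel. (norm (F x))\<^sup>2) \<le> B" and b: "sqrt B = b" for \<xi> and F :: "real \<Rightarrow> complex^2" and b B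
  proof -
    obtain L where L: "\<And>x. x \<notin> {-L..L} \<Longrightarrow> \<xi> x = 0" using testfun1_facts(6)[OF xi] by blast
    have "norm (LINT x|lborel. \<xi> x *\<^sub>R F x) \<le> sqrt (LINT x|lborel. (\<xi> x)\<^sup>2) * sqrt (LINT x:{-R<..<R}|lborel. (norm (F x))\<^sup>2)"
      by (rule L2_prod(2)[OF piecewise_cont_L2[OF F] testfun1_facts(1)[OF xi] L testfun1_facts(4)[OF xi]])
    also have "\<dots> \<le> sqrt (LINT x|lborel. (\<xi> x)\<^sup>2) * b"
      unfolding b[symmetric] by (intro mult_left_mono real_sqrt_le_mono B) simp
    finally show ?thesis by (simp add: mult.commute)
  qed
  have pair: "norm (LINT x|lborel. \<xi> x *\<^sub>R (\<psi> x t - s x)) \<le> M * sqrt (LINT x|lborel. (\<xi> x)\<^sup>2)"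
    "norm (LINT x|lborel. deriv \<xi> x *\<^sub>R (\<psi> x t - s x)) \<le> M * sqrt (LINT x|lborel. (\<xi> x)\<^sup>2)"
    if xi: "testfun1 {-R<..<R} \<xi>" for \<xi>
  proof -
    note t = testfun1_facts[OF xi]
    obtain L where L: "\<And>x. x \<notin> {-L..L} \<Longrightarrow> \<xi> x = 0" "\<And>x. x \<notin> {-L..L} \<Longrightarrow> deriv \<xi> x = 0" using t(6) by blast
    define q where "q = sqrt (LINT x|lborel. (\<xi> x)\<^sup>2)"
    have Q: "norm (LINT x|lborel. \<xi> x *\<^sub>R conv (\<lambda>u. moll d 0 u - moll e0 0 u) (\<psi> x) t) \<le> p * q"
        "norm (LINT x|lborel. deriv \<xi> x *\<^sub>R conv (\<lambda>u. moll d 0 u - moll e0 0 u) (\<psi> x) t) \<le> p * q" if d: "0 < d" "d \<le> e0" for d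
    proof -
      have kd: "smooth_kernel (\<lambda>k u. moll d k u - moll e0 k u)" by (rule kernel_difference) (use d e0 in auto)
      interpret D: dirac m a1 a2 \<i> "mf (\<lambda>k u. moll d k u - moll e0 k u)" "mh (\<lambda>k u. moll d k u - moll e0 k u)" by (rule dirac_mollified[OF a12 kd])
      have Dvf: "conv (\<lambda>u. moll d 0 u - moll e0 0 u) (\<psi> x) t = D.vf t x" for x unfolding D.vf_def by (rule vec2_mf_mh[OF kd, symmetric])
      note N = D.L2_le_N[OF R K[OF d less_imp_le[OF R]]]
      show "norm (LINT x|lborel. \<xi> x *\<^sub>R conv (\<lambda>u. moll d 0 u - moll e0 0 u) (\<psi> x) t) \<le> p * q"
        unfolding q_def Dvf by (rule low[OF xi piecewise_cont_continuous[OF D.vf_facts(1)] N(1)]) (use p in simp)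
      have "norm (LINT x|lborel. \<xi> x *\<^sub>R D.vf' t x) \<le> p * q"
        unfolding q_def by (rule low[OF xi D.vf_facts(3) N(2)]) (use p in simp)
      moreover have "weak_deriv_on {-R<..<R} (D.vf t) (D.vf' t)" by (rule weak_deriv_piecewise[OF D.vf_facts])
      ultimately show "norm (LINT x|lborel. deriv \<xi> x *\<^sub>R conv (\<lambda>u. moll d 0 u - moll e0 0 u) (\<psi> x) t) \<le> p * q"
        unfolding Dvf using xi by (simp add: weak_deriv_on_def)
    qed
    have P1: "norm (LINT x|lborel. \<xi> x *\<^sub>R (conv (moll e0 0) (\<psi> x) t - s x)) \<le> 2 * sqrt R * \<eta> * q"
      unfolding q_def Evf[symmetric] by (rule low[OF xi pc1 b1 tri])
    have "weak_deriv_on {-R<..<R} (\<lambda>x. E.vf t x - s x) (\<lambda>x. E.vf' t x - s' x)"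
      by (intro weak_deriv_on_diff weak_deriv_piecewise[OF E.vf_facts] sw piecewise_cont_L2 piecewise_cont_continuous[OF E.vf_facts(1)] piecewise_cont_continuous[OF sc] sp E.vf_facts(3))
    then have P2: "norm (LINT x|lborel. deriv \<xi> x *\<^sub>R (conv (moll e0 0) (\<psi> x) t - s x)) \<le> 2 * sqrt R * \<eta> * q"
      using low[OF xi pc2 b2 tri] xi unfolding Evf[symmetric] q_def by (simp add: weak_deriv_on_def)
    have M: "p * q + 2 * sqrt R * \<eta> * q = M * q" by (simp add: M_def algebra_simps)
    show "norm (LINT x|lborel. \<xi> x *\<^sub>R (\<psi> x t - s x)) \<le> M * sqrt (LINT x|lborel. (\<xi> x)\<^sup>2)"
      unfolding q_def[symmetric] M[symmetric] by (rule pairing_approx[OF e0 t(1) L(1) sc Q(1) P1])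
    show "norm (LINT x|lborel. deriv \<xi> x *\<^sub>R (\<psi> x t - s x)) \<le> M * sqrt (LINT x|lborel. (\<xi> x)\<^sup>2)"
      unfolding q_def[symmetric] M[symmetric] by (rule pairing_approx[OF e0 t(2) L(2) sc Q(2) P2])
  qed
  have H: "H1_on {-R<..<R} (\<lambda>x. \<psi> x t - s x)"
  proof (rule H1_on_diff)
    show "H1_on {-R<..<R} (\<lambda>x. \<psi> x t)" by (rule H1_on_subset[OF psi_H1]) auto
    show "H1_on {-R<..<R} s" unfolding H1_on_def using piecewise_cont_L2[OF piecewise_cont_continuous[OF sc]] piecewise_cont_L2[OF sp] sw by blast
  qed
  define W where "W = wderiv {-R<..<R} (\<lambda>x. \<psi> x t - s x)"
  have W: "L2_on {-R<..<R} W" "weak_deriv_on {-R<..<R} (\<lambda>x. \<psi> x t - s x) W" unfolding W_def by (rule wderiv_props[OF H])+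
  have "(LINT x:{-R<..<R}|lborel. (norm (\<psi> x t - s x))\<^sup>2) \<le> 4 * M\<^sup>2"
    by (rule L2_duality[OF _ _ M pair(1)]) (use R H in \<open>auto simp: H1_on_def\<close>)
  moreover have "(LINT x:{-R<..<R}|lborel. (norm (W x))\<^sup>2) \<le> 4 * M\<^sup>2"
    by (rule L2_duality[OF _ W(1) M]) (use R pair(2) W(2) in \<open>auto simp: weak_deriv_on_def\<close>)
  ultimately have "(LINT x:{-R<..<R}|lborel. (norm (\<psi> x t - s x))\<^sup>2) + (LINT x:{-R<..<R}|lborel. (norm (W x))\<^sup>2) \<le> 4 * M\<^sup>2 + 4 * M\<^sup>2"
    by (rule add_mono)
  also have "\<dots> \<le> (3 * M)\<^sup>2" by (simp add: power_mult_distrib)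
  finally have "H1norm_on {-R<..<R} (\<lambda>x. \<psi> x t - s x) \<le> sqrt ((3 * M)\<^sup>2)"
    unfolding H1norm_on_def W_def[symmetric] by (rule real_sqrt_le_mono)
  then show ?thesis using M by (simp add: s_def M_def)
qed

text \<open>The order of choices matters: the stability constants fix \<mu>, continuity of \<psi> at
  time 0 fixes the scale e0, and only then does time tend to infinity, for the single mollification
  of that scale.\<close>

lemma eventually_close:
  assumes a12: "a1 < 2 * m" "a2 < 2 * m" and R: "0 < R" and r: "0 < r" and F: "F = at_top \<or> F = at_bot"
  shows "\<forall>\<^sub>F t in F. \<exists>s\<in>Sset m a1 a2. H1norm_on {-R<..<R} (\<lambda>x. \<psi> x t - s x) \<le> r"
proof -
  define stab where "stab = halfline.stab m a1 + halfline.stab m a2"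
  \<comment> \<open>With \<eta> = p / (2 sqrt R) the bound of \<open>H1_close\<close> becomes 3 (p +
    p) = r.\<close>
  define p where "p = r / 6"
  \<comment> \<open>Makes the right side of \<open>difference_initial\<close> at most p^2; the
    absolute value and the 1 keep the divisor positive.\<close>
  define \<mu> where "\<mu> = p / sqrt (32 * (\<bar>stab\<bar> + 1))"
  define \<eta> where "\<eta> = p / (2 * sqrt R)"
  have pos: "0 < p" "0 < \<mu>" "0 < \<eta>" using r R by (simp_all add: p_def \<mu>_def \<eta>_def add_nonneg_pos)
  have "stab * (32 * \<mu>\<^sup>2) \<le> (\<bar>stab\<bar> + 1) * (32 * \<mu>\<^sup>2)" by (rule mult_right_mono) simp_all
  also have "\<dots> = p\<^sup>2"
  proof -
    have "0 < \<bar>stab\<bar> + 1" by simp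
    then show ?thesis by (simp add: \<mu>_def power_divide del: distrib_left_numeral)
  qed
  finally have stab: "stab * (32 * \<mu>\<^sup>2) \<le> p\<^sup>2" .
  obtain d1 where d1: "0 < d1" "\<And>s. dist s 0 < d1 \<Longrightarrow> H1norm_on UNIV (\<lambda>x. \<psi> x s - \<psi> x 0) < \<mu>"
    using psi_close[OF pos(2)] by blast
  have "isCont (\<psi> 0) 0" using psi_slice(2)[of UNIV 0] by (simp add: continuous_on_eq_continuous_at)
  then obtain d2 where d2: "0 < d2" "\<And>s. dist s 0 < d2 \<Longrightarrow> dist (\<psi> 0 s) (\<psi> 0 0) < \<mu>" unfolding continuous_at_eps_delta using pos(2) by blast
  define e0 where "e0 = min 1 (min (d1 / 2) (d2 / 2))"
  have e0: "0 < e0" "e0 \<le> 1" "e0 < d1" "e0 < d2" using d1(1) d2(1) by (auto simp: e0_def)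
  have B: "H1norm_on UNIV (\<lambda>x. \<psi> x s - \<psi> x 0) \<le> \<mu>" "norm (\<psi> 0 s - \<psi> 0 0) \<le> \<mu>" if "\<bar>s\<bar> \<le> e0" for s
    using d1(2)[of s] d2(2)[of s] e0 that by (auto simp: dist_norm)
  have K: "integral {-X..X} (\<lambda>x. dirac.N m a1 a2 \<i> (mf (\<lambda>k u. moll d k u - moll e0 k u)) (mh (\<lambda>k u. moll d k u - moll e0 k u)) 0 x t) \<le> p\<^sup>2"
    if "0 < d" "d \<le> e0" "0 \<le> X" for d X t
    using difference_initial[OF that(1,2) e0(1) order_refl e0(2) a12 pos(2) B that(3), of t] stab by (simp add: stab_def)
  interpret E: dirac m a1 a2 \<i> "mf (moll e0)" "mh (moll e0)" by (rule dirac_mollified[OF a12 kernel_moll[OF e0(1,2)]])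
  have "3 * (p + 2 * sqrt R * \<eta>) = r" using R by (simp add: \<eta>_def p_def)
  note close = H1_close[OF e0(1,2) a12 R K less_imp_le[OF pos(1)] less_imp_le[OF pos(3)], unfolded this]
  have "\<forall>\<^sub>F t in F. \<exists>C1 C2. \<forall>x. x \<noteq> 0 \<longrightarrow> \<bar>x\<bar> \<le> R \<longrightarrow>
     norm (mf (moll e0) 0 x t - E.attr_f C1 C2 x) \<le> \<eta> \<and> norm (mh (moll e0) 0 x t - E.attr_h C1 C2 x) \<le> \<eta> \<and>
     norm (E.FX 0 x t - E.attr_fx C1 C2 x) \<le> \<eta> \<and> norm (E.HX 0 x t - E.attr_hx C1 C2 x) \<le> \<eta>"
    using E.attraction[OF less_imp_le[OF R] pos(3)] E.reverse_attraction[OF less_imp_le[OF R] pos(3)] F by blast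
  then show ?thesis
  proof eventually_elim
    case (elim t)
    then obtain C1 C2 where C: "\<And>x. x \<noteq> 0 \<Longrightarrow> \<bar>x\<bar> \<le> R \<Longrightarrow>
     norm (mf (moll e0) 0 x t - E.attr_f C1 C2 x) \<le> \<eta> \<and> norm (mh (moll e0) 0 x t - E.attr_h C1 C2 x) \<le> \<eta> \<and>
     norm (E.FX 0 x t - E.attr_fx C1 C2 x) \<le> \<eta> \<and> norm (E.HX 0 x t - E.attr_hx C1 C2 x) \<le> \<eta>" by blast
    have "H1norm_on {-R<..<R} (\<lambda>x. \<psi> x t - sol_profile m a1 a2 C1 C2 x) \<le> r" by (rule close[OF _ _ _ C])
    then show ?case by (rule bexI[OF _ E.sol_profile_in_Sset])
  qed
qed

lemma INF_tendsto_0: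
  assumes a12: "a1 < 2 * m" "a2 < 2 * m" and R: "0 < R" and F: "F = at_top \<or> F = at_bot"
  shows "((\<lambda>t. INF s\<in>Sset m a1 a2. H1norm_on {-R<..<R} (\<lambda>x. \<psi> x t - s x)) \<longlongrightarrow> 0) F"
proof (rule tendstoI)
  fix e :: real assume e: "0 < e"
  then have "0 < e / 2" by simp
  from eventually_close[OF a12 R this F]
  show "\<forall>\<^sub>F t in F. dist (INF s\<in>Sset m a1 a2. H1norm_on {-R<..<R} (\<lambda>x. \<psi> x t - s x)) 0 < e"
  proof eventually_elim
    case (elim t)
    then obtain s where s: "s \<in> Sset m a1 a2" "H1norm_on {-R<..<R} (\<lambda>x. \<psi> x t - s x) \<le> e / 2" by blast
    have "(INF s\<in>Sset m a1 a2. H1norm_on {-R<..<R} (\<lambda>x. \<psi> x t - s x)) \<le> H1norm_on {-R<..<R} (\<lambda>x. \<psi> x t - s x)"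
      by (rule cINF_lower[OF bdd_belowI2[of _ 0] s(1)]) (rule H1norm_on_ge(3))
    moreover have "0 \<le> (INF s\<in>Sset m a1 a2. H1norm_on {-R<..<R} (\<lambda>x. \<psi> x t - s x))"
      by (rule cINF_greatest) (use s(1) H1norm_on_ge(3) in auto)
    ultimately show ?case using s(2) e by simp
  qed
qed

end

theorem theoremC1:
  fixes m a1 a2 :: real and \<psi> :: "real \<Rightarrow> real \<Rightarrow> complex^2"
  assumes "m > 0" and "a1 < 2 * m" and "a2 < 2 * m"
    and "is_solution m a1 a2 \<psi>"
  shows "\<forall>R > 0.
     ((\<lambda>t. INF s\<in>Sset m a1 a2. H1norm_on {-R<..<R} (\<lambda>x. \<psi> x t - s x)) \<longlongrightarrow> 0) at_top \<and>
     ((\<lambda>t. INF s\<in>Sset m a1 a2. H1norm_on {-R<..<R} (\<lambda>x. \<psi> x t - s x)) \<longlongrightarrow> 0) at_bot"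
proof -
  interpret solution m a1 a2 \<psi> by unfold_locales (use assms in auto)
  show ?thesis using INF_tendsto_0[OF assms(2,3)] by simp
qed

end
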